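(* For $k$ a positive integer, let $p=tq^{2k+1}$. Then for each $\sigma\in\{0,1\}$, $$\sum_{\substack{\lambda\\ \lambda_1\leq 2k}} q^{(\sigma+1)|\lambda|/2}P_{\lambda}\bigl(1,q,q^2,\dots;t\bigr)=\frac{(p;p)_{\infty}^k}{(\sigma+1)(q;q)_{\infty}^k}\prod_{i=1}^k\theta\bigl(-q^{i-(\sigma+1)/2};p\bigr)\,\theta\bigl(pq^{2i-\sigma-1};p^2\bigr)\prod_{1\leq i<j\leq k}\theta\bigl(q^{j-i};p\bigr)\,\theta\bigl(q^{i+j-\sigma-1};p\bigr)$$ and $$\sum_{\substack{\lambda\\ \lambda_1\leq 2k}} q^{(\sigma+1)|\lambda|/2}\,t^{l(\lambda^{\mathrm{o}})/2}P_{\lambda}\bigl(1,q,q^2,\dots;t\bigr)=\frac{(p;p)_{\infty}^k}{(q;q)_{\infty}^k}\prod_{i=1}^k\theta\bigl(-p^{1/2}q^{i-\sigma/2};p\bigr)\,\theta\bigl(q^{2i-\sigma};p^2\bigr)\prod_{1\leq i<j\leq k}\theta\bigl(q^{j-i};p\bigr)\,\theta\bigl(q^{i+j-\sigma};p\bigr),$$ where both sums are over all partitions $\lambda$ with largest part at most $2k$.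
   Context: $(a;q)_\infty=\prod_{i\ge0}(1-aq^i)$ and $\theta(a;p)=(a;p)_\infty(p/a;p)_\infty$. The identities are understood for complex $q,t$ with $|q|,|t|<1$ (with fixed choices of $q^{1/2},t^{1/2}$ and $p^{1/2}=t^{1/2}q^{k+1/2}$), or as identities of formal power series in $q^{1/2}$ with coefficients polynomial in $t^{1/2}$. For a partition $\lambda$: $|\lambda|=\sum_i\lambda_i$, $l(\lambda)$ is the number of parts, $m_i(\lambda)$ the multiplicity of parts equal to $i$, and $\lambda^{\mathrm{o}}$ is the partition consisting of the odd parts of $\lambda$, so $l(\lambda^{\mathrm{o}})$ is the number of odd parts of $\lambda$. With $(t;t)_m=\prod_{i=1}^m(1-t^i)$, the Hall–Littlewood polynomial in $x=(x_1,\dots,x_n)$, $l(\lambda)\le n$, is $$P_{\lambda}(x;t)=\frac{1}{v_{\lambda}(t)}\sum_{w\in S_n} w\biggl(x_1^{\lambda_1}\cdots x_n^{\lambda_n}\prod_{1\leq i<j\leq n}\frac{x_i-tx_j}{x_i-x_j}\biggr),\qquad v_{\lambda}(t)=\frac{(t;t)_{n-l(\lambda)}}{(1-t)^{n-l(\lambda)}}\prod_{i\geq 1}\frac{(t;t)_{m_i(\lambda)}}{(1-t)^{m_i(\lambda)}},$$ and $P_\lambda(x;t)=0$ if $l(\lambda)>n$. Since $P_\lambda(x_1,\dots,x_n,0;t)=P_\lambda(x_1,\dots,x_n;t)$, it extends to infinitely many variables; $P_\lambda(1,q,q^2,\dots;t)=\lim_{n\to\infty}P_\lambda(1,q,\dots,q^{n-1};t)$.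 *)

theory Defs
  imports "HOL-Analysis.Analysis" "HOL-Combinatorics.Permutations"
begin

definition qpoch_inf :: "complex \<Rightarrow> complex \<Rightarrow> complex" where
  "qpoch_inf a q = (\<Prod>i. 1 - a * q ^ i)"

(* Since p / 0 = 0 and 0 ^ 0 = 1, we get jtheta 0 0 = 1.  This is the limiting value of every
   theta factor used here whose argument and nome both vanish (t = 0 or q = 0). *)
definition jtheta :: "complex \<Rightarrow> complex \<Rightarrow> complex" where
  "jtheta a p = qpoch_inf a p * qpoch_inf (p / a) p"

(* A partition is the weakly decreasing list of its positive parts; hence its size is sum_list
   and its number of parts is length. *)
definition is_partition :: "nat list \<Rightarrow> bool" where
  "is_partition \<mu> \<longleftrightarrow> sorted_wrt (\<ge>) \<mu> \<and> 0 \<notin> set \<mu>"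

(* Zero-based: part \<mu> 0 is the largest part (0 for the empty partition). *)
definition part :: "nat list \<Rightarrow> nat \<Rightarrow> nat" where
  "part \<mu> i = (if i < length \<mu> then \<mu> ! i else 0)"

definition odd_parts :: "nat list \<Rightarrow> nat list" where
  "odd_parts \<mu> = filter odd \<mu>"

definition qfact :: "complex \<Rightarrow> nat \<Rightarrow> complex" where
  "qfact t m = (\<Prod>i=1..m. 1 - t ^ i)"

definition hl_v :: "nat \<Rightarrow> nat list \<Rightarrow> complex \<Rightarrow> complex" where
  "hl_v n \<mu> t = qfact t (n - length \<mu>) / (1 - t) ^ (n - length \<mu>) *
     (\<Prod>i\<in>set \<mu>. qfact t (count_list \<mu> i) / (1 - t) ^ count_list \<mu> i)"

(* The variables are x 0, ..., x (n - 1); the other values of x are irrelevant. *)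
definition hl_summand :: "nat \<Rightarrow> nat list \<Rightarrow> complex \<Rightarrow> (nat \<Rightarrow> complex) \<Rightarrow> complex" where
  "hl_summand n \<mu> t x =
     (\<Prod>i<n. x i ^ part \<mu> i) * (\<Prod>j<n. \<Prod>i<j. (x i - t * x j) / (x i - x j))"

definition hl_formula :: "nat \<Rightarrow> nat list \<Rightarrow> complex \<Rightarrow> (nat \<Rightarrow> complex) \<Rightarrow> complex" where
  "hl_formula n \<mu> t x =
     1 / hl_v n \<mu> t * (\<Sum>w | w permutes {..<n}. hl_summand n \<mu> t (\<lambda>i. x (w i)))"

(* The symmetrised rational function is a polynomial in x.  Its values at points with coinciding
   coordinates, where denominators of hl_formula vanish, are obtained by continuity; at all other
   points the limit is just the value of hl_formula (see hall_littlewood_eq_formula below). *)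
definition hall_littlewood :: "nat \<Rightarrow> nat list \<Rightarrow> complex \<Rightarrow> (nat \<Rightarrow> complex) \<Rightarrow> complex" where
  "hall_littlewood n \<mu> t x =
     (if length \<mu> \<le> n then Lim (at x within {y. inj_on y {..<n}}) (hl_formula n \<mu> t) else 0)"

definition hl_principal :: "nat list \<Rightarrow> complex \<Rightarrow> complex \<Rightarrow> complex" where
  "hl_principal \<mu> q t = lim (\<lambda>n. hall_littlewood n \<mu> t (\<lambda>i. q ^ i))"

lemma tendsto_coordinate:
  fixes x :: "nat \<Rightarrow> complex"
  shows "((\<lambda>y. y i) \<longlongrightarrow> x i) (at x within S)"
  using continuous_on_product_coordinates[of i]
  by (metis UNIV_I continuous_on_def subset_UNIV tendsto_within_subset)

lemma injective_points_nontrivial: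
  fixes x :: "nat \<Rightarrow> complex"
  assumes "inj_on x {..<n}"
  shows "at x within {y. inj_on y {..<n}} \<noteq> bot"
proof -
  let ?y = "\<lambda>m. x(n := x n + 1 / of_nat (Suc m))"
  have "(\<lambda>m. ?y m i) \<longlonglongrightarrow> x i" for i
  proof (cases "i = n")
    case True
    have "(\<lambda>m. 1 / of_nat (Suc m) :: complex) \<longlonglongrightarrow> 0"
      by (rule LIMSEQ_Suc[OF lim_1_over_n])
    then have "(\<lambda>m. x n + 1 / of_nat (Suc m)) \<longlonglongrightarrow> x n + 0"
      by (intro tendsto_add tendsto_const)
    with True show ?thesis by simp
  qed simp
  then have "limitin (product_topology (\<lambda>i. euclidean) UNIV) ?y x sequentially"
    by (simp add: limitin_componentwise)
  then have lim: "?y \<longlonglongrightarrow> x"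
    by (simp only: euclidean_product_topology limitin_canonical_iff)
  have "?y m \<in> {y. inj_on y {..<n}} - {x}" for m
  proof -
    have "?y m n \<noteq> x n"
      using of_nat_neq_0[of m, where 'a = complex] by (simp del: of_nat_Suc)
    then have "?y m \<noteq> x" by metis
    moreover have "inj_on (?y m) {..<n}"
      using assms by (auto simp: inj_on_def)
    ultimately show ?thesis by simp
  qed
  then have "x islimpt {y. inj_on y {..<n}}"
    unfolding islimpt_sequential using lim by (intro exI[of _ ?y] conjI allI)
  then show ?thesis
    by (simp add: trivial_limit_within)
qed

lemma hall_littlewood_eq_formula:
  assumes "inj_on x {..<n}" and "length \<mu> \<le> n"
  shows "hall_littlewood n \<mu> t x = hl_formula n \<mu> t x"
proof -
  have ne: "x (w i) \<noteq> x (w j)" if "w permutes {..<n}" "j < n" "i < j" for w i j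
  proof -
    have "w i \<in> {..<n}" "w j \<in> {..<n}" "w i \<noteq> w j"
      using that permutes_in_image[OF that(1)] inj_eq[OF permutes_inj[OF that(1)]] by auto
    with assms(1) show ?thesis by (meson inj_onD)
  qed
  have "(hl_formula n \<mu> t \<longlongrightarrow> hl_formula n \<mu> t x) (at x within {y. inj_on y {..<n}})"
    unfolding hl_formula_def hl_summand_def
    by (intro tendsto_intros tendsto_coordinate) (use ne in auto)
  then show ?thesis
    using assms injective_points_nontrivial[OF assms(1)]
    by (simp add: hall_littlewood_def tendsto_Lim)
qed

end

theory Submission
 imports "HOL-Complex_Analysis.Complex_Analysis" "HOL-Computational_Algebra.Polynomial"
  "HOL-Combinatorics.Multiset_Permutations" Defs
begin

text \<open>
 For \<open>q = 0\<close> everything reduces to the empty partition. Otherwise, cancelling \<open>v_\<lambda>\<close> in the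
 symmetrisation turns the sum of the \<open>P_\<lambda>\<close> over \<open>\<lambda>_1 \<le> 2k\<close> into a sum over all functions from the
 variables to \<open>{0..2k}\<close>. For finitely many variables \<open>x_i\<close> a Littlewood-type recursion in \<open>k\<close> rewrites
 it as a sum over the sections \<open>S\<close> of \<open>{x_i, 1/x_i}\<close> (one element out of each pair \<open>e, 1/e\<close>) of
 \<open>\<Prod> g(e)\<close> times the product of \<open>(1 - t e f)/(1 - e f)\<close> over the pairs \<open>e, f\<close> in \<open>S\<close>.

 If \<open>t = q^N\<close>, the variables \<open>z q^i\<close> together with their inverses form geometric progressions of ratio \<open>t\<close>,
 and the weight of a section vanishes unless it cuts each progression at a single point. The sum becomes a
 sum over the lattice of cut points of a Gaussian monomial times a Vandermonde-type product, that is, a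
 determinant of one-dimensional theta series. Exchanging \<open>N\<close> and \<open>N + 2k + 1\<close>, hence \<open>t\<close> and
 \<open>p = t q^(2k+1)\<close>, produces the transposed determinant from section sums of ratio \<open>p\<close> whose weight has lost
 its factor \<open>e^(-k)\<close>; those have a closed form by Lagrange interpolation, and this is the product of theta functions.

 Finally both sides are holomorphic in \<open>t^(1/2)\<close> on the unit disc and agree at the points \<open>q^(N/2)\<close>, which
 accumulate at \<open>0\<close>.
\<close>

section \<open>Interpolation identities\<close>

text \<open>In base \<open>q\<close> the variables \<open>z * q^n\<close> and their inverses have
  exponents 1/2 + Z for \<sigma> = 0 and all nonzero integers for \<sigma> = 1. With
  \<open>t = q^N\<close> and \<open>N = 2 * R - \<sigma>\<close> the classes modulo \<open>N\<close>
  fall into \<open>R\<close> orbits under inversion. All of them are pairs, except that for \<sigma>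
  = 1 the multiples of \<open>N\<close> form a class inverse to itself; the parity of
  \<open>N\<close> is chosen to limit this exception to one class. The section sum with the factor
  \<open>e^(-k)\<close> offers no direct closed form. In the determinant, however, \<open>k\<close>
  sits in the Gaussian coefficient \<open>N + 2 * k + 1\<close>, while \<open>N\<close> is the
  modulus of the summation index, and these two enter the theta series symmetrically. After the
  exchange \<open>k\<close> is visible only through the nome \<open>p\<close>. The price is an
  answer with \<open>R\<close> rows of theta functions instead of \<open>k\<close> rows. At
  half-integral powers of \<open>q\<close> a theta function of nome \<open>p\<close> depends on
  residues modulo \<open>2 * (N + 2 * k + 1)\<close>. The residues used by \<open>R\<close> rows and
  by \<open>k\<close> rows complement each other, which trades one product for the other and leaves
  \<open>R\<close> in \<open>p\<close> alone.\<close>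

definition pair_prod :: "('a \<Rightarrow> 'a \<Rightarrow> 'b::comm_monoid_mult) \<Rightarrow> 'a set \<Rightarrow> 'b" where
 "pair_prod h A = (\<Prod>P | P \<subseteq> A \<and> card P = 2. THE c. \<exists>a b. P = {a, b} \<and> a \<noteq> b \<and> c = h a b)"

lemma pair_prod_empty [simp]: "pair_prod h {} = 1" unfolding pair_prod_def by (rule prod.neutral) auto

text \<open>The complex numbers carry no order, so unordered pairs are two-element subsets, and
  \<open>THE\<close> denotes a value only because \<open>h\<close> is symmetric. All later
  inductions go through this recursion.\<close>

lemma pair_prod_insert:
 assumes "\<And>a b. h a b = h b a" "finite A" "v \<notin> A"
 shows "pair_prod h (insert v A) = (\<Prod>a\<in>A. h v a) * pair_prod h A"
proof -
 let ?T = "\<lambda>P. THE c. \<exists>a b. P = {a, b} \<and> a \<noteq> b \<and> c = h a b"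
 have T: "?T {v, a} = h v a" if "a \<in> A" for a
 proof (rule the_equality)
  show "\<exists>b c. {v, a} = {b, c} \<and> b \<noteq> c \<and> h v a = h b c" using that assms(3) by blast
  show "\<And>c. \<exists>b d. {v, a} = {b, d} \<and> b \<noteq> d \<and> c = h b d \<Longrightarrow> c = h v a"
   using assms(1)[of v a] by (auto simp: doubleton_eq_iff)
 qed
 have *: "{P. P \<subseteq> insert v A \<and> card P = 2} = {P. P \<subseteq> A \<and> card P = 2} \<union> (\<lambda>a. {v, a}) ` A"
  (is "?L = ?R")
 proof
  show "?L \<subseteq> ?R"
  proof
   fix P assume P: "P \<in> ?L"
   then obtain a b where ab: "P = {a, b}" "a \<noteq> b" by (auto simp: card_2_iff)
   show "P \<in> ?R"
   proof (cases "v \<in> P")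
    case True
    then have "P = {v, if a = v then b else a}" "(if a = v then b else a) \<in> A" using ab P by auto
    then show ?thesis by blast
   qed (use P in auto)
  qed
  show "?R \<subseteq> ?L" using assms(3) by (auto simp: card_insert_if)
 qed
 have fin: "finite {P. P \<subseteq> A \<and> card P = 2}" using assms(2) by (auto intro: finite_subset[of _ "Pow A"])
 have inj: "inj_on (\<lambda>a. {v, a}) A" by (auto simp: inj_on_def doubleton_eq_iff)
 have "pair_prod h (insert v A) = prod ?T {P. P \<subseteq> A \<and> card P = 2} * prod ?T ((\<lambda>a. {v, a}) ` A)"
  unfolding pair_prod_def * using fin assms(2,3) by (subst prod.union_disjoint) auto
 also have "prod ?T ((\<lambda>a. {v, a}) ` A) = (\<Prod>a\<in>A. h v a)" using inj T by (simp add: prod.reindex)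
 finally show ?thesis by (simp add: pair_prod_def mult.commute)
qed

lemma pair_prod_Un:
 assumes "\<And>a b. h a b = h b a" "finite A" "finite B" "A \<inter> B = {}"
 shows "pair_prod h (A \<union> B) = pair_prod h A * pair_prod h B * (\<Prod>a\<in>A. \<Prod>b\<in>B. h a b)" using assms(2,4)
proof (induction A rule: finite_induct)
 case (insert v A)
 have v: "v \<notin> A \<union> B" "v \<notin> A" "finite A" "finite (A \<union> B)" "A \<inter> B = {}"
  using insert.hyps insert.prems assms(3) by auto
 have "pair_prod h (insert v A \<union> B) = (\<Prod>a\<in>A \<union> B. h v a) * pair_prod h (A \<union> B)"
  using pair_prod_insert[OF assms(1) v(4,1)] by simp
 also have "(\<Prod>a\<in>A \<union> B. h v a) = (\<Prod>a\<in>A. h v a) * (\<Prod>a\<in>B. h v a)"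
  by (rule prod.union_disjoint[OF v(3) assms(3) v(5)])
 also have "pair_prod h (A \<union> B) = pair_prod h A * pair_prod h B * (\<Prod>a\<in>A. \<Prod>b\<in>B. h a b)" by (rule insert.IH[OF v(5)])
 finally have "pair_prod h (insert v A \<union> B) = (\<Prod>a\<in>A. h v a) * (\<Prod>a\<in>B. h v a) *
   (pair_prod h A * pair_prod h B * (\<Prod>a\<in>A. \<Prod>b\<in>B. h a b))" .
 moreover have "pair_prod h (insert v A) = (\<Prod>a\<in>A. h v a) * pair_prod h A" by (rule pair_prod_insert[OF assms(1) v(3,2)])
 moreover have "(\<Prod>a\<in>insert v A. \<Prod>b\<in>B. h a b) = (\<Prod>b\<in>B. h v b) * (\<Prod>a\<in>A. \<Prod>b\<in>B. h a b)"
  by (rule prod.insert[OF v(3,2)])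
 ultimately show ?case by (simp only: mult_ac)
qed simp

section \<open>Polynomial functions with degree bounds\<close>

definition polyfun :: "nat \<Rightarrow> ('a::comm_ring_1 \<Rightarrow> 'a) \<Rightarrow> bool" where
 "polyfun d f \<longleftrightarrow> (\<exists>p. degree p \<le> d \<and> f = poly p)"

lemma polyfun_const: "polyfun d (\<lambda>w. c)" unfolding polyfun_def by (intro exI[of _ "[:c:]"]) auto

lemma polyfun_mono: "polyfun d f \<Longrightarrow> d \<le> e \<Longrightarrow> polyfun e f" unfolding polyfun_def by force

lemma polyfun_lin: "polyfun 1 (\<lambda>w. c + b * w)" unfolding polyfun_def by (intro exI[of _ "[:c, b:]"]) (auto simp: algebra_simps)

lemma polyfun_add: "polyfun d f \<Longrightarrow> polyfun d g \<Longrightarrow> polyfun d (\<lambda>w. f w + g w)" unfolding polyfun_def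
 by (elim exE conjE, rule_tac x = "p + pa" in exI) (auto intro: degree_add_le)

lemma polyfun_diff: "polyfun d f \<Longrightarrow> polyfun d g \<Longrightarrow> polyfun d (\<lambda>w. f w - g w)" unfolding polyfun_def
 by (elim exE conjE, rule_tac x = "p - pa" in exI) (auto intro: degree_diff_le)

lemma polyfun_mult:
 assumes "polyfun d f" "polyfun e g" shows "polyfun (d + e) (\<lambda>w. f w * g w)"
proof -
 obtain p r where "degree p \<le> d" "f = poly p" "degree r \<le> e" "g = poly r" using assms unfolding polyfun_def by blast
 then show ?thesis unfolding polyfun_def by (intro exI[of _ "p * r"]) (auto intro!: order_trans[OF degree_mult_le add_mono])
qed

lemma polyfun_cmult: "polyfun d f \<Longrightarrow> polyfun d (\<lambda>w. c * f w)" using polyfun_mult[OF polyfun_const[of 0 c]] by simp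

lemma polyfun_sum: "(\<And>a. a \<in> A \<Longrightarrow> polyfun d (f a)) \<Longrightarrow> polyfun d (\<lambda>w. \<Sum>a\<in>A. f a w)"
 by (induction A rule: infinite_finite_induct) (auto simp: polyfun_const polyfun_add)

lemma polyfun_prod: "(\<And>a. a \<in> A \<Longrightarrow> polyfun d (f a)) \<Longrightarrow> polyfun (d * card A) (\<lambda>w. \<Prod>a\<in>A. f a w)"
proof (induction A rule: infinite_finite_induct)
 case (insert x A)
 then have "polyfun (d + d * card A) (\<lambda>w. f x w * (\<Prod>a\<in>A. f a w))" by (intro polyfun_mult) auto
 with insert show ?case by simp
qed (auto simp: polyfun_const)

text \<open>The engine of every interpolation argument below: an identity between rational functions
  of one variable is cleared of denominators, its degree is bounded through the closure rules for
  \<open>polyfun\<close>, and one root too many is exhibited.\<close>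

lemma polyfun_zero:
 fixes f :: "'a::idom \<Rightarrow> 'a"
 assumes "polyfun d f" "finite Z" "d < card Z" "\<And>z. z \<in> Z \<Longrightarrow> f z = 0"
 shows "f w = 0"
proof -
 obtain p where p: "degree p \<le> d" "f = poly p" using assms(1) unfolding polyfun_def by blast
 have "p = 0"
 proof (rule ccontr)
  assume "p \<noteq> 0"
  then have "card Z \<le> card {x. poly p x = 0}" "card {x. poly p x = 0} \<le> degree p"
   using assms p by (auto intro!: card_mono poly_roots_finite simp: card_poly_roots_bound)
  with assms(3) p(1) show False by simp
 qed
 with p show ?thesis by simp
qed

definition hlK :: "complex \<Rightarrow> complex \<Rightarrow> complex \<Rightarrow> complex" where
 "hlK t a b = (a - t * b) / (a - b)"

definition hlC :: "complex \<Rightarrow> complex \<Rightarrow> complex \<Rightarrow> complex" where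
 "hlC t a b = (1 - t * a * b) / (1 - a * b)"

lemma hlC_commute: "hlC t a b = hlC t b a" by (simp add: hlC_def mult_ac)

definition generic :: "complex set \<Rightarrow> bool" where
 "generic X \<longleftrightarrow> finite X \<and> 0 \<notin> X \<and> (\<forall>a\<in>X. \<forall>b\<in>X. a * b \<noteq> 1)"

lemma generic_subset: "generic X \<Longrightarrow> Y \<subseteq> X \<Longrightarrow> generic Y" unfolding generic_def using finite_subset by blast

lemma sum_Pow_insert:
 assumes "finite A" "v \<notin> A"
 shows "(\<Sum>P\<in>Pow (insert v A). f P) = (\<Sum>P\<in>Pow A. f P + f (insert v P))"
proof -
 have "inj_on (insert v) (Pow A)" using assms(2) by (auto simp: inj_on_def)
 moreover have "Pow A \<inter> insert v ` Pow A = {}" using assms(2) by auto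
 ultimately show ?thesis using assms(1) by (simp add: Pow_insert sum.union_disjoint sum.reindex sum.distrib)
qed

text \<open>The Lagrange-type identity behind \<open>v\<^sub>\<lambda>(t)\<close>.\<close>

lemma sum_prod_hlK:
 fixes t :: complex
 assumes "finite B"
 shows "(\<Sum>a\<in>B. \<Prod>b\<in>B - {a}. hlK t a b) = (\<Sum>i<card B. t^i)"
proof -
 have nz: "finite B \<Longrightarrow> 0 \<notin> B \<Longrightarrow> (\<Sum>a\<in>B. \<Prod>b\<in>B - {a}. hlK t a b) = (\<Sum>i<card B. t^i)" for B
 proof (induction B rule: finite_induct)
  case (insert v B)
  define c where "c a = (\<Prod>b\<in>B - {a}. hlK t a b)" for a
  \<comment> \<open>Up to the factor \<open>\<Prod>b\<in>B. w - b\<close> this is the claim for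
    \<open>insert w B\<close>, as a polynomial in \<open>w\<close>. Its degree is at most
    \<open>card B\<close>, so the points of \<open>B\<close> and the extra node 0 suffice; this is
    why 0 is kept out of \<open>B\<close> at first.\<close>
  define f where "f w = (\<Sum>a\<in>B. c a * ((t * w - a) * (\<Prod>b\<in>B - {a}. w - b)))
   + (\<Prod>b\<in>B. w - t * b) - (\<Sum>i<Suc (card B). t^i) * (\<Prod>b\<in>B. w - b)" for w
  have IH: "(\<Sum>a\<in>B. c a) = (\<Sum>i<card B. t^i)" using insert by (simp add: c_def)
  have lin1: "polyfun 1 (\<lambda>w. w - b)" for b :: complex using polyfun_lin[of "-b" 1] by simp
  have lin2: "polyfun 1 (\<lambda>w. t * w - b)" for b :: complex using polyfun_lin[of "-b" t] by simp
  have deg: "polyfun (card B) f"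
  proof -
   have "polyfun (card B) (\<lambda>w. c a * ((t * w - a) * (\<Prod>b\<in>B - {a}. w - b)))" if "a \<in> B" for a
   proof -
    have "polyfun (1 + 1 * card (B - {a})) (\<lambda>w. (t * w - a) * (\<Prod>b\<in>B - {a}. w - b))"
     by (intro polyfun_mult lin2 polyfun_prod lin1)
    also have "1 + 1 * card (B - {a}) = card B" using that insert(1) by (simp add: card_Diff_singleton) (metis Suc_pred card_gt_0_iff empty_iff)
    finally show ?thesis by (rule polyfun_cmult)
   qed
   then have "polyfun (card B) (\<lambda>w. \<Sum>a\<in>B. c a * ((t * w - a) * (\<Prod>b\<in>B - {a}. w - b)))" by (rule polyfun_sum)
   moreover have "polyfun (1 * card B) (\<lambda>w. \<Prod>b\<in>B. w - t * b)"
    "polyfun (1 * card B) (\<lambda>w. \<Prod>b\<in>B. w - b)" by (intro polyfun_prod lin1)+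
   ultimately show ?thesis unfolding f_def mult_1 by - (assumption | rule polyfun_diff polyfun_add polyfun_cmult)+
  qed
  have zero: "f w = 0" if "w \<in> insert 0 B" for w
  proof (cases "w = 0")
   case True
   have "(\<Prod>b\<in>B. - t * b) = t^card B * (\<Prod>b\<in>B. - b)" by (simp flip: prod.distrib prod_constant)
   moreover have "(-a) * (\<Prod>b\<in>B - {a}. - b) = (\<Prod>b\<in>B. - b)" if "a \<in> B" for a using that insert(1) by (simp add: prod.remove)
   then have "(\<Sum>a\<in>B. c a * ((-a) * (\<Prod>b\<in>B - {a}. - b))) = (\<Sum>a\<in>B. c a) * (\<Prod>b\<in>B. - b)"
    by (simp add: sum_distrib_right)
   ultimately show ?thesis using True by (simp add: f_def IH algebra_simps)
  next
   case False
   then have w: "w \<in> B" using that by simp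
   have "(\<Sum>a\<in>B. c a * ((t * w - a) * (\<Prod>b\<in>B - {a}. w - b))) =
      (\<Sum>a\<in>B. if a = w then c w * ((t * w - w) * (\<Prod>b\<in>B - {w}. w - b)) else 0)" using w insert(1) by (intro sum.cong) auto
   also have "\<dots> = c w * (\<Prod>b\<in>B - {w}. w - b) * (t * w - w)" using w insert(1) by simp
   also have "c w * (\<Prod>b\<in>B - {w}. w - b) = (\<Prod>b\<in>B - {w}. w - t * b)"
    unfolding c_def hlK_def prod.distrib[symmetric] by (intro prod.cong) auto
   also have "\<dots> * (t * w - w) = - (\<Prod>b\<in>B. w - t * b)" using w insert(1) by (simp add: prod.remove algebra_simps)
   finally show ?thesis using w insert(1) by (auto simp: f_def)
  qed
  have "card B < card (insert 0 B)" using insert.hyps insert.prems by simp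
  then have "f v = 0" using insert.hyps zero by (rule_tac polyfun_zero[OF deg, of "insert 0 B"]) auto
  moreover have nz: "(\<Prod>b\<in>B. v - b) \<noteq> 0" using insert by auto
  moreover have "c a * ((t * v - a) * (\<Prod>b\<in>B - {a}. v - b)) =
    (\<Prod>b\<in>insert v B - {a}. hlK t a b) * (\<Prod>b\<in>B. v - b)" if "a \<in> B" for a
  proof -
   have "insert v B - {a} = insert v (B - {a})" using that insert(2) by auto
   then have "(\<Prod>b\<in>insert v B - {a}. hlK t a b) = hlK t a v * c a" using insert(1,2) by (simp add: c_def)
   moreover have "hlK t a v * (v - a) = t * v - a" using that insert(2) by (auto simp: hlK_def divide_simps) (auto simp: algebra_simps)
   ultimately show ?thesis using that insert(1) by (simp add: prod.remove[of B a "\<lambda>b. v - b"] mult_ac)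
  qed
  moreover have "(\<Prod>b\<in>B. v - t * b) = (\<Prod>b\<in>B. hlK t v b) * (\<Prod>b\<in>B. v - b)"
   unfolding prod.distrib[symmetric] using insert by (intro prod.cong) (auto simp: hlK_def)
  ultimately have "((\<Sum>a\<in>B. \<Prod>b\<in>insert v B - {a}. hlK t a b) + (\<Prod>b\<in>B. hlK t v b)
    - (\<Sum>i<Suc (card B). t^i)) * (\<Prod>b\<in>B. v - b) = 0" unfolding f_def by (simp add: sum_distrib_left sum_distrib_right algebra_simps)
  with nz have "(\<Sum>a\<in>B. \<Prod>b\<in>insert v B - {a}. hlK t a b) + (\<Prod>b\<in>B. hlK t v b) = (\<Sum>i<Suc (card B). t^i)" by simp
  with insert show ?case by (simp add: add.commute)
 qed simp
 show ?thesis
 proof (cases "0 \<in> B")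
  case True
  \<comment> \<open>A zero is harmless because \<open>hlK t 0 b = t\<close> and
    \<open>hlK t a 0 = 1\<close>: it adds the single power \<open>t^card C\<close>.\<close>
  define C where "C = B - {0}"
  have C: "finite C" "0 \<notin> C" "B = insert 0 C" using assms True by (auto simp: C_def)
  have "(\<Prod>b\<in>C. hlK t 0 b) = t^card C" using C(2) unfolding prod_constant[symmetric] by (intro prod.cong) (auto simp: hlK_def)
  moreover have "(\<Prod>b\<in>insert 0 C - {a}. hlK t a b) = (\<Prod>b\<in>C - {a}. hlK t a b)" if "a \<in> C" for a
  proof -
   have "insert 0 C - {a} = insert 0 (C - {a})" using that C(2) by auto
   then show ?thesis using C(1,2) that by (auto simp: hlK_def)
  qed
  ultimately show ?thesis using C nz[of C] by (simp add: C(3) add.commute)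
 qed (use nz assms in auto)
qed

section \<open>A Littlewood-type summation over subsets\<close>

definition littlewood_term :: "complex \<Rightarrow> complex \<Rightarrow> complex set \<Rightarrow> complex set \<Rightarrow> complex" where
 "littlewood_term s t X P = (\<Prod>a\<in>P. a * (s + a) / (1 - a\<^sup>2)) * (\<Prod>a\<in>P. \<Prod>b\<in>X - P. hlK t a b) * pair_prod (hlC t) P"

text \<open>The product side of the Littlewood identity for all partitions, with \<open>s\<close>
  counting odd parts. Removing the first column of every partition turns that sum into one over the
  set \<open>P\<close> of variables with nonzero exponent and exchanges even and odd;
  \<open>littlewood_term\<close> is the resulting summand. Thus \<open>littlewood_sum\<close> says
  that the product reproduces itself under this step.\<close>

definition littlewood_prod :: "complex \<Rightarrow> complex \<Rightarrow> complex set \<Rightarrow> complex" where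
 "littlewood_prod s t X = (\<Prod>a\<in>X. (1 + s * a) / (1 - a\<^sup>2)) * pair_prod (hlC t) X"

lemma littlewood_term_insert_out:
 assumes "finite V" "v \<notin> V" "P \<subseteq> V"
 shows "littlewood_term s t (insert v V) P = littlewood_term s t V P * (\<Prod>a\<in>P. hlK t a v)"
proof -
 have "insert v V - P = insert v (V - P)" "finite (V - P)" "v \<notin> V - P" using assms by auto
 then show ?thesis by (simp add: littlewood_term_def prod.distrib mult_ac)
qed

lemma littlewood_term_insert_in:
 assumes "finite V" "v \<notin> V" "P \<subseteq> V"
 shows "littlewood_term s t (insert v V) (insert v P) =
  littlewood_term s t V P * (v * (s + v) / (1 - v\<^sup>2)) * (\<Prod>b\<in>V - P. hlK t v b) * (\<Prod>a\<in>P. hlC t v a)"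
proof -
 have "insert v V - insert v P = V - P" "finite P" "v \<notin> P" using assms finite_subset by auto
 then show ?thesis by (simp add: littlewood_term_def pair_prod_insert[OF hlC_commute] mult_ac)
qed

lemma littlewood_prod_insert:
 assumes "finite V" "v \<notin> V"
 shows "littlewood_prod s t (insert v V) = littlewood_prod s t V * ((1 + s * v) / (1 - v\<^sup>2)) * (\<Prod>a\<in>V. hlC t v a)"
 using assms by (simp add: littlewood_prod_def pair_prod_insert[OF hlC_commute] mult_ac)

text \<open>The three polynomials come from the identity for \<open>insert y V\<close>, multiplied
  by \<open>1 - y^2\<close> and by all \<open>(1 - y * a) * (y - a)\<close>: the subsets without
  \<open>y\<close>, those with \<open>y\<close>, and the product side.\<close>

definition littlewood_out :: "complex \<Rightarrow> complex set \<Rightarrow> complex set \<Rightarrow> complex \<Rightarrow> complex" where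
 "littlewood_out t V P y = (1 - y\<^sup>2) * (\<Prod>a\<in>V. 1 - y * a) * ((\<Prod>b\<in>V - P. y - b) * (\<Prod>a\<in>P. t * y - a))"

definition littlewood_in :: "complex \<Rightarrow> complex \<Rightarrow> complex set \<Rightarrow> complex set \<Rightarrow> complex \<Rightarrow> complex" where
 "littlewood_in s t V P y = y * (s + y) * ((\<Prod>b\<in>V - P. (y - t * b) * (1 - y * b)) * (\<Prod>a\<in>P. (1 - t * y * a) * (y - a)))"

definition littlewood_rhs :: "complex \<Rightarrow> complex \<Rightarrow> complex set \<Rightarrow> complex \<Rightarrow> complex" where
 "littlewood_rhs s t V y = (1 + s * y) * (\<Prod>a\<in>V. (1 - t * y * a) * (y - a))"

lemmas littlewood_defs = littlewood_out_def littlewood_in_def littlewood_rhs_def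

text \<open>The difference has degree at most \<open>2 + 2 * card V\<close> in \<open>y\<close> and
  vanishes at the \<open>3 + 2 * card V\<close> points 0, 1, -1, \<open>V\<close> and the inverses
  of \<open>V\<close>. At 0, 1 and -1 it reduces to the hypothesis for \<open>V\<close>, at
  \<open>1 / a\<close> to the one for \<open>V - {a}\<close>, and at a point of \<open>V\<close> the
  subsets with and without that point cancel in pairs.\<close>

lemma littlewood_sum_step:
 fixes s t v :: complex
 assumes gen: "generic V" and IH: "\<And>V'. V' \<subseteq> V \<Longrightarrow> (\<Sum>P\<in>Pow V'. littlewood_term s t V' P) = littlewood_prod s t V'"
 defines "f \<equiv> \<lambda>y. (\<Sum>P\<in>Pow V. littlewood_term s t V P * littlewood_out t V P y + littlewood_term s t V P * littlewood_in s t V P y) -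
  littlewood_prod s t V * littlewood_rhs s t V y"
 shows "f v = 0"
proof -
 have fin: "finite V" and V0: "0 \<notin> V" and V1: "\<And>a b. a \<in> V \<Longrightarrow> b \<in> V \<Longrightarrow> a * b \<noteq> 1"
  using gen by (auto simp: generic_def)
 have deg: "polyfun (2 + 2 * card V) f"
 proof -
  have lin: "polyfun 1 (\<lambda>w. w - b)" "polyfun 1 (\<lambda>w. t * w - b)" "polyfun 1 (\<lambda>w. 1 - w * b)"
   "polyfun 1 (\<lambda>w. 1 - t * w * b)" "polyfun 1 (\<lambda>w. s + w)" "polyfun 1 (\<lambda>w. w)"
   "polyfun 1 (\<lambda>w. 1 + s * w)" for b :: complex
   using polyfun_lin[of "-b" 1] polyfun_lin[of "-b" t] polyfun_lin[of 1 "-b"] polyfun_lin[of 1 "-t * b"]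
    polyfun_lin[of s 1] polyfun_lin[of 0 1] polyfun_lin[of 1 s] by (simp_all add: mult_ac)
  have q: "polyfun 2 (\<lambda>w::complex. 1 - w\<^sup>2)" using polyfun_diff[OF polyfun_const[of "1 + 1" 1] polyfun_mult[OF lin(6) lin(6)]]
   by (simp add: power2_eq_square numeral_2_eq_2)
  have c: "card (V - P) + card P = card V" if "P \<subseteq> V" for P
   using fin that by (metis card_Diff_subset card_mono finite_subset le_add_diff_inverse2)
  have A: "polyfun (2 + 2 * card V) (\<lambda>y. littlewood_out t V P y)" if P: "P \<subseteq> V" for P
  proof -
   have "polyfun (2 + 1 * card V + (1 * card (V - P) + 1 * card P)) (\<lambda>y. littlewood_out t V P y)"
    unfolding littlewood_out_def by (intro polyfun_mult polyfun_prod lin q)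
   then show ?thesis using c[OF P] by (simp add: mult_2)
  qed
  have B: "polyfun (2 + 2 * card V) (\<lambda>y. littlewood_in s t V P y)" if P: "P \<subseteq> V" for P
  proof -
   have "polyfun (1 + 1 + ((1 + 1) * card (V - P) + (1 + 1) * card P)) (\<lambda>y. littlewood_in s t V P y)"
    unfolding littlewood_in_def by (intro polyfun_mult polyfun_prod lin)
   moreover have "1 + 1 + ((1 + 1) * card (V - P) + (1 + 1) * card P) = 2 + 2 * card V" using c[OF P] by simp
   ultimately show ?thesis by (simp only:)
  qed
  have "polyfun (1 + (1 + 1) * card V) (\<lambda>y. littlewood_rhs s t V y)" unfolding littlewood_rhs_def by (intro polyfun_mult polyfun_prod lin)
  then have C: "polyfun (2 + 2 * card V) (\<lambda>y. littlewood_rhs s t V y)" by (rule polyfun_mono) simp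
  show ?thesis unfolding f_def by (intro polyfun_diff[OF polyfun_sum polyfun_cmult[OF C]] polyfun_add polyfun_cmult A B) auto
 qed
 have sumV: "(\<Sum>P\<in>Pow V. littlewood_term s t V P) = littlewood_prod s t V" using IH by simp
 have split: "(\<Prod>b\<in>V - P. g b) * (\<Prod>b\<in>P. g b) = (\<Prod>b\<in>V. g b)" if "P \<in> Pow V" for P and g :: "complex \<Rightarrow> complex"
  using prod.subset_diff[of P V g] fin that by simp
 have f0: "f 0 = 0" by (simp add: f_def littlewood_defs split sumV flip: sum_distrib_right)
 have f1: "f y = 0" if "y\<^sup>2 = 1" for y
 proof -
  have yy: "y * y = 1" using that by (simp add: power2_eq_square)
  let ?g = "\<lambda>a. (1 - t * y * a) * (y - a)"
  have aux: "A * (B * C) - A * (D * C) = A * C * (B - D)" for A B C D :: complex by algebra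
  have e: "(y - t * b) * (1 - y * b) = ?g b" for b using yy by algebra
  have "f y = (\<Sum>P\<in>Pow V. littlewood_term s t V P * (y * (s + y) * (\<Prod>a\<in>V. ?g a))) -
    littlewood_prod s t V * ((1 + s * y) * (\<Prod>a\<in>V. ?g a))"
   unfolding f_def littlewood_defs e using that by (intro arg_cong2[where f = "(-)"] sum.cong refl) (simp add: split)
  also have "\<dots> = littlewood_prod s t V * (\<Prod>a\<in>V. ?g a) * (y * (s + y) - (1 + s * y))"
   unfolding sum_distrib_right[symmetric] sumV by (rule aux)
  also have "y * (s + y) - (1 + s * y) = 0" using yy by algebra
  finally show ?thesis by simp
 qed
 have finv: "f y = 0" if a: "a \<in> V" "y = 1 / a" for a y
 proof -
  define W where "W = V - {a}"
  have W: "finite W" "a \<notin> W" "V = insert a W" using fin a by (auto simp: W_def)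
  have a0: "a \<noteq> 0" "a * a \<noteq> 1" "a * y = 1" using a V0 V1[of a a] by auto
  let ?g = "\<lambda>b. (1 - t * y * b) * (y - b)"
  let ?c = "(1 + s * a) / (1 - a\<^sup>2) * (1 + s * y) * ?g a * (\<Prod>b\<in>W. hlC t a b * ?g b)"
  have "(\<Sum>P\<in>Pow V. littlewood_term s t V P * littlewood_in s t V P y) = (\<Sum>P\<in>Pow W. littlewood_term s t W P * ?c)"
   unfolding W(3) sum_Pow_insert[OF W(1,2)]
  proof (rule sum.cong[OF refl])
   fix P assume P: "P \<in> Pow W"
   have fP: "finite P" "a \<notin> P" using P W finite_subset by auto
   have d: "insert a W - P = insert a (W - P)" "insert a W - insert a P = W - P" using P W(2) by auto
   \<comment> \<open>Subsets that miss \<open>a\<close> drop out through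
     \<open>1 - y * a = 0\<close>; the survivors are insertions of \<open>a\<close> into subsets of
     \<open>W\<close>.\<close>
   have 0: "littlewood_in s t (insert a W) P y = 0" unfolding littlewood_in_def d using W(1,2) a0 by (simp add: mult.commute)
   have 1: "(\<Prod>b\<in>W - P. hlK t a b) * (\<Prod>b\<in>W - P. (y - t * b) * (1 - y * b)) = (\<Prod>b\<in>W - P. hlC t a b * ?g b)"
    unfolding prod.distrib[symmetric]
   proof (rule prod.cong[OF refl])
    fix b assume "b \<in> W - P"
    then have b: "b \<in> V" "b \<noteq> a" using W by auto
    then have "a * b \<noteq> 1" "a - b \<noteq> 0" using V1 a by auto
    then show "hlK t a b * ((y - t * b) * (1 - y * b)) = hlC t a b * ?g b" using a0(1) unfolding a(2) hlK_def hlC_def by (simp add: field_simps)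
   qed
   have 2: "(\<Prod>b\<in>P. hlC t a b) * (\<Prod>b\<in>P. ?g b) = (\<Prod>b\<in>P. hlC t a b * ?g b)" by (simp add: prod.distrib)
   have 3: "(a * (s + a) / (1 - a\<^sup>2)) * (y * (s + y)) = (1 + s * a) / (1 - a\<^sup>2) * (1 + s * y)"
   proof -
    have "a * (s + a) * (y * (s + y)) = (1 + s * a) * (1 + s * y)" using a0(3) by algebra
    then show ?thesis by simp
   qed
   have 5: "(\<Prod>b\<in>W. hlC t a b * ?g b) = (\<Prod>b\<in>W - P. hlC t a b * ?g b) * (\<Prod>b\<in>P. hlC t a b * ?g b)"
    using P W(1) by (intro prod.subset_diff) auto
   have i: "littlewood_term s t (insert a W) (insert a P) = littlewood_term s t W P * (a * (s + a) / (1 - a\<^sup>2)) *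
     (\<Prod>b\<in>W - P. hlK t a b) * (\<Prod>b\<in>P. hlC t a b)" using P W by (intro littlewood_term_insert_in) auto
   have "littlewood_term s t (insert a W) (insert a P) * littlewood_in s t (insert a W) (insert a P) y =
     littlewood_term s t W P * ((a * (s + a) / (1 - a\<^sup>2)) * (y * (s + y))) *
     ((\<Prod>b\<in>W - P. hlK t a b) * (\<Prod>b\<in>W - P. (y - t * b) * (1 - y * b))) *
     ((\<Prod>b\<in>P. hlC t a b) * (\<Prod>b\<in>P. ?g b)) * ?g a" unfolding i littlewood_in_def d prod.insert[OF fP] by (simp only: mult_ac)
   also have "\<dots> = littlewood_term s t W P * ?c" unfolding 1 2 3 5 by (simp only: mult_ac)
   finally show "littlewood_term s t (insert a W) P * littlewood_in s t (insert a W) P y +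
    littlewood_term s t (insert a W) (insert a P) * littlewood_in s t (insert a W) (insert a P) y = littlewood_term s t W P * ?c"
    unfolding 0 by simp
  qed
  also have "\<dots> = littlewood_prod s t W * ?c" unfolding sum_distrib_right[symmetric] using IH[of W] W(3) by (simp only: subset_insertI)
  also have "\<dots> = littlewood_prod s t V * littlewood_rhs s t V y"
   unfolding W(3) littlewood_rhs_def littlewood_prod_insert[OF W(1,2)] using W(1,2) by (simp add: prod.distrib)
  finally have main: "(\<Sum>P\<in>Pow V. littlewood_term s t V P * littlewood_in s t V P y) = \<dots>" .
  have "(\<Prod>a\<in>V. 1 - y * a) = 0" using a fin V0 by auto
  then have "littlewood_out t V P y = 0" for P by (simp add: littlewood_out_def)
  then show ?thesis using main by (simp add: f_def)
 qed
 have fx: "f y = 0" if y: "y \<in> V" for y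
 proof -
  define W where "W = V - {y}"
  have W: "finite W" "y \<notin> W" "V = insert y W" using fin y by (auto simp: W_def)
  have "littlewood_rhs s t V y = 0" using y fin by (auto simp: littlewood_rhs_def)
  moreover have "(\<Sum>P\<in>Pow V. littlewood_term s t V P * littlewood_out t V P y + littlewood_term s t V P * littlewood_in s t V P y) = 0"
   unfolding W(3) sum_Pow_insert[OF W(1,2)]
  proof (rule sum.neutral, rule ballI)
   fix P assume P: "P \<in> Pow W"
   have fP: "finite P" "y \<notin> P" using P W finite_subset by auto
   have d: "insert y W - P = insert y (W - P)" "insert y W - insert y P = W - P" using P W(2) by auto
   have z: "littlewood_out t (insert y W) P y = 0" "littlewood_in s t (insert y W) (insert y P) y = 0"
    unfolding littlewood_defs d using W(1,2) fP by auto
   have y1: "y\<^sup>2 \<noteq> 1" using V1[of y y] y by (simp add: power2_eq_square)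
   have A: "(\<Prod>a\<in>W. 1 - y * a) = (\<Prod>a\<in>W - P. 1 - y * a) * (\<Prod>a\<in>P. 1 - y * a)"
    using P W(1) by (intro prod.subset_diff) auto
   have 1: "(\<Prod>b\<in>W - P. hlK t y b) * ((\<Prod>a\<in>W - P. 1 - y * a) * (\<Prod>b\<in>W - P. y - b)) =
     (\<Prod>b\<in>W - P. (y - t * b) * (1 - y * b))" unfolding prod.distrib[symmetric] using W(2) by (intro prod.cong) (auto simp: hlK_def)
   have 2: "(\<Prod>a\<in>P. hlC t y a) * ((\<Prod>a\<in>P. 1 - y * a) * (\<Prod>a\<in>P. t * y - a)) =
     (\<Prod>a\<in>P. hlK t a y) * (\<Prod>a\<in>P. (1 - t * y * a) * (y - a))" unfolding prod.distrib[symmetric]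
   proof (rule prod.cong[OF refl])
    fix a assume "a \<in> P"
    then have "a - y \<noteq> 0" "y * a \<noteq> 1" using P W V1[of y a] y by auto
    then have "hlC t y a * (1 - y * a) = 1 - t * y * a" "hlK t a y * (a - y) = a - t * y" by (simp_all add: hlC_def hlK_def)
    then show "hlC t y a * ((1 - y * a) * (t * y - a)) = hlK t a y * ((1 - t * y * a) * (y - a))" by algebra
   qed
   have 3: "(y * (s + y) / (1 - y\<^sup>2)) * (1 - y\<^sup>2) = y * (s + y)" using y1 by simp
   have 4: "(1 - y * y) * (t * y - y) = - ((y - t * y) * (1 - y * y))" by algebra
   have "littlewood_term s t (insert y W) (insert y P) * littlewood_out t (insert y W) (insert y P) y =
     littlewood_term s t W P * ((y * (s + y) / (1 - y\<^sup>2)) * (1 - y\<^sup>2)) *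
     ((\<Prod>b\<in>W - P. hlK t y b) * ((\<Prod>a\<in>W - P. 1 - y * a) * (\<Prod>b\<in>W - P. y - b))) *
     ((\<Prod>a\<in>P. hlC t y a) * ((\<Prod>a\<in>P. 1 - y * a) * (\<Prod>a\<in>P. t * y - a))) * ((1 - y * y) * (t * y - y))"
    using P unfolding littlewood_out_def d prod.insert[OF W(1,2)] prod.insert[OF fP] A
    by (simp only: littlewood_term_insert_in[OF W(1,2)] Pow_iff mult_ac)
   also have "\<dots> = - (littlewood_term s t (insert y W) P * littlewood_in s t (insert y W) P y)"
    unfolding 1 2 3 4 littlewood_in_def d using P W fP by (simp add: littlewood_term_insert_out mult_ac)
   finally show "littlewood_term s t (insert y W) P * littlewood_out t (insert y W) P y +
     littlewood_term s t (insert y W) P * littlewood_in s t (insert y W) P y +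
     (littlewood_term s t (insert y W) (insert y P) * littlewood_out t (insert y W) (insert y P) y +
      littlewood_term s t (insert y W) (insert y P) * littlewood_in s t (insert y W) (insert y P) y) = 0" unfolding z by simp
  qed
  ultimately show ?thesis unfolding f_def by simp
 qed
 define Z where "Z = {0, 1, -1} \<union> (V \<union> inverse ` V)"
 have m: "a\<^sup>2 \<noteq> 1" if "a \<in> V" for a using V1[of a a] that by (simp add: power2_eq_square)
 have d1: "{0, 1, -1} \<inter> (V \<union> inverse ` V) = {}"
 proof -
  have 1: "x \<notin> V" if "x \<in> {0, 1, -1}" for x :: complex using that V0 m[of 1] m[of "-1"] by auto
  have "x \<notin> inverse ` V" if "x \<in> {0, 1, -1}" for x :: complex
  proof
   assume "x \<in> inverse ` V"
   then have "inverse x \<in> V" by auto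
   with 1[of "inverse x"] that show False by auto
  qed
  with 1 have "x \<notin> V \<union> inverse ` V" if "x \<in> {0, 1, -1}" for x :: complex using that by blast
  then show ?thesis by blast
 qed
 have d2: "V \<inter> inverse ` V = {}"
 proof -
  have "inverse b \<notin> V" if "b \<in> V" for b using V1[of b "inverse b"] that V0 by (cases "b = 0") auto
  then show ?thesis by auto
 qed
 have "card Z = 3 + (card V + card V)" unfolding Z_def using fin d1 d2
  by (subst card_Un_disjoint) (auto simp: card_Un_disjoint card_image inj_on_def)
 then show ?thesis using fin f0 f1 fx finv by (rule_tac polyfun_zero[OF deg, of Z]) (auto simp: Z_def divide_inverse)
qed

text \<open>The step uses the identity for \<open>V\<close> and for every \<open>V - {a}\<close>,
  hence the induction on the cardinality.\<close>

theorem littlewood_sum: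
 "generic X \<Longrightarrow> (\<Sum>P\<in>Pow X. littlewood_term s t X P) = littlewood_prod s t X"
proof (induction "card X" arbitrary: X rule: less_induct)
 case less
 show ?case
 proof (cases "X = {}")
  case True
  then show ?thesis by (simp add: littlewood_term_def littlewood_prod_def)
 next
  case False
  then obtain v V where X: "X = insert v V" "v \<notin> V" by (metis all_not_in_conv mk_disjoint_insert)
  have finX: "finite X" using less.prems by (simp add: generic_def)
  then have fin: "finite V" using X by simp
  have gV: "generic V" using less.prems X generic_subset by blast
  have V1: "v * v \<noteq> 1" "\<And>a. a \<in> V \<Longrightarrow> v * a \<noteq> 1" using less.prems X by (auto simp: generic_def)
  then have v1: "v\<^sup>2 \<noteq> 1" by (simp add: power2_eq_square)
  have "(\<Sum>P\<in>Pow V'. littlewood_term s t V' P) = littlewood_prod s t V'" if "V' \<subseteq> V" for V'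
  proof (rule less.hyps)
   have "card V' \<le> card V" using that fin by (rule card_mono[rotated])
   then show "card V' < card X" using X fin by simp
   show "generic V'" using gV that generic_subset by blast
  qed
  note step = littlewood_sum_step[OF gV this, of v]
  let ?D = "(1 - v\<^sup>2) * (\<Prod>a\<in>V. (1 - v * a) * (v - a))"
  have "?D \<noteq> 0" using v1 V1(2) X(2) fin by auto
  moreover have "((\<Sum>P\<in>Pow X. littlewood_term s t X P) - littlewood_prod s t X) * ?D = 0"
  proof -
   have t1: "littlewood_term s t X P * ?D = littlewood_term s t V P * littlewood_out t V P v" if "P \<in> Pow V" for P
   proof -
    have "(\<Prod>a\<in>V. v - a) = (\<Prod>a\<in>V - P. v - a) * (\<Prod>a\<in>P. v - a)" using that fin by (intro prod.subset_diff) auto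
    moreover have "(\<Prod>a\<in>P. hlK t a v) * (\<Prod>a\<in>P. v - a) = (\<Prod>a\<in>P. t * v - a)" unfolding prod.distrib[symmetric]
    proof (rule prod.cong[OF refl])
     fix a assume "a \<in> P"
     then have "a \<noteq> v" using that X(2) by auto
     then show "hlK t a v * (v - a) = t * v - a" by (auto simp: hlK_def divide_simps) (auto simp: algebra_simps)
    qed
    moreover have "littlewood_term s t X P = littlewood_term s t V P * (\<Prod>a\<in>P. hlK t a v)"
     unfolding X(1) using that fin X by (intro littlewood_term_insert_out) auto
    ultimately show ?thesis by (simp add: littlewood_out_def prod.distrib mult_ac)
   qed
   have t2: "littlewood_term s t X (insert v P) * ?D = littlewood_term s t V P * littlewood_in s t V P v"
    if "P \<in> Pow V" for P
   proof -
    have e1: "(\<Prod>a\<in>V. (1 - v * a) * (v - a)) = (\<Prod>a\<in>V - P. (1 - v * a) * (v - a)) * (\<Prod>a\<in>P. (1 - v * a) * (v - a))"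
     using that fin by (intro prod.subset_diff) auto
    have e2: "(\<Prod>b\<in>V - P. hlK t v b) * (\<Prod>a\<in>V - P. (1 - v * a) * (v - a)) = (\<Prod>b\<in>V - P. (v - t * b) * (1 - v * b))"
     unfolding prod.distrib[symmetric] using X(2) by (intro prod.cong) (auto simp: hlK_def)
    have e3: "(\<Prod>a\<in>P. hlC t v a) * (\<Prod>a\<in>P. (1 - v * a) * (v - a)) = (\<Prod>a\<in>P. (1 - t * v * a) * (v - a))"
     unfolding prod.distrib[symmetric] using that V1(2) by (intro prod.cong) (auto simp: hlC_def)
    have e4: "(v * (s + v) / (1 - v\<^sup>2)) * (1 - v\<^sup>2) = v * (s + v)" using v1 by simp
    have e5: "littlewood_term s t X (insert v P) = littlewood_term s t V P * (v * (s + v) / (1 - v\<^sup>2)) *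
     (\<Prod>b\<in>V - P. hlK t v b) * (\<Prod>a\<in>P. hlC t v a)" unfolding X(1) using that fin X by (intro littlewood_term_insert_in) auto
    have "littlewood_term s t X (insert v P) * ?D = littlewood_term s t V P * ((v * (s + v) / (1 - v\<^sup>2)) * (1 - v\<^sup>2)) *
      ((\<Prod>b\<in>V - P. hlK t v b) * (\<Prod>a\<in>V - P. (1 - v * a) * (v - a))) *
      ((\<Prod>a\<in>P. hlC t v a) * (\<Prod>a\<in>P. (1 - v * a) * (v - a)))" unfolding e5 e1 by (simp only: mult_ac)
    then show ?thesis unfolding littlewood_in_def e2 e3 e4 by (simp only: mult_ac)
   qed
   have t3: "littlewood_prod s t X * ?D = littlewood_prod s t V * littlewood_rhs s t V v"
   proof -
    have e1: "(\<Prod>a\<in>V. hlC t v a) * (\<Prod>a\<in>V. (1 - v * a) * (v - a)) = (\<Prod>a\<in>V. (1 - t * v * a) * (v - a))"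
     unfolding prod.distrib[symmetric] using V1(2) by (intro prod.cong) (auto simp: hlC_def)
    have e2: "(1 + s * v) / (1 - v\<^sup>2) * (1 - v\<^sup>2) = 1 + s * v" using v1 by simp
    have e3: "littlewood_prod s t X = littlewood_prod s t V * ((1 + s * v) / (1 - v\<^sup>2)) * (\<Prod>a\<in>V. hlC t v a)"
     unfolding X(1) using fin X by (intro littlewood_prod_insert) auto
    have "littlewood_prod s t X * ?D = littlewood_prod s t V * ((1 + s * v) / (1 - v\<^sup>2) * (1 - v\<^sup>2)) *
      ((\<Prod>a\<in>V. hlC t v a) * (\<Prod>a\<in>V. (1 - v * a) * (v - a)))" unfolding e3 by (simp only: mult_ac)
    then show ?thesis unfolding littlewood_rhs_def e1 e2 by (simp only: mult_ac)
   qed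
   have "(\<Sum>P\<in>Pow X. littlewood_term s t X P) * ?D =
     (\<Sum>P\<in>Pow V. littlewood_term s t X P * ?D + littlewood_term s t X (insert v P) * ?D)"
    using sum_Pow_insert[OF fin X(2), of "littlewood_term s t X"] by (simp add: X(1) sum_distrib_right distrib_right)
   also have "\<dots> = littlewood_prod s t X * ?D" unfolding t3 using step by (simp only: t1 t2 right_minus_eq cong: sum.cong)
   finally show ?thesis by (simp only: left_diff_distrib right_minus_eq)
  qed
  ultimately show ?thesis by simp
 qed
qed

section \<open>Sections of inversion-closed sets\<close>

definition sections :: "complex set \<Rightarrow> complex set set" where
 "sections U = {S. S \<subseteq> U \<and> (\<forall>e\<in>U. e \<in> S \<longleftrightarrow> inverse e \<notin> S)}"

text \<open>The condition \<open>e * e \<noteq> 1\<close> excludes 1 and -1, which are their own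
  inverses and leave no choice to a section.\<close>

definition inv_closed :: "complex set \<Rightarrow> bool" where
 "inv_closed U \<longleftrightarrow> finite U \<and> 0 \<notin> U \<and> (\<forall>e\<in>U. inverse e \<in> U \<and> e * e \<noteq> 1)"

definition section_weight :: "(complex \<Rightarrow> complex) \<Rightarrow> complex \<Rightarrow> complex set \<Rightarrow> complex" where
 "section_weight g t S = (\<Prod>e\<in>S. g e) * pair_prod (hlC t) S"

definition section_sum :: "(complex \<Rightarrow> complex) \<Rightarrow> complex \<Rightarrow> complex set \<Rightarrow> complex" where
 "section_sum g t U = (\<Sum>S\<in>sections U. section_weight g t S)"

lemma inverse_neq_self: "w \<noteq> 0 \<Longrightarrow> w * w \<noteq> 1 \<Longrightarrow> inverse w \<noteq> (w::complex)" by (metis right_inverse)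

lemma section_weight_insert:
 assumes "finite S" "v \<notin> S"
 shows "section_weight g t (insert v S) = section_weight g t S * g v * (\<Prod>e\<in>S. hlC t v e)"
 using assms by (simp add: section_weight_def pair_prod_insert[OF hlC_commute] mult_ac)

lemma sections_subset: "S \<in> sections U \<Longrightarrow> S \<subseteq> U" by (simp add: sections_def)

lemma sections_empty [simp]: "sections {} = {{}}" by (auto simp: sections_def)

lemma finite_sections: "finite U \<Longrightarrow> finite (sections U)" by (rule finite_subset[of _ "Pow U"]) (auto simp: sections_def)

lemma inv_closed_inverse_notin: "inv_closed U \<Longrightarrow> w \<notin> U \<Longrightarrow> inverse w \<notin> U"
 unfolding inv_closed_def by (metis inverse_inverse_eq)

lemma inv_closed_remove:
 assumes "inv_closed U" "w \<in> U"
 defines "U' \<equiv> U - {w, inverse w}"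
 shows "inv_closed U'" "w \<notin> U'" "w \<noteq> 0" "w * w \<noteq> 1" "U = insert w (insert (inverse w) U')"
  "card U = Suc (Suc (card U'))"
proof -
 show w: "w \<notin> U'" "w \<noteq> 0" "w * w \<noteq> 1" "U = insert w (insert (inverse w) U')" using assms by (auto simp: inv_closed_def)
 show "inv_closed U'" using assms(1) by (auto simp: inv_closed_def U'_def inverse_eq_imp_eq)
 then have "finite U'" "inverse w \<notin> U'" by (auto simp: inv_closed_def U'_def)
 then show "card U = Suc (Suc (card U'))" using w inverse_neq_self[of w] by (subst w(4)) auto
qed

lemma inv_closed_induct [consumes 1, case_names empty insert]:
 assumes "inv_closed U" "P {}"
  and "\<And>w U. inv_closed U \<Longrightarrow> w \<notin> U \<Longrightarrow> w \<noteq> 0 \<Longrightarrow> w * w \<noteq> 1 \<Longrightarrow> P U \<Longrightarrow>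
      P (insert w (insert (inverse w) U))"
 shows "P U" using assms(1)
proof (induction "card U" arbitrary: U rule: less_induct)
 case less
 show ?case
 proof (cases "U = {}")
  case False
  then obtain w where w: "w \<in> U" by blast
  note * = inv_closed_remove[OF less.prems w]
  show ?thesis by (subst *(5), intro assms(3) *(1-4) less.hyps) (simp_all add: *(6))
 qed (use assms(2) in simp)
qed

lemma sections_insert:
 assumes "inv_closed U" "w \<notin> U" "w \<noteq> 0" "w * w \<noteq> 1"
 shows "sections (insert w (insert (inverse w) U)) = insert w ` sections U \<union> insert (inverse w) ` sections U"
  (is "?L = ?R")
proof -
 have w: "inverse w \<notin> U" "inverse w \<noteq> w" using assms inv_closed_inverse_notin inverse_neq_self by auto
 have cl: "inverse e \<in> U" if "e \<in> U" for e using that assms(1) by (auto simp: inv_closed_def)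
 have ne: "inverse e \<noteq> w" "inverse e \<noteq> inverse w" "e \<noteq> w" "e \<noteq> inverse w" if "e \<in> U" for e
  using cl[OF that] that assms(2) w(1) by auto
 show ?thesis
 proof
  have aux: "insert v S \<in> ?L" if S: "S \<in> sections U" and v: "v = w \<or> v = inverse w" for S v
  proof -
   have sub: "S \<subseteq> U" using S by (simp add: sections_def)
   have "e \<in> insert v S \<longleftrightarrow> inverse e \<notin> insert v S"
    if e: "e \<in> insert w (insert (inverse w) U)" for e
   proof (cases "e \<in> U")
    case True
    then have "e \<noteq> v" "inverse e \<noteq> v" using ne v by metis+
    then show ?thesis using S True by (simp add: sections_def)
   next
    case False
    then have "e = w \<or> e = inverse w" using e by simp
    moreover have "w \<notin> S" "inverse w \<notin> S" using sub w(1) assms(2) by blast+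
    ultimately show ?thesis using v w(2) by force
   qed
   then show ?thesis using sub v by (auto simp: sections_def)
  qed
  show "?R \<subseteq> ?L" unfolding Un_subset_iff image_subset_iff using aux[OF _ disjI1[OF refl]] aux[OF _ disjI2[OF refl]] by (intro conjI ballI)
  show "?L \<subseteq> ?R"
  proof
   fix S assume S: "S \<in> ?L"
   define T where "T = S \<inter> U"
   have H: "e \<in> S \<longleftrightarrow> inverse e \<notin> S" if "e \<in> insert w (insert (inverse w) U)" for e
    using S that unfolding sections_def by blast
   have "e \<in> T \<longleftrightarrow> inverse e \<notin> T" if "e \<in> U" for e using H[of e] cl[OF that] that by (simp add: T_def)
   then have "T \<in> sections U" unfolding sections_def T_def by blast
   moreover have "w \<in> S \<longleftrightarrow> inverse w \<notin> S" "S \<subseteq> insert w (insert (inverse w) U)"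
    using H[of w] S by (simp, auto simp: sections_def)
   then have "S = insert w T \<or> S = insert (inverse w) T" by (auto simp: T_def)
   ultimately show "S \<in> ?R" by blast
  qed
 qed
qed

lemma sum_sections_insert:
 assumes "inv_closed U" "w \<notin> U" "w \<noteq> 0" "w * w \<noteq> 1"
 shows "(\<Sum>S\<in>sections (insert w (insert (inverse w) U)). f S) = (\<Sum>S\<in>sections U. f (insert w S) + f (insert (inverse w) S))"
proof -
 have w: "inverse w \<notin> U" "inverse w \<noteq> w" using assms inv_closed_inverse_notin inverse_neq_self by auto
 have fin: "finite (sections U)" using assms(1) by (auto simp: inv_closed_def intro: finite_sections)
 have sub: "w \<notin> S \<and> inverse w \<notin> S" if "S \<in> sections U" for S using that assms(2) w by (auto simp: sections_def)
 have "inj_on (insert w) (sections U)" "inj_on (insert (inverse w)) (sections U)" using sub by (auto simp: inj_on_def) (metis insert_ident)+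
 moreover have "insert w ` sections U \<inter> insert (inverse w) ` sections U = {}" using sub w(2) by (auto simp: set_eq_iff)
 ultimately show ?thesis unfolding sections_insert[OF assms] by (subst sum.union_disjoint) (auto simp: fin sum.reindex sum.distrib)
qed

lemma section_sum_insert:
 assumes "inv_closed U" "w \<notin> U" "w \<noteq> 0" "w * w \<noteq> 1"
 shows "section_sum g t (insert w (insert (inverse w) U)) = (\<Sum>S\<in>sections U. section_weight g t S *
   (g w * (\<Prod>e\<in>S. hlC t w e) + g (inverse w) * (\<Prod>e\<in>S. hlC t (inverse w) e)))"
 unfolding section_sum_def sum_sections_insert[OF assms]
proof (rule sum.cong[OF refl])
 fix S assume S: "S \<in> sections U"
 then have "finite S" "w \<notin> S" "inverse w \<notin> S"
  using assms inv_closed_inverse_notin[OF assms(1,2)] by (auto simp: sections_def inv_closed_def intro: finite_subset)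
 then show "section_weight g t (insert w S) + section_weight g t (insert (inverse w) S) = section_weight g t S *
   (g w * (\<Prod>e\<in>S. hlC t w e) + g (inverse w) * (\<Prod>e\<in>S. hlC t (inverse w) e))" by (simp add: section_weight_insert algebra_simps)
qed

lemma sections_complement:
 assumes "inv_closed U" "S \<in> sections U"
 shows "U - S = inverse ` S"
proof
 show "U - S \<subseteq> inverse ` S"
 proof
  fix e assume "e \<in> U - S"
  then have "inverse e \<in> S" using assms by (auto simp: sections_def inv_closed_def)
  then show "e \<in> inverse ` S" by (metis imageI inverse_inverse_eq)
 qed
 show "inverse ` S \<subseteq> U - S" using assms by (auto simp: sections_def inv_closed_def)
qed

lemma prod_sections_complement:
 assumes "inv_closed U" "S \<in> sections U"
 shows "(\<Prod>e\<in>U - S. f e) = (\<Prod>e\<in>S. f (inverse e))"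
 unfolding sections_complement[OF assms] by (subst prod.reindex) (auto simp: inj_on_def)

lemma prod_sections_split:
 assumes "inv_closed U" "S \<in> sections U"
 shows "(\<Prod>e\<in>U. f e) = (\<Prod>e\<in>S. f e) * (\<Prod>e\<in>U - S. f e)"
 using prod.subset_diff[of S U f] assms by (auto simp: sections_def inv_closed_def mult.commute)

lemma card_sections:
 assumes "inv_closed U" "S \<in> sections U"
 shows "card S = card U div 2" "card (U - S) = card U div 2"
proof -
 have fin: "finite U" "S \<subseteq> U" "finite S" using assms by (auto simp: sections_def inv_closed_def intro: finite_subset)
 have "card (U - S) = card S" unfolding sections_complement[OF assms] by (rule card_image) (auto simp: inj_on_def)
 moreover have "card (U - S) = card U - card S" "card S \<le> card U" using fin by (auto simp: card_Diff_subset card_mono)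
 ultimately show "card S = card U div 2" "card (U - S) = card U div 2" by auto
qed

section \<open>Interpolation recursions for section sums\<close>

definition numer_pos :: "complex \<Rightarrow> complex set \<Rightarrow> complex \<Rightarrow> complex set \<Rightarrow> complex" where
 "numer_pos t U y S = (\<Prod>e\<in>S. 1 - t * y * e) * (\<Prod>e\<in>U - S. 1 - y * e)"

text \<open>Together with \<open>numer_pos\<close>: the two ways of extending a section, by
  \<open>y\<close> or by \<open>inverse y\<close>, multiplied by the common denominator
  \<open>\<Prod>e\<in>U. 1 - y * e\<close>. Both are polynomials in \<open>y\<close> because the
  complement of \<open>S\<close> consists of the inverses of \<open>S\<close>.\<close>

definition numer_neg :: "complex \<Rightarrow> complex set \<Rightarrow> complex \<Rightarrow> complex set \<Rightarrow> complex" where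
 "numer_neg t U y S = (\<Prod>e\<in>S. 1 - y * e) * (\<Prod>e\<in>U - S. t - y * e)"

lemma numer_pos_eq:
 assumes "inv_closed U" "S \<in> sections U" "y \<notin> U"
 shows "(\<Prod>e\<in>U. 1 - y * e) * (\<Prod>e\<in>S. hlC t y e) = numer_pos t U y S"
proof -
 have "(\<Prod>e\<in>S. 1 - y * e) * (\<Prod>e\<in>S. hlC t y e) = (\<Prod>e\<in>S. 1 - t * y * e)" unfolding prod.distrib[symmetric]
 proof (rule prod.cong[OF refl])
  fix e assume "e \<in> S"
  then have "e \<noteq> 0" "inverse e \<in> U" using assms by (auto simp: sections_def inv_closed_def)
  then have "1 - y * e \<noteq> 0" using assms(3) by (metis eq_iff_diff_eq_0 inverse_unique mult.commute)
  then show "(1 - y * e) * hlC t y e = 1 - t * y * e" by (simp add: hlC_def)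
 qed
 note eq = this
 show ?thesis unfolding numer_pos_def prod_sections_split[OF assms(1,2), of "\<lambda>e. 1 - y * e"] eq[symmetric] by (simp only: mult_ac)
qed

lemma numer_neg_eq:
 assumes "inv_closed U" "S \<in> sections U" "y \<notin> U" "y \<noteq> 0"
 shows "(\<Prod>e\<in>U. 1 - y * e) * (\<Prod>e\<in>S. hlC t (inverse y) e) = numer_neg t U y S"
proof -
 have "(\<Prod>e\<in>U - S. 1 - y * e) * (\<Prod>e\<in>S. hlC t (inverse y) e) = (\<Prod>e\<in>U - S. t - y * e)"
  unfolding prod.distrib[symmetric] prod_sections_complement[OF assms(1,2)]
 proof (rule prod.cong[OF refl])
  fix e assume "e \<in> S"
  then have "e \<noteq> 0" "e \<noteq> y" using assms by (auto simp: sections_def inv_closed_def)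
  then have "y - e \<noteq> 0" by simp
  have "hlC t (inverse y) e = (y - t * e) / (y - e)" using \<open>y - e \<noteq> 0\<close> assms(4) by (simp add: hlC_def divide_simps)
  moreover have "1 - y * inverse e = - (y - e) / e" "t - y * inverse e = - (y - t * e) / e"
   using \<open>e \<noteq> 0\<close> by (simp_all add: field_simps)
  ultimately show "(1 - y * inverse e) * hlC t (inverse y) e = t - y * inverse e"
   using \<open>y - e \<noteq> 0\<close> \<open>e \<noteq> 0\<close> by (simp add: divide_simps) algebra
 qed
 note eq = this
 show ?thesis unfolding numer_neg_def prod_sections_split[OF assms(1,2), of "\<lambda>e. 1 - y * e"] eq[symmetric] by (simp only: mult_ac)
qed

text \<open>The poles of the individual terms of a section sum at \<open>y = 1/d\<close> cancel between
 the sections containing \<open>d\<close> and those containing \<open>1/d\<close>.\<close>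

lemma residue_cancel:
 assumes cl: "inv_closed U" and d: "d \<in> U" and y: "y = inverse d"
  and G: "Gp * g d = - (Gm * g y)"
 shows "(\<Sum>S\<in>sections U. section_weight g t S * (Gp * numer_pos t U y S - Gm * numer_neg t U y S)) = 0"
proof -
 define U' where "U' = U - {d, y}"
 note * = inv_closed_remove[OF cl d, folded y, folded U'_def]
 have y0: "y \<noteq> 0" "y * y \<noteq> 1" "y * d = 1" "d * y = 1" "y \<noteq> d" "inverse y = d"
 proof -
  show yd: "y * d = 1" "d * y = 1" "y \<noteq> 0" "inverse y = d" using y *(3) by auto
  show "y * y \<noteq> 1" "y \<noteq> d" using yd *(4) by algebra+
 qed
 have yn: "y \<notin> U'" by (simp add: U'_def)
 have fin: "finite U'" using *(1) by (simp add: inv_closed_def)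
 have "(\<Sum>S\<in>sections U. section_weight g t S * (Gp * numer_pos t U y S - Gm * numer_neg t U y S)) =
  (\<Sum>S\<in>sections U'. section_weight g t (insert d S) * (Gp * numer_pos t U y (insert d S) - Gm * numer_neg t U y (insert d S)) +
    section_weight g t (insert y S) * (Gp * numer_pos t U y (insert y S) - Gm * numer_neg t U y (insert y S)))"
  unfolding *(5) y by (rule sum_sections_insert[OF *(1-4)])
 also have "\<dots> = 0"
 proof (rule sum.neutral, rule ballI)
  fix S assume S: "S \<in> sections U'"
  have dS: "finite S" "d \<notin> S" "y \<notin> S" "S \<subseteq> U'" using S fin *(2) yn by (auto simp: sections_def intro: finite_subset)
  have c: "U - insert d S = insert y (U' - S)" "U - insert y S = insert d (U' - S)" using dS *(2) yn y0(5) unfolding *(5) by auto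
  have n: "finite (U' - S)" "d \<notin> U' - S" "y \<notin> U' - S" using fin *(2) yn by auto
  have np: "numer_pos t U y (insert d S) = (1 - t) * (1 - y * y) * ((\<Prod>e\<in>S. 1 - t * y * e) * (\<Prod>e\<in>U' - S. 1 - y * e))"
   "numer_neg t U y (insert d S) = 0" "numer_pos t U y (insert y S) = 0"
   "numer_neg t U y (insert y S) = (1 - y * y) * (t - 1) * ((\<Prod>e\<in>S. 1 - y * e) * (\<Prod>e\<in>U' - S. t - y * e))"
   unfolding numer_pos_def numer_neg_def c using dS(1-3) n y0(3) by (simp_all add: mult.assoc)
  \<comment> \<open>Because \<open>y * d = 1\<close>, the factors \<open>1 - y / e\<close> and
    \<open>t - y / e\<close> are the denominator and the numerator of \<open>hlC t d e\<close>, up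
    to the same unit \<open>- y / e\<close>.\<close>
  have key: "(\<Prod>e\<in>S. hlC t d e) * ((\<Prod>e\<in>S. 1 - t * y * e) * (\<Prod>e\<in>U' - S. 1 - y * e)) =
     (\<Prod>e\<in>S. hlC t y e) * ((\<Prod>e\<in>S. 1 - y * e) * (\<Prod>e\<in>U' - S. t - y * e))"
   unfolding prod.distrib[symmetric] prod_sections_complement[OF *(1) S]
  proof (rule prod.cong[OF refl])
   fix e assume e: "e \<in> S"
   then have "e \<in> U'" "inverse e \<in> U'" using dS(4) *(1) by (auto simp: inv_closed_def)
   then have e0: "e \<noteq> 0" "e \<noteq> d" "e \<noteq> y" "inverse e \<noteq> y" "inverse e \<noteq> d"
    using *(1,2) yn by (auto simp: inv_closed_def)
   then have "1 - d * e \<noteq> 0" "1 - y * e \<noteq> 0" using y0(3,4) *(3) y0(1) by (metis eq_iff_diff_eq_0 inverse_unique mult.commute)+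
   then have h: "hlC t d e * (1 - d * e) = 1 - t * d * e" "hlC t y e * (1 - y * e) = 1 - t * y * e" by (simp_all add: hlC_def)
   have i: "inverse e * e = 1" using e0 by simp
   have "1 - y * inverse e = (1 - d * e) * (- y * inverse e)" "t - y * inverse e = (1 - t * d * e) * (- y * inverse e)" using i y0(3) by algebra+
   then show "hlC t d e * ((1 - t * y * e) * (1 - y * inverse e)) = hlC t y e * ((1 - y * e) * (t - y * inverse e))" using h by algebra
  qed
  have "section_weight g t (insert d S) * (Gp * numer_pos t U y (insert d S) - Gm * numer_neg t U y (insert d S)) =
    section_weight g t S * (Gp * g d) * ((1 - t) * (1 - y * y)) *
    ((\<Prod>e\<in>S. hlC t d e) * ((\<Prod>e\<in>S. 1 - t * y * e) * (\<Prod>e\<in>U' - S. 1 - y * e)))"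
   unfolding np section_weight_insert[OF dS(1,2)] by (simp add: mult_ac)
  moreover have "section_weight g t (insert y S) * (Gp * numer_pos t U y (insert y S) - Gm * numer_neg t U y (insert y S)) =
    section_weight g t S * (Gm * g y) * ((1 - t) * (1 - y * y)) *
    ((\<Prod>e\<in>S. hlC t y e) * ((\<Prod>e\<in>S. 1 - y * e) * (\<Prod>e\<in>U' - S. t - y * e)))"
   unfolding np section_weight_insert[OF dS(1,3)] by (simp add: algebra_simps)
  ultimately show "section_weight g t (insert d S) * (Gp * numer_pos t U y (insert d S) - Gm * numer_neg t U y (insert d S)) +
    section_weight g t (insert y S) * (Gp * numer_pos t U y (insert y S) - Gm * numer_neg t U y (insert y S)) = 0" unfolding key G by simp
 qed
 finally show ?thesis .
qed

lemma polyfun_numer: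
 assumes "inv_closed U" "S \<in> sections U"
 shows "polyfun (card U) (\<lambda>y. numer_pos t U y S)" "polyfun (card U) (\<lambda>y. numer_neg t U y S)"
proof -
 have lin: "polyfun 1 (\<lambda>w. c - w * b)" "polyfun 1 (\<lambda>w. 1 - t * w * b)" for b c :: complex
  using polyfun_lin[of c "-b"] polyfun_lin[of 1 "-t * b"] by (simp_all add: mult_ac)
 have "S \<subseteq> U" "finite U" using assms by (auto simp: sections_def inv_closed_def)
 then have "card U = 1 * card S + 1 * card (U - S)" using finite_subset[of S U] by (simp add: card_Diff_subset card_mono)
 then show "polyfun (card U) (\<lambda>y. numer_pos t U y S)" "polyfun (card U) (\<lambda>y. numer_neg t U y S)"
  unfolding numer_pos_def numer_neg_def by (simp_all only:) (intro polyfun_mult polyfun_prod lin)+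
qed

lemma numer_0:
 assumes "inv_closed U" "S \<in> sections U"
 shows "numer_pos t U 0 S = 1" "numer_neg t U 0 S = t^(card U div 2)" using card_sections[OF assms] by (simp_all add: numer_pos_def numer_neg_def)

text \<open>The common step for adding a pair \<open>w\<close>, \<open>inverse w\<close>.
  \<open>Gp\<close> and \<open>- Gm\<close> are the numerators of \<open>g\<close> at
  \<open>w\<close> and at its inverse over the common denominator \<open>c\<close>, and
  \<open>K\<close> is the expected value. All points of \<open>U\<close> are roots: the sum vanishes
  there by \<open>residue_cancel\<close>, for which \<open>G\<close> supplies the antisymmetry, and
  the right-hand side has a zero factor. The degree is at most \<open>2 + card U\<close>, so three
  further points \<open>Z\<close> decide.\<close>

lemma section_sum_step:
 fixes Gp Gm K g :: "complex \<Rightarrow> complex"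
 assumes cl: "inv_closed U" and w: "w \<notin> U" "w \<noteq> 0" "w * w \<noteq> 1"
  and pf: "polyfun 2 Gp" "polyfun 2 Gm" "polyfun 2 K"
  and Z: "card Z = 3" "Z \<inter> U = {}"
  and zero: "\<And>y. y \<in> Z \<Longrightarrow> (\<Sum>S\<in>sections U. section_weight g t S *
   (Gp y * numer_pos t U y S - Gm y * numer_neg t U y S)) = K y * (\<Prod>e\<in>U. 1 - y * e)"
  and G: "\<And>d y. d * y = 1 \<Longrightarrow> d * d \<noteq> 1 \<Longrightarrow> y * y \<noteq> 1 \<Longrightarrow> Gp y * g d = - (Gm y * g y)"
  and c: "c \<noteq> 0" "g w * c = Gp w" "g (inverse w) * c = - Gm w"
 shows "section_sum g t (insert w (insert (inverse w) U)) * c = K w"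
proof -
 define P where "P y = (\<Prod>e\<in>U. 1 - y * e)" for y
 define F where "F y = (\<Sum>S\<in>sections U. section_weight g t S * (Gp y * numer_pos t U y S - Gm y * numer_neg t U y S))" for y
 have fin: "finite U" and cl': "\<And>e. e \<in> U \<Longrightarrow> inverse e \<in> U \<and> e * e \<noteq> 1 \<and> e \<noteq> 0"
  using cl by (auto simp: inv_closed_def)
 have lin: "polyfun 1 (\<lambda>y. 1 - y * b)" for b :: complex using polyfun_lin[of 1 "-b"] by (simp add: mult_ac)
 have "polyfun (2 + 1 * card U) (\<lambda>y. K y * P y)" unfolding P_def by (intro polyfun_mult pf polyfun_prod lin)
 then have KP: "polyfun (2 + card U) (\<lambda>y. K y * P y)" by simp
 have deg: "polyfun (2 + card U) (\<lambda>y. F y - K y * P y)" unfolding F_def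
  by (intro polyfun_diff[OF polyfun_sum KP] polyfun_cmult polyfun_diff polyfun_mult pf polyfun_numer cl)
 have "F y - K y * P y = 0" if d: "y \<in> U" for y
 proof -
  define d where "d = inverse y"
  have y: "d \<in> U" "y = inverse d" "d * y = 1" "y * y \<noteq> 1" "d * d \<noteq> 1" using cl'[OF d] cl'[of d] by (auto simp: d_def)
  have "P y = 0" unfolding P_def using y(1,3) fin by (auto simp: mult.commute)
  with residue_cancel[OF cl y(1,2) G[OF y(3,5,4)]] show ?thesis by (simp add: F_def)
 qed
 moreover have "card (Z \<union> U) = 3 + card U" "finite Z" using fin Z card_ge_0_finite[of Z] by (auto simp: card_Un_disjoint)
 moreover have "F y - K y * P y = 0" if "y \<in> Z" for y using zero[OF that] by (simp only: F_def P_def diff_self)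
 ultimately have fw: "F w - K w * P w = 0" using fin by (rule_tac polyfun_zero[OF deg, of "Z \<union> U"]) auto
 have "1 - w * e \<noteq> 0" if "e \<in> U" for e using cl'[OF that] w(1) by (metis eq_iff_diff_eq_0 inverse_unique mult.commute)
 then have P: "P w \<noteq> 0" using fin by (simp add: P_def)
 have "section_sum g t (insert w (insert (inverse w) U)) * (c * P w) = F w" unfolding section_sum_insert[OF cl w] sum_distrib_right F_def
 proof (rule sum.cong[OF refl])
  fix S assume S: "S \<in> sections U"
  have "section_weight g t S * (g w * (\<Prod>e\<in>S. hlC t w e) + g (inverse w) * (\<Prod>e\<in>S. hlC t (inverse w) e)) * (c * P w) =
   section_weight g t S * ((g w * c) * (P w * (\<Prod>e\<in>S. hlC t w e)) + (g (inverse w) * c) * (P w * (\<Prod>e\<in>S. hlC t (inverse w) e)))"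
   by (simp only: distrib_left distrib_right mult_ac)
  then show "section_weight g t S * (g w * (\<Prod>e\<in>S. hlC t w e) + g (inverse w) * (\<Prod>e\<in>S. hlC t (inverse w) e)) * (c * P w) =
   section_weight g t S * (Gp w * numer_pos t U w S - Gm w * numer_neg t U w S)"
   unfolding c(2,3) P_def numer_pos_eq[OF cl S w(1)] numer_neg_eq[OF cl S w(1,2)] by simp
 qed
 with fw P show ?thesis by simp
qed

text \<open>The extra nodes are 0, 1 and -1. At 1 and -1 the two extensions coincide and cancel; at
  0 they have values 1 and \<open>a * b * t^(card U div 2)\<close>, which gives the new
  factor.\<close>

lemma section_sum_two_param_step:
 fixes a b t w :: complex
 assumes cl: "inv_closed U" and w: "w \<notin> U" "w \<noteq> 0" "w * w \<noteq> 1"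
 defines "g \<equiv> \<lambda>e. (1 - a * e) * (1 - b * e) / (1 - e\<^sup>2)"
 shows "section_sum g t (insert w (insert (inverse w) U)) = (1 - a * b * t^(card U div 2)) * section_sum g t U"
proof -
 have w2: "1 - w\<^sup>2 \<noteq> 0" using w by (simp add: power2_eq_square)
 have cl': "inverse e \<in> U \<and> e * e \<noteq> 1 \<and> e \<noteq> 0" if "e \<in> U" for e using cl that by (auto simp: inv_closed_def)
 have "section_sum g t (insert w (insert (inverse w) U)) * (1 - w\<^sup>2) = (1 - a * b * t^(card U div 2)) * section_sum g t U * (1 - w\<^sup>2)"
 proof (rule section_sum_step[OF cl w, where Z = "{0, 1, -1}"
    and Gp = "\<lambda>y. (1 - a * y) * (1 - b * y)" and Gm = "\<lambda>y. (y - a) * (y - b)"])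
  have lin: "polyfun 1 (\<lambda>w. w - b)" "polyfun 1 (\<lambda>w. 1 - b * w)" for b :: complex
   using polyfun_lin[of "-b" 1] polyfun_lin[of 1 "-b"] by simp_all
  show "polyfun 2 (\<lambda>y. (1 - a * y) * (1 - b * y))" "polyfun 2 (\<lambda>y. (y - a) * (y - b))"
   using polyfun_mult[OF lin(2) lin(2)] polyfun_mult[OF lin(1) lin(1)] by (simp_all add: numeral_2_eq_2)
  have "polyfun 2 (\<lambda>y::complex. 1 - y\<^sup>2)"
   using polyfun_mult[OF lin(2)[of 1] lin(2)[of "-1"]] by (simp add: numeral_2_eq_2 algebra_simps)
  then show "polyfun 2 (\<lambda>y. (1 - a * b * t^(card U div 2)) * section_sum g t U * (1 - y\<^sup>2))" by (rule polyfun_cmult)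
  show "{0, 1, -1} \<inter> U = {}" using cl' by fastforce
  have "numer_pos t U y S = numer_neg t U y S" if S: "S \<in> sections U" and yy: "y * y = 1" for y S
   unfolding numer_pos_def numer_neg_def prod_sections_complement[OF cl S] prod.distrib[symmetric]
  proof (rule prod.cong[OF refl])
   fix e assume "e \<in> S"
   then have "inverse e * e = 1" using sections_subset[OF S] cl'[of e] by auto
   then show "(1 - t * y * e) * (1 - y * inverse e) = (1 - y * e) * (t - y * inverse e)" using yy by algebra
  qed
  moreover have "(1 - a * y) * (1 - b * y) = (y - a) * (y - b)" if "y * y = 1" for y using that by algebra
  ultimately have 1: "section_weight g t S * ((1 - a * y) * (1 - b * y) * numer_pos t U y S -
    (y - a) * (y - b) * numer_neg t U y S) = 0" if "S \<in> sections U" "y * y = 1" for S y using that by simp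
  show "(\<Sum>S\<in>sections U. section_weight g t S * ((1 - a * y) * (1 - b * y) * numer_pos t U y S - (y - a) * (y - b) * numer_neg t U y S)) =
   (1 - a * b * t^(card U div 2)) * section_sum g t U * (1 - y\<^sup>2) * (\<Prod>e\<in>U. 1 - y * e)" if "y \<in> {0, 1, -1}" for y
  proof (cases "y = 0")
   case False
   then have "y * y = 1" using that by auto
   then show ?thesis by (simp add: 1 power2_eq_square)
  qed (simp add: numer_0[OF cl] section_sum_def mult_ac flip: sum_distrib_right)
  fix d y :: complex assume y: "d * y = 1" "d * d \<noteq> 1" "y * y \<noteq> 1"
  then have "1 - d\<^sup>2 \<noteq> 0" "1 - y\<^sup>2 \<noteq> 0" by (auto simp: power2_eq_square)
  moreover have "(1 - a * d) * (1 - b * d) * (1 - y\<^sup>2) * ((1 - a * y) * (1 - b * y)) =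
     - ((y - a) * (y - b) * ((1 - a * y) * (1 - b * y)) * (1 - d\<^sup>2))" using y(1) by algebra
  ultimately show "(1 - a * y) * (1 - b * y) * g d = - ((y - a) * (y - b) * g y)" by (simp add: g_def divide_simps mult_ac)
 next
  have "(inverse w)\<^sup>2 \<noteq> 1" using w2 by (auto simp: power_inverse field_simps)
  then have "g (inverse w) * (1 - (inverse w)\<^sup>2) = (1 - a * inverse w) * (1 - b * inverse w)" by (simp add: g_def)
  moreover have "inverse w * w = 1" using w by simp
  ultimately show "g (inverse w) * (1 - w\<^sup>2) = - ((w - a) * (w - b))" by algebra
 qed (use w2 in \<open>auto simp: g_def\<close>)
 with w2 show ?thesis by simp
qed

text \<open>Each pair contributes a factor that depends only on how many pairs came before. Three
  instances matter: \<open>b = 0\<close> for the base of the recursion in \<open>m\<close>,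
  parameters -1 and \<open>- rp\<close> for the even dual system, and parameters 1 and -1 for the
  constant weight 1.\<close>

lemma section_sum_two_param:
 fixes a b t :: complex
 assumes "inv_closed U"
 defines "g \<equiv> \<lambda>e. (1 - a * e) * (1 - b * e) / (1 - e\<^sup>2)"
 shows "section_sum g t U = (\<Prod>i<card U div 2. 1 - a * b * t^i)" using assms(1)
proof (induction rule: inv_closed_induct)
 case empty
 show ?case by (simp add: section_sum_def section_weight_def)
next
 case (insert w U)
 have "card (insert w (insert (inverse w) U)) = Suc (Suc (card U))"
  using insert.hyps inv_closed_inverse_notin[OF insert.hyps(1,2)] inverse_neq_self[OF insert.hyps(3,4)] by (simp add: inv_closed_def)
 then show ?case using section_sum_two_param_step[OF insert.hyps(1-4), of a b t] insert.IH by (simp add: g_def mult.commute)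
qed

text \<open>For the weight \<open>1 + s * e\<close> the two extensions no longer cancel at 1 and -1.
  At \<open>y = - s\<close> and \<open>y = - 1 / s\<close> one extension vanishes and the factors of
  the other merge with the weights into those of parameter \<open>t * s\<close>. The outcome is a
  recursion linking \<open>s\<close> to \<open>t * s\<close>; it is solved in the limit by
  \<open>section_sum_one_param_limit\<close>.\<close>

lemma section_sum_one_param_step:
 fixes s t w :: complex
 assumes cl: "inv_closed U" and w: "w \<notin> U" "w \<noteq> 0" "w * w \<noteq> 1"
  and s: "s \<noteq> 0" "s\<^sup>2 \<noteq> 1" "- s \<notin> U"
 shows "section_sum (\<lambda>e. 1 + s * e) t (insert w (insert (inverse w) U)) =
  t^(card U div 2) * (1 + s * w) * (1 + s / w) * section_sum (\<lambda>e. 1 + s * e) t U +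
  (1 - s\<^sup>2) * section_sum (\<lambda>e. 1 + t * s * e) t U"
proof -
 define g where "g e = 1 + s * e" for e
 define B where "B = section_sum g t U"
 define B' where "B' = section_sum (\<lambda>e. 1 + t * s * e) t U"
 define K where "K y = t^(card U div 2) * B * ((1 + s * y) * (y + s)) + (1 - s\<^sup>2) * B' * y" for y
 have cl': "inverse e \<in> U \<and> e * e \<noteq> 1 \<and> e \<noteq> 0" if "e \<in> U" for e using cl that by (auto simp: inv_closed_def)
 have "section_sum g t (insert w (insert (inverse w) U)) * w = K w"
 proof (rule section_sum_step[OF cl w, where Z = "{0, - s, - inverse s}"
    and Gp = "\<lambda>y. y * (1 + s * y)" and Gm = "\<lambda>y. - (y + s)"])
  have lin: "polyfun 1 (\<lambda>w. w + s)" "polyfun 1 (\<lambda>w. 1 + s * w)" "polyfun 1 (\<lambda>w::complex. w)" "polyfun 1 (\<lambda>w. - (w + s))"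
   using polyfun_lin[of s 1] polyfun_lin[of 1 s] polyfun_lin[of 0 1] polyfun_lin[of "-s" "-1"] by (simp_all add: add_ac)
  show Gp: "polyfun 2 (\<lambda>y. y * (1 + s * y))" "polyfun 2 (\<lambda>y. - (y + s))"
   using polyfun_mult[OF lin(3) lin(2)] polyfun_mono[OF lin(4), of 2] by (simp_all add: numeral_2_eq_2)
  show "polyfun 2 K" unfolding K_def
   by (intro polyfun_add polyfun_cmult polyfun_mono[OF lin(3)] polyfun_mult[OF lin(2,1), unfolded one_add_one]) simp
  show "card {0, - s, - inverse s} = 3" using s(1,2) by (auto simp: field_simps power2_eq_square)
  have "- inverse s \<notin> U" using cl' s(3) by (metis inverse_inverse_eq inverse_minus_eq)
  then show "{0, - s, - inverse s} \<inter> U = {}" using cl' s(3) by auto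
  fix y assume "y \<in> {0, - s, - inverse s}"
  then consider "y = 0" | "y = - s" | "s * y = -1" using s(1) by auto
  then show "(\<Sum>S\<in>sections U. section_weight g t S * (y * (1 + s * y) * numer_pos t U y S - - (y + s) * numer_neg t U y S)) =
   K y * (\<Prod>e\<in>U. 1 - y * e)"
  proof cases
   case 1
   then show ?thesis by (simp add: K_def numer_0[OF cl] B_def section_sum_def sum_distrib_left sum_distrib_right mult_ac)
  next
   case 2
   have "section_weight g t S * numer_pos t U y S = section_weight (\<lambda>e. 1 + t * s * e) t S * (\<Prod>e\<in>U. 1 - y * e)"
    if "S \<in> sections U" for S unfolding prod_sections_split[OF cl that] section_weight_def numer_pos_def g_def 2 by simp
   then have "(\<Sum>S\<in>sections U. section_weight g t S * numer_pos t U y S) = B' * (\<Prod>e\<in>U. 1 - y * e)"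
    unfolding B'_def section_sum_def sum_distrib_right by simp
   moreover have "(\<Sum>S\<in>sections U. section_weight g t S * (y * (1 + s * y) * numer_pos t U y S - - (y + s) * numer_neg t U y S)) =
    y * (1 - s\<^sup>2) * (\<Sum>S\<in>sections U. section_weight g t S * numer_pos t U y S)"
    unfolding sum_distrib_left by (rule sum.cong) (simp_all add: 2 power2_eq_square mult_ac)
   ultimately show ?thesis using 2 by (simp add: K_def)
  next
   case 3
   have "section_weight g t S * numer_neg t U y S = section_weight (\<lambda>e. 1 + t * s * e) t S * (\<Prod>e\<in>U. 1 - y * e)"
    if S: "S \<in> sections U" for S
   proof -
    have eq: "(\<Prod>e\<in>S. g e) * (\<Prod>e\<in>S. t - y * inverse e) = (\<Prod>e\<in>S. 1 + t * s * e) * (\<Prod>e\<in>S. 1 - y * inverse e)"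
     unfolding prod.distrib[symmetric]
    proof (rule prod.cong[OF refl])
     fix e assume "e \<in> S"
     then have "inverse e * e = 1" using sections_subset[OF S] cl'[of e] by auto
     then show "g e * (t - y * inverse e) = (1 + t * s * e) * (1 - y * inverse e)" unfolding g_def using 3 by algebra
    qed
    have "section_weight g t S * numer_neg t U y S = pair_prod (hlC t) S * (\<Prod>e\<in>S. 1 - y * e) *
      ((\<Prod>e\<in>S. g e) * (\<Prod>e\<in>S. t - y * inverse e))"
     unfolding section_weight_def numer_neg_def prod_sections_complement[OF cl S] by (simp only: mult_ac)
    then show ?thesis unfolding eq prod_sections_split[OF cl S] section_weight_def prod_sections_complement[OF cl S] by (simp only: mult_ac)
   qed
   then have B: "(\<Sum>S\<in>sections U. section_weight g t S * numer_neg t U y S) = B' * (\<Prod>e\<in>U. 1 - y * e)"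
    unfolding B'_def section_sum_def sum_distrib_right by simp
   have "y + s = (1 - s\<^sup>2) * y" "1 + s * y = 0" using 3 by algebra+
   then have "K y = B' * (y + s)" by (simp add: K_def)
   moreover have "(\<Sum>S\<in>sections U. section_weight g t S * (y * (1 + s * y) * numer_pos t U y S - - (y + s) * numer_neg t U y S)) =
    (y + s) * (\<Sum>S\<in>sections U. section_weight g t S * numer_neg t U y S)"
    unfolding sum_distrib_left 3 by (rule sum.cong) (simp_all add: algebra_simps)
   ultimately show ?thesis unfolding B by (simp only: mult_ac)
  qed
 next
  show "y * (1 + s * y) * g d = - (- (y + s) * g y)" if "d * y = 1" for d y unfolding g_def using that by algebra
  show "g w * w = w * (1 + s * w)" "g (inverse w) * w = - (- (w + s))" using w(2) by (simp_all add: g_def distrib_left distrib_right)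
 qed (rule w(2))
 also have "K w = (t^(card U div 2) * (1 + s * w) * (1 + s / w) * B + (1 - s\<^sup>2) * B') * w"
 proof -
  have "w + s = (1 + s / w) * w" using w(2) by (simp add: field_simps)
  moreover have "T * B * (v * (u * w)) + c * w = (T * v * u * B + c) * w" for T u v c by (simp add: algebra_simps)
  ultimately show ?thesis unfolding K_def by metis
 qed
 finally show ?thesis using w(2) by (simp add: B_def B'_def g_def[abs_def])
qed

section \<open>Sums over bounded functions and their form as section sums\<close>

definition fun_weight :: "complex \<Rightarrow> complex \<Rightarrow> complex \<Rightarrow> ('a \<Rightarrow> complex) \<Rightarrow> 'a set \<Rightarrow> ('a \<Rightarrow> nat) \<Rightarrow> complex" where
 "fun_weight \<alpha> \<beta> t x A f = (\<Prod>a\<in>A. (if even (f a) then \<alpha> else \<beta>) * x a^f a) *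
   (\<Prod>a\<in>A. \<Prod>b\<in>A. if f b < f a then hlK t (x a) (x b) else 1)"

text \<open>The two scalars mark even and odd values. Lowering all nonzero values by one
  interchanges them, so the recursion in \<open>m\<close> closes only when both are carried
  along.\<close>

definition bounded_sum :: "nat \<Rightarrow> complex \<Rightarrow> complex \<Rightarrow> complex \<Rightarrow> ('a \<Rightarrow> complex) \<Rightarrow> 'a set \<Rightarrow> complex" where
 "bounded_sum m \<alpha> \<beta> t x A = (\<Sum>f\<in>A \<rightarrow>\<^sub>E {..m}. fun_weight \<alpha> \<beta> t x A f)"

lemma bounded_sum_0:
 assumes "finite A"
 shows "bounded_sum 0 \<alpha> \<beta> t x A = \<alpha>^card A"
proof -
 have "A \<rightarrow>\<^sub>E {..0::nat} = {\<lambda>a\<in>A. 0}" by (auto simp: PiE_eq_singleton)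
 then show ?thesis by (simp add: bounded_sum_def fun_weight_def)
qed

lemma fun_weight_extend:
 assumes "finite A" "P \<subseteq> A"
 shows "fun_weight \<alpha> \<beta> t x A (\<lambda>a\<in>A. if a \<in> P then Suc (f a) else 0) =
  \<alpha>^card (A - P) * (\<Prod>a\<in>P. x a) * (\<Prod>a\<in>P. \<Prod>b\<in>A - P. hlK t (x a) (x b)) * fun_weight \<beta> \<alpha> t x P f"
proof -
 let ?g = "\<lambda>a\<in>A. if a \<in> P then Suc (f a) else 0"
 have split: "prod h A = prod h (A - P) * prod h P" for h :: "'a \<Rightarrow> complex" using assms by (intro prod.subset_diff)
 have "(\<Prod>a\<in>A. (if even (?g a) then \<alpha> else \<beta>) * x a^?g a) =
   (\<Prod>a\<in>A - P. \<alpha>) * (\<Prod>a\<in>P. x a * ((if even (f a) then \<beta> else \<alpha>) * x a^f a))"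
  unfolding split using assms(2) by (intro arg_cong2[where f = "(*)", OF prod.cong prod.cong] refl) auto
 also have "\<dots> = \<alpha>^card (A - P) * ((\<Prod>a\<in>P. x a) * (\<Prod>a\<in>P. (if even (f a) then \<beta> else \<alpha>) * x a^f a))"
  by (simp add: prod.distrib)
 finally have 1: "(\<Prod>a\<in>A. (if even (?g a) then \<alpha> else \<beta>) * x a^?g a) = \<dots>" .
 have "(\<Prod>a\<in>A. \<Prod>b\<in>A. if ?g b < ?g a then hlK t (x a) (x b) else 1) =
   (\<Prod>a\<in>P. \<Prod>b\<in>A. if ?g b < ?g a then hlK t (x a) (x b) else 1)"
  using assms by (intro prod.mono_neutral_right) (auto intro!: prod.neutral)
 also have "\<dots> = (\<Prod>a\<in>P. (\<Prod>b\<in>A - P. hlK t (x a) (x b)) * (\<Prod>b\<in>P. if f b < f a then hlK t (x a) (x b) else 1))"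
  unfolding split using assms(2) by (intro prod.cong arg_cong2[where f = "(*)"] refl) auto
 finally have 2: "(\<Prod>a\<in>A. \<Prod>b\<in>A. if ?g b < ?g a then hlK t (x a) (x b) else 1) =
  (\<Prod>a\<in>P. \<Prod>b\<in>A - P. hlK t (x a) (x b)) * (\<Prod>a\<in>P. \<Prod>b\<in>P. if f b < f a then hlK t (x a) (x b) else 1)"
  by (simp add: prod.distrib)
 show ?thesis unfolding fun_weight_def 1 2 by (simp only: mult_ac)
qed

text \<open>\<open>P\<close> is the set where the function is positive. Comparisons inside
  \<open>P\<close> survive the shift by one, and every pair from \<open>P\<close> to its complement
  contributes an \<open>hlK\<close> factor.\<close>

lemma bounded_sum_Suc:
 assumes "finite A"
 shows "bounded_sum (Suc m) \<alpha> \<beta> t x A = (\<Sum>P\<in>Pow A. \<alpha>^card (A - P) * (\<Prod>a\<in>P. x a) *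
  (\<Prod>a\<in>P. \<Prod>b\<in>A - P. hlK t (x a) (x b)) * bounded_sum m \<beta> \<alpha> t x P)"
proof -
 define ext where "ext P f = (\<lambda>a\<in>A. if a \<in> P then Suc (f a) else 0)" for P and f :: "'a \<Rightarrow> nat"
 have "(\<Sum>P\<in>Pow A. \<alpha>^card (A - P) * (\<Prod>a\<in>P. x a) *
   (\<Prod>a\<in>P. \<Prod>b\<in>A - P. hlK t (x a) (x b)) * bounded_sum m \<beta> \<alpha> t x P) =
  (\<Sum>P\<in>Pow A. \<Sum>f\<in>P \<rightarrow>\<^sub>E {..m}. fun_weight \<alpha> \<beta> t x A (ext P f))"
  unfolding bounded_sum_def sum_distrib_left ext_def using assms by (intro sum.cong refl fun_weight_extend[symmetric]) auto
 also have "\<dots> = (\<Sum>(P, f)\<in>Sigma (Pow A) (\<lambda>P. P \<rightarrow>\<^sub>E {..m}). fun_weight \<alpha> \<beta> t x A (ext P f))"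
  using assms by (intro sum.Sigma) (auto intro!: finite_PiE intro: finite_subset)
 also have "\<dots> = (\<Sum>f\<in>A \<rightarrow>\<^sub>E {..Suc m}. fun_weight \<alpha> \<beta> t x A f)"
 proof (rule sum.reindex_bij_witness[where
   i = "\<lambda>f. ({a\<in>A. f a \<noteq> 0}, \<lambda>a\<in>{a\<in>A. f a \<noteq> 0}. f a - 1)" and j = "\<lambda>(P, f). ext P f"], goal_cases)
  case (1 Pf)
  then obtain P f where Pf: "Pf = (P, f)" "P \<subseteq> A" "f \<in> P \<rightarrow>\<^sub>E {..m}" by auto
  then have "{a\<in>A. ext P f a \<noteq> 0} = P" by (auto simp: ext_def)
  moreover have "(\<lambda>a\<in>P. ext P f a - 1) = f" using Pf by (auto simp: ext_def fun_eq_iff PiE_def extensional_def)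
  ultimately show ?case using Pf by simp
 next
  case (2 Pf)
  then show ?case by (auto simp: ext_def PiE_def Pi_def)
 next
  case (3 f)
  then have "f a = undefined" if "a \<notin> A" for a using that by (auto simp: PiE_def extensional_def)
  then show ?case by (auto simp: ext_def fun_eq_iff)
 next
  case (4 f)
  then show ?case by (auto simp: PiE_def Pi_def)
 qed auto
 finally show ?thesis by (simp add: bounded_sum_def)
qed

definition pole_weight :: "complex \<Rightarrow> complex \<Rightarrow> complex \<Rightarrow> complex" where
 "pole_weight \<alpha> \<beta> y = (\<alpha> + \<beta> * y) / (1 - y\<^sup>2)"

text \<open>For one variable this is a finite geometric sum written as two rational functions, one
  expanded from each end: \<open>pole_weight\<close> generates the coefficients \<alpha>, \<beta>,
  \<alpha>, ..., and the upper end runs down from \<open>a^m\<close> in powers of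
  \<open>inverse a\<close>. \<open>M\<close> collects the variables taken from the upper end; the
  parity of \<open>m\<close> decides which scalar starts there.\<close>

definition sign_sum :: "nat \<Rightarrow> complex \<Rightarrow> complex \<Rightarrow> complex \<Rightarrow> complex set \<Rightarrow> complex" where
 "sign_sum m \<alpha> \<beta> t X = (\<Sum>M\<in>Pow X.
   (\<Prod>a\<in>M. a^m * (if even m then pole_weight \<alpha> \<beta> (inverse a) else pole_weight \<beta> \<alpha> (inverse a))) *
   (\<Prod>a\<in>X - M. pole_weight \<alpha> \<beta> a) * pair_prod (hlC t) ((X - M) \<union> inverse ` M))"

lemma generic_inv_closed:
 assumes "generic X"
 shows "inv_closed (X \<union> inverse ` X)" "X \<inter> inverse ` X = {}"
proof -
 have X: "finite X" "0 \<notin> X" "\<And>a b. a \<in> X \<Longrightarrow> b \<in> X \<Longrightarrow> a * b \<noteq> 1"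
  using assms by (auto simp: generic_def)
 have i: "inverse a \<notin> X" if "a \<in> X" for a using X(3)[OF that, of "inverse a"] that X(2) by (cases "a = 0") auto
 then show "X \<inter> inverse ` X = {}" by auto
 have "inverse a * inverse a \<noteq> 1" if "a \<in> X" for a using X(3)[OF that that] by (metis inverse_1 inverse_inverse_eq inverse_mult_distrib)
 then show "inv_closed (X \<union> inverse ` X)" using X by (auto simp: inv_closed_def)
qed

lemma section_sum_eq_Pow:
 assumes "generic X"
 shows "section_sum g t (X \<union> inverse ` X) =
  (\<Sum>M\<in>Pow X. (\<Prod>a\<in>M. g (inverse a)) * (\<Prod>a\<in>X - M. g a) * pair_prod (hlC t) ((X - M) \<union> inverse ` M))"
proof -
 note cl = generic_inv_closed[OF assms]
 have fin: "finite X" using assms by (simp add: generic_def)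
 have i: "inverse a \<notin> X" if "a \<in> X" for a using cl(2) that by blast
 have ij: "X - (X - S) \<union> inverse ` (X - S) = S" if 1: "S \<in> sections (X \<union> inverse ` X)" for S
 proof -
  have H: "e \<in> S \<longleftrightarrow> inverse e \<notin> S" if "e \<in> X" for e using 1 that unfolding sections_def by blast
  have sub: "S \<subseteq> X \<union> inverse ` X" using 1 by (rule sections_subset)
  have "inverse ` (X - S) = S - X"
  proof
   show "inverse ` (X - S) \<subseteq> S - X" using H i by auto
   show "S - X \<subseteq> inverse ` (X - S)"
   proof
    fix e assume e: "e \<in> S - X"
    then obtain a where "a \<in> X" "e = inverse a" using sub by blast
    then show "e \<in> inverse ` (X - S)" using H[of a] e by auto
   qed
  qed
  moreover have "X - (X - S) = X \<inter> S" by blast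
  ultimately show ?thesis by auto
 qed
 have "section_sum g t (X \<union> inverse ` X) = (\<Sum>M\<in>Pow X. section_weight g t ((X - M) \<union> inverse ` M))" unfolding section_sum_def
 proof (rule sum.reindex_bij_witness[where i = "\<lambda>M. (X - M) \<union> inverse ` M" and j = "\<lambda>S. X - S"], goal_cases)
  case (1 S)
  then show ?case by (rule ij)
 next
  case (3 M)
  then show ?case using i by auto
 next
  case (4 M)
  show ?case unfolding sections_def
  proof (intro CollectI conjI ballI)
   show "X - M \<union> inverse ` M \<subseteq> X \<union> inverse ` X" using 4 by blast
   fix e assume e: "e \<in> X \<union> inverse ` X"
   have *: "inverse a \<in> X - M \<union> inverse ` M \<longleftrightarrow> a \<in> M" "a \<in> X - M \<union> inverse ` M \<longleftrightarrow> a \<notin> M" if "a \<in> X" for a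
    using that i 4 by auto
   show "e \<in> X - M \<union> inverse ` M \<longleftrightarrow> inverse e \<notin> X - M \<union> inverse ` M"
   proof (cases "e \<in> X")
    case True
    show ?thesis unfolding *(1)[OF True] *(2)[OF True] ..
   next
    case False
    then obtain a where a: "a \<in> X" "e = inverse a" using e by blast
    show ?thesis unfolding a(2) inverse_inverse_eq *(1)[OF a(1)] *(2)[OF a(1)] by simp
   qed
  qed
 next
  case (5 S)
  then show ?case by (simp only: ij)
 qed auto
 also have "\<dots> = (\<Sum>M\<in>Pow X. (\<Prod>a\<in>M. g (inverse a)) * (\<Prod>a\<in>X - M. g a) * pair_prod (hlC t) ((X - M) \<union> inverse ` M))"
 proof (rule sum.cong[OF refl])
  fix M assume "M \<in> Pow X"
  then have "(X - M) \<inter> inverse ` M = {}" "finite (X - M)" "finite (inverse ` M)" using i fin by (auto intro: finite_subset)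
  then show "section_weight g t (X - M \<union> inverse ` M) =
    (\<Prod>a\<in>M. g (inverse a)) * (\<Prod>a\<in>X - M. g a) * pair_prod (hlC t) ((X - M) \<union> inverse ` M)"
   by (simp add: section_weight_def prod.union_disjoint prod.reindex inj_on_def mult_ac)
 qed
 finally show ?thesis .
qed

text \<open>\<open>pole_weight\<close> is \<alpha> times the two-parameter weight with parameters
  \<open>- \<beta> / \<alpha>\<close> and 0, whose section sum is 1.\<close>

lemma sign_sum_0:
 assumes "generic X" "\<alpha> \<noteq> 0"
 shows "sign_sum 0 \<alpha> \<beta> t X = \<alpha>^card X"
proof -
 define g where "g e = (1 - (- \<beta> / \<alpha>) * e) * (1 - 0 * e) / (1 - e\<^sup>2)" for e :: complex
 have fin: "finite X" using assms by (simp add: generic_def)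
 have pg: "pole_weight \<alpha> \<beta> y = \<alpha> * g y" for y
 proof -
  have "\<alpha> * (1 - (- \<beta> / \<alpha>) * y) = \<alpha> + \<beta> * y" using assms(2) by (simp add: field_simps)
  then show ?thesis by (simp only: pole_weight_def g_def times_divide_eq_right mult_zero_left diff_zero mult_1_right)
 qed
 have "sign_sum 0 \<alpha> \<beta> t X = (\<Sum>M\<in>Pow X. \<alpha>^card X * ((\<Prod>a\<in>M. g (inverse a)) * (\<Prod>a\<in>X - M. g a) *
   pair_prod (hlC t) ((X - M) \<union> inverse ` M)))" unfolding sign_sum_def
 proof (rule sum.cong[OF refl])
  fix M assume M: "M \<in> Pow X"
  then have "card X = card M + card (X - M)" using fin finite_subset[of M X] by (simp add: card_Diff_subset card_mono)
  then show "(\<Prod>a\<in>M. a^0 * (if even (0::nat) then pole_weight \<alpha> \<beta> (inverse a) else pole_weight \<beta> \<alpha> (inverse a))) *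
   (\<Prod>a\<in>X - M. pole_weight \<alpha> \<beta> a) * pair_prod (hlC t) ((X - M) \<union> inverse ` M) =
   \<alpha>^card X * ((\<Prod>a\<in>M. g (inverse a)) * (\<Prod>a\<in>X - M. g a) * pair_prod (hlC t) ((X - M) \<union> inverse ` M))"
   by (simp add: pg prod.distrib power_add mult_ac)
 qed
 also have "\<dots> = \<alpha>^card X * section_sum g t (X \<union> inverse ` X)" unfolding section_sum_eq_Pow[OF assms(1)] sum_distrib_left ..
 also have "section_sum g t (X \<union> inverse ` X) = 1" unfolding g_def section_sum_two_param[OF generic_inv_closed(1)[OF assms(1)]] by simp
 finally show ?thesis by simp
qed

lemma littlewood_sum_two_param:
 assumes "generic W" "\<alpha> \<noteq> 0"
 shows "(\<Sum>Q\<in>Pow W. \<alpha>^card (W - Q) * (\<Prod>a\<in>Q. a * pole_weight \<beta> \<alpha> a) *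
   (\<Prod>a\<in>Q. \<Prod>b\<in>W - Q. hlK t a b) * pair_prod (hlC t) Q) = (\<Prod>a\<in>W. pole_weight \<alpha> \<beta> a) * pair_prod (hlC t) W"
proof -
 let ?s = "\<beta> / \<alpha>"
 have fin: "finite W" using assms by (simp add: generic_def)
 have "(\<Sum>Q\<in>Pow W. \<alpha>^card (W - Q) * (\<Prod>a\<in>Q. a * pole_weight \<beta> \<alpha> a) *
   (\<Prod>a\<in>Q. \<Prod>b\<in>W - Q. hlK t a b) * pair_prod (hlC t) Q) = (\<Sum>Q\<in>Pow W. \<alpha>^card W * littlewood_term ?s t W Q)"
 proof (rule sum.cong[OF refl])
  fix Q assume "Q \<in> Pow W"
  then have "card W = card (W - Q) + card Q" using fin finite_subset[of Q W] by (simp add: card_Diff_subset card_mono)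
  moreover have "a * pole_weight \<beta> \<alpha> a = \<alpha> * (a * (?s + a) / (1 - a\<^sup>2))" for a
  proof -
   have "\<alpha> * (a * (?s + a)) = a * (\<beta> + \<alpha> * a)" using assms(2) by (simp add: field_simps)
   then show ?thesis by (simp only: pole_weight_def times_divide_eq_right)
  qed
  ultimately show "\<alpha>^card (W - Q) * (\<Prod>a\<in>Q. a * pole_weight \<beta> \<alpha> a) *
   (\<Prod>a\<in>Q. \<Prod>b\<in>W - Q. hlK t a b) * pair_prod (hlC t) Q = \<alpha>^card W * littlewood_term ?s t W Q"
   by (simp only: littlewood_term_def prod.distrib prod_constant power_add mult_ac)
 qed
 also have "\<dots> = \<alpha>^card W * littlewood_prod ?s t W" unfolding sum_distrib_left[symmetric] littlewood_sum[OF assms(1)] ..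
 also have "\<dots> = (\<Prod>a\<in>W. pole_weight \<alpha> \<beta> a) * pair_prod (hlC t) W"
 proof -
  have "pole_weight \<alpha> \<beta> a = \<alpha> * ((1 + ?s * a) / (1 - a\<^sup>2))" for a
  proof -
   have "\<alpha> * (1 + ?s * a) = \<alpha> + \<beta> * a" using assms(2) by (simp add: field_simps)
   then show ?thesis by (simp only: pole_weight_def times_divide_eq_right)
  qed
  then show ?thesis by (simp only: littlewood_prod_def prod.distrib prod_constant mult_ac)
 qed
 finally show ?thesis .
qed

text \<open>This is the recursion of \<open>bounded_sum\<close>. After exchanging the sums over
  \<open>P\<close> and \<open>M \<subseteq> P\<close> and putting \<open>Q = P - M\<close>,
  everything that involves \<open>M\<close> becomes independent of \<open>Q\<close>:
  \<open>hlC\<close> at an inverted variable is \<open>hlK\<close>, so the pairs from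
  \<open>M\<close> to \<open>Q\<close> and from \<open>M\<close> to the rest recombine. What remains
  is the Littlewood sum over \<open>X - M\<close>.\<close>

lemma sign_sum_Suc:
 assumes gen: "generic X" and \<alpha>: "\<alpha> \<noteq> 0"
 shows "sign_sum (Suc m) \<alpha> \<beta> t X = (\<Sum>P\<in>Pow X. \<alpha>^card (X - P) * (\<Prod>a\<in>P. a) *
  (\<Prod>a\<in>P. \<Prod>b\<in>X - P. hlK t a b) * sign_sum m \<beta> \<alpha> t P)"
proof -
 have X: "finite X" "0 \<notin> X" "\<And>a b. a \<in> X \<Longrightarrow> b \<in> X \<Longrightarrow> a * b \<noteq> 1"
  using gen by (auto simp: generic_def)
 have i: "inverse a \<notin> X" if "a \<in> X" for a using X(3)[OF that, of "inverse a"] that X(2) by (cases "a = 0") auto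
 define \<eta> where "\<eta> a = a^m * (if even m then pole_weight \<beta> \<alpha> (inverse a) else pole_weight \<alpha> \<beta> (inverse a))" for a
 define rhs where "rhs P M = \<alpha>^card (X - P) * (\<Prod>a\<in>P. a) *
  (\<Prod>a\<in>P. \<Prod>b\<in>X - P. hlK t a b) * ((\<Prod>a\<in>M. \<eta> a) *
   (\<Prod>a\<in>P - M. pole_weight \<beta> \<alpha> a) * pair_prod (hlC t) ((P - M) \<union> inverse ` M))" for P M
 have "(\<Sum>P\<in>Pow X. \<alpha>^card (X - P) * (\<Prod>a\<in>P. a) * (\<Prod>a\<in>P. \<Prod>b\<in>X - P. hlK t a b) * sign_sum m \<beta> \<alpha> t P) =
  (\<Sum>P\<in>Pow X. \<Sum>M\<in>Pow P. rhs P M)" unfolding sign_sum_def sum_distrib_left rhs_def \<eta>_def ..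
 also have "\<dots> = (\<Sum>(P, M)\<in>Sigma (Pow X) Pow. rhs P M)" using X(1) by (intro sum.Sigma) (auto intro: finite_subset)
 also have "\<dots> = (\<Sum>(M, Q)\<in>Sigma (Pow X) (\<lambda>M. Pow (X - M)). rhs (M \<union> Q) M)"
  by (rule sum.reindex_bij_witness[where i = "\<lambda>(M, Q). (M \<union> Q, M)" and j = "\<lambda>(P, M). (M, P - M)"])
    (auto simp: Un_absorb1)
 also have "\<dots> = (\<Sum>M\<in>Pow X. \<Sum>Q\<in>Pow (X - M). rhs (M \<union> Q) M)" using X(1) by (intro sum.Sigma[symmetric]) auto
 also have "\<dots> = sign_sum (Suc m) \<alpha> \<beta> t X" unfolding sign_sum_def
 proof (rule sum.cong[OF refl])
  fix M assume "M \<in> Pow X"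
  then have M: "M \<subseteq> X" "finite M" using X(1) finite_subset by auto
  define W where "W = X - M"
  have W: "finite W" "W \<subseteq> X" "M \<inter> W = {}" "generic W" "X = M \<union> W" using X M gen generic_subset by (auto simp: W_def)
  have pp: "pair_prod (hlC t) (Q \<union> inverse ` M) = pair_prod (hlC t) Q * pair_prod (hlC t) (inverse ` M) *
    (\<Prod>a\<in>M. \<Prod>b\<in>Q. hlK t a b)" if "Q \<subseteq> W" for Q
  proof -
   have fQ: "finite Q" using that W(1) finite_subset by blast
   have dis: "Q \<inter> inverse ` M = {}" using that W(2) M(1) i by auto
   have "pair_prod (hlC t) (Q \<union> inverse ` M) = pair_prod (hlC t) Q * pair_prod (hlC t) (inverse ` M) *
     (\<Prod>b\<in>Q. \<Prod>a\<in>inverse ` M. hlC t b a)" using fQ M(2) dis by (intro pair_prod_Un hlC_commute) auto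
   also have "(\<Prod>b\<in>Q. \<Prod>a\<in>inverse ` M. hlC t b a) = (\<Prod>b\<in>Q. \<Prod>a\<in>M. hlK t a b)"
   proof (rule prod.cong[OF refl])
    fix b assume "b \<in> Q"
    have "(\<Prod>a\<in>inverse ` M. hlC t b a) = (\<Prod>a\<in>M. hlC t b (inverse a))" by (subst prod.reindex) (auto simp: inj_on_def)
    also have "\<dots> = (\<Prod>a\<in>M. hlK t a b)"
    proof (rule prod.cong[OF refl])
     fix a assume "a \<in> M"
     then have "a \<noteq> 0" using M X(2) by auto
     then have "1 - t * b * inverse a = (a - t * b) / a" "1 - b * inverse a = (a - b) / a" by (simp_all add: field_simps)
     then show "hlC t b (inverse a) = hlK t a b" using \<open>a \<noteq> 0\<close> by (simp add: hlC_def hlK_def)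
    qed
    finally show "(\<Prod>a\<in>inverse ` M. hlC t b a) = (\<Prod>a\<in>M. hlK t a b)" .
   qed
   also have "\<dots> = (\<Prod>a\<in>M. \<Prod>b\<in>Q. hlK t a b)" by (rule prod.swap)
   finally show ?thesis .
  qed
  define c where "c = (\<Prod>a\<in>M. a * \<eta> a) * pair_prod (hlC t) (inverse ` M) * (\<Prod>a\<in>M. \<Prod>b\<in>W. hlK t a b)"
  have "rhs (M \<union> Q) M = c * (\<alpha>^card (W - Q) * (\<Prod>a\<in>Q. a * pole_weight \<beta> \<alpha> a) *
   (\<Prod>a\<in>Q. \<Prod>b\<in>W - Q. hlK t a b) * pair_prod (hlC t) Q)" if Q: "Q \<in> Pow W" for Q
  proof -
   have fQ: "finite Q" "M \<inter> Q = {}" "Q \<subseteq> W" using Q W finite_subset by auto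
   have e: "X - (M \<union> Q) = W - Q" "(M \<union> Q) - M = Q" using fQ W by auto
   have s: "(\<Prod>a\<in>M. \<Prod>b\<in>W. hlK t a b) = (\<Prod>a\<in>M. \<Prod>b\<in>W - Q. hlK t a b) * (\<Prod>a\<in>M. \<Prod>b\<in>Q. hlK t a b)"
    unfolding prod.distrib[symmetric] using W(1) fQ(3) by (intro prod.cong refl prod.subset_diff)
   show ?thesis unfolding rhs_def e pp[OF fQ(3)] c_def s prod.union_disjoint[OF M(2) fQ(1,2)] by (simp only: prod.distrib mult_ac)
  qed
  then have "(\<Sum>Q\<in>Pow (X - M). rhs (M \<union> Q) M) = c * ((\<Prod>a\<in>W. pole_weight \<alpha> \<beta> a) * pair_prod (hlC t) W)"
   unfolding W_def[symmetric] littlewood_sum_two_param[OF W(4) \<alpha>, symmetric] sum_distrib_left by (intro sum.cong refl)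
  also have "\<dots> = (\<Prod>a\<in>M. a^Suc m * (if even (Suc m) then pole_weight \<alpha> \<beta> (inverse a) else pole_weight \<beta> \<alpha> (inverse a))) *
   (\<Prod>a\<in>X - M. pole_weight \<alpha> \<beta> a) * pair_prod (hlC t) ((X - M) \<union> inverse ` M)"
  proof -
   have "(\<Prod>a\<in>M. a * \<eta> a) = (\<Prod>a\<in>M. a^Suc m * (if even (Suc m) then pole_weight \<alpha> \<beta> (inverse a) else pole_weight \<beta> \<alpha> (inverse a)))"
    by (intro prod.cong) (auto simp: \<eta>_def)
   then show ?thesis unfolding W_def[symmetric] pp[OF order_refl] c_def by (simp only: mult_ac)
  qed
  finally show "(\<Sum>Q\<in>Pow (X - M). rhs (M \<union> Q) M) = \<dots>" .
 qed
 finally show ?thesis by simp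
qed

theorem bounded_sum_eq_sign_sum:
 assumes "generic (x ` A)" "inj_on x A" "\<alpha> \<noteq> 0" "\<beta> \<noteq> 0"
 shows "bounded_sum m \<alpha> \<beta> t x A = sign_sum m \<alpha> \<beta> t (x ` A)" using assms
proof (induction m arbitrary: \<alpha> \<beta> A)
 case 0
 then have "finite A" by (auto simp: generic_def dest: finite_imageD)
 with 0 show ?case by (simp add: bounded_sum_0 sign_sum_0 card_image)
next
 case (Suc m)
 have fin: "finite A" using Suc.prems by (auto simp: generic_def dest: finite_imageD)
 have "bounded_sum (Suc m) \<alpha> \<beta> t x A = (\<Sum>P\<in>Pow A. \<alpha>^card (x ` A - x ` P) * (\<Prod>a\<in>x ` P. a) *
  (\<Prod>a\<in>x ` P. \<Prod>b\<in>x ` A - x ` P. hlK t a b) * sign_sum m \<beta> \<alpha> t (x ` P))" unfolding bounded_sum_Suc[OF fin]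
 proof (rule sum.cong[OF refl])
  fix P assume "P \<in> Pow A"
  then have P: "P \<subseteq> A" "inj_on x P" "inj_on x (A - P)" using Suc.prems(2) by (auto intro: inj_on_subset)
  have "x ` A - x ` P = x ` (A - P)" using Suc.prems(2) P(1) by (metis inj_on_image_set_diff Diff_subset order_refl)
  moreover have "bounded_sum m \<beta> \<alpha> t x P = sign_sum m \<beta> \<alpha> t (x ` P)"
   using Suc.prems P by (intro Suc.IH) (auto intro: generic_subset)
  ultimately show "\<alpha>^card (A - P) * (\<Prod>a\<in>P. x a) * (\<Prod>a\<in>P. \<Prod>b\<in>A - P. hlK t (x a) (x b)) * bounded_sum m \<beta> \<alpha> t x P =
   \<alpha>^card (x ` A - x ` P) * (\<Prod>a\<in>x ` P. a) *
   (\<Prod>a\<in>x ` P. \<Prod>b\<in>x ` A - x ` P. hlK t a b) * sign_sum m \<beta> \<alpha> t (x ` P)"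
   using P(2,3) by (simp add: prod.reindex card_image)
 qed
 also have "\<dots> = (\<Sum>P\<in>image x ` Pow A. \<alpha>^card (x ` A - P) * (\<Prod>a\<in>P. a) *
  (\<Prod>a\<in>P. \<Prod>b\<in>x ` A - P. hlK t a b) * sign_sum m \<beta> \<alpha> t P)"
  using inj_on_image_Pow[OF Suc.prems(2)] by (simp add: sum.reindex)
 also have "image x ` Pow A = Pow (x ` A)" by (rule image_Pow_surj) simp
 finally show ?case unfolding sign_sum_Suc[OF Suc.prems(1,3)] .
qed

text \<open>At \<open>m = 2 * k\<close> the exponent splits evenly: taking \<open>a^k\<close> out of
  every variable leaves the \<open>k\<close>-th power of the inverse at each element of the section,
  whether that element is a variable or the inverse of one. Even \<open>m\<close> also lets both
  ends start with the same scalar, so one function \<open>g\<close> serves for both.\<close>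

corollary bounded_sum_eq_section_sum:
 assumes "generic (x ` A)" "inj_on x A" "s \<noteq> 0"
 shows "bounded_sum (2 * k) 1 s t x A =
  (\<Prod>a\<in>A. x a^k) * section_sum (\<lambda>y. inverse y^k * ((1 + s * y) / (1 - y\<^sup>2))) t (x ` A \<union> inverse ` x ` A)"
proof -
 let ?X = "x ` A"
 have fin: "finite ?X" and nz: "0 \<notin> ?X" using assms by (auto simp: generic_def)
 have "bounded_sum (2 * k) 1 s t x A = sign_sum (2 * k) 1 s t ?X" using assms by (intro bounded_sum_eq_sign_sum) auto
 also have "\<dots> = (\<Prod>a\<in>?X. a^k) * section_sum (\<lambda>y. inverse y^k * pole_weight 1 s y) t (?X \<union> inverse ` ?X)"
  unfolding sign_sum_def section_sum_eq_Pow[OF assms(1)] sum_distrib_left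
 proof (rule sum.cong[OF refl])
  fix M assume M: "M \<in> Pow ?X"
  have 1: "(\<Prod>a\<in>?X. a^k) = (\<Prod>a\<in>?X - M. a^k) * (\<Prod>a\<in>M. a^k)" using M fin by (intro prod.subset_diff) auto
  have 2: "(\<Prod>a\<in>?X - M. pole_weight 1 s a) = (\<Prod>a\<in>?X - M. a^k) * (\<Prod>a\<in>?X - M. inverse a^k * pole_weight 1 s a)"
   unfolding prod.distrib[symmetric]
  proof (rule prod.cong[OF refl])
   fix a assume "a \<in> ?X - M"
   then have "a \<noteq> 0" using nz by auto
   then have "a^k * inverse a^k = 1" by (simp flip: power_mult_distrib)
   then show "pole_weight 1 s a = a^k * (inverse a^k * pole_weight 1 s a)" by (simp flip: mult.assoc)
  qed
  have 3: "(\<Prod>a\<in>M. a^(2 * k) * pole_weight 1 s (inverse a)) =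
    (\<Prod>a\<in>M. a^k) * (\<Prod>a\<in>M. inverse (inverse a)^k * pole_weight 1 s (inverse a))"
   unfolding prod.distrib[symmetric] by (intro prod.cong refl) (simp only: mult_2 power_add inverse_inverse_eq mult.assoc)
  show "(\<Prod>a\<in>M. a^(2 * k) * (if even (2 * k) then pole_weight 1 s (inverse a) else pole_weight s 1 (inverse a))) *
   (\<Prod>a\<in>?X - M. pole_weight 1 s a) * pair_prod (hlC t) ((?X - M) \<union> inverse ` M) =
   (\<Prod>a\<in>?X. a^k) * ((\<Prod>a\<in>M. inverse (inverse a)^k * pole_weight 1 s (inverse a)) *
   (\<Prod>a\<in>?X - M. inverse a^k * pole_weight 1 s a) * pair_prod (hlC t) ((?X - M) \<union> inverse ` M))"
   using 2 3 unfolding 1 by (simp add: mult_ac)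
 qed
 also have "(\<Prod>a\<in>?X. a^k) = (\<Prod>a\<in>A. x a^k)" using assms(2) by (simp add: prod.reindex)
 finally show ?thesis by (simp add: pole_weight_def)
qed

section \<open>Hall--Littlewood polynomials as sums over functions\<close>

fun perm_term :: "complex \<Rightarrow> ('a \<Rightarrow> complex) \<Rightarrow> nat list \<Rightarrow> 'a list \<Rightarrow> complex" where
 "perm_term t x (l # ls) (y # ys) = x y^l * (\<Prod>b\<in>set ys. hlK t (x y) (x b)) * perm_term t x ls ys"
| "perm_term t x _ _ = 1"

lemma perm_term_eq:
 assumes "length ls = length ys" "distinct ys"
 shows "perm_term t x ls ys = (\<Prod>i<length ys. x (ys ! i)^(ls ! i)) * (\<Prod>j<length ys. \<Prod>i<j. hlK t (x (ys ! i)) (x (ys ! j)))"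
 using assms
proof (induction ls ys rule: list_induct2)
 case (Cons l ls y ys)
 have "(\<Prod>b\<in>set ys. hlK t (x y) (x b)) = (\<Prod>j<length ys. hlK t (x y) (x (ys ! j)))"
  using Cons.prems by (simp add: prod.distinct_set_conv_list prod.list_conv_set_nth atLeast0LessThan)
 then show ?case using Cons by (simp add: prod.lessThan_Suc_shift prod.distrib mult_ac del: prod.lessThan_Suc)
qed simp

lemma sum_permutes_eq_sum_lists:
 "(\<Sum>w | w permutes {..<n}. F (map w [0..<n])) = (\<Sum>ys\<in>permutations_of_set {..<n}. F ys)"
proof -
 let ?h = "\<lambda>w. map w [0..<n]"
 have inj: "inj_on ?h {w. w permutes {..<n}}"
 proof (rule inj_onI, clarify)
  fix w w' :: "nat \<Rightarrow> nat" assume w: "w permutes {..<n}" "w' permutes {..<n}" "?h w = ?h w'"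
  show "w = w'"
  proof
   fix i show "w i = w' i" using w by (cases "i < n") (auto simp: permutes_def)
  qed
 qed
 have "?h ` {w. w permutes {..<n}} = permutations_of_set {..<n}"
 proof (rule card_subset_eq)
  show "?h ` {w. w permutes {..<n}} \<subseteq> permutations_of_set {..<n}"
  proof
   fix ys assume "ys \<in> ?h ` {w. w permutes {..<n}}"
   then obtain w where w: "w permutes {..<n}" "ys = ?h w" by blast
   then have "distinct ys" "set ys = {..<n}" using permutes_inj_on[OF w(1)] permutes_image[OF w(1)] by (auto simp: distinct_map atLeast0LessThan)
   then show "ys \<in> permutations_of_set {..<n}" by (rule permutations_of_setI[rotated])
  qed
  show "card (?h ` {w. w permutes {..<n}}) = card (permutations_of_set {..<n})" using inj by (simp add: card_image card_permutations[OF refl])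
 qed simp
 then show ?thesis using inj by (metis (no_types, lifting) sum.reindex_cong)
qed

definition funs_of_type :: "'a set \<Rightarrow> nat list \<Rightarrow> ('a \<Rightarrow> nat) set" where
 "funs_of_type A ls = {f \<in> A \<rightarrow>\<^sub>E UNIV. image_mset f (mset_set A) = mset ls}"

text \<open>\<open>hl_v\<close> with the quotients \<open>(1 - t^i) / (1 - t)\<close> written as
  geometric sums and with zero parts counted like all others.\<close>

definition mult_fact :: "complex \<Rightarrow> nat list \<Rightarrow> complex" where
 "mult_fact t ls = (\<Prod>i\<in>set ls. \<Prod>m<count_list ls i. \<Sum>j\<le>m. t^j)"

lemma finite_funs_of_type: "finite A \<Longrightarrow> finite (funs_of_type A ls)"
proof -
 assume A: "finite A"
 have "funs_of_type A ls \<subseteq> A \<rightarrow>\<^sub>E set ls"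
 proof
  fix f assume f: "f \<in> funs_of_type A ls"
  have "f a \<in> set ls" if "a \<in> A" for a
  proof -
   have "f a \<in># image_mset f (mset_set A)" using that A by simp
   also have "image_mset f (mset_set A) = mset ls" using f by (simp add: funs_of_type_def)
   finally show ?thesis by simp
  qed
  then show "f \<in> A \<rightarrow>\<^sub>E set ls" using f by (auto simp: funs_of_type_def PiE_def)
 qed
 then show ?thesis using A by (auto intro!: finite_PiE intro: finite_subset)
qed

lemma mult_fact_Cons: "mult_fact t (l # ls) = mult_fact t ls * (\<Sum>j\<le>count_list ls l. t^j)"
proof -
 let ?F = "\<lambda>ls i. \<Prod>m<count_list ls i. \<Sum>j\<le>m. t^j"
 have 1: "mult_fact t ls = (\<Prod>i\<in>insert l (set ls). ?F ls i)"
  unfolding mult_fact_def by (cases "l \<in> set ls") (auto simp: insert_absorb count_list_0_iff)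
 have "mult_fact t (l # ls) = ?F (l # ls) l * (\<Prod>i\<in>set ls - {l}. ?F (l # ls) i)" unfolding mult_fact_def by (simp add: prod.insert_remove)
 also have "(\<Prod>i\<in>set ls - {l}. ?F (l # ls) i) = (\<Prod>i\<in>set ls - {l}. ?F ls i)" by (intro prod.cong) auto
 also have "?F (l # ls) l = ?F ls l * (\<Sum>j\<le>count_list ls l. t^j)" by simp
 finally show ?thesis unfolding 1 by (simp add: prod.insert_remove mult_ac)
qed

text \<open>The list is peeled at its first, hence largest, part \<open>l\<close>. A permutation
  consists of a first variable \<open>a\<close> and a permutation of the rest. For a fixed function
  \<open>f\<close> the admissible \<open>a\<close> are those with \<open>f a = l\<close>, and the
  products of \<open>hlK\<close> within this level set add up to a geometric sum by
  \<open>sum_prod_hlK\<close>. These sums accumulate to \<open>mult_fact\<close>.\<close>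

lemma sum_perm_term:
 assumes "finite A" "inj_on x A" "length ls = card A" "sorted_wrt (\<ge>) ls"
 shows "(\<Sum>ys\<in>permutations_of_set A. perm_term t x ls ys) = mult_fact t ls * (\<Sum>f\<in>funs_of_type A ls. fun_weight 1 1 t x A f)"
 using assms
proof (induction ls arbitrary: A)
 case Nil
 then have "A = {}" by simp
 moreover from this have "funs_of_type A [] = {\<lambda>_. undefined}" by (auto simp: funs_of_type_def)
 ultimately show ?case by (simp add: mult_fact_def fun_weight_def)
next
 case (Cons l ls)
 have A: "finite A" "A \<noteq> {}" using Cons.prems by auto
 have sub: "inj_on x (A - {a})" "length ls = card (A - {a})" if "a \<in> A" for a using Cons.prems that by (auto intro: inj_on_subset)
 have srt: "sorted_wrt (\<ge>) ls" "\<And>y. y \<in> set ls \<Longrightarrow> y \<le> l" using Cons.prems(4) by auto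
 define c where "c a = x a^l * (\<Prod>b\<in>A - {a}. hlK t (x a) (x b))" for a
 have "(\<Sum>ys\<in>permutations_of_set A. perm_term t x (l # ls) ys) =
   (\<Sum>a\<in>A. \<Sum>ys\<in>(#) a ` permutations_of_set (A - {a}). perm_term t x (l # ls) ys)"
  unfolding permutations_of_set_nonempty[OF A(2)] using A(1) by (intro sum.UNION_disjoint) auto
 also have "\<dots> = (\<Sum>a\<in>A. \<Sum>ys\<in>permutations_of_set (A - {a}). c a * perm_term t x ls ys)"
  by (simp add: sum.reindex c_def permutations_of_set_def)
 also have "\<dots> = (\<Sum>a\<in>A. c a * (mult_fact t ls * (\<Sum>f\<in>funs_of_type (A - {a}) ls. fun_weight 1 1 t x (A - {a}) f)))"
  unfolding sum_distrib_left[symmetric] using A(1) sub srt(1) by (intro sum.cong refl arg_cong2[where f = "(*)"] Cons.IH) auto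
 also have "\<dots> = mult_fact t ls * (\<Sum>a\<in>A. \<Sum>f\<in>funs_of_type (A - {a}) ls. c a * fun_weight 1 1 t x (A - {a}) f)"
  by (simp add: sum_distrib_left mult_ac)
 also have "(\<Sum>a\<in>A. \<Sum>f\<in>funs_of_type (A - {a}) ls. c a * fun_weight 1 1 t x (A - {a}) f) =
   (\<Sum>(a, f)\<in>Sigma A (\<lambda>a. funs_of_type (A - {a}) ls). c a * fun_weight 1 1 t x (A - {a}) f)"
  using A(1) by (intro sum.Sigma) (auto intro: finite_funs_of_type)
 also have "\<dots> = (\<Sum>(f, a)\<in>Sigma (funs_of_type A (l # ls)) (\<lambda>f. {a\<in>A. f a = l}).
   c a * fun_weight 1 1 t x (A - {a}) (restrict f (A - {a})))"
 proof (rule sum.reindex_bij_witness[where i = "\<lambda>(f, a). (a, restrict f (A - {a}))"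
    and j = "\<lambda>(a, f). (f(a := l), a)"], goal_cases)
  case (1 p)
  then show ?case by (auto simp: funs_of_type_def fun_eq_iff PiE_def extensional_def restrict_def)
 next
  case (2 p)
  then obtain a f where p: "p = (a, f)" "a \<in> A" "f \<in> funs_of_type (A - {a}) ls" by auto
  have "mset_set A = add_mset a (mset_set (A - {a}))"
   using A(1) p(2) by (metis insert_Diff finite_Diff mset_set.insert Diff_iff insertI1 finite_insert)
  moreover have "image_mset (f(a := l)) (mset_set (A - {a})) = image_mset f (mset_set (A - {a}))" using A(1) by (intro image_mset_cong) auto
  ultimately have "f(a := l) \<in> funs_of_type A (l # ls)" using p by (auto simp: funs_of_type_def PiE_def extensional_def)
  then show ?case using p by auto
 next
  case (3 p)
  then show ?case by (auto simp: fun_eq_iff funs_of_type_def PiE_def extensional_def restrict_def)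
 next
  case (4 p)
  then obtain a f where p: "p = (f, a)" "a \<in> A" "f a = l" "f \<in> funs_of_type A (l # ls)" by auto
  have "mset_set A = add_mset a (mset_set (A - {a}))"
   using A(1) p(2) by (metis insert_Diff finite_Diff mset_set.insert Diff_iff insertI1 finite_insert)
  moreover have "image_mset (restrict f (A - {a})) (mset_set (A - {a})) = image_mset f (mset_set (A - {a}))"
   using A(1) by (intro image_mset_cong) auto
  ultimately have "restrict f (A - {a}) \<in> funs_of_type (A - {a}) ls" using p by (auto simp: funs_of_type_def)
  then show ?case using p by auto
 next
  case (5 p)
  then obtain a f where p: "p = (a, f)" "a \<in> A" "f \<in> funs_of_type (A - {a}) ls" by auto
  then have "restrict (f(a := l)) (A - {a}) = f" by (auto simp: funs_of_type_def fun_eq_iff PiE_def extensional_def restrict_def)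
  then show ?case using p by simp
 qed
 also have "\<dots> = (\<Sum>f\<in>funs_of_type A (l # ls). \<Sum>a\<in>{a\<in>A. f a = l}. 
   c a * fun_weight 1 1 t x (A - {a}) (restrict f (A - {a})))" using A(1) by (intro sum.Sigma[symmetric]) (auto intro: finite_funs_of_type)
 also have "\<dots> = (\<Sum>f\<in>funs_of_type A (l # ls). fun_weight 1 1 t x A f * (\<Sum>j\<le>count_list ls l. t^j))"
 proof (rule sum.cong[OF refl])
  fix f assume f: "f \<in> funs_of_type A (l # ls)"
  define B where "B = {a\<in>A. f a = l}"
  have le: "f a \<le> l" if "a \<in> A" for a
  proof -
   have "f a \<in># image_mset f (mset_set A)" using that A(1) by simp
   also have "image_mset f (mset_set A) = mset (l # ls)" using f by (simp add: funs_of_type_def)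
   finally show ?thesis using srt(2) by auto
  qed
  have "count (image_mset f (mset_set A)) l = card B"
  proof -
   have "count (image_mset f (mset_set A)) l = (\<Sum>i\<in>B. count (mset_set A) i)"
    using A(1) unfolding count_image_mset' by (intro sum.cong) (auto simp: B_def)
   also have "\<dots> = (\<Sum>i\<in>B. 1)" using A(1) by (intro sum.cong) (auto simp: B_def)
   finally show ?thesis by simp
  qed
  then have cardB: "card B = Suc (count_list ls l)" using f by (simp add: funs_of_type_def count_mset)
  have "c a * fun_weight 1 1 t x (A - {a}) (restrict f (A - {a})) =
    fun_weight 1 1 t x A f * (\<Prod>b\<in>B - {a}. hlK t (x a) (x b))" if "a \<in> B" for a
  proof -
   have a: "a \<in> A" "f a = l" using that by (auto simp: B_def)
   let ?C = "A - {a}"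
   have C: "finite ?C" "a \<notin> ?C" "insert a ?C = A" using A(1) a by auto
   have 1: "(\<Prod>b\<in>?C. hlK t (x a) (x b)) =
     (\<Prod>b\<in>?C. if f b < f a then hlK t (x a) (x b) else 1) * (\<Prod>b\<in>B - {a}. hlK t (x a) (x b))"
   proof -
    have "B - {a} = {b\<in>?C. f b = l}" by (auto simp: B_def)
    then have e: "(\<Prod>b\<in>B - {a}. hlK t (x a) (x b)) = (\<Prod>b\<in>?C. if f b = l then hlK t (x a) (x b) else 1)"
     using C(1) by (simp only: prod.inter_filter)
    have "hlK t (x a) (x b) = (if f b < f a then hlK t (x a) (x b) else 1) * (if f b = l then hlK t (x a) (x b) else 1)" if "b \<in> ?C" for b
     using le[of b] that a(2) by (cases "f b = l") auto
    then show ?thesis unfolding e prod.distrib[symmetric] by (intro prod.cong refl)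
   qed
   have 2: "(\<Prod>c\<in>?C. \<Prod>b\<in>A. if f b < f c then hlK t (x c) (x b) else 1) =
     (\<Prod>c\<in>?C. \<Prod>b\<in>?C. if f b < f c then hlK t (x c) (x b) else 1)"
   proof (rule prod.cong[OF refl])
    fix c assume "c \<in> ?C"
    then have "\<not> f a < f c" using le a by (auto simp: not_less)
    then show "(\<Prod>b\<in>A. if f b < f c then hlK t (x c) (x b) else 1) = (\<Prod>b\<in>?C. if f b < f c then hlK t (x c) (x b) else 1)"
     using A(1) a by (simp add: prod.remove)
   qed
   have "fun_weight 1 1 t x A f = (x a^f a * (\<Prod>b\<in>?C. x b^f b)) * ((\<Prod>b\<in>A. if f b < f a then hlK t (x a) (x b) else 1) *
     (\<Prod>c\<in>?C. \<Prod>b\<in>A. if f b < f c then hlK t (x c) (x b) else 1))"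
    by (simp add: fun_weight_def prod.remove[OF A(1) a(1), of "\<lambda>c. x c^f c"]
      prod.remove[OF A(1) a(1), of "\<lambda>c. \<Prod>b\<in>A. if f b < f c then hlK t (x c) (x b) else 1"])
   also have "(\<Prod>b\<in>A. if f b < f a then hlK t (x a) (x b) else 1) = (\<Prod>b\<in>?C. if f b < f a then hlK t (x a) (x b) else 1)"
    using A(1) a by (simp add: prod.remove)
   finally have 3: "fun_weight 1 1 t x A f = (x a^f a * (\<Prod>b\<in>?C. x b^f b)) *
     ((\<Prod>b\<in>?C. if f b < f a then hlK t (x a) (x b) else 1) *
     (\<Prod>c\<in>?C. \<Prod>b\<in>?C. if f b < f c then hlK t (x c) (x b) else 1))" unfolding 2 .
   have 4: "fun_weight 1 1 t x ?C (restrict f ?C) = (\<Prod>b\<in>?C. x b^f b) *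
     (\<Prod>c\<in>?C. \<Prod>b\<in>?C. if f b < f c then hlK t (x c) (x b) else 1)" by (simp add: fun_weight_def)
   show ?thesis unfolding 3 4 c_def 1 a(2) by (simp only: mult_ac)
  qed
  then have "(\<Sum>a\<in>B. c a * fun_weight 1 1 t x (A - {a}) (restrict f (A - {a}))) =
    fun_weight 1 1 t x A f * (\<Sum>a\<in>B. \<Prod>b\<in>B - {a}. hlK t (x a) (x b))" by (simp add: sum_distrib_left)
  also have "(\<Sum>a\<in>B. \<Prod>b\<in>B - {a}. hlK t (x a) (x b)) = (\<Sum>a\<in>x ` B. \<Prod>b\<in>x ` B - {a}. hlK t a b)"
  proof -
   have inj: "inj_on x B" using Cons.prems(2) by (rule inj_on_subset) (auto simp: B_def)
   have "(\<Prod>b\<in>x ` B - {x a}. hlK t (x a) b) = (\<Prod>b\<in>B - {a}. hlK t (x a) (x b))" if "a \<in> B" for a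
   proof -
    have "x ` B - {x a} = x ` (B - {a})" using inj that by (auto simp: inj_on_def)
    moreover have "inj_on x (B - {a})" using inj by (rule inj_on_subset) auto
    ultimately show ?thesis by (simp add: prod.reindex)
   qed
   then show ?thesis using inj by (simp add: sum.reindex)
  qed
  also have "\<dots> = (\<Sum>j\<le>count_list ls l. t^j)"
  proof -
   have inj: "inj_on x B" using Cons.prems(2) by (rule inj_on_subset) (auto simp: B_def)
   have "finite B" using A(1) by (simp add: B_def)
   then show ?thesis using sum_prod_hlK[of "x ` B" t] cardB inj by (simp add: card_image lessThan_Suc_atMost)
  qed
  finally show "(\<Sum>a\<in>{a\<in>A. f a = l}. c a * fun_weight 1 1 t x (A - {a}) (restrict f (A - {a}))) =
    fun_weight 1 1 t x A f * (\<Sum>j\<le>count_list ls l. t^j)" unfolding B_def .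
 qed
 finally show ?case unfolding mult_fact_Cons sum_distrib_right[symmetric] by (simp only: mult_ac)
qed

lemma qfact_eq:
 assumes "norm t < 1"
 shows "qfact t m / (1 - t)^m = (\<Prod>i<m. \<Sum>j\<le>i. t^j)"
proof -
 have t: "1 - t \<noteq> 0" using assms by auto
 have "qfact t m = (\<Prod>i<m. (1 - t) * (\<Sum>j\<le>i. t^j))" unfolding qfact_def
  by (rule prod.reindex_bij_witness[where i = Suc and j = "\<lambda>i. i - 1"])
    (auto simp: sum_gp_basic lessThan_Suc_atMost[symmetric] one_diff_power_eq)
 then show ?thesis using t by (simp add: prod.distrib)
qed

lemma qfact_nz: "norm t < 1 \<Longrightarrow> qfact t m \<noteq> 0"
proof
 assume t: "norm t < 1" and "qfact t m = 0"
 then obtain i where i: "1 \<le> i" "t^i = 1" by (auto simp: qfact_def)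
 have "norm t^i \<le> norm t^1" using t i(1) by (intro power_decreasing) auto
 then have "norm (t^i) < 1" using t by (simp add: norm_power)
 with i(2) show False by simp
qed

text \<open>The normalisation of the polynomial has a factor for the \<open>n - length \<mu>\<close>
  vanishing exponents, so they are listed explicitly as zero parts.\<close>

definition padded :: "nat \<Rightarrow> nat list \<Rightarrow> nat list" where
 "padded n \<mu> = \<mu> @ replicate (n - length \<mu>) 0"

lemma hl_v_eq:
 assumes "norm t < 1" "0 \<notin> set \<mu>"
 shows "hl_v n \<mu> t = mult_fact t (padded n \<mu>)"
proof -
 let ?F = "\<lambda>m. \<Prod>i<m. \<Sum>j\<le>i. t^j"
 have "hl_v n \<mu> t = ?F (n - length \<mu>) * (\<Prod>i\<in>set \<mu>. ?F (count_list \<mu> i))" by (simp add: hl_v_def qfact_eq[OF assms(1)])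
 also have "\<dots> = mult_fact t (padded n \<mu>)"
 proof (induction "n - length \<mu>")
  case 0
  then show ?case by (simp add: padded_def mult_fact_def flip: 0)
 next
  case (Suc k)
  have cr: "count_list (replicate k 0) i = (if i = 0 then k else 0)" for i k :: nat by (induction k) auto
  have "set (padded n \<mu>) = insert 0 (set \<mu>)" using Suc(2) by (auto simp: padded_def)
  moreover have "count_list (padded n \<mu>) i = (if i = 0 then n - length \<mu> else count_list \<mu> i)" for i
   using assms(2) by (auto simp: padded_def cr count_list_0_iff)
  ultimately show ?case using assms(2) by (auto simp: mult_fact_def intro!: prod.cong)
 qed
 finally show ?thesis .
qed

lemma hl_v_nz: "norm t < 1 \<Longrightarrow> hl_v n \<mu> t \<noteq> 0" by (auto simp: hl_v_def qfact_nz)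

text \<open>The permutations that lead to the same assignment of parts to variables account exactly
  for \<open>hl_v\<close>, so a plain sum over assignments is left.\<close>

lemma hall_littlewood_eq_fun_sum:
 assumes "inj_on x {..<n}" "length \<mu> \<le> n" "is_partition \<mu>" "norm t < 1"
 shows "hl_formula n \<mu> t x = (\<Sum>f\<in>funs_of_type {..<n} (padded n \<mu>). fun_weight 1 1 t x {..<n} f)"
proof -
 have len: "length (padded n \<mu>) = n" using assms(2) by (simp add: padded_def)
 have nth: "padded n \<mu> ! i = part \<mu> i" if "i < n" for i using that by (simp add: padded_def part_def nth_append)
 have "hl_summand n \<mu> t (\<lambda>i. x (w i)) = perm_term t x (padded n \<mu>) (map w [0..<n])" if "w permutes {..<n}" for w
 proof -
  have "distinct (map w [0..<n])" using permutes_inj_on[OF that] by (auto simp: distinct_map atLeast0LessThan)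
  then show ?thesis by (subst perm_term_eq) (auto simp: len hl_summand_def hlK_def nth intro!: arg_cong2[where f = "(*)"] prod.cong)
 qed
 then have "(\<Sum>w | w permutes {..<n}. hl_summand n \<mu> t (\<lambda>i. x (w i))) =
   (\<Sum>w | w permutes {..<n}. perm_term t x (padded n \<mu>) (map w [0..<n]))" by (intro sum.cong) auto
 also have "\<dots> = (\<Sum>ys\<in>permutations_of_set {..<n}. perm_term t x (padded n \<mu>) ys)" by (rule sum_permutes_eq_sum_lists)
 also have "\<dots> = mult_fact t (padded n \<mu>) * (\<Sum>f\<in>funs_of_type {..<n} (padded n \<mu>). fun_weight 1 1 t x {..<n} f)"
 proof (rule sum_perm_term)
  have "sorted_wrt (\<ge>) (replicate k (0::nat))" for k by (induction k) auto
  then show "sorted_wrt (\<ge>) (padded n \<mu>)" using assms(3) by (auto simp: padded_def is_partition_def sorted_wrt_append)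
 qed (use assms len in auto)
 also have "mult_fact t (padded n \<mu>) = hl_v n \<mu> t" using assms by (simp add: hl_v_eq is_partition_def)
 finally show ?thesis using hl_v_nz[OF assms(4)] by (simp add: hl_formula_def)
qed

section \<open>Infinitely many variables\<close>

text \<open>Tannery's theorem for unordered sums: outside one finite set all sums are controlled by
  the tail of \<open>g\<close>.\<close>

lemma tendsto_infsum_dominated:
 fixes b :: "nat \<Rightarrow> 'a \<Rightarrow> 'b::banach"
 assumes lim: "\<And>x. x \<in> A \<Longrightarrow> (\<lambda>n. b n x) \<longlonglongrightarrow> \<beta> x"
  and bound: "\<And>n x. x \<in> A \<Longrightarrow> norm (b n x) \<le> g x"
  and g: "g summable_on A"
 shows "(\<lambda>n. infsum (b n) A) \<longlonglongrightarrow> infsum \<beta> A" "\<beta> summable_on A"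
  "\<And>n. b n summable_on A"
proof -
 have bound': "norm (\<beta> x) \<le> g x" if "x \<in> A" for x using tendsto_norm[OF lim[OF that]] bound[OF that] by (intro LIMSEQ_le_const2) auto
 show sb: "b n summable_on A" for n by (rule abs_summable_summable[OF Infinite_Sum.abs_summable_on_comparison_test'[OF g bound]])
 show s\<beta>: "\<beta> summable_on A" by (rule abs_summable_summable[OF Infinite_Sum.abs_summable_on_comparison_test'[OF g bound']])
 show "(\<lambda>n. infsum (b n) A) \<longlonglongrightarrow> infsum \<beta> A"
 proof (rule LIMSEQ_I)
  fix e :: real assume e: "0 < e"
  obtain F where F: "finite F" "F \<subseteq> A" "dist (sum g F) (infsum g A) \<le> e / 4"
   using infsum_finite_approximation[OF g, of "e / 4"] e by auto
  have tail: "norm (infsum c A - sum c F) \<le> e / 4" if c: "c summable_on A" "\<And>x. x \<in> A \<Longrightarrow> norm (c x) \<le> g x" for c :: "'a \<Rightarrow> 'b"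
  proof -
   have fin: "(c has_sum sum c F) F" "(g has_sum sum g F) F" using F(1) by (auto intro: has_sum_finite)
   have "norm (infsum c A - sum c F) \<le> infsum g A - sum g F"
    using c F(2) g by (intro norm_infsum_le[OF has_sum_Diff[OF has_sum_infsum fin(1)] has_sum_Diff[OF has_sum_infsum fin(2)]]) auto
   also have "\<dots> \<le> e / 4" using F(3) unfolding dist_real_def by linarith
   finally show ?thesis .
  qed
  have "(\<lambda>n. sum (b n) F) \<longlonglongrightarrow> sum \<beta> F" using F(2) by (intro tendsto_sum lim) auto
  then obtain N where N: "\<And>n. n \<ge> N \<Longrightarrow> norm (sum (b n) F - sum \<beta> F) < e / 4"
   using e LIMSEQ_D[of "\<lambda>n. sum (b n) F" "sum \<beta> F" "e / 4"] by auto
  show "\<exists>N. \<forall>n\<ge>N. norm (infsum (b n) A - infsum \<beta> A) < e"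
  proof (intro exI allI impI)
   fix n assume n: "n \<ge> N"
   have "infsum (b n) A - infsum \<beta> A = (infsum (b n) A - sum (b n) F) + (sum (b n) F - sum \<beta> F) - (infsum \<beta> A - sum \<beta> F)"
    by simp
   also have "norm \<dots> \<le> norm (infsum (b n) A - sum (b n) F) + norm (sum (b n) F - sum \<beta> F) + norm (infsum \<beta> A - sum \<beta> F)"
    by (intro order_trans[OF norm_triangle_ineq4] add_mono norm_triangle_ineq order_refl)
   also have "\<dots> < e" using tail[OF sb bound, of n] tail[OF s\<beta> bound'] N[OF n] e by simp
   finally show "norm (infsum (b n) A - infsum \<beta> A) < e" .
  qed
 qed
qed

section \<open>Row factors and a summable majorant\<close>

definition supp :: "(nat \<Rightarrow> nat) \<Rightarrow> nat set" where
 "supp f = {i. f i \<noteq> 0}"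

definition fin_funs :: "nat \<Rightarrow> (nat \<Rightarrow> nat) set" where
 "fin_funs m = {f. finite (supp f) \<and> (\<forall>i. f i \<le> m)}"

definition hl_row :: "complex \<Rightarrow> complex \<Rightarrow> (nat \<Rightarrow> nat) \<Rightarrow> nat \<Rightarrow> nat \<Rightarrow> complex" where
 "hl_row q t f a b = (if f b < f a then hlK t (q^a) (q^b) else 1)"

text \<open>The index set of the limit must not depend on the number \<open>n\<close> of variables.
  Functions on \<open>{..<n}\<close> are therefore extended by zero, and functions with larger
  support get weight 0. A row with value 0 is an empty product, hence the product over the support
  only.\<close>

definition row_weight :: "complex \<Rightarrow> complex \<Rightarrow> nat \<Rightarrow> (nat \<Rightarrow> nat) \<Rightarrow> complex" where
 "row_weight q t n f = (if supp f \<subseteq> {..<n} then \<Prod>a\<in>supp f. (q^a)^f a * (\<Prod>b<n. hl_row q t f a b) else 0)"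

definition lim_weight :: "complex \<Rightarrow> complex \<Rightarrow> (nat \<Rightarrow> nat) \<Rightarrow> complex" where
 "lim_weight q t f = (\<Prod>a\<in>supp f. (q^a)^f a * prodinf (hl_row q t f a))"

definition stat_weight :: "complex \<Rightarrow> complex \<Rightarrow> (nat \<Rightarrow> nat) \<Rightarrow> complex" where
 "stat_weight z s f = (\<Prod>a\<in>supp f. (if even (f a) then 1 else s) * z^f a)"

lemma hlK_power_cases:
 assumes "q \<noteq> 0" "norm q < 1" "a \<noteq> b"
 shows "hlK t (q^a) (q^b) = (if b < a then (q^(a - b) - t) / (q^(a - b) - 1) else (1 - t * q^(b - a)) / (1 - q^(b - a)))"
proof (cases "b < a")
 case True
 then have "q^a = q^b * q^(a - b)" by (simp flip: power_add)
 then have "q^a - t * q^b = q^b * (q^(a - b) - t)" "q^a - q^b = q^b * (q^(a - b) - 1)" by (simp_all add: algebra_simps)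
 then show ?thesis using True assms by (simp add: hlK_def)
next
 case False
 then have "q^b = q^a * q^(b - a)" by (simp flip: power_add)
 then have "q^a - t * q^b = q^a * (1 - t * q^(b - a))" "q^a - q^b = q^a * (1 - q^(b - a))" by (simp_all add: algebra_simps)
 then show ?thesis using False assms by (simp add: hlK_def)
qed

lemma norm_power_le_self:
 assumes "norm (q::complex) < 1" "d > 0"
 shows "norm q^d \<le> norm q" using assms power_decreasing[of 1 d "norm q"] by simp

lemma norm_ratio_le:
 fixes u v :: complex and r R :: real
 assumes "norm u \<le> 1 + R" "norm v \<ge> 1 - R" "R \<le> r" "r < 1" "0 \<le> R"
 shows "norm (u / v) \<le> 1 + 2 / (1 - r) * R"
proof -
 have pos: "0 < 1 - R" "0 < 1 - r" using assms by auto
 have "norm (u / v) \<le> (1 + R) / (1 - R)" unfolding norm_divide using assms pos by (intro frac_le) auto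
 also have "\<dots> = 1 + 2 * R / (1 - R)" using pos by (simp add: field_simps)
 also have "2 * R / (1 - R) \<le> 2 * R / (1 - r)" using assms pos by (intro divide_left_mono) auto
 finally show ?thesis by simp
qed

text \<open>For \<open>b\<close> far beyond \<open>a\<close> the factor tends to 1, for
  \<open>b\<close> far before \<open>a\<close> it tends to \<open>t\<close>; since
  \<open>norm t \<le> 1\<close>, the same upper bound serves both sides.\<close>

lemma norm_hl_row_le:
 assumes "q \<noteq> 0" "norm q < 1" "norm t \<le> 1"
 shows "norm (hl_row q t f a b) \<le> 1 + 2 / (1 - norm q) * norm q^(if b < a then a - b else b - a)"
proof (cases "f b < f a")
 case True
 then have ab: "a \<noteq> b" by auto
 have 1: "1 - norm (q^d) \<le> norm (1 - q^d)" "norm (1 - q^d) = norm (q^d - 1)" for d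
  using norm_triangle_ineq2[of 1 "q^d"] by (auto simp: norm_minus_commute)
 have 2: "norm (q^d - t) \<le> 1 + norm (q^d)" "norm (1 - t * q^d) \<le> 1 + norm (q^d)" for d
 proof -
  show "norm (q^d - t) \<le> 1 + norm (q^d)" using norm_triangle_ineq4[of "q^d" t] assms(3) by linarith
  have "norm (t * q^d) \<le> norm (q^d)" unfolding norm_mult using assms(3) by (intro mult_left_le_one_le) auto
  then show "norm (1 - t * q^d) \<le> 1 + norm (q^d)" using norm_triangle_ineq4[of 1 "t * q^d"] by simp
 qed
 show ?thesis
 proof (cases "b < a")
  case True
  have "norm ((q^(a - b) - t) / (q^(a - b) - 1)) \<le> 1 + 2 / (1 - norm q) * norm (q^(a - b))"
   using 1[of "a - b"] 2[of "a - b"] norm_power_le_self[OF assms(2), of "a - b"] True assms(2) by (intro norm_ratio_le) (auto simp: norm_power)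
  then show ?thesis using True \<open>f b < f a\<close> ab by (simp add: hl_row_def hlK_power_cases[OF assms(1,2) ab] norm_power)
 next
  case False
  have "norm ((1 - t * q^(b - a)) / (1 - q^(b - a))) \<le> 1 + 2 / (1 - norm q) * norm (q^(b - a))"
   using 1[of "b - a"] 2[of "b - a"] norm_power_le_self[OF assms(2), of "b - a"] False ab assms(2) by (intro norm_ratio_le) (auto simp: norm_power)
  then show ?thesis using False \<open>f b < f a\<close> ab by (simp add: hl_row_def hlK_power_cases[OF assms(1,2) ab] norm_power)
 qed
next
 case False
 then show ?thesis using assms by (simp add: hl_row_def)
qed

lemma geometric_partial_le:
 fixes r :: real
 assumes "0 \<le> r" "r < 1" "finite A"
 shows "(\<Sum>i\<in>A. r^i) \<le> 1 / (1 - r)"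
 using assms sum_le_suminf[of "\<lambda>i. r^i" A] by (simp add: suminf_geometric summable_geometric)

text \<open>A bound for a whole row, uniform in its position, in \<open>n\<close> and in
  \<open>f\<close>: the exponential of two geometric series around the diagonal, each at most
  \<open>1 / (1 - norm q)\<close>, times the constant \<open>2 / (1 - norm q)\<close> of
  \<open>norm_hl_row_le\<close>.\<close>

definition row_const :: "complex \<Rightarrow> real" where
 "row_const q = exp (4 / (1 - norm q)\<^sup>2)"

lemma norm_row_le:
 assumes "q \<noteq> 0" "norm q < 1" "norm t \<le> 1"
 shows "norm (\<Prod>b<n. hl_row q t f a b) \<le> row_const q"
proof -
 let ?r = "norm q" and ?c = "2 / (1 - norm q)"
 let ?h = "\<lambda>b. ?c * ?r^(if b < a then a - b else b - a)"
 have c: "0 \<le> ?c" using assms(2) by simp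
 have "norm (\<Prod>b<n. hl_row q t f a b) \<le> (\<Prod>b<n. 1 + ?h b)"
  unfolding prod_norm[symmetric] using norm_hl_row_le[OF assms] by (intro prod_mono) auto
 also have "\<dots> \<le> exp (\<Sum>b<n. ?h b)" using c by (intro prod_le_exp_sum) auto
 also have "(\<Sum>b<n. ?h b) \<le> 4 / (1 - ?r)\<^sup>2"
 proof -
  have s1: "(\<Sum>b\<in>{..<n} \<inter> {..<a}. ?r^(a - b)) \<le> 1 / (1 - ?r)"
  proof -
   have "(\<Sum>b\<in>{..<n} \<inter> {..<a}. ?r^(a - b)) = (\<Sum>j\<in>(\<lambda>b. a - b) ` ({..<n} \<inter> {..<a}). ?r^j)"
    by (subst sum.reindex) (auto simp: inj_on_def)
   also have "\<dots> \<le> 1 / (1 - ?r)" using assms by (intro geometric_partial_le) auto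
   finally show ?thesis .
  qed
  have s2: "(\<Sum>b\<in>{..<n} - {..<a}. ?r^(b - a)) \<le> 1 / (1 - ?r)"
  proof -
   have "(\<Sum>b\<in>{..<n} - {..<a}. ?r^(b - a)) = (\<Sum>j\<in>(\<lambda>b. b - a) ` ({..<n} - {..<a}). ?r^j)"
    by (subst sum.reindex) (auto simp: inj_on_def)
   also have "\<dots> \<le> 1 / (1 - ?r)" using assms by (intro geometric_partial_le) auto
   finally show ?thesis .
  qed
  have "(\<Sum>b<n. ?h b) = ?c * (\<Sum>b<n. ?r^(if b < a then a - b else b - a))" by (simp only: sum_distrib_left)
  also have "(\<Sum>b<n. ?r^(if b < a then a - b else b - a)) =
    (\<Sum>b\<in>{..<n} \<inter> {..<a}. ?r^(if b < a then a - b else b - a)) + (\<Sum>b\<in>{..<n} - {..<a}. ?r^(if b < a then a - b else b - a))"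
   by (rule sum.Int_Diff) simp
  also have "(\<Sum>b\<in>{..<n} \<inter> {..<a}. ?r^(if b < a then a - b else b - a)) = (\<Sum>b\<in>{..<n} \<inter> {..<a}. ?r^(a - b))"
   by (intro sum.cong) auto
  also have "(\<Sum>b\<in>{..<n} - {..<a}. ?r^(if b < a then a - b else b - a)) = (\<Sum>b\<in>{..<n} - {..<a}. ?r^(b - a))"
   by (intro sum.cong) auto
  also have "?c * ((\<Sum>b\<in>{..<n} \<inter> {..<a}. ?r^(a - b)) + (\<Sum>b\<in>{..<n} - {..<a}. ?r^(b - a))) \<le>
    ?c * (1 / (1 - ?r) + 1 / (1 - ?r))" by (intro mult_left_mono add_mono s1 s2 c)
  also have "\<dots> = 4 / (1 - ?r)\<^sup>2" by (simp add: power2_eq_square)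
  finally show ?thesis .
 qed
 finally show ?thesis by (simp add: row_const_def)
qed

lemma row_tendsto:
 assumes "q \<noteq> 0" "norm q < 1" "norm t \<le> 1"
 shows "(\<lambda>n. \<Prod>b<n. hl_row q t f a b) \<longlonglongrightarrow> prodinf (hl_row q t f a)"
proof -
 let ?r = "norm q"
 have "summable (\<lambda>b. norm (hl_row q t f a b - 1))"
 proof (rule summable_comparison_test_ev)
  show "summable (\<lambda>b. (2 / (1 - ?r) / ?r^a) * ?r^b)" using assms by (intro summable_mult summable_geometric) auto
  show "eventually (\<lambda>b. norm (norm (hl_row q t f a b - 1)) \<le> 2 / (1 - ?r) / ?r^a * ?r^b) sequentially"
   using eventually_gt_at_top[of a]
  proof eventually_elim
   case (elim b)
   let ?R = "?r^(b - a)"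
   have R: "?R \<le> ?r" "0 \<le> ?R" using norm_power_le_self[OF assms(2), of "b - a"] elim by auto
   have e: "?r^b = ?r^a * ?R" using elim by (simp flip: power_add)
   show ?case
   proof (cases "f b < f a")
    case True
    have "1 - q^(b - a) \<noteq> 0"
    proof
     assume "1 - q^(b - a) = 0"
     then have "?R = 1" by (metis norm_one norm_power right_minus_eq)
     with R assms(2) show False by simp
    qed
    then have "hl_row q t f a b - 1 = (1 - t) * q^(b - a) / (1 - q^(b - a))"
     using True elim assms by (simp add: hl_row_def hlK_power_cases field_simps)
    also have "norm \<dots> = norm (1 - t) * ?R / norm (1 - q^(b - a))" by (simp add: norm_mult norm_divide norm_power)
    also have "\<dots> \<le> (2 * ?R) / (1 - ?r)"
    proof (rule frac_le)
     have "norm (1 - t) \<le> 2" using norm_triangle_ineq4[of 1 t] assms(3) by simp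
     then show "norm (1 - t) * ?R \<le> 2 * ?R" by (intro mult_right_mono) auto
     show "1 - ?r \<le> norm (1 - q^(b - a))" using norm_triangle_ineq2[of 1 "q^(b - a)"] R by (simp add: norm_power)
    qed (use R assms in auto)
    also have "\<dots> = 2 / (1 - ?r) / ?r^a * ?r^b" using assms(1) unfolding e by simp
    finally show ?thesis by simp
   next
    case False
    then show ?thesis using assms by (simp add: hl_row_def)
   qed
  qed
 qed
 then have "convergent_prod (hl_row q t f a)" by (intro abs_convergent_prod_imp_convergent_prod summable_imp_abs_convergent_prod)
 then show ?thesis using convergent_prod_LIMSEQ LIMSEQ_lessThan_iff_atMost[of "\<lambda>A. prod (hl_row q t f a) A"] by blast
qed

text \<open>On the support the values of \<open>f\<close> are at least 1, so \<open>norm q^a\<close>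
  dominates the monomial. For each variable the majorant is 1 at the value 0 and constant on the
  values from 1 to \<open>m\<close>; its sum is bounded by a product of factors
  \<open>1 + m * row_const q * norm q^i\<close>.\<close>

definition dom_weight :: "complex \<Rightarrow> (nat \<Rightarrow> nat) \<Rightarrow> real" where
 "dom_weight q f = (\<Prod>a\<in>supp f. norm q^a * row_const q)"

lemma norm_row_weight_le:
 assumes "q \<noteq> 0" "norm q < 1" "norm t \<le> 1"
 shows "norm (row_weight q t n f) \<le> dom_weight q f"
proof (cases "supp f \<subseteq> {..<n}")
 case True
 then have "norm (row_weight q t n f) = (\<Prod>a\<in>supp f. norm (q^a)^f a * norm (\<Prod>b<n. hl_row q t f a b))"
  by (simp add: row_weight_def norm_mult norm_power flip: prod_norm)
 also have "\<dots> \<le> dom_weight q f" unfolding dom_weight_def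
 proof (intro prod_mono conjI mult_mono norm_row_le assms)
  fix a assume "a \<in> supp f"
  then have "f a \<ge> 1" by (simp add: supp_def)
  then have "norm (q^a)^f a \<le> norm (q^a)^1" using assms(2) by (intro power_decreasing) (auto simp: norm_power power_le_one)
  then show "norm (q^a)^f a \<le> norm q^a" by (simp add: norm_power)
 qed auto
 finally show ?thesis .
next
 case False
 then show ?thesis by (auto simp: row_weight_def dom_weight_def row_const_def intro!: prod_nonneg)
qed

lemma row_weight_tendsto:
 assumes "q \<noteq> 0" "norm q < 1" "norm t \<le> 1" "finite (supp f)"
 shows "(\<lambda>n. row_weight q t n f) \<longlonglongrightarrow> lim_weight q t f"
proof -
 obtain N where N: "supp f \<subseteq> {..<N}" using assms(4) by (meson finite_nat_iff_bounded)
 have "(\<lambda>n. \<Prod>a\<in>supp f. (q^a)^f a * (\<Prod>b<n. hl_row q t f a b)) \<longlonglongrightarrow> lim_weight q t f"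
  unfolding lim_weight_def by (intro tendsto_prod tendsto_mult tendsto_const row_tendsto assms)
 moreover have "eventually (\<lambda>n. (\<Prod>a\<in>supp f. (q^a)^f a * (\<Prod>b<n. hl_row q t f a b)) = row_weight q t n f) sequentially"
  using eventually_ge_at_top[of N] by eventually_elim (use N in \<open>auto simp: row_weight_def\<close>)
 ultimately show ?thesis by (rule Lim_transform_eventually)
qed

lemma summable_dom_weight:
 assumes "norm q < 1"
 shows "dom_weight q summable_on fin_funs m"
proof -
 let ?C = "row_const q" and ?r = "norm q"
 have C: "0 \<le> ?C" by (simp add: row_const_def)
 show ?thesis
 proof (rule nonneg_bounded_partial_sums_imp_summable_on)
  show "0 \<le> dom_weight q f" for f using C by (auto simp: dom_weight_def intro!: prod_nonneg)
  let ?B = "exp (real m * ?C * (1 / (1 - ?r)))"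
  have "sum (dom_weight q) X \<le> ?B" if X: "finite X" "X \<subseteq> fin_funs m" for X
  proof -
   have "finite (\<Union>f\<in>X. supp f)" using X by (auto simp: fin_funs_def)
   then obtain N where N: "(\<Union>f\<in>X. supp f) \<subseteq> {..<N}" by (meson finite_nat_iff_bounded)
   let ?w = "\<lambda>i j. if j = (0::nat) then 1 else ?r^i * ?C"
   have inj: "inj_on (\<lambda>f. restrict f {..<N}) X"
   proof (rule inj_onI)
    fix f g assume fg: "f \<in> X" "g \<in> X" "restrict f {..<N} = restrict g {..<N}"
    show "f = g"
    proof
     fix i show "f i = g i"
     proof (cases "i < N")
      case True
      then show ?thesis using fun_cong[OF fg(3), of i] by simp
     next
      case False
      then have "i \<notin> supp f" "i \<notin> supp g" using N fg(1,2) by blast+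
      then show ?thesis by (simp add: supp_def)
     qed
    qed
   qed
   have dw: "dom_weight q f = (\<Prod>i<N. ?w i (f i))" if "f \<in> X" for f
   proof -
    have "(\<Prod>i<N. ?w i (f i)) = (\<Prod>i\<in>supp f. ?w i (f i))" using N that by (intro prod.mono_neutral_right) (auto simp: supp_def)
    also have "\<dots> = dom_weight q f" unfolding dom_weight_def by (intro prod.cong) (auto simp: supp_def)
    finally show ?thesis by simp
   qed
   have "sum (dom_weight q) X = (\<Sum>f\<in>X. \<Prod>i<N. ?w i (restrict f {..<N} i))" using dw by (intro sum.cong) auto
   also have "\<dots> = (\<Sum>f\<in>(\<lambda>f. restrict f {..<N}) ` X. \<Prod>i<N. ?w i (f i))" using inj by (simp add: sum.reindex)
   also have "\<dots> \<le> (\<Sum>f\<in>{..<N} \<rightarrow>\<^sub>E {..m}. \<Prod>i<N. ?w i (f i))"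
   proof (rule sum_mono2)
    show "(\<lambda>f. restrict f {..<N}) ` X \<subseteq> {..<N} \<rightarrow>\<^sub>E {..m}"
     unfolding image_subset_iff restrict_PiE_iff using X(2) by (auto simp: fin_funs_def)
   qed (use C in \<open>auto intro!: prod_nonneg finite_PiE\<close>)
   also have "\<dots> = (\<Prod>i<N. \<Sum>j\<le>m. ?w i j)" by (rule prod_sum_PiE[symmetric]) auto
   also have "\<dots> = (\<Prod>i<N. 1 + real m * (?r^i * ?C))" by (intro prod.cong refl) (simp add: sum.atMost_shift)
   also have "\<dots> \<le> exp (\<Sum>i<N. real m * (?r^i * ?C))" using C by (intro prod_le_exp_sum) auto
   also have "(\<Sum>i<N. real m * (?r^i * ?C)) = real m * ?C * (\<Sum>i<N. ?r^i)" by (simp add: sum_distrib_left mult_ac)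
   also have "\<dots> \<le> real m * ?C * (1 / (1 - ?r))" using C assms by (intro mult_left_mono geometric_partial_le) auto
   finally show ?thesis by simp
  qed
  then show "eventually (\<lambda>X. sum (dom_weight q) X \<le> ?B) (finite_subsets_at_top (fin_funs m))"
   by (auto simp: eventually_finite_subsets_at_top intro!: exI[of _ "{}"])
 qed
qed

lemma norm_stat_weight_le:
 assumes "norm z \<le> 1" "norm s \<le> 1"
 shows "norm (stat_weight z s f) \<le> 1" unfolding stat_weight_def prod_norm[symmetric]
 using assms by (intro prod_le_1) (auto simp: norm_mult norm_power power_le_one mult_le_one)

text \<open>\<open>hlK\<close> is homogeneous of degree 0, so \<open>z\<close> enters through the
  monomials only.\<close>

lemma fun_weight_eq_row_weight:
 assumes "supp f \<subseteq> {..<n}" "z \<noteq> 0"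
 shows "fun_weight 1 s t (\<lambda>i. z * q^i) {..<n} f = stat_weight z s f * row_weight q t n f"
proof -
 have K: "hlK t (z * q^a) (z * q^b) = hlK t (q^a) (q^b)" for a b
 proof -
  have "z * q^a - t * (z * q^b) = z * (q^a - t * q^b)" "z * q^a - z * q^b = z * (q^a - q^b)" by (simp_all add: algebra_simps)
  then show ?thesis using assms(2) by (simp add: hlK_def)
 qed
 have 1: "(\<Prod>a<n. (if even (f a) then 1 else s) * (z * q^a)^f a) = (\<Prod>a\<in>supp f. (if even (f a) then 1 else s) * (z * q^a)^f a)"
  using assms(1) by (intro prod.mono_neutral_right) (auto simp: supp_def)
 have 2: "(\<Prod>a<n. \<Prod>b<n. if f b < f a then hlK t (z * q^a) (z * q^b) else 1) = (\<Prod>a\<in>supp f. \<Prod>b<n. hl_row q t f a b)"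
  unfolding K hl_row_def using assms(1) by (intro prod.mono_neutral_right) (auto simp: supp_def)
 show ?thesis unfolding fun_weight_def 1 2 row_weight_def stat_weight_def using assms(1) by (simp add: prod.distrib power_mult_distrib mult_ac)
qed

definition zero_ext :: "nat \<Rightarrow> (nat \<Rightarrow> nat) \<Rightarrow> nat \<Rightarrow> nat" where
 "zero_ext n f = (\<lambda>i. if i < n then f i else 0)"

lemma fun_weight_zero_ext: "fun_weight \<alpha> \<beta> t x {..<n} (zero_ext n f) = fun_weight \<alpha> \<beta> t x {..<n} f"
 unfolding fun_weight_def zero_ext_def by (intro arg_cong2[where f = "(*)", OF prod.cong prod.cong] refl prod.cong) auto

lemma bounded_sum_eq_infsum:
 assumes "z \<noteq> 0"
 shows "bounded_sum m 1 s t (\<lambda>i. z * q^i) {..<n} = infsum (\<lambda>f. stat_weight z s f * row_weight q t n f) (fin_funs m)"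
proof -
 let ?S = "{f \<in> fin_funs m. supp f \<subseteq> {..<n}}"
 have "bounded_sum m 1 s t (\<lambda>i. z * q^i) {..<n} = (\<Sum>f\<in>?S. fun_weight 1 s t (\<lambda>i. z * q^i) {..<n} f)"
  unfolding bounded_sum_def
 proof (rule sum.reindex_bij_witness[where i = "\<lambda>f. restrict f {..<n}" and j = "zero_ext n"], goal_cases)
  case (1 f)
  then show ?case by (auto simp: zero_ext_def fun_eq_iff PiE_def extensional_def)
 next
  case (2 f)
  have "supp (zero_ext n f) \<subseteq> {..<n}" by (auto simp: supp_def zero_ext_def)
  moreover from this have "finite (supp (zero_ext n f))" by (rule finite_subset) simp
  moreover have "zero_ext n f i \<le> m" for i using 2 by (auto simp: zero_ext_def PiE_def Pi_def)
  ultimately show ?case by (simp add: fin_funs_def)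
 next
  case (3 f)
  then show ?case by (auto simp: zero_ext_def fun_eq_iff supp_def)
 next
  case (4 f)
  then show ?case by (auto simp: fin_funs_def)
 next
  case (5 f)
  then show ?case by (simp add: fun_weight_zero_ext)
 qed
 also have "\<dots> = (\<Sum>f\<in>?S. stat_weight z s f * row_weight q t n f)" using assms by (intro sum.cong refl fun_weight_eq_row_weight) auto
 also have "\<dots> = infsum (\<lambda>f. stat_weight z s f * row_weight q t n f) ?S"
 proof (rule infsum_finite[symmetric])
  have "?S \<subseteq> zero_ext n ` ({..<n} \<rightarrow>\<^sub>E {..m})"
  proof
   fix f assume "f \<in> ?S"
   then have "f = zero_ext n (restrict f {..<n})" "restrict f {..<n} \<in> {..<n} \<rightarrow>\<^sub>E {..m}"
    by (auto simp: zero_ext_def fun_eq_iff supp_def fin_funs_def)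
   then show "f \<in> zero_ext n ` ({..<n} \<rightarrow>\<^sub>E {..m})" by blast
  qed
  then show "finite ?S" by (rule finite_subset) (auto intro: finite_PiE)
 qed
 also have "\<dots> = infsum (\<lambda>f. stat_weight z s f * row_weight q t n f) (fin_funs m)"
  by (rule infsum_cong_neutral) (auto simp: row_weight_def)
 finally show ?thesis .
qed

section \<open>Regrouping functions by partitions\<close>

definition partition_of :: "(nat \<Rightarrow> nat) \<Rightarrow> nat list" where
 "partition_of f = rev (sorted_list_of_multiset (image_mset f (mset_set (supp f))))"


definition fiber :: "nat list \<Rightarrow> (nat \<Rightarrow> nat) set" where
 "fiber \<mu> = {f. finite (supp f) \<and> image_mset f (mset_set (supp f)) = mset \<mu>}"

lemma partition_of_eq_iff:
 assumes "is_partition \<mu>"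
 shows "image_mset f (mset_set (supp f)) = mset \<mu> \<longleftrightarrow> partition_of f = \<mu>"
proof
 assume "image_mset f (mset_set (supp f)) = mset \<mu>"
 then have "partition_of f = rev (sort \<mu>)" by (simp add: partition_of_def)
 moreover have "sort \<mu> = rev \<mu>" using assms by (intro properties_for_sort) (auto simp: is_partition_def sorted_wrt_rev)
 ultimately show "partition_of f = \<mu>" by simp
next
 assume "partition_of f = \<mu>"
 then show "image_mset f (mset_set (supp f)) = mset \<mu>" by (auto simp: partition_of_def)
qed

lemma partition_of_fin_funs:
 assumes "f \<in> fin_funs m"
 shows "is_partition (partition_of f)" "part (partition_of f) 0 \<le> m"
proof -
 have fin: "finite (supp f)" and le: "\<And>i. f i \<le> m" using assms by (auto simp: fin_funs_def)
 have set: "set (partition_of f) = f ` supp f" using fin by (simp add: partition_of_def)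
 then show "is_partition (partition_of f)" by (auto simp: is_partition_def supp_def partition_of_def sorted_wrt_rev)
 show "part (partition_of f) 0 \<le> m"
 proof (cases "partition_of f = []")
  case False
  then have "partition_of f ! 0 \<in> f ` supp f" unfolding set[symmetric] by (intro nth_mem) auto
  then show ?thesis using le False by (auto simp: part_def)
 qed (simp add: part_def)
qed

lemma fiber_subset_fin_funs:
 assumes "is_partition \<mu>" "part \<mu> 0 \<le> m"
 shows "fiber \<mu> \<subseteq> fin_funs m"
proof
 fix f assume f: "f \<in> fiber \<mu>"
 have "f i \<le> m" for i
 proof (cases "f i = 0")
  case False
  then have "f i \<in># image_mset f (mset_set (supp f))"
   unfolding in_image_mset using f by (intro imageI) (simp add: fiber_def, simp add: supp_def)
  also have "image_mset f (mset_set (supp f)) = mset \<mu>" using f by (simp add: fiber_def)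
  finally obtain j where j: "j < length \<mu>" "\<mu> ! j = f i" by (auto simp: in_set_conv_nth)
  then have "\<mu> ! j \<le> \<mu> ! 0" using assms(1) sorted_wrt_nth_less[of "(\<ge>)" \<mu> 0 j] by (cases "j = 0") (auto simp: is_partition_def)
  then show ?thesis using j assms(2) by (auto simp: part_def split: if_splits)
 qed simp
 then show "f \<in> fin_funs m" using f by (simp add: fiber_def fin_funs_def)
qed

lemma image_mset_lessThan:
 assumes "supp f \<subseteq> {..<n}"
 shows "image_mset f (mset_set {..<n}) = image_mset f (mset_set (supp f)) + replicate_mset (n - card (supp f)) 0"
proof -
 have fin: "finite (supp f)" using assms by (rule finite_subset) simp
 have "mset_set {..<n} = mset_set (supp f) + mset_set ({..<n} - supp f)" using assms fin by (subst mset_set_Union[symmetric]) (auto simp: Un_absorb1)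
 moreover have "image_mset f (mset_set ({..<n} - supp f)) = image_mset (\<lambda>_. 0) (mset_set ({..<n} - supp f))"
  by (intro image_mset_cong) (auto simp: supp_def)
 moreover have "\<dots> = replicate_mset (n - card (supp f)) 0" using assms fin by (simp add: image_mset_const_eq card_Diff_subset)
 ultimately show ?thesis by simp
qed

text \<open>The powers of \<open>q\<close> are distinct for \<open>0 < norm q < 1\<close>, so
  \<open>hall_littlewood\<close> is given by its formula. Splitting off the zeros of the padded
  partition from the multiset of values identifies functions on \<open>{..<n}\<close> with the
  members of the fiber supported there.\<close>

lemma hall_littlewood_powers:
 assumes "q \<noteq> 0" "norm q < 1" "norm t < 1" "is_partition \<mu>"
 shows "hall_littlewood n \<mu> t (\<lambda>i. q^i) = infsum (row_weight q t n) (fiber \<mu>)"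
proof -
 have inj: "inj_on (\<lambda>i. q^i) {..<n}"
 proof (rule inj_onI)
  fix i j assume "q^i = q^j"
  then have "norm q^i = norm q^j" by (metis norm_power)
  then show "i = j" using assms(1,2) power_inject_exp'[of "norm q" i j] by simp
 qed
 let ?S = "{f \<in> fiber \<mu>. supp f \<subseteq> {..<n}}"
 have card_supp: "card (supp f) = length \<mu>" if "f \<in> fiber \<mu>" for f
 proof -
  have "size (image_mset f (mset_set (supp f))) = size (mset \<mu>)" using that by (simp add: fiber_def)
  then show ?thesis by simp
 qed
 have inf: "infsum (row_weight q t n) (fiber \<mu>) = infsum (row_weight q t n) ?S" by (rule infsum_cong_neutral) (auto simp: row_weight_def)
 show ?thesis
 proof (cases "length \<mu> \<le> n")
  case False
  have e: "?S = {}"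
  proof -
   have "\<not> supp f \<subseteq> {..<n}" if "f \<in> fiber \<mu>" for f using card_mono[of "{..<n}" "supp f"] card_supp[OF that] False by auto
   then show ?thesis by auto
  qed
  show ?thesis using False unfolding inf e by (simp add: hall_littlewood_def)
 next
  case True
  have z: "stat_weight 1 1 f = 1" for f by (simp add: stat_weight_def)
  have fin: "finite ?S" 
  proof (rule finite_subset)
   show "?S \<subseteq> zero_ext n ` ({..<n} \<rightarrow>\<^sub>E {..part \<mu> 0})"
   proof
    fix f assume f: "f \<in> ?S"
    then have "f \<in> fin_funs (part \<mu> 0)" using fiber_subset_fin_funs[OF assms(4) order_refl] by auto
    then have "f = zero_ext n (restrict f {..<n})" "restrict f {..<n} \<in> {..<n} \<rightarrow>\<^sub>E {..part \<mu> 0}"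
     using f by (auto simp: zero_ext_def fun_eq_iff supp_def fin_funs_def)
    then show "f \<in> zero_ext n ` ({..<n} \<rightarrow>\<^sub>E {..part \<mu> 0})" by blast
   qed
  qed (auto intro: finite_PiE)
  have "hall_littlewood n \<mu> t (\<lambda>i. q^i) =
    (\<Sum>f\<in>funs_of_type {..<n} (padded n \<mu>). fun_weight 1 1 t (\<lambda>i. q^i) {..<n} f)"
   using True assms inj by (simp add: hall_littlewood_eq_formula hall_littlewood_eq_fun_sum)
  also have "\<dots> = (\<Sum>f\<in>?S. fun_weight 1 1 t (\<lambda>i. q^i) {..<n} f)"
  proof (rule sum.reindex_bij_witness[where i = "\<lambda>f. restrict f {..<n}" and j = "zero_ext n"], goal_cases)
   case (1 f)
   then show ?case by (auto simp: zero_ext_def fun_eq_iff PiE_def extensional_def funs_of_type_def)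
  next
   case (2 f)
   have s: "supp (zero_ext n f) \<subseteq> {..<n}" by (auto simp: supp_def zero_ext_def)
   then have fs: "finite (supp (zero_ext n f))" by (rule finite_subset) simp
   have "mset \<mu> + replicate_mset (n - length \<mu>) 0 = image_mset f (mset_set {..<n})" using 2 by (simp add: funs_of_type_def padded_def)
   also have "\<dots> = image_mset (zero_ext n f) (mset_set {..<n})" by (intro image_mset_cong) (auto simp: zero_ext_def)
   also have "\<dots> = image_mset (zero_ext n f) (mset_set (supp (zero_ext n f))) + replicate_mset (n - card (supp (zero_ext n f))) 0"
    by (rule image_mset_lessThan[OF s])
   finally have "filter_mset (\<lambda>i. i \<noteq> 0) (mset \<mu> + replicate_mset (n - length \<mu>) 0) =
    filter_mset (\<lambda>i. i \<noteq> 0) (image_mset (zero_ext n f) (mset_set (supp (zero_ext n f))) +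
     replicate_mset (n - card (supp (zero_ext n f))) 0)" by (rule arg_cong)
   moreover have r: "filter_mset (\<lambda>i. i \<noteq> 0) (replicate_mset k 0) = {#}" for k by (auto simp: filter_mset_eq_conv)
   moreover have "filter_mset (\<lambda>i. i \<noteq> 0) (mset \<mu>) = mset \<mu>"
   proof -
    have "x \<noteq> 0" if "x \<in> set \<mu>" for x using that assms(4) by (metis is_partition_def)
    then show ?thesis by (simp add: filter_mset_eq_conv)
   qed
   moreover have "filter_mset (\<lambda>i. i \<noteq> 0) (image_mset (zero_ext n f) (mset_set (supp (zero_ext n f)))) =
     image_mset (zero_ext n f) (mset_set (supp (zero_ext n f)))" using fs by (auto simp: filter_mset_eq_conv supp_def)
   ultimately have "image_mset (zero_ext n f) (mset_set (supp (zero_ext n f))) = mset \<mu>" by (simp only: filter_union_mset r add_0_right)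
   then show ?case using s fs by (simp add: fiber_def)
  next
   case (3 f)
   then show ?case by (auto simp: zero_ext_def fun_eq_iff supp_def)
  next
   case (4 f)
   then have "image_mset f (mset_set {..<n}) = mset \<mu> + replicate_mset (n - length \<mu>) 0"
    using image_mset_lessThan[of f n] card_supp[of f] by (simp add: fiber_def)
   moreover have "image_mset (restrict f {..<n}) (mset_set {..<n}) = image_mset f (mset_set {..<n})" by (intro image_mset_cong) auto
   ultimately show ?case by (simp add: funs_of_type_def padded_def)
  next
   case (5 f)
   then show ?case by (simp add: fun_weight_zero_ext)
  qed
  also have "\<dots> = (\<Sum>f\<in>?S. row_weight q t n f)"
   using fun_weight_eq_row_weight[where z = 1 and s = 1] by (intro sum.cong refl) (simp add: z)
  also have "\<dots> = infsum (row_weight q t n) ?S" using fin by simp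
  finally show ?thesis unfolding inf .
 qed
qed

lemma hl_principal_eq:
 assumes "q \<noteq> 0" "norm q < 1" "norm t < 1" "is_partition \<mu>"
 shows "hl_principal \<mu> q t = infsum (lim_weight q t) (fiber \<mu>)" "lim_weight q t summable_on fiber \<mu>"
proof -
 have sum: "dom_weight q summable_on fiber \<mu>" using summable_dom_weight[OF assms(2)] fiber_subset_fin_funs[OF assms(4) order_refl]
  by (rule summable_on_subset_banach)
 have "norm t \<le> 1" using assms by simp
 note d = tendsto_infsum_dominated[OF row_weight_tendsto[OF assms(1,2) this] norm_row_weight_le[OF assms(1,2) this] sum]
 show "lim_weight q t summable_on fiber \<mu>" by (rule d(2)) (simp add: fiber_def)
 have "(\<lambda>n. infsum (row_weight q t n) (fiber \<mu>)) \<longlonglongrightarrow> infsum (lim_weight q t) (fiber \<mu>)"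
  by (rule d(1)) (simp add: fiber_def)
 then show "hl_principal \<mu> q t = infsum (lim_weight q t) (fiber \<mu>)"
  unfolding hl_principal_def hall_littlewood_powers[OF assms] by (rule limI)
qed

lemma stat_weight_fiber:
 assumes "f \<in> fiber \<mu>"
 shows "stat_weight z s f = z^sum_list \<mu> * s^length (odd_parts \<mu>)"
proof -
 let ?h = "\<lambda>v. (if even v then 1 else s) * z^v"
 have "stat_weight z s f = prod_mset (image_mset ?h (image_mset f (mset_set (supp f))))"
  by (simp add: stat_weight_def prod_unfold_prod_mset image_mset.compositionality o_def)
 also have "\<dots> = prod_mset (image_mset ?h (mset \<mu>))" using assms by (simp add: fiber_def)
 also have "\<dots> = z^sum_list \<mu> * s^length (odd_parts \<mu>)" by (induction \<mu>) (auto simp: odd_parts_def power_add mult_ac)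
 finally show ?thesis .
qed

definition partition_sum :: "nat \<Rightarrow> complex \<Rightarrow> complex \<Rightarrow> complex \<Rightarrow> complex \<Rightarrow> complex" where
 "partition_sum m z q s t = infsum (\<lambda>f. stat_weight z s f * lim_weight q t f) (fin_funs m)"

context
 fixes q t z s :: complex
 assumes q: "q \<noteq> 0" "norm q < 1" and t: "norm t < 1" and z: "norm z \<le> 1" and s: "norm s \<le> 1"
begin

lemma norm_weight_le: "norm (stat_weight z s f * row_weight q t n f) \<le> dom_weight q f"
proof -
 have "norm (stat_weight z s f * row_weight q t n f) \<le> 1 * dom_weight q f" unfolding norm_mult using t
  by (intro mult_mono norm_stat_weight_le[OF z s] norm_row_weight_le[OF q]) auto
 then show ?thesis by simp
qed

lemma bounded_sum_tendsto:
 assumes "z \<noteq> 0"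
 shows "(\<lambda>n. bounded_sum m 1 s t (\<lambda>i. z * q^i) {..<n}) \<longlonglongrightarrow> partition_sum m z q s t"
 unfolding bounded_sum_eq_infsum[OF assms] partition_sum_def
proof (rule tendsto_infsum_dominated(1))
 fix f assume "f \<in> fin_funs m"
 then show "(\<lambda>n. stat_weight z s f * row_weight q t n f) \<longlonglongrightarrow> stat_weight z s f * lim_weight q t f"
  using q t by (intro tendsto_mult tendsto_const row_weight_tendsto) (auto simp: fin_funs_def)
qed (use norm_weight_le summable_dom_weight[OF q(2)] in auto)

lemma norm_bounded_sum_le:
 assumes "z \<noteq> 0"
 shows "norm (bounded_sum m 1 s t (\<lambda>i. z * q^i) {..<n}) \<le> infsum (dom_weight q) (fin_funs m)" unfolding bounded_sum_eq_infsum[OF assms]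
proof (rule norm_infsum_le[OF has_sum_infsum has_sum_infsum])
 show "dom_weight q summable_on fin_funs m" by (rule summable_dom_weight[OF q(2)])
 then show "(\<lambda>f. stat_weight z s f * row_weight q t n f) summable_on fin_funs m"
  using norm_weight_le by (rule abs_summable_summable[OF Infinite_Sum.abs_summable_on_comparison_test'])
qed (rule norm_weight_le)

text \<open>Every function in \<open>fin_funs m\<close> lies in exactly one fiber, that of its
  sorted nonzero values, and a summable family may be grouped by fibers.\<close>

lemma has_sum_partitions:
 "((\<lambda>\<mu>. z^sum_list \<mu> * s^length (odd_parts \<mu>) * hl_principal \<mu> q t) has_sum partition_sum m z q s t)
   {\<mu>. is_partition \<mu> \<and> part \<mu> 0 \<le> m}"
proof -
 let ?w = "\<lambda>f. stat_weight z s f * lim_weight q t f"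
 let ?\<Lambda> = "{\<mu>. is_partition \<mu> \<and> part \<mu> 0 \<le> m}"
 have "?w summable_on fin_funs m"
 proof (rule tendsto_infsum_dominated(2))
  fix f assume "f \<in> fin_funs m"
  then show "(\<lambda>n. stat_weight z s f * row_weight q t n f) \<longlonglongrightarrow> stat_weight z s f * lim_weight q t f"
   using q t by (intro tendsto_mult tendsto_const row_weight_tendsto) (auto simp: fin_funs_def)
 qed (use norm_weight_le summable_dom_weight[OF q(2)] in auto)
 then have 1: "(?w has_sum partition_sum m z q s t) (fin_funs m)" unfolding partition_sum_def by (rule has_sum_infsum)
 have bij: "bij_betw snd (Sigma ?\<Lambda> fiber) (fin_funs m)"
 proof (rule bij_betwI[where g = "\<lambda>f. (partition_of f, f)"])
  show "snd \<in> Sigma ?\<Lambda> fiber \<rightarrow> fin_funs m" using fiber_subset_fin_funs[THEN subsetD] by auto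
  show "(\<lambda>f. (partition_of f, f)) \<in> fin_funs m \<rightarrow> Sigma ?\<Lambda> fiber"
   using partition_of_fin_funs by (auto simp: fiber_def fin_funs_def partition_of_def)
  show "(partition_of (snd p), snd p) = p" if "p \<in> Sigma ?\<Lambda> fiber" for p using that partition_of_eq_iff by (auto simp: fiber_def)
 qed auto
 have 2: "((\<lambda>p. ?w (snd p)) has_sum partition_sum m z q s t) (Sigma ?\<Lambda> fiber)"
  using 1 unfolding has_sum_reindex_bij_betw[OF bij, symmetric] .
 show ?thesis
 proof (rule has_sum_SigmaD[OF 2])
  fix \<mu> assume \<mu>: "\<mu> \<in> ?\<Lambda>"
  have "((\<lambda>f. z^sum_list \<mu> * s^length (odd_parts \<mu>) * lim_weight q t f) has_sum
    z^sum_list \<mu> * s^length (odd_parts \<mu>) * infsum (lim_weight q t) (fiber \<mu>)) (fiber \<mu>)"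
   using \<mu> hl_principal_eq(2)[OF q t] by (intro has_sum_cmult_right has_sum_infsum) auto
  moreover have "hl_principal \<mu> q t = infsum (lim_weight q t) (fiber \<mu>)" using \<mu> by (intro hl_principal_eq(1)[OF q t]) auto
  ultimately have "((\<lambda>f. z^sum_list \<mu> * s^length (odd_parts \<mu>) * lim_weight q t f) has_sum
    z^sum_list \<mu> * s^length (odd_parts \<mu>) * hl_principal \<mu> q t) (fiber \<mu>)" by (simp only:)
  then show "((\<lambda>f. ?w (snd (\<mu>, f))) has_sum z^sum_list \<mu> * s^length (odd_parts \<mu>) * hl_principal \<mu> q t) (fiber \<mu>)"
   by (subst has_sum_cong) (simp_all add: stat_weight_fiber)
 qed
qed

end

section \<open>Determinants\<close>

text \<open>The determinant of a matrix given as a function on indices, so that the size is an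
  ordinary number.\<close>

definition leibniz :: "nat \<Rightarrow> (nat \<Rightarrow> nat \<Rightarrow> complex) \<Rightarrow> complex" where
 "leibniz n A = (\<Sum>\<pi> | \<pi> permutes {..<n}. of_int (sign \<pi>) * (\<Prod>i<n. A i (\<pi> i)))"

lemma leibniz_transpose: "leibniz n (\<lambda>i j. A j i) = leibniz n A"
proof -
 have "leibniz n (\<lambda>i j. A j i) = (\<Sum>\<pi> | \<pi> permutes {..<n}. of_int (sign (inv \<pi>)) * (\<Prod>i<n. A (inv \<pi> i) i))"
  unfolding leibniz_def by (rule sum_permutations_inverse)
 also have "\<dots> = leibniz n A" unfolding leibniz_def
 proof (rule sum.cong[OF refl])
  fix \<pi> assume "\<pi> \<in> {\<pi>. \<pi> permutes {..<n}}"
  then have \<pi>: "\<pi> permutes {..<n}" by simp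
  have "(\<Prod>i<n. A (inv \<pi> i) i) = (\<Prod>i<n. A (inv \<pi> (\<pi> i)) (\<pi> i))" by (rule prod.permute[OF \<pi>, unfolded o_def])
  also have "\<dots> = (\<Prod>i<n. A i (\<pi> i))" using permutes_inverses(2)[OF \<pi>] by simp
  finally show "of_int (sign (inv \<pi>)) * (\<Prod>i<n. A (inv \<pi> i) i) = of_int (sign \<pi>) * (\<Prod>i<n. A i (\<pi> i))"
   using sign_inverse[OF permutation_permutes[THEN iffD2, OF exI[of _ "{..<n}"]], of \<pi>] \<pi> by simp
 qed
 finally show ?thesis .
qed

lemma leibniz_equal_rows:
 assumes "i < n" "j < n" "i \<noteq> j" "\<And>k. k < n \<Longrightarrow> A i k = A j k"
 shows "leibniz n A = 0"
proof -
 let ?\<tau> = "Transposition.transpose i j"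
 have \<tau>: "?\<tau> permutes {..<n}" using assms by (intro permutes_swap_id) auto
 have "leibniz n A = (\<Sum>\<pi> | \<pi> permutes {..<n}. of_int (sign (\<pi> \<circ> ?\<tau>)) * (\<Prod>k<n. A k ((\<pi> \<circ> ?\<tau>) k)))"
  unfolding leibniz_def by (rule sum_permutations_compose_right[OF \<tau>])
 also have "\<dots> = (\<Sum>\<pi> | \<pi> permutes {..<n}. - (of_int (sign \<pi>) * (\<Prod>k<n. A k (\<pi> k))))"
 proof (rule sum.cong[OF refl])
  fix \<pi> assume "\<pi> \<in> {\<pi>. \<pi> permutes {..<n}}"
  then have \<pi>: "\<pi> permutes {..<n}" by simp
  have "(\<Prod>k<n. A k ((\<pi> \<circ> ?\<tau>) k)) = (\<Prod>k<n. A (?\<tau> k) (\<pi> (?\<tau> k)))"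
  proof (rule prod.cong[OF refl])
   fix k assume k: "k \<in> {..<n}"
   have "A k l = A (?\<tau> k) l" if "l < n" for l using assms(4)[OF that] by (auto simp: Transposition.transpose_def)
   moreover have "\<pi> (?\<tau> k) < n" using permutes_in_image[OF \<pi>, of "?\<tau> k"] permutes_in_image[OF \<tau>, of k] k by simp
   ultimately show "A k ((\<pi> \<circ> ?\<tau>) k) = A (?\<tau> k) (\<pi> (?\<tau> k))" by simp
  qed
  also have "\<dots> = (\<Prod>k<n. A k (\<pi> k))" using prod.permute[OF \<tau>, of "\<lambda>k. A k (\<pi> k)"] by (simp add: o_def)
  finally have 1: "(\<Prod>k<n. A k ((\<pi> \<circ> ?\<tau>) k)) = (\<Prod>k<n. A k (\<pi> k))" .
  have "permutation \<pi>" "permutation ?\<tau>" using \<pi> \<tau> by (auto simp: permutation_permutes)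
  then have "sign (\<pi> \<circ> ?\<tau>) = - sign \<pi>" using assms(3) by (simp add: sign_compose sign_swap_id)
  with 1 show "of_int (sign (\<pi> \<circ> ?\<tau>)) * (\<Prod>k<n. A k ((\<pi> \<circ> ?\<tau>) k)) = - (of_int (sign \<pi>) * (\<Prod>k<n. A k (\<pi> k)))"
   by simp
 qed
 also have "\<dots> = - leibniz n A" by (simp add: leibniz_def sum_negf)
 finally show ?thesis by simp
qed

lemma leibniz_scale_rows: "leibniz n (\<lambda>i j. d i * A i j) = (\<Prod>i<n. d i) * leibniz n A"
 by (simp add: leibniz_def prod.distrib sum_distrib_left mult_ac)

lemma leibniz_cong: "(\<And>i j. i < n \<Longrightarrow> j < n \<Longrightarrow> A i j = B i j) \<Longrightarrow> leibniz n A = leibniz n B"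
 unfolding leibniz_def
proof (intro sum.cong refl arg_cong2[where f = "(*)"] prod.cong, goal_cases)
 case (1 \<pi> i)
 then show ?case using permutes_in_image[of \<pi> "{..<n}" i] by auto
qed

definition vandermonde :: "nat \<Rightarrow> (nat \<Rightarrow> complex) \<Rightarrow> complex" where
 "vandermonde n c = (\<Prod>j<n. \<Prod>i<j. c j - c i)"

lemma permutes_fix_last: "{\<pi>. \<pi> permutes {..<Suc n} \<and> \<pi> n = n} = {\<pi>. \<pi> permutes {..<n}}"
proof (intro Collect_cong iffI conjI)
 fix \<pi> assume \<pi>: "\<pi> permutes {..<Suc n} \<and> \<pi> n = n"
 show "\<pi> permutes {..<n}"
 proof (rule permutes_superset[OF conjunct1[OF \<pi>]])
  fix x assume "x \<in> {..<Suc n} - {..<n}"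
  then have "x = n" by simp
  then show "\<pi> x = x" using \<pi> by simp
 qed
next
 fix \<pi> :: "nat \<Rightarrow> nat" assume \<pi>: "\<pi> permutes {..<n}"
 show "\<pi> permutes {..<Suc n}" by (rule permutes_subset[OF \<pi>]) simp
 show "\<pi> n = n" by (rule permutes_not_in[OF \<pi>]) simp
qed

text \<open>As a function of the last node the determinant is a polynomial of degree at most
  \<open>n\<close> that vanishes at the earlier nodes. Its top coefficient is the smaller
  determinant, because only permutations fixing \<open>n\<close> reach degree \<open>n\<close>.
  Coinciding nodes make both sides zero.\<close>

theorem leibniz_monic:
 assumes "\<And>m. degree (\<phi> m) = m" "\<And>m. lead_coeff (\<phi> m) = 1"
 shows "leibniz n (\<lambda>i j. poly (\<phi> j) (c i)) = vandermonde n c"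
proof (induction n)
 case 0
 have "{\<pi>. \<pi> permutes {..<0::nat}} = {id}" by auto
 then show ?case by (simp add: leibniz_def vandermonde_def)
next
 case (Suc n)
 show ?case
 proof (cases "inj_on c {..<Suc n}")
  case False
  then obtain i j where ij: "i < Suc n" "j < Suc n" "i \<noteq> j" "c i = c j" by (auto simp: inj_on_def)
  then have "leibniz (Suc n) (\<lambda>i j. poly (\<phi> j) (c i)) = 0" by (intro leibniz_equal_rows[of i _ j]) auto
  moreover have "vandermonde (Suc n) c = 0"
  proof -
   obtain i j where "i < j" "j < Suc n" "c i = c j" using ij by (metis linorder_neqE_nat)
   then have "(\<Prod>i<j. c j - c i) = 0" by (intro prod_zero bexI[of _ i]) auto
   with \<open>j < Suc n\<close> show ?thesis unfolding vandermonde_def by (intro prod_zero) auto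
  qed
  ultimately show ?thesis by simp
 next
  case True
  define u where "u \<pi> = of_int (sign \<pi>) * (\<Prod>i<n. poly (\<phi> (\<pi> i)) (c i))" for \<pi> :: "nat \<Rightarrow> nat"
  define p where "p = (\<Sum>\<pi> | \<pi> permutes {..<Suc n}. smult (u \<pi>) (\<phi> (\<pi> n)))"
  define P where "P = smult (leibniz n (\<lambda>i j. poly (\<phi> j) (c i))) (\<Prod>i<n. [:- c i, 1:])"
  have fin: "finite {\<pi>. \<pi> permutes {..<Suc n}}" by (simp add: finite_permutations)
  have le: "\<pi> n \<le> n" if "\<pi> permutes {..<Suc n}" for \<pi> using permutes_in_image[OF that, of n] by simp
  have ev: "poly p x = leibniz (Suc n) (\<lambda>i j. poly (\<phi> j) (if i = n then x else c i))" for x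
   unfolding p_def leibniz_def u_def poly_sum by (intro sum.cong refl) simp
  have degp: "degree p \<le> n" unfolding p_def using le assms(1) by (intro degree_sum_le fin) (auto intro: order_trans[OF degree_smult_le])
  have degP: "degree P \<le> n" unfolding P_def by (rule order_trans[OF degree_smult_le]) (simp add: degree_prod_eq_sum_degree)
  have "coeff p n = (\<Sum>\<pi> | \<pi> permutes {..<Suc n}. if \<pi> n = n then u \<pi> else 0)" unfolding p_def coeff_sum
  proof (rule sum.cong[OF refl])
   fix \<pi> assume "\<pi> \<in> {\<pi>. \<pi> permutes {..<Suc n}}"
   then have "\<pi> n \<le> n" using le by simp
   then show "coeff (smult (u \<pi>) (\<phi> (\<pi> n))) n = (if \<pi> n = n then u \<pi> else 0)"
    using assms(1)[of "\<pi> n"] assms(2)[of n] assms(1)[of n] by (auto simp: coeff_eq_0)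
  qed
  also have "\<dots> = (\<Sum>\<pi>\<in>{\<pi>. \<pi> permutes {..<Suc n} \<and> \<pi> n = n}. u \<pi>)"
   using fin by (simp add: sum.inter_filter[symmetric])
  also have "\<dots> = leibniz n (\<lambda>i j. poly (\<phi> j) (c i))" unfolding permutes_fix_last leibniz_def u_def ..
  finally have cp: "coeff p n = leibniz n (\<lambda>i j. poly (\<phi> j) (c i))" .
  have mon: "lead_coeff (\<Prod>i<n. [:- c i, 1:]) = 1" "degree (\<Prod>i<n. [:- c i, 1:]) = n"
  proof -
   show "lead_coeff (\<Prod>i<n. [:- c i, 1:]) = 1" unfolding lead_coeff_prod by simp
   show "degree (\<Prod>i<n. [:- c i, 1:]) = n" by (simp add: degree_prod_eq_sum_degree)
  qed
  then have cP: "coeff P n = coeff p n" unfolding P_def cp by simp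
  have "p - P = 0"
  proof (rule ccontr)
   assume nz: "p - P \<noteq> 0"
   have "degree (p - P) \<le> n" using degp degP by (rule degree_diff_le)
   moreover have "degree (p - P) \<noteq> n"
   proof
    assume "degree (p - P) = n"
    then have "lead_coeff (p - P) = 0" using cP by simp
    then show False using nz leading_coeff_0_iff by blast
   qed
   moreover have "c ` {..<n} \<subseteq> {x. poly (p - P) x = 0}"
   proof
    fix x assume "x \<in> c ` {..<n}"
    then obtain i where i: "i < n" "x = c i" by auto
    have "poly p x = 0" unfolding ev using i by (intro leibniz_equal_rows[of i _ n]) auto
    moreover have "poly P x = 0" unfolding P_def using i by (auto simp: poly_prod)
    ultimately show "x \<in> {x. poly (p - P) x = 0}" by simp
   qed
   then have "card (c ` {..<n}) \<le> card {x. poly (p - P) x = 0}" using nz by (intro card_mono poly_roots_finite)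
   moreover have "card {x. poly (p - P) x = 0} \<le> degree (p - P)" using nz by (rule card_poly_roots_bound)
   moreover have "card (c ` {..<n}) = n" using True by (subst card_image) (auto intro: inj_on_subset)
   ultimately show False by simp
  qed
  then have "poly p (c n) = poly P (c n)" by simp
  moreover have "poly p (c n) = leibniz (Suc n) (\<lambda>i j. poly (\<phi> j) (c i))" unfolding ev by (rule leibniz_cong) auto
  moreover have "poly P (c n) = vandermonde n c * (\<Prod>i<n. c n - c i)" unfolding P_def Suc.IH by (simp add: poly_prod)
  ultimately show ?thesis by (simp add: vandermonde_def)
 qed
qed

section \<open>Determinants of odd Laurent polynomials\<close>

fun cheb :: "complex \<Rightarrow> nat \<Rightarrow> complex poly" where
 "cheb d 0 = 1"
| "cheb d (Suc 0) = [:d, 1:]"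
| "cheb d (Suc (Suc n)) = [:0, 1:] * cheb d (Suc n) - cheb d n"

lemma cheb_monic: "degree (cheb d n) = n \<and> lead_coeff (cheb d n) = 1"
proof (induction d n rule: cheb.induct)
 case (3 d n)
 have nz: "cheb d (Suc n) \<noteq> 0" using 3 by auto
 then have d: "degree ([:0, 1:] * cheb d (Suc n)) = Suc (Suc n)" using 3 by (subst degree_mult_eq) auto
 have e: "[:0, 1:] * cheb d (Suc n) - cheb d n = [:0, 1:] * cheb d (Suc n) + (- cheb d n)" by simp
 have lt: "degree (- cheb d n) < degree ([:0, 1:] * cheb d (Suc n))" unfolding d using 3 by simp
 have deg: "degree (cheb d (Suc (Suc n))) = Suc (Suc n)" unfolding cheb.simps e by (subst degree_add_eq_left[OF lt]) (rule d)
 have "lead_coeff (cheb d (Suc (Suc n))) = lead_coeff ([:0, 1:] * cheb d (Suc n))"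
  unfolding cheb.simps e add.commute[of _ "- cheb d n"] by (rule lead_coeff_add_le[OF lt])
 moreover have "lead_coeff (cheb d (Suc n)) = 1" using "3.IH" by (elim conjE)
 ultimately have "lead_coeff (cheb d (Suc (Suc n))) = lead_coeff [:0, 1:]" by (simp only: lead_coeff_mult mult_1_right)
 then have "lead_coeff (cheb d (Suc (Suc n))) = 1" by simp
 with deg show ?case by (intro conjI)
qed auto

text \<open>In the variable \<open>u^2 + v^2\<close> the quotients satisfy the Chebyshev recursion:
  \<open>d = 1\<close> gives the polynomials of the fourth kind and \<open>d = 0\<close> those of
  the second kind, rescaled to be monic.\<close>

lemma cheb_eval:
 fixes u v :: complex
 assumes uv: "u * v = 1" and ad: "a = 1 \<and> d = 1 \<or> a = 2 \<and> d = 0"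
 shows "u^(a + 2 * j) - v^(a + 2 * j) = (u^a - v^a) * poly (cheb d j) (u\<^sup>2 + v\<^sup>2)"
proof (induction j rule: induct_nat_012)
 case 1
 show ?case
 proof (cases "a = 1")
  case True
  then have "d = 1" using ad by auto
  moreover have "u * (u * u) - v * (v * v) = (u - v) * (1 + (u * u + v * v))" using uv by algebra
  ultimately show ?thesis using True by (simp add: power2_eq_square)
 next
  case False
  then have "a = 2" "d = 0" using ad by auto
  moreover have "u^4 - v^4 = (u^2 - v^2) * (u^2 + v^2)" by algebra
  ultimately show ?thesis by simp
 qed
next
 case (ge2 n)
 define p where "p = u^(a + 2 * n)"
 define r where "r = v^(a + 2 * n)"
 have e: "u^(a + 2 * Suc n) = p * u\<^sup>2" "v^(a + 2 * Suc n) = r * v\<^sup>2"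
  "u^(a + 2 * Suc (Suc n)) = p * u\<^sup>2 * u\<^sup>2" "v^(a + 2 * Suc (Suc n)) = r * v\<^sup>2 * v\<^sup>2"
  unfolding p_def r_def by (simp_all flip: power_add add: algebra_simps)
 have "(u^a - v^a) * poly (cheb d (Suc (Suc n))) (u\<^sup>2 + v\<^sup>2) =
   (u\<^sup>2 + v\<^sup>2) * ((u^a - v^a) * poly (cheb d (Suc n)) (u\<^sup>2 + v\<^sup>2)) - (u^a - v^a) * poly (cheb d n) (u\<^sup>2 + v\<^sup>2)"
  by (simp add: algebra_simps)
 also have "\<dots> = (u\<^sup>2 + v\<^sup>2) * (p * u\<^sup>2 - r * v\<^sup>2) - (p - r)" unfolding ge2[symmetric] e by (simp add: p_def r_def)
 also have "\<dots> = p * u\<^sup>2 * u\<^sup>2 - r * v\<^sup>2 * v\<^sup>2" using uv by algebra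
 finally show ?case unfolding e by simp
qed simp

text \<open>The Weyl denominator formulas of type B (\<open>a = 1\<close>) and type C
  (\<open>a = 2\<close>) in the variables \<open>Z i^2\<close>.\<close>

theorem leibniz_odd_powers:
 fixes Z :: "nat \<Rightarrow> complex"
 assumes "\<And>i. Z i \<noteq> 0" "a \<in> {1, 2}"
 shows "leibniz n (\<lambda>i j. Z i^(a + 2 * j) - inverse (Z i)^(a + 2 * j)) =
  (\<Prod>i<n. Z i^a - inverse (Z i)^a) * vandermonde n (\<lambda>i. Z i^2 + inverse (Z i)^2)"
proof -
 define d :: complex where "d = (if a = 1 then 1 else 0)"
 have "Z i^(a + 2 * j) - inverse (Z i)^(a + 2 * j) = (Z i^a - inverse (Z i)^a) * poly (cheb d j) (Z i^2 + inverse (Z i)^2)" for i j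
  using assms by (intro cheb_eval) (auto simp: d_def)
 then have "leibniz n (\<lambda>i j. Z i^(a + 2 * j) - inverse (Z i)^(a + 2 * j)) =
  (\<Prod>i<n. Z i^a - inverse (Z i)^a) * leibniz n (\<lambda>i j. poly (cheb d j) (Z i^2 + inverse (Z i)^2))"
  by (simp only: leibniz_scale_rows)
 also have "leibniz n (\<lambda>i j. poly (cheb d j) (Z i^2 + inverse (Z i)^2)) = vandermonde n (\<lambda>i. Z i^2 + inverse (Z i)^2)"
  using cheb_monic by (intro leibniz_monic) blast+
 finally show ?thesis .
qed

section \<open>Section sums over geometric progressions\<close>

lemma pair_prod_zero:
 assumes "\<And>x y. h x y = h y x" "finite A" "u \<in> A" "v \<in> A" "u \<noteq> v" "h u v = (0::'b::comm_semiring_1)"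
 shows "pair_prod h A = 0"
proof -
 have "pair_prod h (insert u (A - {u})) = (\<Prod>x\<in>A - {u}. h u x) * pair_prod h (A - {u})" using assms by (intro pair_prod_insert) auto
 moreover have "(\<Prod>x\<in>A - {u}. h u x) = 0" using assms by (intro prod_zero bexI[of _ v]) auto
 moreover have "insert u (A - {u}) = A" using assms by auto
 ultimately show ?thesis by simp
qed

lemma prod_telescope_int:
 fixes f :: "int \<Rightarrow> complex"
 assumes "lo \<le> hi" "\<And>l. lo \<le> l \<Longrightarrow> l \<le> hi \<Longrightarrow> f l \<noteq> 0"
 shows "(\<Prod>l\<in>{lo..<hi}. f l / f (l + 1)) = f lo / f hi" using assms
proof (induction hi rule: int_ge_induct)
 case base
 then show ?case by simp
next
 case (step hi)
 have "{lo..<hi + 1} = insert hi {lo..<hi}" using step.hyps by auto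
 then show ?case using step by simp
qed

lemma prod_telescope_int':
 fixes f :: "int \<Rightarrow> complex"
 assumes "lo \<le> hi" "\<And>l. lo - 1 \<le> l \<Longrightarrow> l < hi \<Longrightarrow> f l \<noteq> 0"
 shows "(\<Prod>l\<in>{lo..<hi}. f l / f (l - 1)) = f (hi - 1) / f (lo - 1)" using assms
proof (induction hi rule: int_ge_induct)
 case base
 then show ?case by simp
next
 case (step hi)
 have "{lo..<hi + 1} = insert hi {lo..<hi}" using step.hyps by auto
 then show ?case using step by simp
qed

text \<open>All points are integral powers of one base \<open>w\<close>. The progression with index
  \<open>i\<close> has ratio \<open>w^(4 * N)\<close>; an offset \<open>b i < N\<close> keeps it
  apart from its inverse. For \<open>b i = N\<close> it is its own inverse: these indices form
  \<open>L\<close>, at most one by injectivity of \<open>b\<close>, and only half of such a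
  progression is used.\<close>

locale chain =
 fixes w :: complex and R N :: nat and b :: "nat \<Rightarrow> int" and L :: "nat set"
 assumes w: "w \<noteq> 0" "norm w < 1" and N: "N > 0"
  and b_pos: "\<And>i. i < R \<Longrightarrow> 0 < b i" and b_inj: "inj_on b {..<R}"
  and b_sum: "\<And>i j. i < R \<Longrightarrow> j < R \<Longrightarrow> b i + b j < 2 * int N \<or> (i = j \<and> i \<in> L)"
  and b_special: "\<And>i. i < R \<Longrightarrow> i \<in> L \<Longrightarrow> b i = int N"
  and L: "L \<subseteq> {..<R}"
begin

definition nome :: complex where "nome = w powi (4 * int N)"
definition ex :: "nat \<Rightarrow> int \<Rightarrow> int" where "ex i l = 2 * (int N + b i + 2 * int N * l)"
text \<open>For an index in \<open>L\<close> the point at \<open>l = - 1\<close> is 1, and the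
  points at \<open>l\<close> and \<open>- 2 - l\<close> are inverse to each other; hence the start
  at 0.\<close>

definition low :: "nat \<Rightarrow> nat \<Rightarrow> int" where "low J i = (if i \<in> L then 0 else - int J)"
definition idx :: "nat \<Rightarrow> (nat \<times> int) set" where "idx J = Sigma {..<R} (\<lambda>i. {low J i..<int J})"
definition box :: "nat \<Rightarrow> (nat \<Rightarrow> int) set" where "box J = PiE {..<R} (\<lambda>i. {low J i..int J})"
definition point :: "nat \<times> int \<Rightarrow> complex" where "point p = w powi (ex (fst p) (snd p))"
text \<open>\<open>M\<close> is the set of points that are replaced by their inverses.\<close>

definition sect :: "nat \<Rightarrow> (nat \<times> int) set \<Rightarrow> complex set" where
 "sect J M = point ` (idx J - M) \<union> (\<lambda>p. inverse (point p)) ` M"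
definition omega :: "nat \<Rightarrow> complex set" where "omega J = point ` idx J \<union> inverse ` point ` idx J"
definition below :: "nat \<Rightarrow> (nat \<Rightarrow> int) \<Rightarrow> (nat \<times> int) set" where
 "below J r = {p \<in> idx J. snd p < r (fst p)}"

lemma powi_eq_iff: "w powi m = w powi n \<longleftrightarrow> m = n"
proof
 assume "w powi m = w powi n"
 then have "w powi (m - n) = 1" using w by (simp add: power_int_diff)
 then have 1: "norm w powi (m - n) = 1" by (metis norm_one norm_power_int)
 show "m = n"
 proof (rule ccontr)
  assume "m \<noteq> n"
  then consider "m - n > 0" | "n - m > 0" by linarith
  then show False
  proof cases
   case 1
   then have "norm w^nat (m - n) = 1" using \<open>norm w powi (m - n) = 1\<close> by (simp add: power_int_def)
   moreover have "norm w^nat (m - n) \<le> norm w" using 1 w by (intro norm_power_le_self) auto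
   ultimately show False using w by simp
  next
   case 2
   have "norm w powi (n - m) = inverse (norm w powi (m - n))" using power_int_minus[of "norm w" "m - n"] by simp
   then have "norm w^nat (n - m) = 1" using 2 1 by (simp add: power_int_def)
   moreover have "norm w^nat (n - m) \<le> norm w" using 2 w by (intro norm_power_le_self) auto
   ultimately show False using w by simp
  qed
 qed
qed simp

lemma powi_eq_1_iff: "w powi m = 1 \<longleftrightarrow> m = 0" using powi_eq_iff[of m 0] by simp

lemma b_le: "i < R \<Longrightarrow> b i \<le> int N" using b_sum[of i i] b_special[of i] by auto

lemma mult_small_eq_0:
 assumes "\<bar>2 * int N * k\<bar> < 2 * int N"
 shows "k = 0"
proof (rule ccontr)
 assume "k \<noteq> 0"
 then have "2 * int N * 1 \<le> 2 * int N * \<bar>k\<bar>" by (intro mult_left_mono) auto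
 then show False using assms by (simp add: abs_mult)
qed

lemma ex_inj:
 assumes "i < R" "j < R" "ex i l = ex j l'"
 shows "i = j \<and> l = l'"
proof -
 have e: "b i - b j = 2 * int N * (l' - l)" using assms(3) by (simp add: ex_def algebra_simps)
 have "\<bar>b i - b j\<bar> < 2 * int N" using b_pos[OF assms(1)] b_pos[OF assms(2)] b_le[OF assms(1)] b_le[OF assms(2)] N by auto
 then have "l' - l = 0" unfolding e by (rule mult_small_eq_0)
 with e have "b i = b j" "l = l'" by auto
 then show ?thesis using b_inj assms by (auto simp: inj_on_def)
qed

text \<open>One side admits \<open>low J j - 1\<close> because the telescoping products below reach
  one step past the lower end.\<close>

lemma ex_sum:
 assumes "i < R" "j < R" "low J i \<le> l" "low J j - 1 \<le> l'"
 shows "ex i l + ex j l' \<noteq> 0"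
proof
 assume "ex i l + ex j l' = 0"
 then have e: "b i + b j = 2 * int N * (- (l + l' + 1))" by (simp add: ex_def algebra_simps)
 show False
 proof (cases "b i + b j < 2 * int N")
  case True
  then have "\<bar>2 * int N * (- (l + l' + 1))\<bar> < 2 * int N" unfolding e[symmetric] using b_pos[OF assms(1)] b_pos[OF assms(2)] by simp
  then have "- (l + l' + 1) = 0" by (rule mult_small_eq_0)
  then show False using e b_pos[OF assms(1)] b_pos[OF assms(2)] by simp
 next
  case False
  then have ij: "i = j" "i \<in> L" using b_sum[OF assms(1,2)] by auto
  then have "b i = int N" using b_special assms by auto
  then have "2 * int N * (l + l' + 2) = 0" using e ij by (simp add: algebra_simps)
  then have "l + l' + 2 = 0" using N by simp
  then show False using assms ij by (simp add: low_def)
 qed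
qed

lemma nome_point: "nome * point (i, l) = point (i, l + 1)" "nome * inverse (point (i, l)) = inverse (point (i, l - 1))"
 using w by (simp_all add: nome_def point_def ex_def power_int_add[symmetric] power_int_minus[symmetric] algebra_simps)

lemma finite_idx: "finite (idx J)" by (auto simp: idx_def)

lemma point_inj: "inj_on point (idx J)"
proof (rule inj_onI)
 fix p p' assume "p \<in> idx J" "p' \<in> idx J" "point p = point p'"
 then show "p = p'" using ex_inj[of "fst p" "fst p'" "snd p" "snd p'"] by (auto simp: idx_def point_def powi_eq_iff prod_eq_iff)
qed

lemma point_mult_neq_1: "p \<in> idx J \<Longrightarrow> p' \<in> idx J \<Longrightarrow> point p * point p' \<noteq> 1"
 using ex_sum[of "fst p" "fst p'" J "snd p" "snd p'"] w by (auto simp: idx_def point_def power_int_add[symmetric] powi_eq_1_iff)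

lemma point_neq_inverse: "p \<in> idx J \<Longrightarrow> p' \<in> idx J \<Longrightarrow> point p \<noteq> inverse (point p')"
 using point_mult_neq_1[of p J p'] w by (auto simp: point_def field_simps)

lemma point_nz: "point p \<noteq> 0" using w by (simp add: point_def)

lemma generic_points: "generic (point ` idx J)" using finite_idx point_mult_neq_1[of _ J] point_nz by (auto simp: generic_def)

lemma section_sum_omega: "section_sum g nome (omega J) = (\<Sum>M\<in>Pow (idx J). section_weight g nome (sect J M))"
proof -
 have "section_sum g nome (omega J) = (\<Sum>M\<in>Pow (point ` idx J). (\<Prod>a\<in>M. g (inverse a)) *
   (\<Prod>a\<in>point ` idx J - M. g a) * pair_prod (hlC nome) ((point ` idx J - M) \<union> inverse ` M))"
  unfolding omega_def by (rule section_sum_eq_Pow[OF generic_points])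
 also have "Pow (point ` idx J) = image point ` Pow (idx J)" by (rule image_Pow_surj[symmetric]) simp
 also have "(\<Sum>M\<in>image point ` Pow (idx J). (\<Prod>a\<in>M. g (inverse a)) *
   (\<Prod>a\<in>point ` idx J - M. g a) * pair_prod (hlC nome) ((point ` idx J - M) \<union> inverse ` M)) =
   (\<Sum>M\<in>Pow (idx J). (\<Prod>a\<in>point ` M. g (inverse a)) *
   (\<Prod>a\<in>point ` idx J - point ` M. g a) * pair_prod (hlC nome) ((point ` idx J - point ` M) \<union> inverse ` point ` M))"
  using inj_on_image_Pow[OF point_inj] by (simp add: sum.reindex)
 also have "\<dots> = (\<Sum>M\<in>Pow (idx J). section_weight g nome (sect J M))"
 proof (rule sum.cong[OF refl])
  fix M assume M: "M \<in> Pow (idx J)"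
  then have M': "finite M" "M \<subseteq> idx J" using finite_idx finite_subset by auto
  have d: "point ` idx J - point ` M = point ` (idx J - M)" using M' point_inj by (metis Diff_subset inj_on_image_set_diff order_refl)
  have s: "sect J M = point ` (idx J - M) \<union> inverse ` point ` M" by (simp add: sect_def image_image)
  have "inj_on point M" using point_inj M'(2) by (rule inj_on_subset)
  then have i: "(\<Prod>a\<in>inverse ` point ` M. g a) = (\<Prod>a\<in>point ` M. g (inverse a))" by (subst prod.reindex) (auto simp: inj_on_def)
  have dis: "point ` (idx J - M) \<inter> inverse ` point ` M = {}" using point_neq_inverse[of _ J] M'(2) by auto
  have "(\<Prod>a\<in>sect J M. g a) = (\<Prod>a\<in>point ` (idx J - M). g a) * (\<Prod>a\<in>point ` M. g (inverse a))"
   unfolding s i[symmetric] using finite_idx M' dis by (intro prod.union_disjoint) auto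
  then show "(\<Prod>a\<in>point ` M. g (inverse a)) * (\<Prod>a\<in>point ` idx J - point ` M. g a) *
    pair_prod (hlC nome) ((point ` idx J - point ` M) \<union> inverse ` point ` M) = section_weight g nome (sect J M)"
   unfolding d section_weight_def by (simp add: s mult_ac)
 qed
 finally show ?thesis .
qed

text \<open>If \<open>v\<close> is kept while its successor \<open>nome * v\<close> is inverted,
  this pair contributes the numerator \<open>1 - nome * v * inverse (nome * v) = 0\<close>.\<close>

lemma section_weight_gap:
 assumes "M \<subseteq> idx J" "(i, l) \<in> idx J - M" "(i, l + 1) \<in> M"
 shows "section_weight g nome (sect J M) = 0"
proof -
 have "finite M" using finite_idx assms(1) by (rule finite_subset[rotated])
 then have fin: "finite (sect J M)" using finite_idx by (simp add: sect_def)
 have "nome * point (i, l) * inverse (point (i, l + 1)) = 1" using point_nz[of "(i, l + 1)"] by (simp add: nome_point)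
 then have "hlC nome (point (i, l)) (inverse (point (i, l + 1))) = 0" by (simp add: hlC_def)
 moreover have "point (i, l) \<noteq> inverse (point (i, l + 1))" using assms by (intro point_neq_inverse) auto
 ultimately have "pair_prod (hlC nome) (sect J M) = 0"
  using assms fin by (intro pair_prod_zero[OF hlC_commute fin, of "point (i, l)" "inverse (point (i, l + 1))"])
   (auto simp: sect_def)
 then show ?thesis by (simp add: section_weight_def)
qed

text \<open>In a contributing section the inverted points form an initial piece of every
  progression. \<open>r i\<close> is the first kept position, or \<open>J\<close> if everything is
  inverted, hence the extra element in the minimum.\<close>

lemma down_closed_eq_below:
 assumes M: "M \<subseteq> idx J" and cl: "\<And>i l. (i, l + 1) \<in> M \<Longrightarrow> (i, l) \<in> idx J \<Longrightarrow> (i, l) \<in> M"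
 shows "\<exists>r\<in>box J. M = below J r"
proof -
 define r where "r = (\<lambda>i\<in>{..<R}. Min (insert (int J) {l. (i, l) \<in> idx J - M}))"
 have fin: "finite {l. (i, l) \<in> idx J - M}" for i by (rule finite_subset[of _ "snd ` idx J"]) (force simp: finite_idx)+
 have rbox: "r \<in> box J"
 proof -
  have "r i \<in> {low J i..int J}" if "i < R" for i using that fin[of i] by (auto simp: r_def idx_def low_def)
  then show ?thesis by (auto simp: box_def r_def)
 qed
 have "p \<in> M \<longleftrightarrow> p \<in> below J r" for p
 proof
  assume p: "p \<in> M"
  obtain i l where il: "p = (i, l)" by (cases p)
  have pi: "(i, l) \<in> idx J" using p il M by auto
  have *: "(i, l - int k) \<in> M" if "low J i \<le> l - int k" for k using that
  proof (induction k)
   case (Suc k)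
   have "(i, (l - int (Suc k)) + 1) \<in> M" using Suc by (simp add: algebra_simps)
   moreover have "(i, l - int (Suc k)) \<in> idx J" using Suc.prems pi by (auto simp: idx_def)
   ultimately show ?case by (rule cl)
  qed (use p il in simp)
  have "l < l'" if "(i, l') \<in> idx J - M" for l'
  proof (rule ccontr)
   assume "\<not> l < l'"
   then have "(i, l - int (nat (l - l'))) \<in> M" using that by (intro *) (auto simp: idx_def)
   then show False using \<open>\<not> l < l'\<close> that by simp
  qed
  then have "l < r i" using pi fin[of i] by (auto simp: r_def idx_def)
  then show "p \<in> below J r" using pi by (simp add: below_def il)
 next
  assume p: "p \<in> below J r"
  obtain i l where il: "p = (i, l)" by (cases p)
  then have pi: "(i, l) \<in> idx J" "l < r i" using p by (auto simp: below_def)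
  then show "p \<in> M" using fin[of i] by (auto simp: r_def idx_def il)
 qed
 then show ?thesis using rbox by blast
qed

lemma below_inj: "inj_on (below J) (box J)"
proof (rule inj_onI)
 fix r r' assume r: "r \<in> box J" "r' \<in> box J" "below J r = below J r'"
 have le: "r i \<le> r' i" if "r \<in> box J" "r' \<in> box J" "below J r = below J r'" "i < R" for r r' i
 proof (rule ccontr)
  assume "\<not> r i \<le> r' i"
  moreover have "low J i \<le> r' i" "r i \<le> int J" using that by (auto simp: box_def)
  ultimately have "(i, r' i) \<in> below J r" using that(4) by (simp add: below_def idx_def)
  then have "(i, r' i) \<in> below J r'" unfolding that(3) .
  then show False by (simp add: below_def)
 qed
 show "r = r'"
 proof
  fix i show "r i = r' i"
  proof (cases "i < R")
   case True
   then show ?thesis using le[OF r(1,2,3) True] le[OF r(2,1) r(3)[symmetric] True] by simp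
  next
   case False
   then show ?thesis using r by (auto simp: box_def PiE_def extensional_def)
  qed
 qed
qed

lemma below_subset: "below J r \<subseteq> idx J" by (auto simp: below_def)

lemma section_sum_box:
 "section_sum g nome (omega J) = (\<Sum>r\<in>box J. section_weight g nome (sect J (below J r)))"
proof -
 have "section_sum g nome (omega J) = (\<Sum>M\<in>below J ` box J. section_weight g nome (sect J M))" unfolding section_sum_omega
 proof (rule sum.mono_neutral_right)
  show "\<forall>M\<in>Pow (idx J) - below J ` box J. section_weight g nome (sect J M) = 0"
  proof
   fix M assume M: "M \<in> Pow (idx J) - below J ` box J"
   then obtain i l where "(i, l + 1) \<in> M" "(i, l) \<in> idx J" "(i, l) \<notin> M" using down_closed_eq_below[of M J] by blast
   then show "section_weight g nome (sect J M) = 0" using M by (intro section_weight_gap[of M J i l]) auto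
  qed
 qed (use finite_idx below_subset in auto)
 also have "\<dots> = (\<Sum>r\<in>box J. section_weight g nome (sect J (below J r)))" using below_inj by (simp add: sum.reindex)
 finally show ?thesis .
qed

end

section \<open>Moving one cut point\<close>

context chain
begin

text \<open>The cross ratio \<open>(1 - v e) / (1 - e / v)\<close> for \<open>v = w\<^sup>n\<close> and \<open>e = w\<^sup>m\<close>.\<close>

definition cross :: "int \<Rightarrow> int \<Rightarrow> complex" where
 "cross n m = (1 - w powi (m + n)) / (1 - w powi (m - n))"

lemma cross_nz: "m \<noteq> n \<Longrightarrow> m + n \<noteq> 0 \<Longrightarrow> cross n m \<noteq> 0" by (simp add: cross_def powi_eq_1_iff)

text \<open>Inverting \<open>v\<close> changes its factor with \<open>e\<close> by the quotient of
  the cross ratios at \<open>e\<close> and at the successor \<open>nome * e\<close>, so that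
  products along a progression telescope.\<close>

lemma hlC_flip:
 assumes "m \<noteq> n" "m + n \<noteq> 0" "m + 4 * int N \<noteq> n" "m + 4 * int N + n \<noteq> 0"
 shows "hlC nome (inverse (w powi n)) (w powi m) = hlC nome (w powi n) (w powi m) * (cross n m / cross n (m + 4 * int N))"
proof -
 have e: "nome * inverse (w powi n) * w powi m = w powi (m + 4 * int N - n)"
  "inverse (w powi n) * w powi m = w powi (m - n)"
  "nome * w powi n * w powi m = w powi (m + 4 * int N + n)" "w powi n * w powi m = w powi (m + n)"
  using w by (simp_all add: nome_def power_int_add power_int_diff divide_inverse mult_ac)
 have nz: "1 - w powi (m + n) \<noteq> 0" "1 - w powi (m - n) \<noteq> 0" "1 - w powi (m + 4 * int N + n) \<noteq> 0"
  "1 - w powi (m + 4 * int N - n) \<noteq> 0" using assms by (simp_all add: powi_eq_1_iff)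
 have "D / B = C / A * ((A / B) / (C / D))" if "A \<noteq> 0" "B \<noteq> 0" "C \<noteq> 0" "D \<noteq> 0" for A B C D :: complex using that by simp
 from this[OF nz(1,2,3,4)] show ?thesis unfolding hlC_def cross_def e .
qed

text \<open>What telescoping leaves at the two truncated ends of each progression. It disappears as
  \<open>J\<close> grows, except at the lower end of a special progression, which stays at exponent
  0.\<close>

definition ends :: "nat \<Rightarrow> int \<Rightarrow> complex" where
 "ends J n = (\<Prod>j<R. cross n (ex j (int J)) * cross n (- ex j (low J j - 1)))"

lemma prod_idx_split: "M \<subseteq> idx J \<Longrightarrow> (\<Prod>p\<in>M. f p) = (\<Prod>j<R. \<Prod>l\<in>{l. (j, l) \<in> M}. f (j, l))"
proof -
 assume M: "M \<subseteq> idx J"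
 have fin: "finite {l. (j, l) \<in> M}" for j by (rule finite_subset[of _ "snd ` idx J"]) (use M finite_idx in force)+
 have "M = Sigma {..<R} (\<lambda>j. {l. (j, l) \<in> M})" using M by (auto simp: idx_def)
 then have "(\<Prod>p\<in>M. f p) = (\<Prod>p\<in>Sigma {..<R} (\<lambda>j. {l. (j, l) \<in> M}). f p)" by simp
 also have "\<dots> = (\<Prod>j<R. \<Prod>l\<in>{l. (j, l) \<in> M}. f (j, l))" using fin by (subst prod.Sigma) (auto simp: case_prod_unfold)
 finally show ?thesis .
qed

text \<open>Raising one cut inverts the single point \<open>v\<close> at the cut. Its factors with
  all other elements telescope along each progression, leaving one cross ratio on either side of the
  cut \<open>r j\<close> and the ends. Progression \<open>i\<close> is separate, since
  \<open>v\<close> itself is missing there and the neighbours on both sides of it remain.\<close>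

lemma section_weight_flip:
 assumes r: "r \<in> box J" and i: "i < R" "r i < int J"
  and g: "g (w powi (ex i (r i))) \<noteq> 0"
 defines "n \<equiv> ex i (r i)"
 shows "section_weight g nome (sect J (below J (r(i := r i + 1)))) * g (w powi n) * ends J n =
  section_weight g nome (sect J (below J r)) * g (w powi (- n)) * ((\<Prod>j\<in>{..<R} - {i}. cross n (ex j (r j)) * cross n (- ex j (r j - 1))) *
   (cross n (n + 4 * int N) * cross n (4 * int N - n)))"
proof -
 define M where "M = below J r"
 define M' where "M' = insert (i, r i) M"
 define v where "v = w powi n"
 have rb: "low J j \<le> r j" "r j \<le> int J" if "j < R" for j
 proof -
  have "r j \<in> {low J j..int J}" using r that unfolding box_def by (intro PiE_mem[of r "{..<R}"]) auto
  then show "low J j \<le> r j" "r j \<le> int J" by simp_all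
 qed
 have p: "(i, r i) \<in> idx J" "(i, r i) \<notin> M" using i rb[OF i(1)] by (auto simp: idx_def M_def below_def)
 have M: "M \<subseteq> idx J" "M' \<subseteq> idx J" using below_subset p by (auto simp: M_def M'_def)
 have M': "below J (r(i := r i + 1)) = M'" using p i by (auto simp: M'_def M_def below_def split: if_splits)
 have pv: "point (i, r i) = v" by (simp add: point_def v_def n_def)
 define S where "S = point ` (idx J - M') \<union> (\<lambda>p. inverse (point p)) ` M"
 have finS: "finite S" using finite_idx finite_subset[OF M(1) finite_idx] by (simp add: S_def)
 have s1: "sect J M = insert v S" using p pv by (auto simp: sect_def S_def M'_def)
 have s2: "sect J M' = insert (inverse v) S" using pv by (auto simp: sect_def S_def M'_def)
 have vS: "v \<notin> S"
 proof
  assume "v \<in> S"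
  then consider p' where "p' \<in> idx J - M'" "point p' = v" | p' where "p' \<in> M" "inverse (point p') = v" by (auto simp: S_def)
  then show False
  proof cases
   case 1
   then have "p' = (i, r i)" using point_inj p pv by (auto simp: inj_on_def)
   with 1 show False by (simp add: M'_def)
  next
   case 2
   then show False using point_neq_inverse[of "(i, r i)" J p'] p M pv by auto
  qed
 qed
 have ivS: "inverse v \<notin> S"
 proof
  assume "inverse v \<in> S"
  then consider p' where "p' \<in> idx J - M'" "point p' = inverse v" | p' where "p' \<in> M" "point p' = v" by (auto simp: S_def)
  then show False
  proof cases
   case 1
   then show False using point_neq_inverse[of p' J "(i, r i)"] p pv by auto
  next
   case 2
   then have "p' = (i, r i)" using point_inj p pv M by (auto simp: inj_on_def)
   with 2 p show False by simp
  qed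
 qed
 have W1: "section_weight g nome (sect J M) = section_weight g nome S * g v * (\<Prod>e\<in>S. hlC nome v e)"
  unfolding s1 by (rule section_weight_insert[OF finS vS])
 have W2: "section_weight g nome (sect J M') = section_weight g nome S * g (inverse v) * (\<Prod>e\<in>S. hlC nome (inverse v) e)"
  unfolding s2 by (rule section_weight_insert[OF finS ivS])
 define C where "C = (\<Prod>p\<in>idx J - M'. cross n (ex (fst p) (snd p)) / cross n (ex (fst p) (snd p + 1))) *
   (\<Prod>p\<in>M. cross n (- ex (fst p) (snd p)) / cross n (- ex (fst p) (snd p - 1)))"
 have ex_step: "ex j (l + 1) = ex j l + 4 * int N" "- ex j (l - 1) = - ex j l + 4 * int N" for j l by (simp_all add: ex_def algebra_simps)
 have prodS: "(\<Prod>e\<in>S. f e) = (\<Prod>p\<in>idx J - M'. f (point p)) * (\<Prod>p\<in>M. f (inverse (point p)))" for f :: "complex \<Rightarrow> complex"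
 proof -
  have fin: "finite M" "finite (idx J - M')" using finite_subset[OF M(1) finite_idx] finite_idx by auto
  have i1: "inj_on point (idx J - M')" using point_inj by (rule inj_on_subset) auto
  have i2: "inj_on (\<lambda>p. inverse (point p)) M" using inj_on_subset[OF point_inj M(1)] by (auto simp: inj_on_def)
  have dis: "point ` (idx J - M') \<inter> (\<lambda>p. inverse (point p)) ` M = {}" using point_neq_inverse[of _ J] M(1) by auto
  show ?thesis unfolding S_def using fin dis i1 i2 by (simp add: prod.union_disjoint prod.reindex)
 qed
 have n1: "ex j l \<noteq> n \<or> (j = i \<and> l = r i)" if "j < R" for j l using ex_inj[OF that i(1), of l "r i"] by (auto simp: n_def)
 have n2: "ex j l + n \<noteq> 0" if "j < R" "low J j - 1 \<le> l" for j l
  using ex_sum[OF i(1) that(1) rb(1)[OF i(1)] that(2)] by (simp add: n_def add.commute)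
 have "(\<Prod>e\<in>S. hlC nome (inverse v) e) = (\<Prod>e\<in>S. hlC nome v e) * C"
 proof -
  have h1: "hlC nome (inverse v) (point p) = hlC nome v (point p) *
    (cross n (ex (fst p) (snd p)) / cross n (ex (fst p) (snd p + 1)))" if p': "p \<in> idx J - M'" for p
  proof -
   obtain j l where jl: "p = (j, l)" by (cases p)
   have j: "j < R" "low J j \<le> l" "(j, l) \<noteq> (i, r i)" "\<not> l < r j" using p' jl by (auto simp: idx_def M'_def M_def below_def)
   have d: "\<not> (j = i \<and> l = r i)" "\<not> (j = i \<and> l + 1 = r i)" using j(3,4) by auto
   have l: "low J j - 1 \<le> l" "low J j - 1 \<le> l + 1" using j(2) by simp_all
   have "ex j l \<noteq> n" using n1[OF j(1), of l] d(1) by blast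
   moreover have "ex j (l + 1) \<noteq> n" using n1[OF j(1), of "l + 1"] d(2) by blast
   ultimately show ?thesis unfolding jl point_def v_def fst_conv snd_conv ex_step(1)
    by (intro hlC_flip n2[OF j(1) l(1)] n2[OF j(1) l(2), unfolded ex_step(1)])
  qed
  have h2: "hlC nome (inverse v) (inverse (point p)) = hlC nome v (inverse (point p)) *
    (cross n (- ex (fst p) (snd p)) / cross n (- ex (fst p) (snd p - 1)))" if p': "p \<in> M" for p
  proof -
   obtain j l where jl: "p = (j, l)" by (cases p)
   have j: "j < R" "low J j \<le> l" "l < r j" using p' jl by (auto simp: idx_def M_def below_def)
   have d: "\<not> (j = i \<and> l = r i)" "\<not> (j = i \<and> l - 1 = r i)" using j(3) by auto
   have l: "low J j - 1 \<le> l" "low J j - 1 \<le> l - 1" using j(2) by simp_all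
   have pi: "inverse (point p) = w powi (- ex j l)" by (simp add: jl point_def power_int_minus)
   have e: "- ex j l \<noteq> n" "- ex j (l - 1) \<noteq> n" using n2[OF j(1) l(1)] n2[OF j(1) l(2)] by linarith+
   have "ex j l \<noteq> n" using n1[OF j(1), of l] d(1) by blast
   then have e': "- ex j l + n \<noteq> 0" by linarith
   have "ex j (l - 1) \<noteq> n" using n1[OF j(1), of "l - 1"] d(2) by blast
   then have "- ex j (l - 1) + n \<noteq> 0" by linarith
   from hlC_flip[OF e(1) e' e(2)[unfolded ex_step(2)] this[unfolded ex_step(2)]] show ?thesis
    unfolding pi v_def unfolding jl fst_conv snd_conv ex_step(2) .
  qed
  have "(\<Prod>p\<in>idx J - M'. hlC nome (inverse v) (point p)) = (\<Prod>p\<in>idx J - M'. hlC nome v (point p)) *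
    (\<Prod>p\<in>idx J - M'. cross n (ex (fst p) (snd p)) / cross n (ex (fst p) (snd p + 1)))"
   unfolding prod.distrib[symmetric] by (intro prod.cong refl h1)
  moreover have "(\<Prod>p\<in>M. hlC nome (inverse v) (inverse (point p))) = (\<Prod>p\<in>M. hlC nome v (inverse (point p))) *
    (\<Prod>p\<in>M. cross n (- ex (fst p) (snd p)) / cross n (- ex (fst p) (snd p - 1)))"
   unfolding prod.distrib[symmetric] by (intro prod.cong refl h2)
  ultimately show ?thesis unfolding prodS C_def by (simp only: mult_ac)
 qed
 then have main: "section_weight g nome (sect J M') * g v = section_weight g nome (sect J M) * g (inverse v) * C"
  unfolding W1 W2 by (simp only: mult_ac)
 have C_eq: "C = (\<Prod>j<R. (\<Prod>l\<in>{l. (j, l) \<in> idx J - M'}. cross n (ex j l) / cross n (ex j (l + 1))) *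
   (\<Prod>l\<in>{l. (j, l) \<in> M}. cross n (- ex j l) / cross n (- ex j (l - 1))))"
 proof -
  have "idx J - M' \<subseteq> idx J" by blast
  then show ?thesis unfolding C_def prod_idx_split[OF M(1)] by (subst prod_idx_split) (auto simp: prod.distrib)
 qed
 have lower: "(\<Prod>l\<in>{l. (j, l) \<in> M}. cross n (- ex j l) / cross n (- ex j (l - 1))) =
   cross n (- ex j (r j - 1)) / cross n (- ex j (low J j - 1))" if j: "j < R" for j
 proof -
  have "{l. (j, l) \<in> M} = {low J j..<r j}" using j rb[OF j] by (auto simp: M_def below_def idx_def)
  moreover have "(\<Prod>l\<in>{low J j..<r j}. cross n (- ex j l) / cross n (- ex j (l - 1))) =
   cross n (- ex j (r j - 1)) / cross n (- ex j (low J j - 1))"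
  proof (rule prod_telescope_int')
   fix l assume l: "low J j - 1 \<le> l" "l < r j"
   have "\<not> (j = i \<and> l = r i)" using l by auto
   then have "ex j l \<noteq> n" using n1[OF j, of l] by blast
   then have "- ex j l \<noteq> n" "- ex j l + n \<noteq> 0" using n2[OF j l(1)] by linarith+
   then show "cross n (- ex j l) \<noteq> 0" by (rule cross_nz)
  qed (rule rb[OF j])
  ultimately show ?thesis by simp
 qed
 have upper: "(\<Prod>l\<in>{l. (j, l) \<in> idx J - M'}. cross n (ex j l) / cross n (ex j (l + 1))) =
   cross n (ex j (if j = i then r i + 1 else r j)) / cross n (ex j (int J))" if j: "j < R" for j
 proof -
  let ?s = "if j = i then r i + 1 else r j"
  have "{l. (j, l) \<in> idx J - M'} = {?s..<int J}" using j rb[OF j] by (auto simp: M'_def M_def below_def idx_def)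
  moreover have "(\<Prod>l\<in>{?s..<int J}. cross n (ex j l) / cross n (ex j (l + 1))) = cross n (ex j ?s) / cross n (ex j (int J))"
  proof (rule prod_telescope_int)
   show "?s \<le> int J" using rb[OF j] i by auto
   fix l assume l: "?s \<le> l" "l \<le> int J"
   then have l': "low J j - 1 \<le> l" "\<not> (j = i \<and> l = r i)" using rb(1)[OF j] by (auto split: if_splits)
   have "ex j l \<noteq> n" using n1[OF j, of l] l'(2) by blast
   moreover have "ex j l + n \<noteq> 0" by (rule n2[OF j l'(1)])
   ultimately show "cross n (ex j l) \<noteq> 0" by (rule cross_nz)
  qed
  ultimately show ?thesis by simp
 qed
 have ends_nz: "ends J n \<noteq> 0"
 proof -
  have "cross n (ex j (int J)) * cross n (- ex j (low J j - 1)) \<noteq> 0" if j: "j < R" for j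
  proof -
   have "low J j - 1 \<le> int J" by (simp add: low_def)
   then have "ex j (int J) + n \<noteq> 0" by (rule n2[OF j])
   moreover have "ex j (low J j - 1) + n \<noteq> 0" by (rule n2[OF j order_refl])
   then have "- ex j (low J j - 1) \<noteq> n" by linarith
   moreover have "\<not> (j = i \<and> int J = r i)" "\<not> (j = i \<and> low J j - 1 = r i)" using i rb(1)[OF j] by auto
   then have "ex j (int J) \<noteq> n" "ex j (low J j - 1) \<noteq> n" using n1[OF j, of "int J"] n1[OF j, of "low J j - 1"] by blast+
   moreover from this(2) have "- ex j (low J j - 1) + n \<noteq> 0" by linarith
   ultimately show ?thesis using cross_nz[of "ex j (int J)" n] cross_nz[of "- ex j (low J j - 1)" n] by (metis mult_eq_0_iff)
  qed
  then show ?thesis by (auto simp: ends_def)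
 qed
 have "C * ends J n = (\<Prod>j<R. cross n (ex j (if j = i then r i + 1 else r j)) * cross n (- ex j (r j - 1)))"
  unfolding C_eq ends_def prod.distrib[symmetric]
 proof (rule prod.cong[OF refl])
  fix j assume "j \<in> {..<R}"
  then have j: "j < R" by simp
  have "cross n (ex j (int J)) \<noteq> 0" "cross n (- ex j (low J j - 1)) \<noteq> 0" using ends_nz j by (auto simp: ends_def)
  then show "(\<Prod>l\<in>{l. (j, l) \<in> idx J - M'}. cross n (ex j l) / cross n (ex j (l + 1))) *
   (\<Prod>l\<in>{l. (j, l) \<in> M}. cross n (- ex j l) / cross n (- ex j (l - 1))) * (cross n (ex j (int J)) * cross n (- ex j (low J j - 1))) =
   cross n (ex j (if j = i then r i + 1 else r j)) * cross n (- ex j (r j - 1))" unfolding lower[OF j] upper[OF j] by simp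
 qed
 also have "\<dots> = (cross n (ex i (r i + 1)) * cross n (- ex i (r i - 1))) *
   (\<Prod>j\<in>{..<R} - {i}. cross n (ex j (r j)) * cross n (- ex j (r j - 1)))"
  using i(1) by (subst prod.remove[of _ i]) (auto intro!: prod.cong)
 also have "ex i (r i + 1) = n + 4 * int N" by (simp add: ex_step n_def)
 also have "- ex i (r i - 1) = 4 * int N - n" unfolding ex_step by (simp add: n_def)
 finally have CE: "C * ends J n = (cross n (n + 4 * int N) * cross n (4 * int N - n)) *
   (\<Prod>j\<in>{..<R} - {i}. cross n (ex j (r j)) * cross n (- ex j (r j - 1)))" .
 have "section_weight g nome (sect J M') * g v * ends J n = section_weight g nome (sect J M) * g (inverse v) * (C * ends J n)"
  unfolding main by (simp only: mult_ac)
 then show ?thesis unfolding CE M' unfolding M_def v_def by (simp add: power_int_minus mult_ac)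
qed

end

text \<open>Cross-multiplied, so that coinciding nodes do no harm.\<close>

lemma vandermonde_update:
 assumes "i < n" "\<And>j. j < n \<Longrightarrow> j \<noteq> i \<Longrightarrow> c' j = c j"
 shows "vandermonde n c' * (\<Prod>j\<in>{..<n} - {i}. c i - c j) = vandermonde n c * (\<Prod>j\<in>{..<n} - {i}. c' i - c j)" using assms
proof (induction n)
 case (Suc n)
 show ?case
 proof (cases "i = n")
  case True
  have "vandermonde n c' = vandermonde n c" unfolding vandermonde_def using Suc.prems True by (intro prod.cong refl arg_cong2[where f = "(-)"]) auto
  moreover have "{..<Suc n} - {i} = {..<n}" using True by auto
  moreover have "(\<Prod>j<n. c' n - c' j) = (\<Prod>j<n. c' n - c j)" using Suc.prems True by (intro prod.cong refl) auto
  ultimately show ?thesis using True by (simp add: vandermonde_def)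
 next
  case False
  then have i: "i < n" using Suc.prems by auto
  have IH: "vandermonde n c' * (\<Prod>j\<in>{..<n} - {i}. c i - c j) = vandermonde n c * (\<Prod>j\<in>{..<n} - {i}. c' i - c j)"
   using Suc.prems by (intro Suc.IH i) auto
  have s: "{..<Suc n} - {i} = insert n ({..<n} - {i})" using False by auto
  have n: "c' n = c n" using Suc.prems False by auto
  have r: "(\<Prod>j<n. c' n - c' j) = (c n - c' i) * (\<Prod>j\<in>{..<n} - {i}. c n - c j)"
   "(\<Prod>j<n. c n - c j) = (c n - c i) * (\<Prod>j\<in>{..<n} - {i}. c n - c j)"
   using i Suc.prems n by (auto simp: prod.remove[of "{..<n}" i] intro!: prod.cong)
  have "vandermonde (Suc n) c' * (\<Prod>j\<in>{..<Suc n} - {i}. c i - c j) =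
    (vandermonde n c' * (\<Prod>j\<in>{..<n} - {i}. c i - c j)) * ((c n - c' i) * (c i - c n) * (\<Prod>j\<in>{..<n} - {i}. c n - c j))"
   unfolding s using r by (simp add: vandermonde_def mult_ac)
  also have "\<dots> = (vandermonde n c * (\<Prod>j\<in>{..<n} - {i}. c' i - c j)) * ((c n - c i) * (c' i - c n) * (\<Prod>j\<in>{..<n} - {i}. c n - c j))"
   unfolding IH by (simp add: algebra_simps)
  also have "\<dots> = vandermonde (Suc n) c * (\<Prod>j\<in>{..<Suc n} - {i}. c' i - c j)"
   unfolding s using r by (simp add: vandermonde_def mult_ac)
  finally show ?thesis .
 qed
qed simp

text \<open>\<open>g_flip\<close> says that the local factor of a moved cut is a quotient of the
  differences \<open>dd\<close> below, times a power of \<open>w\<close> linear in the cut. Each of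
  the other \<open>R - 1\<close> progressions supplies a factor \<open>w powi (2 * ex i l)\<close>
  in \<open>cross_pair\<close>; the term \<open>2 * (int R - 1)\<close> compensates for them, and
  \<open>K\<close> remains as the coefficient of a Gaussian.\<close>

locale chain_weight = chain +
 fixes g :: "complex \<Rightarrow> complex" and a :: nat and K :: int and sg :: complex
 assumes a: "a \<in> {1, 2}" and sg: "sg = 1 \<or> sg = -1" and K: "K > 0"
  and g_nz: "\<And>i l. i < R \<Longrightarrow> (i \<in> L \<Longrightarrow> 0 \<le> l) \<Longrightarrow> g (w powi ex i l) \<noteq> 0"
  and g_flip: "\<And>i l. i < R \<Longrightarrow> (i \<in> L \<Longrightarrow> 0 \<le> l) \<Longrightarrow>
   g (w powi (- ex i l)) * (1 - w powi (2 * ex i l + 4 * int N)) *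
    (w powi (int a * (b i + 2 * int N * l)) - w powi (- (int a * (b i + 2 * int N * l)))) =
   (\<Prod>j\<in>L. cross (ex i l) 0) * sg * w powi (ex i l * (K - 2 * (int R - 1))) *
    (w powi (int a * (b i + 2 * int N * (l + 1))) - w powi (- (int a * (b i + 2 * int N * (l + 1))))) *
    (g (w powi ex i l) * (1 - w powi (4 * int N - 2 * ex i l)))"
begin

definition beta :: "nat \<Rightarrow> int \<Rightarrow> int" where "beta i l = b i + 2 * int N * l"
definition cc :: "nat \<Rightarrow> int \<Rightarrow> complex" where
 "cc i l = (w powi beta i l)\<^sup>2 + (inverse (w powi beta i l))\<^sup>2"
definition dd :: "nat \<Rightarrow> int \<Rightarrow> complex" where
 "dd i l = (w powi beta i l)^a - inverse (w powi beta i l)^a"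
text \<open>The determinant of \<open>leibniz_odd_powers\<close> in factored form; the quotients of
  section weights produce it as a product, and \<open>denom_leibniz\<close> makes it
  expandable.\<close>

definition denom :: "(nat \<Rightarrow> int) \<Rightarrow> complex" where
 "denom r = (\<Prod>i<R. dd i (r i)) * vandermonde R (\<lambda>i. cc i (r i))"
definition ends' :: "nat \<Rightarrow> int \<Rightarrow> complex" where
 "ends' J n = (\<Prod>j<R. cross n (ex j (int J))) * (\<Prod>j\<in>{..<R} - L. cross n (- ex j (- int J - 1)))"
text \<open>The exponent is the quadratic function of \<open>l\<close> with increments
  \<open>K * ex i l\<close> and value 0 at 0.\<close>

definition mono :: "nat \<Rightarrow> int \<Rightarrow> complex" where
 "mono i l = sg powi l * w powi (2 * K * (int N * l * l + b i * l))"
text \<open>The truncation factors accumulated between cut 0 and cut \<open>l\<close>; they tend to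
  1 with growing \<open>J\<close>.\<close>

definition cor :: "nat \<Rightarrow> nat \<Rightarrow> int \<Rightarrow> complex" where
 "cor J i l = (if 0 \<le> l then \<Prod>m\<in>{0..<l}. inverse (ends' J (ex i m)) else \<Prod>m\<in>{l..<0}. ends' J (ex i m))"
definition wt :: "nat \<Rightarrow> (nat \<Rightarrow> int) \<Rightarrow> complex" where
 "wt J r = section_weight g nome (sect J (below J r))"

lemma beta_nz: "i < R \<Longrightarrow> beta i l \<noteq> 0"
proof
 assume i: "i < R" and "beta i l = 0"
 then have e: "b i = 2 * int N * (- l)" by (simp add: beta_def)
 have "\<bar>2 * int N * (- l)\<bar> < 2 * int N" unfolding e[symmetric] using b_pos[OF i] b_le[OF i] by simp
 then have "- l = 0" by (rule mult_small_eq_0)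
 then show False using e b_pos[OF i] by simp
qed

lemma beta_neq:
 assumes "i < R" "j < R" "i \<noteq> j"
 shows "beta i l \<noteq> beta j l'" "beta i l + beta j l' \<noteq> 0"
proof -
 show "beta i l \<noteq> beta j l'" using ex_inj[OF assms(1,2), of l l'] assms(3) by (auto simp: beta_def ex_def)
 show "beta i l + beta j l' \<noteq> 0"
 proof
  assume "beta i l + beta j l' = 0"
  then have e: "b i + b j = 2 * int N * (- (l + l'))" by (simp add: beta_def algebra_simps)
  have "\<bar>2 * int N * (- (l + l'))\<bar> < 2 * int N"
   unfolding e[symmetric] using b_pos[OF assms(1)] b_pos[OF assms(2)] b_sum[OF assms(1,2)] assms(3) by simp
  then have "- (l + l') = 0" by (rule mult_small_eq_0)
  then show False using e b_pos[OF assms(1)] b_pos[OF assms(2)] by simp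
 qed
qed

lemma cc_eq: "cc i l = w powi (2 * beta i l) + w powi (- 2 * beta i l)"
 by (simp add: cc_def power_int_mult[of w "beta i l" 2, symmetric] mult.commute power_int_minus flip: power_int_mult)
   (simp add: power2_eq_square power_int_add[symmetric] w(1) power_int_minus[symmetric] flip: power_int_minus)

lemma powi_add: "w powi (m + n) = w powi m * w powi n" using w by (simp add: power_int_add)

lemma powi_cancel: "w powi m * w powi (- m) = 1" using powi_add[of m "- m"] by simp

lemma dd_eq: "dd i l = w powi (int a * beta i l) - w powi (- (int a * beta i l))"
 by (simp add: dd_def power_int_power' power_int_minus power_inverse mult.commute flip: power_int_minus)

lemma ex_beta: "ex i l = 2 * int N + 2 * beta i l" by (simp add: ex_def beta_def algebra_simps)

lemma beta_step: "beta i (l + 1) = beta i l + 2 * int N" by (simp add: beta_def algebra_simps)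

lemma one_minus_pair: "(1 - w powi (x + y)) * (1 - w powi (x - y)) = w powi x * (w powi x + w powi (- x) - (w powi y + w powi (- y)))"
proof -
 have "w powi (x - y) = w powi x * w powi (- y)" using powi_add[of x "- y"] by simp
 then show ?thesis using powi_cancel[of x] powi_cancel[of y] powi_add[of x y] by algebra
qed

lemma cc_diff_nz: "i < R \<Longrightarrow> j < R \<Longrightarrow> i \<noteq> j \<Longrightarrow> cc i l - cc j l' \<noteq> 0"
proof
 assume ij: "i < R" "j < R" "i \<noteq> j" and 0: "cc i l - cc j l' = 0"
 have "(1 - w powi (2 * beta i l + 2 * beta j l')) * (1 - w powi (2 * beta i l - 2 * beta j l')) = 0"
  unfolding one_minus_pair using 0 by (simp add: cc_eq)
 then show False using beta_neq[OF ij, of l l'] by (auto simp: powi_eq_1_iff)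
qed

lemma dd_nz: "i < R \<Longrightarrow> dd i l \<noteq> 0" using beta_nz[of i l] a by (auto simp: dd_eq powi_eq_iff)

text \<open>Numerators and denominators pair up by \<open>one_minus_pair\<close> into differences of
  terms \<open>w^x + w^(-x)\<close>. This is where the Vandermonde factors come from.\<close>

lemma cross_pair:
 assumes "i < R" "j < R" "i \<noteq> j"
 shows "cross (ex i l) (ex j l') * cross (ex i l) (- ex j (l' - 1)) * (cc i l - cc j l') = w powi (2 * ex i l) * (cc i (l + 1) - cc j l')"
proof -
 define x where "x = 4 * int N + 2 * beta i l"
 define y where "y = 2 * beta j l'"
 define z where "z = - (2 * beta i l)"
 have e: "ex j l' + ex i l = x + y" "ex j l' - ex i l = z + y"
  "- ex j (l' - 1) + ex i l = x - y" "- ex j (l' - 1) - ex i l = z - y" "2 * ex i l = x - z"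
  using beta_step[of j "l' - 1"] by (simp_all add: ex_beta x_def y_def z_def algebra_simps)
 have c: "cc i l = w powi z + w powi (- z)" "cc j l' = w powi y + w powi (- y)"
  "cc i (l + 1) = w powi x + w powi (- x)" using beta_step[of i l] by (simp_all add: cc_eq x_def y_def z_def algebra_simps)
 have nz: "cc i l - cc j l' \<noteq> 0" using assms by (rule cc_diff_nz)
 have "cross (ex i l) (ex j l') * cross (ex i l) (- ex j (l' - 1)) =
   ((1 - w powi (x + y)) * (1 - w powi (x - y))) / ((1 - w powi (z + y)) * (1 - w powi (z - y)))"
  unfolding cross_def e(1-4) times_divide_times_eq ..
 also have "\<dots> = (w powi x * (cc i (l + 1) - cc j l')) / (w powi z * (cc i l - cc j l'))" unfolding one_minus_pair c ..
 finally have "cross (ex i l) (ex j l') * cross (ex i l) (- ex j (l' - 1)) * (cc i l - cc j l') = (w powi x / w powi z) * (cc i (l + 1) - cc j l')"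
  using nz by simp
 also have "w powi x / w powi z = w powi (2 * ex i l)" unfolding e using w by (simp add: power_int_diff)
 finally show ?thesis .
qed

lemma cross_self:
 assumes "i < R"
 shows "cross (ex i l) (ex i l + 4 * int N) * cross (ex i l) (4 * int N - ex i l) * (1 - w powi (4 * int N - 2 * ex i l)) =
  1 - w powi (2 * ex i l + 4 * int N)"
proof -
 have "4 * int N - 2 * ex i l \<noteq> 0" using beta_nz[OF assms, of l] by (simp add: ex_beta)
 then have nz: "1 - w powi (4 * int N - 2 * ex i l) \<noteq> 0" "1 - w powi (4 * int N) \<noteq> 0" using N by (auto simp: powi_eq_1_iff)
 have "ex i l + 4 * int N + ex i l = 2 * ex i l + 4 * int N" "ex i l + 4 * int N - ex i l = 4 * int N"
  "4 * int N - ex i l + ex i l = 4 * int N" "4 * int N - ex i l - ex i l = 4 * int N - 2 * ex i l" by simp_all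
 then have "cross (ex i l) (ex i l + 4 * int N) * cross (ex i l) (4 * int N - ex i l) =
  (1 - w powi (2 * ex i l + 4 * int N)) / (1 - w powi (4 * int N)) * ((1 - w powi (4 * int N)) / (1 - w powi (4 * int N - 2 * ex i l)))"
  by (simp only: cross_def)
 with nz show ?thesis by simp
qed

lemma denom_nz: "denom r \<noteq> 0"
proof -
 have "cc j (r j) - cc i (r i) \<noteq> 0" if "j < R" "i < j" for i j using that by (intro cc_diff_nz) auto
 then have "vandermonde R (\<lambda>i. cc i (r i)) \<noteq> 0" by (auto simp: vandermonde_def)
 then show ?thesis using dd_nz by (auto simp: denom_def)
qed

lemma ends_split: "ends J n = ends' J n * (\<Prod>j\<in>L. cross n 0)"
proof -
 have "(\<Prod>j<R. cross n (- ex j (low J j - 1))) =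
   (\<Prod>j\<in>{..<R} - L. cross n (- ex j (low J j - 1))) * (\<Prod>j\<in>L. cross n (- ex j (low J j - 1)))"
  using L by (intro prod.subset_diff) auto
 also have "(\<Prod>j\<in>L. cross n (- ex j (low J j - 1))) = (\<Prod>j\<in>L. cross n 0)"
  using L b_special by (intro prod.cong) (auto simp: low_def ex_def)
 also have "(\<Prod>j\<in>{..<R} - L. cross n (- ex j (low J j - 1))) = (\<Prod>j\<in>{..<R} - L. cross n (- ex j (- int J - 1)))"
  by (intro prod.cong) (auto simp: low_def)
 finally show ?thesis by (simp add: ends_def ends'_def prod.distrib mult_ac)
qed

lemma box_range: "r \<in> box J \<Longrightarrow> i < R \<Longrightarrow> low J i \<le> r i \<and> r i \<le> int J"
 using PiE_mem[of r "{..<R}" "\<lambda>i. {low J i..int J}" i] by (auto simp: box_def)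

lemma special_range: "r \<in> box J \<Longrightarrow> i < R \<Longrightarrow> i \<in> L \<Longrightarrow> 0 \<le> r i"
 using box_range[of r J i] by (simp add: low_def)

text \<open>Section weight and \<open>denom\<close> change by the same factors up to a monomial: the
  other progressions match through \<open>cross_pair\<close> and \<open>vandermonde_update\<close>,
  progression \<open>i\<close> itself through \<open>cross_self\<close> and
  \<open>g_flip\<close>.\<close>

lemma wt_step:
 assumes r: "r \<in> box J" and i: "i < R" "r i < int J"
 shows "wt J (r(i := r i + 1)) * denom r * ends' J (ex i (r i)) = wt J r * denom (r(i := r i + 1)) * (sg * w powi (K * ex i (r i)))"
proof -
 let ?n = "ex i (r i)" and ?r = "r(i := r i + 1)"
 let ?I = "{..<R} - {i}"
 have sp: "i \<in> L \<Longrightarrow> 0 \<le> r i" using special_range[OF r i(1)] .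
 define G where "G = g (w powi ?n)"
 define G' where "G' = g (w powi (- ?n))"
 define S where "S = (\<Prod>j\<in>L. cross ?n 0)"
 define A where "A = 1 - w powi (4 * int N - 2 * ?n)"
 define B where "B = 1 - w powi (2 * ?n + 4 * int N)"
 define C where "C = (\<Prod>j\<in>?I. cc i (r i) - cc j (r j))"
 define C' where "C' = (\<Prod>j\<in>?I. cc i (r i + 1) - cc j (r j))"
 define D where "D = (\<Prod>j\<in>?I. dd j (r j))"
 define V where "V = vandermonde R (\<lambda>j. cc j (r j))"
 define V' where "V' = vandermonde R (\<lambda>j. cc j (?r j))"
 define P where "P = (\<Prod>j\<in>?I. cross ?n (ex j (r j)) * cross ?n (- ex j (r j - 1)))"
 define Q where "Q = cross ?n (?n + 4 * int N) * cross ?n (4 * int N - ?n)"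
 define x where "x = w powi (2 * ?n * (int R - 1))"
 have G0: "G \<noteq> 0" unfolding G_def using g_nz[OF i(1) sp] .
 have n0: "?n \<noteq> 0" using ex_sum[OF i(1) i(1), of J "r i" "r i"] box_range[OF r i(1)] by auto
 have S0: "S \<noteq> 0" unfolding S_def using n0 cross_nz[of 0 ?n] finite_subset[OF L] by (simp add: prod_constant)
 have A0: "A \<noteq> 0" using beta_nz[OF i(1), of "r i"] by (simp add: A_def ex_beta powi_eq_1_iff)
 have C0: "C \<noteq> 0" using cc_diff_nz[OF i(1), of _ "r i"] finite_subset[of ?I "{..<R}"] by (auto simp: C_def)
 have flip: "wt J ?r * G * (ends' J ?n * S) = wt J r * G' * (P * Q)" using section_weight_flip[OF r i, of g] g_nz[OF i(1) sp]
  unfolding wt_def G_def G'_def P_def Q_def S_def ends_split .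
 have PC: "P * C = x * C'"
 proof -
  have "P * C = (\<Prod>j\<in>?I. w powi (2 * ?n) * (cc i (r i + 1) - cc j (r j)))"
   unfolding P_def C_def prod.distrib[symmetric] using i(1) by (intro prod.cong refl cross_pair) auto
  also have "\<dots> = (w powi (2 * ?n))^(R - 1) * C'" unfolding C'_def prod.distrib using i(1) by simp
  also have "(w powi (2 * ?n))^(R - 1) = x" using i(1) by (simp add: x_def power_int_power' of_nat_diff)
  finally show ?thesis .
 qed
 have QA: "Q * A = B" unfolding Q_def A_def B_def by (rule cross_self[OF i(1)])
 have VC: "V' * C = V * C'"
  using vandermonde_update[of i R "\<lambda>j. cc j (?r j)" "\<lambda>j. cc j (r j)"] i(1) by (simp add: V_def V'_def C_def C'_def)
 have dr: "denom r = dd i (r i) * D * V" unfolding denom_def V_def D_def using i(1) by (simp add: prod.remove[of "{..<R}" i])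
 have dr': "denom ?r = dd i (r i + 1) * D * V'"
 proof -
  have "(\<Prod>j<R. dd j (?r j)) = dd i (r i + 1) * (\<Prod>j\<in>?I. dd j (?r j))" using i(1) by (simp add: prod.remove[of "{..<R}" i])
  also have "(\<Prod>j\<in>?I. dd j (?r j)) = D" unfolding D_def by (intro prod.cong) auto
  finally show ?thesis by (simp add: denom_def V'_def)
 qed
 have loc: "G' * B * dd i (r i) = S * sg * w powi (?n * (K - 2 * (int R - 1))) * dd i (r i + 1) * (G * A)"
  using g_flip[OF i(1) sp] unfolding G_def G'_def A_def B_def S_def dd_eq beta_def .
 have Kx: "w powi (?n * (K - 2 * (int R - 1))) * x = w powi (K * ?n)"
  unfolding x_def powi_add[symmetric] by (intro arg_cong[where f = "power_int w"]) (simp add: algebra_simps)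
 \<comment> \<open>Division is postponed: both sides carry the nonzero factor
   \<open>G * S * A * C\<close>, which turns every quotient used here into a product.\<close>
 have "(wt J ?r * denom r * ends' J ?n) * (G * S * A * C) = (wt J ?r * G * (ends' J ?n * S)) * A * C * denom r" by (simp only: mult_ac)
 also have "\<dots> = wt J r * G' * (Q * A) * (P * C) * (dd i (r i) * D * V)" unfolding flip dr by (simp only: mult_ac)
 also have "\<dots> = wt J r * (G' * B * dd i (r i)) * x * D * (V * C')" unfolding QA PC by (simp only: mult_ac)
 also have "\<dots> = wt J r * (S * sg * (w powi (?n * (K - 2 * (int R - 1))) * x) * dd i (r i + 1) * (G * A)) * D * (V' * C)"
  unfolding loc VC by (simp only: mult_ac)
 also have "\<dots> = (wt J r * denom ?r * (sg * w powi (K * ?n))) * (G * S * A * C)" unfolding Kx dr' by (simp only: mult_ac)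
 finally show ?thesis using G0 S0 A0 C0 by simp
qed

lemma mono_step: "mono i (l + 1) = mono i l * (sg * w powi (K * ex i l))"
proof -
 have sg0: "sg \<noteq> 0" using sg by auto
 have "2 * K * (int N * (l + 1) * (l + 1) + b i * (l + 1)) = 2 * K * (int N * l * l + b i * l) + K * ex i l" by (simp add: ex_def algebra_simps)
 then have "w powi (2 * K * (int N * (l + 1) * (l + 1) + b i * (l + 1))) =
   w powi (2 * K * (int N * l * l + b i * l)) * w powi (K * ex i l)" by (simp only: powi_add)
 moreover have "sg powi (l + 1) = sg powi l * sg" using sg0 by (simp add: power_int_add)
 ultimately show ?thesis by (simp add: mono_def mult_ac)
qed

lemma cor_step:
 assumes "ends' J (ex i l) \<noteq> 0"
 shows "cor J i (l + 1) * ends' J (ex i l) = cor J i l"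
proof (cases "0 \<le> l")
 case True
 then have "{0..<l + 1} = insert l {0..<l}" by auto
 then show ?thesis using True assms by (simp add: cor_def)
next
 case False
 then have "{l..<0} = insert l {l + 1..<0}" by auto
 moreover have "cor J i (l + 1) = (\<Prod>m\<in>{l + 1..<0}. ends' J (ex i m))" using False by (cases "l = -1") (auto simp: cor_def)
 ultimately show ?thesis using False by (simp add: cor_def)
qed

lemma ends'_nz:
 assumes "i < R" "low J i \<le> l" "l < int J"
 shows "ends' J (ex i l) \<noteq> 0"
proof -
 let ?n = "ex i l"
 have "cross ?n (ex j (int J)) \<noteq> 0" if j: "j < R" for j
 proof (rule cross_nz)
  show "ex j (int J) \<noteq> ?n" using ex_inj[OF j assms(1), of "int J" l] assms by auto
  show "ex j (int J) + ?n \<noteq> 0" using ex_sum[OF assms(1) j assms(2), of "int J"] by (simp add: low_def add.commute)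
 qed
 moreover have "cross ?n (- ex j (- int J - 1)) \<noteq> 0" if j: "j < R" "j \<notin> L" for j
 proof (rule cross_nz)
  have "ex i l + ex j (- int J - 1) \<noteq> 0" using ex_sum[OF assms(1) j(1) assms(2), of "- int J - 1"] j by (simp add: low_def)
  then show "- ex j (- int J - 1) \<noteq> ?n" by linarith
  have "ex j (- int J - 1) \<noteq> ?n" using ex_inj[OF j(1) assms(1), of "- int J - 1" l] assms by (auto simp: low_def split: if_splits)
  then show "- ex j (- int J - 1) + ?n \<noteq> 0" by linarith
 qed
 ultimately show ?thesis by (auto simp: ends'_def)
qed

definition factor :: "nat \<Rightarrow> (nat \<Rightarrow> int) \<Rightarrow> complex" where
 "factor J r = (\<Prod>i<R. mono i (r i) * cor J i (r i))"

abbreviation "zero \<equiv> (\<lambda>i\<in>{..<R}. 0 :: int)"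

lemma wt_formula_step:
 assumes r: "r \<in> box J" and i: "i < R" "r i < int J"
 defines "r' \<equiv> r(i := r i + 1)"
 shows "wt J r * denom zero = wt J zero * denom r * factor J r \<longleftrightarrow> wt J r' * denom zero = wt J zero * denom r' * factor J r'"
proof -
 define e where "e = ends' J (ex i (r i))"
 define x where "x = sg * w powi (K * ex i (r i))"
 have e0: "e \<noteq> 0" unfolding e_def using box_range[OF r i(1)] i by (intro ends'_nz) auto
 have x0: "x \<noteq> 0" using sg w by (auto simp: x_def)
 have st: "wt J r' * denom r * e = wt J r * denom r' * x" using wt_step[OF r i] by (simp add: r'_def e_def x_def)
 have fs: "factor J r' * e = factor J r * x"
 proof -
  have "factor J r' = (mono i (r i + 1) * cor J i (r i + 1)) * (\<Prod>j\<in>{..<R} - {i}. mono j (r' j) * cor J j (r' j))"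
   unfolding factor_def using i(1) by (simp add: prod.remove[of "{..<R}" i] r'_def)
  also have "(\<Prod>j\<in>{..<R} - {i}. mono j (r' j) * cor J j (r' j)) = (\<Prod>j\<in>{..<R} - {i}. mono j (r j) * cor J j (r j))"
   by (intro prod.cong) (auto simp: r'_def)
  finally have 1: "factor J r' = (mono i (r i + 1) * cor J i (r i + 1)) * \<dots>" .
  have 2: "factor J r = (mono i (r i) * cor J i (r i)) * (\<Prod>j\<in>{..<R} - {i}. mono j (r j) * cor J j (r j))"
   unfolding factor_def using i(1) by (simp add: prod.remove[of "{..<R}" i])
  have "mono i (r i + 1) * cor J i (r i + 1) * e = mono i (r i) * x * (cor J i (r i + 1) * e)" by (simp add: mono_step x_def mult_ac)
  also have "\<dots> = mono i (r i) * x * cor J i (r i)" using cor_step[of J i "r i"] e0 by (simp add: e_def)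
  finally have 3: "mono i (r i + 1) * cor J i (r i + 1) * e = mono i (r i) * x * cor J i (r i)" .
  have "factor J r' * e = (mono i (r i + 1) * cor J i (r i + 1) * e) * (\<Prod>j\<in>{..<R} - {i}. mono j (r j) * cor J j (r j))"
   unfolding 1 by (simp only: mult_ac)
  then show ?thesis unfolding 2 3 by (simp only: mult_ac)
 qed
 show ?thesis
 proof
  assume A: "wt J r * denom zero = wt J zero * denom r * factor J r"
  have "(wt J r' * denom zero) * (denom r * e) = (wt J r' * denom r * e) * denom zero" by (simp only: mult_ac)
  also have "\<dots> = (wt J r * denom zero) * denom r' * x" unfolding st by (simp only: mult_ac)
  also have "\<dots> = (wt J zero * denom r') * denom r * (factor J r * x)" unfolding A by (simp only: mult_ac)
  also have "\<dots> = (wt J zero * denom r' * factor J r') * (denom r * e)" unfolding fs[symmetric] by (simp only: mult_ac)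
  finally show "wt J r' * denom zero = wt J zero * denom r' * factor J r'" using denom_nz[of r] e0 by simp
 next
  assume A: "wt J r' * denom zero = wt J zero * denom r' * factor J r'"
  have "(wt J r * denom zero) * (denom r' * x) = (wt J r * denom r' * x) * denom zero" by (simp only: mult_ac)
  also have "\<dots> = (wt J r' * denom zero) * denom r * e" unfolding st[symmetric] by (simp only: mult_ac)
  also have "\<dots> = (wt J zero * denom r) * denom r' * (factor J r' * e)" unfolding A by (simp only: mult_ac)
  also have "\<dots> = (wt J zero * denom r * factor J r) * (denom r' * x)" unfolding fs by (simp only: mult_ac)
  finally show "wt J r * denom zero = wt J zero * denom r * factor J r" using denom_nz[of r'] x0 by simp
 qed
qed

text \<open>Induction on the total distance of the cuts from 0. The single step is an equivalence,
  since the way to 0 raises some cuts and lowers others.\<close>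

lemma wt_formula:
 assumes "r \<in> box J"
 shows "wt J r * denom zero = wt J zero * denom r * factor J r" using assms
proof (induction "\<Sum>i<R. nat \<bar>r i\<bar>" arbitrary: r rule: less_induct)
 case less
 show ?case
 proof (cases "\<exists>i<R. r i \<noteq> 0")
  case False
  then have "r = zero" using less.prems by (auto simp: box_def PiE_def extensional_def fun_eq_iff)
  moreover have "factor J zero = 1" by (simp add: factor_def mono_def cor_def)
  ultimately show ?thesis by (metis mult.right_neutral)
 next
  case True
  then obtain i where i: "i < R" "r i \<noteq> 0" by blast
  define r1 where "r1 = (if r i > 0 then r(i := r i - 1) else r(i := r i + 1))"
  have rng: "low J i \<le> r i" "r i \<le> int J" "low J i \<le> 0" using box_range[OF less.prems i(1)] by (auto simp: low_def)
  have r1: "r1 \<in> box J" using less.prems i rng unfolding box_def r1_def by (auto simp: PiE_def Pi_def extensional_def)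
  have "(\<Sum>j<R. nat \<bar>r1 j\<bar>) < (\<Sum>j<R. nat \<bar>r j\<bar>)" using i by (intro sum_strict_mono_ex1) (auto simp: r1_def)
  then have IH: "wt J r1 * denom zero = wt J zero * denom r1 * factor J r1" using r1 by (rule less.hyps)
  show ?thesis
  proof (cases "r i > 0")
   case True
   then have "r1(i := r1 i + 1) = r" "r1 i < int J" using rng by (auto simp: r1_def)
   with wt_formula_step[OF r1 i(1)] IH show ?thesis by simp
  next
   case False
   then have "r(i := r i + 1) = r1" "r i < int J" using i by (auto simp: r1_def)
   with wt_formula_step[OF less.prems i(1)] IH show ?thesis by simp
  qed
 qed
qed

lemma denom_leibniz:
 "denom r = leibniz R (\<lambda>i j. (w powi beta i (r i))^(a + 2 * j) - inverse (w powi beta i (r i))^(a + 2 * j))"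
 unfolding denom_def dd_def cc_def using w a by (intro leibniz_odd_powers[symmetric]) auto

definition entry :: "nat \<Rightarrow> int \<Rightarrow> nat \<Rightarrow> complex" where
 "entry i l j = mono i l * ((w powi beta i l)^(a + 2 * j) - inverse (w powi beta i l)^(a + 2 * j))"

text \<open>The weight is now a determinant times a product over its rows, so each row absorbs the
  sum over its own cut.\<close>

theorem section_sum_leibniz:
 "section_sum g nome (omega J) * denom zero = wt J zero * leibniz R (\<lambda>i j. \<Sum>l\<in>{low J i..int J}. cor J i l * entry i l j)"
proof -
 have "section_sum g nome (omega J) * denom zero = (\<Sum>r\<in>box J. wt J zero * (denom r * factor J r))"
  unfolding section_sum_box sum_distrib_right using wt_formula by (intro sum.cong) (auto simp: wt_def mult_ac)
 also have "\<dots> = wt J zero * (\<Sum>r\<in>box J. denom r * factor J r)" by (simp add: sum_distrib_left)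
 also have "(\<Sum>r\<in>box J. denom r * factor J r) = (\<Sum>r\<in>box J. \<Sum>\<pi> | \<pi> permutes {..<R}.
   of_int (sign \<pi>) * (\<Prod>i<R. cor J i (r i) * entry i (r i) (\<pi> i)))"
  unfolding denom_leibniz leibniz_def sum_distrib_right factor_def entry_def prod.distrib by (intro sum.cong refl) (simp add: mult_ac)
 also have "\<dots> = (\<Sum>\<pi> | \<pi> permutes {..<R}. \<Sum>r\<in>box J. of_int (sign \<pi>) * (\<Prod>i<R. cor J i (r i) * entry i (r i) (\<pi> i)))"
  by (rule sum.swap)
 also have "\<dots> = leibniz R (\<lambda>i j. \<Sum>l\<in>{low J i..int J}. cor J i l * entry i l j)"
  unfolding leibniz_def box_def by (simp add: prod_sum_PiE sum_distrib_left)
 finally show ?thesis .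
qed

end

section \<open>Progressions of infinite length\<close>

lemma summable_gaussian:
 fixes \<rho> C :: real
 assumes \<rho>: "0 \<le> \<rho>" "\<rho> < 1" and C: "0 \<le> C"
 shows "(\<lambda>l::int. \<rho>^nat (l * l) * C^nat \<bar>l\<bar>) summable_on UNIV"
proof -
 let ?f = "\<lambda>l::int. \<rho>^nat (l * l) * C^nat \<bar>l\<bar>"
 have "(\<lambda>n. \<rho>^n * C) \<longlonglongrightarrow> 0 * C" using \<rho> by (intro tendsto_mult tendsto_const LIMSEQ_power_zero) auto
 then have "\<forall>\<^sub>F n in sequentially. \<rho>^n * C < 1 / 2" by (intro order_tendstoD(2)) auto
 then have "\<forall>\<^sub>F n in sequentially. norm ((\<rho>^n * C)^n) \<le> (1 / 2)^n"
 proof eventually_elim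
  case (elim n)
  then have "(\<rho>^n * C)^n \<le> (1 / 2)^n" using \<rho> C by (intro power_mono) auto
  then show ?case using \<rho> C by simp
 qed
 then have "summable (\<lambda>n. (\<rho>^n * C)^n)" by (rule summable_comparison_test_ev) auto
 then have "(\<lambda>n. (\<rho>^n * C)^n) summable_on UNIV" using \<rho> C by (intro summable_nonneg_imp_summable_on) auto
 moreover have "?f (int n) = (\<rho>^n * C)^n" "?f (- int n) = (\<rho>^n * C)^n" for n
  by (simp_all add: power_mult_distrib nat_mult_distrib power_mult)
 ultimately have "(?f \<circ> int) summable_on UNIV" "(?f \<circ> (\<lambda>n. - int n)) summable_on UNIV" by (simp_all only: comp_def)
 then have "?f summable_on range int" "?f summable_on range (\<lambda>n. - int n)" by (subst summable_on_reindex; simp add: inj_on_def)+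
 then have "?f summable_on (range int \<union> range (\<lambda>n. - int n))" by (rule summable_on_union)
 also have "range int \<union> range (\<lambda>n. - int n) = UNIV" by (auto simp: image_iff) (metis int_cases2)
 finally show ?thesis .
qed

context chain
begin

lemma norm_powi_le: "n \<le> m \<Longrightarrow> norm (w powi m) \<le> norm w powi n"
 unfolding norm_power_int using w by (intro power_int_decreasing) auto

lemma norm_cross_le:
 assumes "m + n > 0" "m - n > 0"
 shows "norm (cross n m) \<le> (1 + norm w) / (1 - norm w)" "norm (inverse (cross n m)) \<le> (1 + norm w) / (1 - norm w)"
proof -
 have b: "norm (1 - w powi x) \<le> 1 + norm w \<and> 1 - norm w \<le> norm (1 - w powi x)" if "x > 0" for x
 proof -
  have "norm (w powi x) \<le> norm w" using norm_powi_le[of 1 x] that by simp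
  then show ?thesis using norm_triangle_ineq4[of 1 "w powi x"] norm_triangle_ineq2[of 1 "w powi x"] by simp
 qed
 have q: "norm (1 - w powi x) / norm (1 - w powi y) \<le> (1 + norm w) / (1 - norm w)" if "x > 0" "y > 0" for x y
  using b[OF that(1)] b[OF that(2)] w by (intro frac_le) auto
 show "norm (cross n m) \<le> (1 + norm w) / (1 - norm w)" "norm (inverse (cross n m)) \<le> (1 + norm w) / (1 - norm w)"
  using q[OF assms] q[OF assms(2,1)] by (simp_all add: cross_def norm_divide norm_inverse)
qed

lemma tendsto_powi_zero:
 fixes m :: int
 shows "c > 0 \<Longrightarrow> (\<lambda>J. w powi (m + c * int J)) \<longlonglongrightarrow> 0"
proof -
 assume c: "c > 0"
 have "(\<lambda>J. (w powi c)^J) \<longlonglongrightarrow> 0"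
 proof (rule LIMSEQ_power_zero)
  have "norm (w powi c) \<le> norm w" using norm_powi_le[of 1 c] c by simp
  then show "norm (w powi c) < 1" using w(2) by (rule le_less_trans)
 qed
 then have "(\<lambda>J. w powi m * (w powi c)^J) \<longlonglongrightarrow> w powi m * 0" by (rule tendsto_mult_left)
 moreover have "w powi m * (w powi c)^J = w powi (m + c * int J)" for J using w by (simp add: power_int_add power_int_power')
 ultimately show ?thesis by (simp only: mult_zero_right)
qed

end

context chain_weight
begin

text \<open>Bounds \<open>ends'\<close> and its inverse independently of \<open>J\<close>. Over
  \<open>l\<close> steps \<open>cor\<close> therefore grows at most geometrically, which the
  Gaussian in \<open>mono\<close> beats.\<close>

definition rim :: real where "rim = ((1 + norm w) / (1 - norm w))^(2 * R)"

lemma rim_ge_1: "1 \<le> rim" unfolding rim_def using w by (intro one_le_power) (simp add: field_simps)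

lemma rim_exponents:
 assumes "i < R" "low J i \<le> l" "l < int J" "j < R"
 shows "ex j (int J) + ex i l > 0" "ex j (int J) - ex i l > 0"
  "j \<notin> L \<Longrightarrow> - ex j (- int J - 1) + ex i l > 0" "j \<notin> L \<Longrightarrow> - ex j (- int J - 1) - ex i l > 0"
proof -
 have l: "- int J \<le> l" using assms(2) by (auto simp: low_def split: if_splits)
 note b = b_pos[OF assms(1)] b_pos[OF assms(4)] b_le[OF assms(1)] b_le[OF assms(4)] b_sum[OF assms(1,4)]
 have 1: "0 \<le> int N * (int J + l)" using l by simp
 have 2: "int N * 1 \<le> int N * (int J - l)" using assms(3) by (intro mult_left_mono) auto
 show "ex j (int J) + ex i l > 0" "ex j (int J) - ex i l > 0"
  "j \<notin> L \<Longrightarrow> - ex j (- int J - 1) + ex i l > 0" "j \<notin> L \<Longrightarrow> - ex j (- int J - 1) - ex i l > 0"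
  using b 1 2 N by (auto simp: ex_def algebra_simps)
qed

lemma norm_ends'_le:
 assumes "i < R" "low J i \<le> l" "l < int J"
 shows "norm (ends' J (ex i l)) \<le> rim" "norm (inverse (ends' J (ex i l))) \<le> rim"
proof -
 let ?n = "ex i l" and ?B = "(1 + norm w) / (1 - norm w)"
 have B: "?B \<ge> 1" using w by (simp add: field_simps)
 have 1: "norm (cross ?n (ex j (int J))) \<le> ?B" "norm (inverse (cross ?n (ex j (int J)))) \<le> ?B" if "j < R" for j
  using norm_cross_le[OF rim_exponents(1,2)[OF assms that]] .
 have 2: "norm (cross ?n (- ex j (- int J - 1))) \<le> ?B" "norm (inverse (cross ?n (- ex j (- int J - 1)))) \<le> ?B"
  if "j < R" "j \<notin> L" for j using norm_cross_le[OF rim_exponents(3,4)[OF assms that]] .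
 have c: "card ({..<R} - L) \<le> R" using card_mono[of "{..<R}" "{..<R} - L"] by simp
 have r: "?B^R * ?B^card ({..<R} - L) \<le> rim" unfolding rim_def mult_2 power_add using B c by (intro mult_left_mono power_increasing) auto
 have "norm (ends' J ?n) \<le> (\<Prod>j<R. ?B) * (\<Prod>j\<in>{..<R} - L. ?B)" unfolding ends'_def norm_mult prod_norm[symmetric] using B 1 2
  by (intro mult_mono prod_mono prod_nonneg) auto
 also have "\<dots> \<le> rim" using r by simp
 finally show "norm (ends' J ?n) \<le> rim" .
 have "inverse (ends' J ?n) = (\<Prod>j<R. inverse (cross ?n (ex j (int J)))) * (\<Prod>j\<in>{..<R} - L. inverse (cross ?n (- ex j (- int J - 1))))"
  unfolding ends'_def inverse_mult_distrib prod_inversef[symmetric] comp_def ..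
 also have "norm \<dots> \<le> (\<Prod>j<R. ?B) * (\<Prod>j\<in>{..<R} - L. ?B)" unfolding norm_mult prod_norm[symmetric] using B 1 2
  by (intro mult_mono prod_mono prod_nonneg) auto
 also have "\<dots> \<le> rim" using r by simp
 finally show "norm (inverse (ends' J ?n)) \<le> rim" .
qed

lemma norm_cor_le:
 assumes "i < R" "low J i \<le> l" "l \<le> int J"
 shows "norm (cor J i l) \<le> rim^nat \<bar>l\<bar>"
proof (cases "0 \<le> l")
 case True
 have "norm (cor J i l) \<le> (\<Prod>m\<in>{0..<l}. rim)" using True unfolding cor_def if_P[OF True] prod_norm[symmetric]
 proof (intro prod_mono conjI norm_ge_zero)
  fix m assume "m \<in> {0..<l}"
  then have "low J i \<le> m" "m < int J" using assms by (auto simp: low_def)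
  then show "norm (inverse (ends' J (ex i m))) \<le> rim" using assms(1) by (intro norm_ends'_le)
 qed
 also have "\<dots> = rim^nat \<bar>l\<bar>" using True by simp
 finally show ?thesis .
next
 case False
 have "norm (cor J i l) \<le> (\<Prod>m\<in>{l..<0}. rim)" unfolding cor_def if_not_P[OF False] prod_norm[symmetric]
 proof (intro prod_mono conjI norm_ge_zero)
  fix m assume "m \<in> {l..<0}"
  then have "low J i \<le> m" "m < int J" using assms False by auto
  then show "norm (ends' J (ex i m)) \<le> rim" using assms(1) by (intro norm_ends'_le)
 qed
 also have "\<dots> = rim^nat \<bar>l\<bar>" using False by simp
 finally show ?thesis .
qed

lemma cross_tendsto_1:
 fixes u n c :: int
 assumes "c > 0"
 shows "(\<lambda>J. cross n (u + c * int J)) \<longlonglongrightarrow> 1"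
proof -
 have "(\<lambda>J. (1 - w powi ((u + n) + c * int J)) / (1 - w powi ((u - n) + c * int J))) \<longlonglongrightarrow> (1 - 0) / (1 - 0)"
  using assms by (intro tendsto_intros tendsto_powi_zero) auto
 then show ?thesis by (simp add: cross_def algebra_simps)
qed

lemma ends'_tendsto_1: "(\<lambda>J. ends' J n) \<longlonglongrightarrow> 1"
proof -
 have "ex j (int J) = 2 * (int N + b j) + 4 * int N * int J" "- ex j (- int J - 1) = 2 * (int N - b j) + 4 * int N * int J" for j J
  by (simp_all add: ex_def algebra_simps)
 then have "(\<lambda>J. cross n (ex j (int J))) \<longlonglongrightarrow> 1" "(\<lambda>J. cross n (- ex j (- int J - 1))) \<longlonglongrightarrow> 1" for j
  using N by (simp_all only: cross_tendsto_1)
 then have "(\<lambda>J. ends' J n) \<longlonglongrightarrow> (\<Prod>j<R. 1) * (\<Prod>j\<in>{..<R} - L. 1)"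
  unfolding ends'_def by (intro tendsto_mult tendsto_prod)
 then show ?thesis by simp
qed

lemma cor_tendsto_1: "(\<lambda>J. cor J i l) \<longlonglongrightarrow> 1"
proof (cases "0 \<le> l")
 case True
 have "(\<lambda>J. \<Prod>m\<in>{0..<l}. inverse (ends' J (ex i m))) \<longlonglongrightarrow> (\<Prod>m\<in>{0..<l}. inverse 1)"
  by (intro tendsto_prod tendsto_inverse ends'_tendsto_1) auto
 then show ?thesis using True by (simp add: cor_def)
next
 case False
 have "(\<lambda>J. \<Prod>m\<in>{l..<0}. ends' J (ex i m)) \<longlonglongrightarrow> (\<Prod>m\<in>{l..<0}. 1)"
  by (intro tendsto_prod ends'_tendsto_1)
 then show ?thesis using False by (simp add: cor_def)
qed

definition span :: "nat \<Rightarrow> int set" where "span i = (if i \<in> L then {0..} else UNIV)"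

lemma norm_entry_le:
 assumes "i < R"
 shows "norm (entry i l j) \<le> 2 * norm w powi (2 * K * int N * (l * l - \<bar>l\<bar>) - int (a + 2 * j) * (int N + 2 * int N * \<bar>l\<bar>))"
proof -
 let ?c = "int (a + 2 * j)"
 let ?M = "- (?c * (int N + 2 * int N * \<bar>l\<bar>))"
 have e: "entry i l j = mono i l * (w powi (?c * beta i l) - w powi (- (?c * beta i l)))"
  by (simp add: entry_def power_int_power' power_inverse mult.commute power_int_minus flip: power_int_minus of_nat_Suc)
 have "\<bar>b i + 2 * int N * l\<bar> \<le> \<bar>b i\<bar> + \<bar>2 * int N * l\<bar>" by (rule abs_triangle_ineq)
 then have "\<bar>beta i l\<bar> \<le> int N + 2 * int N * \<bar>l\<bar>" using b_pos[OF assms] b_le[OF assms] by (simp add: beta_def abs_mult)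
 then have "\<bar>?c * beta i l\<bar> \<le> - ?M" by (simp add: abs_mult mult_left_mono)
 then have M: "?M \<le> ?c * beta i l" "?M \<le> - (?c * beta i l)" by linarith+
 have "norm (w powi (?c * beta i l) - w powi (- (?c * beta i l))) \<le> norm w powi ?M + norm w powi ?M"
  using norm_triangle_ineq4[of "w powi (?c * beta i l)" "w powi (- (?c * beta i l))"]
   norm_powi_le[OF M(1)] norm_powi_le[OF M(2)] by linarith
 moreover have "norm (mono i l) \<le> norm w powi (2 * K * int N * (l * l - \<bar>l\<bar>))"
 proof -
  have "norm (sg powi l) = 1" using sg by (auto simp: norm_power_int)
  then have "norm (mono i l) = norm (w powi (2 * K * (int N * l * l + b i * l)))" by (simp add: mono_def norm_mult)
  also have "\<dots> \<le> norm w powi (2 * K * int N * (l * l - \<bar>l\<bar>))"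
  proof (rule norm_powi_le)
   have "\<bar>b i * l\<bar> \<le> int N * \<bar>l\<bar>" using b_pos[OF assms] b_le[OF assms] by (simp add: abs_mult mult_right_mono)
   then have "int N * (l * l - \<bar>l\<bar>) \<le> int N * l * l + b i * l" by (simp add: algebra_simps abs_le_iff)
   then have "2 * K * (int N * (l * l - \<bar>l\<bar>)) \<le> 2 * K * (int N * l * l + b i * l)" using K by (intro mult_left_mono) auto
   then show "2 * K * int N * (l * l - \<bar>l\<bar>) \<le> 2 * K * (int N * l * l + b i * l)" by (simp add: mult.assoc)
  qed
  finally show ?thesis .
 qed
 ultimately have "norm (entry i l j) \<le> norm w powi (2 * K * int N * (l * l - \<bar>l\<bar>)) * (norm w powi ?M + norm w powi ?M)"
  unfolding e norm_mult using w by (intro mult_mono) auto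
 also have "\<dots> = 2 * norm w powi (2 * K * int N * (l * l - \<bar>l\<bar>) + ?M)"
  using power_int_add[of "norm w" "2 * K * int N * (l * l - \<bar>l\<bar>)" ?M] w by (simp only: norm_eq_zero disj_not1 simp_thms mult_2 distrib_left)
 finally show ?thesis by (simp only: diff_conv_add_uminus)
qed

text \<open>Dominated convergence: the truncated sum is extended by 0 to all cuts, and the majorant
  \<open>G\<close> is a Gaussian times a geometric factor that covers \<open>cor\<close> and all
  linear exponents.\<close>

lemma entry_tendsto:
 assumes i: "i < R"
 shows "(\<lambda>J. \<Sum>l\<in>{low J i..int J}. cor J i l * entry i l j) \<longlonglongrightarrow> infsum (\<lambda>l. entry i l j) (span i)"
  and "(\<lambda>l. entry i l j) summable_on span i"
proof -
 let ?c = "int (a + 2 * j)"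
 let ?D = "norm w powi (- 2 * K * int N - 2 * ?c * int N)"
 let ?E = "2 * norm w powi (- ?c * int N)"
 define G where "G = (\<lambda>l. ?E * ((norm w powi (2 * K * int N))^nat (l * l) * (rim * ?D)^nat \<bar>l\<bar>))"
 define F where "F = (\<lambda>J l. if l \<in> {low J i..int J} then cor J i l * entry i l j else 0)"
 have rho: "norm w powi (2 * K * int N) < 1"
 proof -
  have "1 \<le> 2 * K * int N" using K N by (simp add: int_one_le_iff_zero_less)
  then have "norm (w powi (2 * K * int N)) \<le> norm w powi 1" by (rule norm_powi_le)
  then show ?thesis using w by (simp add: norm_power_int)
 qed
 have r0: "0 \<le> rim" using rim_ge_1 by simp
 have "G summable_on UNIV" unfolding G_def using rho w r0 by (intro summable_on_cmult_right summable_gaussian) auto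
 then have G: "G summable_on span i" by (rule summable_on_subset_banach) auto
 have bound: "norm (F J l) \<le> G l" for J l
 proof (cases "l \<in> {low J i..int J}")
  case True
  have n: "int (nat (l * l)) = l * l" "int (nat \<bar>l\<bar>) = \<bar>l\<bar>" by simp_all
  have "norm w powi (2 * K * int N * (l * l - \<bar>l\<bar>) - ?c * (int N + 2 * int N * \<bar>l\<bar>)) =
    norm w powi (2 * K * int N * int (nat (l * l)) + (- 2 * K * int N - 2 * ?c * int N) * int (nat \<bar>l\<bar>) + (- ?c * int N))"
   unfolding n by (intro arg_cong[where f = "power_int (norm w)"]) (simp add: algebra_simps)
  also have "\<dots> = (norm w powi (2 * K * int N))^nat (l * l) * ?D^nat \<bar>l\<bar> * norm w powi (- ?c * int N)"
   using w by (simp only: power_int_add power_int_power' norm_eq_zero disj_not1 simp_thms)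
  finally have "norm (entry i l j) \<le> 2 * ((norm w powi (2 * K * int N))^nat (l * l) * ?D^nat \<bar>l\<bar> * norm w powi (- ?c * int N))"
   using norm_entry_le[OF i, of l j] by simp
  then have "norm (cor J i l * entry i l j) \<le> rim^nat \<bar>l\<bar> *
    (2 * ((norm w powi (2 * K * int N))^nat (l * l) * ?D^nat \<bar>l\<bar> * norm w powi (- ?c * int N)))"
   unfolding norm_mult using norm_cor_le[OF i, of J l] True r0 by (intro mult_mono) auto
  also have "\<dots> = G l" unfolding G_def power_mult_distrib by (simp only: mult_ac)
  finally show ?thesis using True by (simp add: F_def)
 next
  case False
  have "0 \<le> G l" using w r0 by (simp add: G_def)
  then show ?thesis using False by (simp only: F_def if_False norm_zero)
 qed
 have lim: "(\<lambda>J. F J l) \<longlonglongrightarrow> entry i l j" if l: "l \<in> span i" for l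
 proof -
  have "\<forall>\<^sub>F J in sequentially. cor J i l * entry i l j = F J l" using eventually_ge_at_top[of "nat \<bar>l\<bar>"]
  proof eventually_elim
   case (elim J)
   then have "l \<in> {low J i..int J}" using l by (auto simp: span_def low_def split: if_splits)
   then show ?case by (simp add: F_def)
  qed
  moreover have "(\<lambda>J. cor J i l * entry i l j) \<longlonglongrightarrow> 1 * entry i l j" by (intro tendsto_intros cor_tendsto_1)
  ultimately show ?thesis by (simp add: tendsto_cong)
 qed
 have "infsum (F J) (span i) = (\<Sum>l\<in>{low J i..int J}. cor J i l * entry i l j)" for J
 proof -
  have "infsum (F J) (span i) = infsum (F J) {low J i..int J}" by (rule infsum_cong_neutral) (auto simp: F_def span_def low_def split: if_splits)
  also have "\<dots> = sum (F J) {low J i..int J}" by simp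
  also have "\<dots> = (\<Sum>l\<in>{low J i..int J}. cor J i l * entry i l j)" by (intro sum.cong) (auto simp: F_def)
  finally show ?thesis .
 qed
 then show "(\<lambda>J. \<Sum>l\<in>{low J i..int J}. cor J i l * entry i l j) \<longlonglongrightarrow> infsum (\<lambda>l. entry i l j) (span i)"
  "(\<lambda>l. entry i l j) summable_on span i"
  using tendsto_infsum_dominated[of "span i" F "\<lambda>l. entry i l j" G, OF lim bound G] by simp_all
qed

text \<open>With offset \<open>N\<close> the cuts \<open>l\<close> and \<open>- 1 - l\<close> have
  opposite \<open>beta\<close>. The power of \<open>sg\<close> and the odd difference both change
  sign, so the half progression carries exactly half of a two-sided theta series.\<close>

lemma entry_reflect:
 assumes "i \<in> L" "sg = -1"
 shows "entry i (-1 - l) j = entry i l j"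
proof -
 have i: "i < R" "b i = int N" using assms L b_special by auto
 have "mono i (-1 - l) = - mono i l"
 proof -
  have "int N * (-1 - l) * (-1 - l) + int N * (-1 - l) = int N * l * l + int N * l" by (simp add: algebra_simps)
  moreover have "sg powi (-1 - l) = - (sg powi l)" unfolding assms(2) by (cases "even l") (simp_all add: power_int_diff)
  ultimately show ?thesis by (simp add: mono_def i)
 qed
 moreover have "beta i (-1 - l) = - beta i l" by (simp add: beta_def i algebra_simps)
 ultimately show ?thesis by (simp add: entry_def power_int_minus algebra_simps)
qed

definition total :: "nat \<Rightarrow> nat \<Rightarrow> complex" where
 "total i j = infsum (\<lambda>l. entry i l j) UNIV"

lemma entry_summable:
 assumes "i < R" "i \<in> L \<Longrightarrow> sg = -1"
 shows "(\<lambda>l. entry i l j) summable_on UNIV"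
  and "infsum (\<lambda>l. entry i l j) (span i) = (if i \<in> L then total i j / 2 else total i j)"
proof -
 have "(\<lambda>l. entry i l j) summable_on UNIV \<and> infsum (\<lambda>l. entry i l j) (span i) = (if i \<in> L then total i j / 2 else total i j)"
 proof (cases "i \<in> L")
  case False
  then show ?thesis using entry_tendsto(2)[OF assms(1), of j] by (simp add: span_def total_def)
 next
  case True
  let ?f = "\<lambda>l. entry i l j" and ?r = "\<lambda>l :: int. -1 - l"
  have inj: "inj_on ?r {0..}" by (auto simp: inj_on_def)
  have s: "?f summable_on {0..}" using entry_tendsto(2)[OF assms(1), of j] True by (simp add: span_def)
  have im: "?r ` {0..} = {..<0}" by (auto simp: image_iff intro: bexI[of _ "-1 - _"])
  have c: "?f \<circ> ?r = ?f" using entry_reflect[OF True] assms(2) True by (auto simp: fun_eq_iff)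
  have s': "?f summable_on {..<0}" using s summable_on_reindex[OF inj, of ?f] unfolding im c by simp
  have i': "infsum ?f {..<0} = infsum ?f {0..}" using infsum_reindex[OF inj, of ?f] unfolding im c by simp
  have U: "UNIV = {0::int..} \<union> {..<0}" by auto
  have "?f summable_on UNIV" unfolding U using s s' by (rule summable_on_union)
  moreover have "total i j = infsum ?f {0..} + infsum ?f {..<0}" unfolding total_def U using s s' by (intro infsum_Un_disjoint) auto
  ultimately show ?thesis using True i' by (simp add: span_def)
 qed
 then show "(\<lambda>l. entry i l j) summable_on UNIV"
  "infsum (\<lambda>l. entry i l j) (span i) = (if i \<in> L then total i j / 2 else total i j)" by blast+
qed

text \<open>The normalisation \<open>c J\<close> is left free: in the first system the weights
  contain \<open>e^(-k)\<close> and need a monomial prefactor to converge, in the second it is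
  1.\<close>

theorem section_sum_limit:
 assumes L': "L \<noteq> {} \<Longrightarrow> sg = -1" and T: "(\<lambda>J. c J * wt J zero) \<longlonglongrightarrow> T0"
 shows "(\<lambda>J. c J * section_sum g nome (omega J)) \<longlonglongrightarrow> T0 / denom zero * (1 / 2)^card L * leibniz R total"
proof -
 have "(\<lambda>J. c J * wt J zero * leibniz R (\<lambda>i j. \<Sum>l\<in>{low J i..int J}. cor J i l * entry i l j)) \<longlonglongrightarrow>
  T0 * leibniz R (\<lambda>i j. infsum (\<lambda>l. entry i l j) (span i))"
  unfolding leibniz_def by (intro tendsto_mult T tendsto_sum tendsto_const tendsto_prod entry_tendsto) auto
 then have "(\<lambda>J. c J * (section_sum g nome (omega J) * denom zero) / denom zero) \<longlonglongrightarrow>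
  T0 * leibniz R (\<lambda>i j. infsum (\<lambda>l. entry i l j) (span i)) / denom zero"
  unfolding section_sum_leibniz mult.assoc[symmetric] by (rule tendsto_divide[OF _ tendsto_const denom_nz])
 moreover have "leibniz R (\<lambda>i j. infsum (\<lambda>l. entry i l j) (span i)) = (1 / 2)^card L * leibniz R total"
 proof -
  have "(\<Prod>i<R. infsum (\<lambda>l. entry i l (\<pi> i)) (span i)) = (1 / 2)^card L * (\<Prod>i<R. total i (\<pi> i))" for \<pi>
  proof -
   have "(\<Prod>i<R. infsum (\<lambda>l. entry i l (\<pi> i)) (span i)) = (\<Prod>i<R. (if i \<in> L then 1 / 2 else 1) * total i (\<pi> i))"
    using L' by (intro prod.cong refl) (subst entry_summable(2), auto)
   also have "\<dots> = (\<Prod>i<R. if i \<in> L then 1 / 2 else 1) * (\<Prod>i<R. total i (\<pi> i))" by (rule prod.distrib)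
   also have "(\<Prod>i<R. if i \<in> L then 1 / 2 else 1 :: complex) = (\<Prod>i\<in>L. 1 / 2)"
    using L by (intro prod.mono_neutral_cong_right) auto
   finally show ?thesis by simp
  qed
  then show ?thesis unfolding leibniz_def by (simp add: sum_distrib_left mult_ac)
 qed
 ultimately show ?thesis using denom_nz by (simp add: mult_ac)
qed

end

section \<open>q-shifted factorials\<close>

lemma prod_group_mod:
 fixes f :: "nat \<Rightarrow> 'a::comm_monoid_mult"
 shows "prod f {..<n * C} = (\<Prod>c<C. \<Prod>i<n. f (i * C + c))"
proof -
 have "prod f {..<n * C} = (\<Prod>i<n. prod f {i * C..<i * C + C})" by (rule prod.nat_group[symmetric])
 also have "\<dots> = (\<Prod>i<n. \<Prod>c<C. f (i * C + c))"
 proof (rule prod.cong[OF refl])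
  fix i
  show "prod f {i * C..<i * C + C} = (\<Prod>c<C. f (i * C + c))"
   using prod.shift_bounds_nat_ivl[of f 0 "i * C" C] by (simp add: atLeast0LessThan add.commute)
 qed
 also have "\<dots> = (\<Prod>c<C. \<Prod>i<n. f (i * C + c))" by (rule prod.swap)
 finally show ?thesis .
qed

lemma convergent_prod_qpoch:
 fixes q :: complex
 assumes "norm q < 1"
 shows "convergent_prod (\<lambda>i. 1 - a * q^i)"
proof (intro abs_convergent_prod_imp_convergent_prod summable_imp_abs_convergent_prod)
 have "summable (\<lambda>i. norm a * norm q^i)" using assms by (intro summable_mult summable_geometric) auto
 then show "summable (\<lambda>i. norm (1 - a * q^i - 1))" by (simp add: norm_mult norm_power)
qed

lemma qpoch_LIMSEQ:
 assumes "norm q < 1"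
 shows "(\<lambda>n. \<Prod>i<n. 1 - a * q^i) \<longlonglongrightarrow> qpoch_inf a q"
 using convergent_prod_LIMSEQ[OF convergent_prod_qpoch[OF assms]]
 unfolding qpoch_inf_def by (rule_tac LIMSEQ_imp_Suc) (simp add: lessThan_Suc_atMost)

context
 fixes q :: complex
 assumes q: "norm q < 1"
begin

lemma qpoch_nz: "(\<And>i. a * q^i \<noteq> 1) \<Longrightarrow> qpoch_inf a q \<noteq> 0"
 unfolding qpoch_inf_def by (rule prodinf_nonzero[OF convergent_prod_qpoch[OF q]]) (metis eq_iff_diff_eq_0)

lemma qpoch_nz_norm: assumes "norm a < 1" shows "qpoch_inf a q \<noteq> 0"
proof (rule qpoch_nz)
 fix i
 have "norm (a * q^i) \<le> norm a * 1" unfolding norm_mult norm_power using q by (intro mult_left_mono power_le_one) auto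
 then show "a * q^i \<noteq> 1" using assms by auto
qed

lemma qpoch_split: "qpoch_inf a q = (\<Prod>i<n. 1 - a * q^i) * qpoch_inf (a * q^n) q"
proof (rule LIMSEQ_unique)
 show "(\<lambda>m. \<Prod>i<m + n. 1 - a * q^i) \<longlonglongrightarrow> qpoch_inf a q"
  using qpoch_LIMSEQ[OF q] by (rule LIMSEQ_ignore_initial_segment)
 have "(\<Prod>i<m + n. 1 - a * q^i) = (\<Prod>i<n. 1 - a * q^i) * (\<Prod>i<m. 1 - a * q^n * q^i)" for m
 proof (induction m)
  case (Suc m)
  then show ?case by (simp add: power_add mult_ac)
 qed simp
 then show "(\<lambda>m. \<Prod>i<m + n. 1 - a * q^i) \<longlonglongrightarrow> (\<Prod>i<n. 1 - a * q^i) * qpoch_inf (a * q^n) q"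
  using tendsto_mult_left[OF qpoch_LIMSEQ[OF q, of "a * q^n"]] by simp
qed

lemma qpoch_multisection:
 assumes "C > 0"
 shows "qpoch_inf a q = (\<Prod>c<C. qpoch_inf (a * q^c) (q^C))"
proof (rule LIMSEQ_unique)
 have qC: "norm (q^C) < 1" unfolding norm_power using q assms by (simp add: power_less_one_iff)
 have "filterlim (\<lambda>n. n * C) at_top sequentially" using assms by (intro filterlim_subseq) (simp add: strict_mono_def)
 then show "(\<lambda>n. \<Prod>i<n * C. 1 - a * q^i) \<longlonglongrightarrow> qpoch_inf a q" by (rule filterlim_compose[OF qpoch_LIMSEQ[OF q]])
 have "(\<Prod>i<n * C. 1 - a * q^i) = (\<Prod>c<C. \<Prod>i<n. 1 - a * q^c * (q^C)^i)" for n
  unfolding prod_group_mod by (simp add: power_add power_mult[symmetric] mult_ac)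
 moreover note qpoch_LIMSEQ[OF qC, of "a * q^_"]
 ultimately show "(\<lambda>n. \<Prod>i<n * C. 1 - a * q^i) \<longlonglongrightarrow> (\<Prod>c<C. qpoch_inf (a * q^c) (q^C))"
  by (simp add: tendsto_prod)
qed

lemma qpoch_parity: "qpoch_inf a q = qpoch_inf a (q\<^sup>2) * qpoch_inf (a * q) (q\<^sup>2)"
 using qpoch_multisection[of 2 a] by (simp add: lessThan_nat_numeral)

end

lemma qpoch_square:
 assumes q: "norm q < 1"
 shows "qpoch_inf (a\<^sup>2) (q\<^sup>2) = qpoch_inf a q * qpoch_inf (- a) q"
proof (rule LIMSEQ_unique)
 have "norm (q\<^sup>2) < 1" unfolding norm_power using q by (simp add: power_less_one_iff)
 then show "(\<lambda>n. \<Prod>i<n. 1 - a\<^sup>2 * (q\<^sup>2)^i) \<longlonglongrightarrow> qpoch_inf (a\<^sup>2) (q\<^sup>2)" by (rule qpoch_LIMSEQ)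
 have "1 - a\<^sup>2 * (q\<^sup>2)^i = (1 - a * q^i) * (1 - (- a) * q^i)" for i
 proof -
  have "(q\<^sup>2)^i = (q^i)\<^sup>2" by (simp add: power_mult[symmetric] mult.commute)
  then show ?thesis by (simp add: power2_eq_square algebra_simps)
 qed
 then have e: "(\<lambda>n. \<Prod>i<n. 1 - a\<^sup>2 * (q\<^sup>2)^i) = (\<lambda>n. (\<Prod>i<n. 1 - a * q^i) * (\<Prod>i<n. 1 - (- a) * q^i))"
  by (simp only: prod.distrib)
 show "(\<lambda>n. \<Prod>i<n. 1 - a\<^sup>2 * (q\<^sup>2)^i) \<longlonglongrightarrow> qpoch_inf a q * qpoch_inf (- a) q"
  unfolding e by (intro tendsto_mult qpoch_LIMSEQ[OF q])
qed

text \<open>Euler's identity behind partitions into distinct and into odd parts: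
  \<open>(q; q)\<close> is split by parity of the index, and \<open>(q^2; q^2)\<close> into
  conjugate factors.\<close>

lemma qpoch_euler:
 assumes q: "norm q < 1"
 shows "qpoch_inf (- q) q * qpoch_inf q (q\<^sup>2) = 1"
proof -
 have "norm (q\<^sup>2) < 1" unfolding norm_power using q by (simp add: power_less_one_iff)
 then have nz: "qpoch_inf (q\<^sup>2) (q\<^sup>2) \<noteq> 0" by (intro qpoch_nz_norm)
 have "qpoch_inf (q\<^sup>2) (q\<^sup>2) = qpoch_inf q q * qpoch_inf (- q) q" by (rule qpoch_square[OF q])
 also have "qpoch_inf q q = qpoch_inf q (q\<^sup>2) * qpoch_inf (q\<^sup>2) (q\<^sup>2)"
  using qpoch_parity[OF q, of q] by (simp add: power2_eq_square)
 finally have "qpoch_inf (q\<^sup>2) (q\<^sup>2) * 1 = qpoch_inf (q\<^sup>2) (q\<^sup>2) * (qpoch_inf (- q) q * qpoch_inf q (q\<^sup>2))"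
  by (simp add: mult_ac)
 then show ?thesis using nz by (simp only: mult_cancel_left) simp
qed

text \<open>A quotient of two partial products of the same convergent, nonvanishing infinite
  product.\<close>

lemma prod_ratio_tendsto:
 fixes q c :: complex
 assumes q: "norm q < 1" and c: "norm c < 1"
 shows "(\<lambda>M. \<Prod>m<M. 1 - c * q^(m + M)) \<longlonglongrightarrow> 1"
proof -
 let ?P = "\<lambda>M. \<Prod>i<M. 1 - c * q^i"
 have nz: "1 - c * q^i \<noteq> 0" for i
 proof -
  have "norm (c * q^i) \<le> norm c * 1" unfolding norm_mult norm_power using q by (intro mult_left_mono power_le_one) auto
  then show ?thesis using c by auto
 qed
 have "filterlim (\<lambda>n::nat. n + n) at_top sequentially" by (intro filterlim_subseq) (simp add: strict_mono_def)
 then have "(\<lambda>M. ?P (M + M)) \<longlonglongrightarrow> qpoch_inf c q" by (rule filterlim_compose[OF qpoch_LIMSEQ[OF q]])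
 then have "(\<lambda>M. ?P (M + M) / ?P M) \<longlonglongrightarrow> qpoch_inf c q / qpoch_inf c q"
  using qpoch_nz_norm[OF q c] by (intro tendsto_divide qpoch_LIMSEQ[OF q])
 moreover have "?P (M + M) / ?P M = (\<Prod>m<M. 1 - c * q^(m + M))" for M
 proof -
  have "?P (n + M) = ?P M * (\<Prod>m<n. 1 - c * q^(m + M))" for n by (induction n) (simp_all add: mult_ac)
  moreover have "?P M \<noteq> 0" using nz by simp
  ultimately show ?thesis by simp
 qed
 ultimately show ?thesis using qpoch_nz_norm[OF q c] by simp
qed

section \<open>Limits of section weights over geometric progressions\<close>

lemma norm_mult_power_less_1:
 fixes a q :: complex
 assumes "norm a < 1" "norm q < 1"
 shows "norm (a * q^i) < 1"
proof -
 have "norm (a * q^i) \<le> norm a * 1" unfolding norm_mult norm_power using assms by (intro mult_left_mono power_le_one) auto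
 then show ?thesis using assms by simp
qed

lemma one_minus_nz: "norm (a::complex) < 1 \<Longrightarrow> 1 - a \<noteq> 0" by auto

text \<open>With \<open>t = q^N\<close> the factor of two elements is
  \<open>e (m + n + N) / e (m + n)\<close>, where \<open>e\<close> depends on the sum of the indices
  only, and such quotients telescope. The right-hand side is the part that tends to 1; the product
  on the left gives the reciprocal of the limit.\<close>

lemma pair_prod_geometric:
 fixes q z :: complex
 assumes q: "norm q < 1" and z: "norm z < 1" and inj: "inj (\<lambda>n. z * q^n)"
 shows "pair_prod (hlC (q^N)) ((\<lambda>n. z * q^n) ` {..<M}) * (\<Prod>d<N. \<Prod>m<M. 1 - z\<^sup>2 * q^Suc d * (q\<^sup>2)^m) =
  (\<Prod>d<N. \<Prod>m<M. 1 - z\<^sup>2 * q^d * q^(m + M))"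
proof (induction M)
 case 0
 then show ?case by simp
next
 case (Suc M)
 let ?x = "\<lambda>n. z * q^n"
 define e where "e n = 1 - z\<^sup>2 * q^n" for n
 have z2: "norm (z\<^sup>2) < 1" using z by (simp add: norm_power power_less_one_iff)
 have e0: "e n \<noteq> 0" for n unfolding e_def by (intro one_minus_nz norm_mult_power_less_1 z2 q)
 have im: "?x ` {..<Suc M} = insert (?x M) (?x ` {..<M})" by (simp add: lessThan_Suc)
 have "?x M \<notin> ?x ` {..<M}" using inj by (auto dest: injD)
 then have P: "pair_prod (hlC (q^N)) (?x ` {..<Suc M}) = (\<Prod>m<M. hlC (q^N) (?x M) (?x m)) * pair_prod (hlC (q^N)) (?x ` {..<M})"
  unfolding im using inj by (subst pair_prod_insert[OF hlC_commute]) (auto simp: prod.reindex inj_on_def dest: injD)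
 have h: "hlC (q^N) (?x M) (?x m) = e (m + M + N) / e (m + M)" for m by (simp add: hlC_def e_def power_add power2_eq_square mult_ac)
 have a: "1 - z\<^sup>2 * q^Suc d * (q\<^sup>2)^m = e (m + m + Suc d)" for d m
  by (simp add: e_def power_add power_mult[symmetric] mult_2 power2_eq_square mult_ac power_mult_distrib)
 have b: "1 - z\<^sup>2 * q^d * q^(m + M) = e (m + M + d)" for d m M by (simp add: e_def power_add mult_ac)
 have tel: "(\<Prod>d<N. e (m + M + d)) * e (m + M + N) = e (m + M) * (\<Prod>d<N. e (m + Suc M + d))" for m
  using prod.lessThan_Suc_shift[of "\<lambda>d. e (m + M + d)" N] by simp
 have IH: "pair_prod (hlC (q^N)) (?x ` {..<M}) * (\<Prod>d<N. \<Prod>m<M. e (m + m + Suc d)) = (\<Prod>m<M. \<Prod>d<N. e (m + M + d))"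
  using Suc.IH unfolding a b by (subst (2) prod.swap)
 have "(\<Prod>m<M. e (m + M + N) / e (m + M)) * (\<Prod>m<M. \<Prod>d<N. e (m + M + d)) = (\<Prod>m<M. \<Prod>d<N. e (m + Suc M + d))"
  unfolding prod.distrib[symmetric]
 proof (intro prod.cong[OF refl])
  fix m
  have "e (m + M + N) / e (m + M) * (\<Prod>d<N. e (m + M + d)) = ((\<Prod>d<N. e (m + M + d)) * e (m + M + N)) / e (m + M)" by simp
  then show "e (m + M + N) / e (m + M) * (\<Prod>d<N. e (m + M + d)) = (\<Prod>d<N. e (m + Suc M + d))" unfolding tel using e0 by simp
 qed
 then have "(\<Prod>m<M. e (m + M + N) / e (m + M)) * (pair_prod (hlC (q^N)) (?x ` {..<M}) * (\<Prod>d<N. \<Prod>m<M. e (m + m + Suc d))) *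
   (\<Prod>d<N. e (M + M + Suc d)) = (\<Prod>m<Suc M. \<Prod>d<N. e (m + Suc M + d))" unfolding IH by simp
 also have "\<dots> = (\<Prod>d<N. \<Prod>m<Suc M. e (m + Suc M + d))" by (rule prod.swap)
 finally show ?case unfolding P h a b by (simp add: prod.distrib mult_ac)
qed

lemma pair_prod_geometric_tendsto:
 fixes q z :: complex
 assumes q: "norm q < 1" and z: "norm z < 1" and inj: "inj (\<lambda>n. z * q^n)"
 shows "(\<lambda>M. pair_prod (hlC (q^N)) ((\<lambda>n. z * q^n) ` {..<M})) \<longlonglongrightarrow> inverse (\<Prod>d<N. qpoch_inf (z\<^sup>2 * q^Suc d) (q\<^sup>2))"
proof -
 let ?D = "\<lambda>M. \<Prod>d<N. \<Prod>m<M. 1 - z\<^sup>2 * q^Suc d * (q\<^sup>2)^m"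
 have z2: "norm (z\<^sup>2) < 1" "norm (q\<^sup>2) < 1" using z q by (simp_all add: norm_power power_less_one_iff)
 have n: "norm (z\<^sup>2 * q^d) < 1" for d using z2(1) q by (rule norm_mult_power_less_1)
 have "(\<lambda>M. (\<Prod>d<N. \<Prod>m<M. 1 - z\<^sup>2 * q^d * q^(m + M)) / ?D M) \<longlonglongrightarrow>
   (\<Prod>d<N. 1) / (\<Prod>d<N. qpoch_inf (z\<^sup>2 * q^Suc d) (q\<^sup>2))"
 proof (intro tendsto_divide tendsto_prod prod_ratio_tendsto[OF q n] qpoch_LIMSEQ[OF z2(2)])
  have "qpoch_inf (z\<^sup>2 * q^Suc d) (q\<^sup>2) \<noteq> 0" for d using qpoch_nz_norm[OF z2(2) n] .
  then show "(\<Prod>d<N. qpoch_inf (z\<^sup>2 * q^Suc d) (q\<^sup>2)) \<noteq> 0" by simp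
 qed
 moreover have "(\<Prod>d<N. \<Prod>m<M. 1 - z\<^sup>2 * q^d * q^(m + M)) / ?D M = pair_prod (hlC (q^N)) ((\<lambda>n. z * q^n) ` {..<M})" for M
 proof -
  have "1 - z\<^sup>2 * q^Suc d * (q\<^sup>2)^m \<noteq> 0" for d m by (intro one_minus_nz norm_mult_power_less_1[OF n z2(2)])
  then have "?D M \<noteq> 0" by simp
  then show ?thesis unfolding pair_prod_geometric[OF assms, symmetric] by simp
 qed
 ultimately show ?thesis by (simp add: inverse_eq_divide)
qed

lemma cross_prod_geometric_tendsto:
 fixes p u v :: complex
 assumes p: "norm p < 1" and u: "norm (u * v) < 1"
 shows "(\<lambda>J. \<Prod>l<J. \<Prod>m<J. hlC p (u * p^l) (v * p^m)) \<longlonglongrightarrow> inverse (qpoch_inf (u * v) p)"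
proof -
 define e where "e n = 1 - u * v * p^n" for n
 have e0: "e n \<noteq> 0" for n unfolding e_def by (intro one_minus_nz norm_mult_power_less_1 u p)
 have h: "hlC p (u * p^l) (v * p^m) = e (l + Suc m) / e (l + m)" for l m by (simp add: hlC_def e_def power_add mult_ac)
 have tel: "(\<Prod>m<J. e (l + Suc m) / e (l + m)) = e (l + J) / e l" for l J using e0 by (induction J) simp_all
 have "(\<lambda>J. (\<Prod>l<J. e (l + J)) / (\<Prod>l<J. e l)) \<longlonglongrightarrow> 1 / qpoch_inf (u * v) p"
  unfolding e_def using qpoch_nz_norm[OF p u] by (intro tendsto_divide prod_ratio_tendsto[OF p u] qpoch_LIMSEQ[OF p])
 then show ?thesis unfolding h tel by (simp only: prod_dividef inverse_eq_divide)
qed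

definition rays :: "(nat \<Rightarrow> complex) \<Rightarrow> complex \<Rightarrow> nat \<Rightarrow> nat \<Rightarrow> complex set" where
 "rays y p C J = (\<lambda>(c, l). y c * p^l) ` ({..<C} \<times> {..<J})"

lemma prod_rays:
 assumes "inj_on (\<lambda>(c, l). y c * p^l) ({..<C} \<times> UNIV)"
 shows "(\<Prod>e\<in>rays y p C J. f e) = (\<Prod>c<C. \<Prod>l<J. f (y c * p^l))"
proof -
 have "inj_on (\<lambda>(c, l). y c * p^l) ({..<C} \<times> {..<J})" by (rule inj_on_subset[OF assms]) auto
 then show ?thesis unfolding rays_def by (subst prod.reindex) (auto simp: prod.cartesian_product case_prod_unfold)
qed

lemma pair_prod_rays_tendsto:
 fixes p :: complex
 assumes p: "norm p < 1" and y: "\<And>c. c < C \<Longrightarrow> norm (y c) < 1"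
  and inj: "inj_on (\<lambda>(c, l). y c * p^l) ({..<C} \<times> UNIV)"
 shows "(\<lambda>J. pair_prod (hlC p) (rays y p C J)) \<longlonglongrightarrow>
  (\<Prod>c<C. inverse (qpoch_inf ((y c)\<^sup>2 * p) (p\<^sup>2))) * (\<Prod>c<C. \<Prod>d<c. inverse (qpoch_inf (y c * y d) p))" using y inj
proof (induction C)
 case 0
 then show ?case by (simp add: rays_def)
next
 case (Suc C)
 let ?A = "\<lambda>J. rays y p C J" and ?B = "\<lambda>J. (\<lambda>l. y C * p^l) ` {..<J}"
 have injC: "inj_on (\<lambda>(c, l). y c * p^l) ({..<C} \<times> UNIV)" by (rule inj_on_subset[OF Suc.prems(2)]) auto
 have IH: "(\<lambda>J. pair_prod (hlC p) (?A J)) \<longlonglongrightarrow>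
  (\<Prod>c<C. inverse (qpoch_inf ((y c)\<^sup>2 * p) (p\<^sup>2))) * (\<Prod>c<C. \<Prod>d<c. inverse (qpoch_inf (y c * y d) p))"
  using Suc.prems injC by (intro Suc.IH) auto
 have inj1: "inj (\<lambda>l. y C * p^l)"
 proof (rule injI)
  fix l m assume "y C * p^l = y C * p^m"
  then show "l = m" using inj_onD[OF Suc.prems(2), of "(C, l)" "(C, m)"] by auto
 qed
 have B: "(\<lambda>J. pair_prod (hlC p) (?B J)) \<longlonglongrightarrow> inverse (qpoch_inf ((y C)\<^sup>2 * p) (p\<^sup>2))"
  using pair_prod_geometric_tendsto[OF p _ inj1, of 1] Suc.prems(1)[of C] by simp
 have X: "(\<lambda>J. \<Prod>c<C. \<Prod>l<J. \<Prod>m<J. hlC p (y c * p^l) (y C * p^m)) \<longlonglongrightarrow> (\<Prod>c<C. inverse (qpoch_inf (y c * y C) p))"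
 proof (intro tendsto_prod cross_prod_geometric_tendsto p)
  fix c assume "c \<in> {..<C}"
  then have "norm (y c) < 1" "norm (y C) < 1" using Suc.prems by auto
  then have "norm (y c) * norm (y C) \<le> norm (y c) * 1" by (intro mult_left_mono) auto
  then show "norm (y c * y C) < 1" using \<open>norm (y c) < 1\<close> by (simp add: norm_mult)
 qed
 have un: "pair_prod (hlC p) (rays y p (Suc C) J) = pair_prod (hlC p) (?A J) * pair_prod (hlC p) (?B J) *
   (\<Prod>c<C. \<Prod>l<J. \<Prod>m<J. hlC p (y c * p^l) (y C * p^m))" for J
 proof -
  have s: "rays y p (Suc C) J = ?A J \<union> ?B J" by (auto simp: rays_def lessThan_Suc)
  have "?A J \<inter> ?B J = {}"
  proof -
   have "y c * p^l \<noteq> y C * p^m" if "c < C" for c l m using inj_onD[OF Suc.prems(2), of "(c, l)" "(C, m)"] that by auto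
   then show ?thesis by (auto simp: rays_def)
  qed
  then have "pair_prod (hlC p) (?A J \<union> ?B J) = pair_prod (hlC p) (?A J) * pair_prod (hlC p) (?B J) *
    (\<Prod>a\<in>?A J. \<Prod>b\<in>?B J. hlC p a b)" by (intro pair_prod_Un[OF hlC_commute]) (auto simp: rays_def)
  also have "(\<Prod>a\<in>?A J. \<Prod>b\<in>?B J. hlC p a b) = (\<Prod>c<C. \<Prod>l<J. \<Prod>m<J. hlC p (y c * p^l) (y C * p^m))"
   unfolding prod_rays[OF injC] using inj1 by (simp add: prod.reindex inj_on_def inj_def)
  finally show ?thesis unfolding s .
 qed
 have "(\<lambda>J. pair_prod (hlC p) (rays y p (Suc C) J)) \<longlonglongrightarrow>
  (\<Prod>c<C. inverse (qpoch_inf ((y c)\<^sup>2 * p) (p\<^sup>2))) * (\<Prod>c<C. \<Prod>d<c. inverse (qpoch_inf (y c * y d) p)) *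
   inverse (qpoch_inf ((y C)\<^sup>2 * p) (p\<^sup>2)) * (\<Prod>c<C. inverse (qpoch_inf (y c * y C) p))"
  unfolding un by (intro tendsto_mult[OF tendsto_mult[OF IH B] X])
 then show ?case by (simp add: mult_ac)
qed

lemma section_weight_rays_tendsto:
 fixes p :: complex
 assumes p: "norm p < 1" and y: "\<And>c. c < C \<Longrightarrow> norm (y c) < 1"
  and inj: "inj_on (\<lambda>(c, l). y c * p^l) ({..<C} \<times> UNIV)"
  and g: "\<And>c. c < C \<Longrightarrow> (\<lambda>J. \<Prod>l<J. g (y c * p^l)) \<longlonglongrightarrow> G c"
 shows "(\<lambda>J. section_weight g p (rays y p C J)) \<longlonglongrightarrow>
  (\<Prod>c<C. G c * inverse (qpoch_inf ((y c)\<^sup>2 * p) (p\<^sup>2))) * (\<Prod>c<C. \<Prod>d<c. inverse (qpoch_inf (y c * y d) p))"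
 unfolding section_weight_def prod_rays[OF inj] prod.distrib mult.assoc
 by (intro tendsto_mult[OF _ pair_prod_rays_tendsto[OF p y inj], unfolded mult.assoc] tendsto_prod g) auto

text \<open>The values \<open>r * X 0\<close>, \<open>r / X 0\<close>, \<open>r * X 1\<close>, ...
  are listed in this order. The two values of one \<open>j\<close> multiply to \<open>r^2\<close>;
  two different indices meet in four products.\<close>

lemma prod_pairs_interleaved:
 fixes f :: "complex \<Rightarrow> complex" and X :: "nat \<Rightarrow> complex" and r :: complex
 assumes "\<And>j. j < R \<Longrightarrow> X j \<noteq> 0"
 defines "y \<equiv> \<lambda>c. r * (if even c then X (c div 2) else inverse (X (c div 2)))"
 shows "(\<Prod>c<2 * R. \<Prod>d<c. f (y c * y d)) = (\<Prod>j<R. f (r\<^sup>2)) *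
  (\<Prod>j<R. \<Prod>i<j. f (r\<^sup>2 * (X j * X i)) * f (r\<^sup>2 * (X j / X i)) * (f (r\<^sup>2 * (X i / X j)) * f (r\<^sup>2 * inverse (X j * X i))))"
 using assms(1)
proof (induction R)
 case (Suc R)
 have s: "2 * Suc R = Suc (Suc (2 * R))" by simp
 have p: "(\<Prod>d<2 * R. h (y d)) = (\<Prod>i<R. h (r * X i) * h (r * inverse (X i)))" for h :: "complex \<Rightarrow> complex"
 proof (induction R)
  case (Suc R)
  then show ?case by (simp add: y_def mult_ac)
 qed simp
 have y: "y (2 * R) = r * X R" "y (Suc (2 * R)) = r * inverse (X R)" by (simp_all add: y_def)
 have "(\<Prod>d<2 * R. f (y (2 * R) * y d)) = (\<Prod>i<R. f (r\<^sup>2 * (X R * X i)) * f (r\<^sup>2 * (X R / X i)))"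
  using p[of "\<lambda>x. f (y (2 * R) * x)"] unfolding y by (simp only: power2_eq_square divide_inverse mult_ac)
 moreover have "(\<Prod>d<2 * R. f (y (Suc (2 * R)) * y d)) = (\<Prod>i<R. f (r\<^sup>2 * (X i / X R)) * f (r\<^sup>2 * inverse (X R * X i)))"
  using p[of "\<lambda>x. f (y (Suc (2 * R)) * x)"] unfolding y by (simp only: power2_eq_square divide_inverse mult_ac inverse_mult_distrib)
 moreover have "y (Suc (2 * R)) * y (2 * R) = r\<^sup>2" unfolding y using Suc.prems[of R] by (simp add: power2_eq_square)
 moreover have IH: "(\<Prod>c<2 * R. \<Prod>d<c. f (y c * y d)) = (\<Prod>j<R. f (r\<^sup>2)) *
  (\<Prod>j<R. \<Prod>i<j. f (r\<^sup>2 * (X j * X i)) * f (r\<^sup>2 * (X j / X i)) * (f (r\<^sup>2 * (X i / X j)) * f (r\<^sup>2 * inverse (X j * X i))))"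
  using Suc.prems by (intro Suc.IH) auto
 ultimately show ?case unfolding s by (simp only: prod.lessThan_Suc prod.distrib mult_ac)
qed simp

text \<open>As the bounds \<open>m n\<close> are summable, from a late \<open>n0\<close> on the
  recurrence is almost a pure shift: \<open>\<beta> (n0 + d) 0\<close> is close to
  \<open>\<beta> n0 d\<close>, uniformly in \<open>d\<close>. Then \<open>d\<close> tends to
  infinity for fixed \<open>n0\<close>.\<close>

lemma recurrence_limit:
 fixes \<beta> :: "nat \<Rightarrow> nat \<Rightarrow> 'a::real_normed_field" and m :: "nat \<Rightarrow> real"
 assumes step: "\<And>n j. \<beta> (Suc n) j = M n j * \<beta> n j + \<beta> n (Suc j)"
  and M: "\<And>n j. norm (M n j) \<le> m n" and m: "summable m" and B: "\<And>j. norm (\<beta> 0 j) \<le> B"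
  and lim: "\<And>n. (\<lambda>j. \<beta> n j) \<longlonglongrightarrow> \<gamma> n" and \<gamma>: "\<gamma> \<longlonglongrightarrow> \<Gamma>"
 shows "(\<lambda>n. \<beta> n 0) \<longlonglongrightarrow> \<Gamma>"
proof -
 have m0: "0 \<le> m n" for n using M[of n 0] by (meson norm_ge_zero order_trans)
 have B0: "0 \<le> B" using B[of 0] by (meson norm_ge_zero order_trans)
 define C where "C = B * exp (suminf m)"
 have C0: "0 \<le> C" using B0 by (simp add: C_def)
 have "norm (\<beta> n j) \<le> B * (\<Prod>i<n. 1 + m i)" for n j
 proof (induction n arbitrary: j)
  case (Suc n)
  have "norm (\<beta> (Suc n) j) \<le> norm (M n j) * norm (\<beta> n j) + norm (\<beta> n (Suc j))"
   unfolding step by (rule order_trans[OF norm_triangle_ineq]) (simp add: norm_mult)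
  also have "\<dots> \<le> m n * (B * (\<Prod>i<n. 1 + m i)) + B * (\<Prod>i<n. 1 + m i)" using Suc.IH M m0 by (intro add_mono mult_mono) auto
  finally show ?case by (simp add: algebra_simps)
 qed (simp add: B)
 moreover have "(\<Prod>i<n. 1 + m i) \<le> exp (suminf m)" for n
 proof -
  have "(\<Prod>i<n. 1 + m i) \<le> exp (sum m {..<n})" by (rule prod_le_exp_sum) (use m0 in auto)
  also have "sum m {..<n} \<le> suminf m" using m m0 by (intro sum_le_suminf) auto
  finally show ?thesis by simp
 qed
 ultimately have bnd: "norm (\<beta> n j) \<le> C" for n j unfolding C_def using B0 by (meson mult_left_mono order_trans)
 have near: "norm (\<beta> (n0 + d) j - \<beta> n0 (j + d)) \<le> C * sum m {n0..<n0 + d}" for n0 d j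
 proof (induction d arbitrary: j)
  case (Suc d)
  have "\<beta> (n0 + Suc d) j - \<beta> n0 (j + Suc d) = M (n0 + d) j * \<beta> (n0 + d) j + (\<beta> (n0 + d) (Suc j) - \<beta> n0 (Suc j + d))"
   by (simp add: step)
  then have "norm (\<beta> (n0 + Suc d) j - \<beta> n0 (j + Suc d)) \<le>
    norm (M (n0 + d) j) * norm (\<beta> (n0 + d) j) + norm (\<beta> (n0 + d) (Suc j) - \<beta> n0 (Suc j + d))"
   using norm_triangle_ineq[of "M (n0 + d) j * \<beta> (n0 + d) j" "\<beta> (n0 + d) (Suc j) - \<beta> n0 (Suc j + d)"] by (simp only: norm_mult)
  also have "\<dots> \<le> m (n0 + d) * C + C * sum m {n0..<n0 + d}" using M bnd m0 Suc.IH[of "Suc j"] by (intro add_mono mult_mono) auto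
  finally show ?case by (simp add: algebra_simps)
 qed simp
 show ?thesis
 proof (rule LIMSEQ_I)
  fix r :: real assume r: "r > 0"
  have "(\<lambda>n. C * (suminf m - sum m {..<n})) \<longlonglongrightarrow> C * (suminf m - suminf m)"
   by (intro tendsto_mult tendsto_diff tendsto_const summable_LIMSEQ m)
  then have "\<forall>\<^sub>F n in sequentially. C * (suminf m - sum m {..<n}) < r / 3" using r by (intro order_tendstoD) auto
  moreover have "\<forall>\<^sub>F n in sequentially. dist (\<gamma> n) \<Gamma> < r / 3" using \<gamma> r by (intro tendstoD) auto
  ultimately obtain n0 where n0: "C * (suminf m - sum m {..<n0}) < r / 3" "dist (\<gamma> n0) \<Gamma> < r / 3"
   by (metis (mono_tags, lifting) eventually_conj eventually_happens trivial_limit_sequentially)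
  obtain d0 where d0: "\<And>d. d \<ge> d0 \<Longrightarrow> dist (\<beta> n0 d) (\<gamma> n0) < r / 3"
   using tendstoD[OF lim[of n0], of "r / 3"] r by (auto simp: eventually_at_top_linorder)
  show "\<exists>no. \<forall>n\<ge>no. norm (\<beta> n 0 - \<Gamma>) < r"
  proof (intro exI allI impI)
   fix n assume n: "n \<ge> n0 + d0"
   define d where "d = n - n0"
   have nd: "n = n0 + d" "d \<ge> d0" using n by (auto simp: d_def)
   have "sum m {..<n} = sum m {..<n0} + sum m {n0..<n0 + d}"
    unfolding nd(1) using sum.atLeastLessThan_concat[of 0 n0 "n0 + d" m] by (simp add: atLeast0LessThan)
   moreover have "sum m {..<n} \<le> suminf m" using m m0 by (intro sum_le_suminf) auto
   ultimately have "C * sum m {n0..<n0 + d} \<le> C * (suminf m - sum m {..<n0})" using C0 by (intro mult_left_mono) auto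
   then have "norm (\<beta> n 0 - \<beta> n0 d) < r / 3" using near[of n0 d 0] n0(1) nd by simp
   moreover have "norm (\<beta> n0 d - \<gamma> n0) < r / 3" "norm (\<gamma> n0 - \<Gamma>) < r / 3"
    using d0[OF nd(2)] n0(2) by (simp_all add: dist_norm)
   moreover have "norm (\<beta> n 0 - \<Gamma>) \<le> norm (\<beta> n 0 - \<beta> n0 d) + (norm (\<beta> n0 d - \<gamma> n0) + norm (\<gamma> n0 - \<Gamma>))"
    using norm_triangle_ineq[of "\<beta> n 0 - \<beta> n0 d" "(\<beta> n0 d - \<gamma> n0) + (\<gamma> n0 - \<Gamma>)"]
     norm_triangle_ineq[of "\<beta> n0 d - \<gamma> n0" "\<gamma> n0 - \<Gamma>"] by simp
   ultimately show "norm (\<beta> n 0 - \<Gamma>) < r" by linarith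
  qed
 qed
qed

lemma section_sum_cong:
 assumes "\<And>e. e \<in> U \<Longrightarrow> g e = h e"
 shows "section_sum g t U = section_sum h t U" unfolding section_sum_def section_weight_def
proof (intro sum.cong refl arg_cong2[where f = "(*)"] prod.cong)
 fix S e assume "S \<in> sections U" "e \<in> S"
 then show "g e = h e" using assms sections_subset by blast
qed

text \<open>Division by \<open>a j\<close> turns \<open>section_sum_one_param_step\<close> for the
  parameter \<open>t^j * s\<close> into the recurrence of \<open>recurrence_limit\<close>. As
  \<open>j\<close> grows the weight tends to the constant 1, the two-parameter weight for 1 and -1,
  whose sum is \<open>\<Prod>i<n. 1 + t^i\<close>.\<close>

lemma section_sum_one_param_limit:
 fixes t s :: complex and v :: "nat \<Rightarrow> complex"
 defines "U \<equiv> \<lambda>n. v ` {..<n} \<union> inverse ` v ` {..<n}"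
 assumes t: "norm t < 1" "t \<noteq> 0" and s: "norm s < 1" "s \<noteq> 0" and inj: "inj v"
  and gen: "\<And>n. generic (v ` {..<n})" and avoid: "\<And>n j. - (t^j * s) \<notin> U n"
  and m: "\<And>n j. norm (t^n * (1 + t^j * s * v n) * (1 + t^j * s / v n)) \<le> m n" "summable m"
 shows "(\<lambda>n. section_sum (\<lambda>e. 1 + s * e) t (U n)) \<longlonglongrightarrow> qpoch_inf (s\<^sup>2) (t\<^sup>2) * qpoch_inf (- 1) t"
proof -
 have t2: "norm (t\<^sup>2) < 1" and s2: "norm (s\<^sup>2) < 1" using t s by (simp_all add: norm_power power_less_one_iff)
 define x where "x j = t^j * s" for j
 define a where "a j = qpoch_inf (s\<^sup>2 * (t\<^sup>2)^j) (t\<^sup>2)" for j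
 have a0: "a j \<noteq> 0" for j unfolding a_def by (intro qpoch_nz_norm t2 norm_mult_power_less_1 s2)
 have aS: "a j = (1 - (x j)\<^sup>2) * a (Suc j)" for j using qpoch_split[OF t2, of "s\<^sup>2 * (t\<^sup>2)^j" 1]
  by (simp add: a_def x_def power_mult_distrib mult_ac flip: power_mult)
 have alim: "a \<longlonglongrightarrow> 1"
 proof -
  have "(\<lambda>n. qpoch_inf (s\<^sup>2) (t\<^sup>2) / (\<Prod>i<n. 1 - s\<^sup>2 * (t\<^sup>2)^i)) \<longlonglongrightarrow> qpoch_inf (s\<^sup>2) (t\<^sup>2) / qpoch_inf (s\<^sup>2) (t\<^sup>2)"
   using qpoch_nz_norm[OF t2 s2] by (intro tendsto_divide tendsto_const qpoch_LIMSEQ[OF t2])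
  moreover have "qpoch_inf (s\<^sup>2) (t\<^sup>2) / (\<Prod>i<n. 1 - s\<^sup>2 * (t\<^sup>2)^i) = a n" for n
  proof -
   have "1 - s\<^sup>2 * (t\<^sup>2)^i \<noteq> 0" for i by (intro one_minus_nz norm_mult_power_less_1 s2 t2)
   then have "(\<Prod>i<n. 1 - s\<^sup>2 * (t\<^sup>2)^i) \<noteq> 0" by simp
   then show ?thesis using qpoch_split[OF t2, of "s\<^sup>2" n] by (simp add: a_def)
  qed
  ultimately show ?thesis using qpoch_nz_norm[OF t2 s2] by simp
 qed
 have x0: "x j \<noteq> 0" "(x j)\<^sup>2 \<noteq> 1" for j
 proof -
  have "norm (s * t^j) < 1" by (intro norm_mult_power_less_1 s t)
  then have "norm ((x j)\<^sup>2) < 1" by (simp add: x_def norm_power power_less_one_iff mult.commute)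
  then show "(x j)\<^sup>2 \<noteq> 1" by auto
 qed (use s t in \<open>simp add: x_def\<close>)
 have v: "v n \<notin> U n" "v n \<noteq> 0" "v n * v n \<noteq> 1" "inverse (v n) \<notin> U n" for n
 proof -
  have G: "generic (v ` {..<Suc n})" by (rule gen)
  then show "v n \<noteq> 0" "v n * v n \<noteq> 1" by (auto simp: generic_def lessThan_Suc)
  have neq: "v n \<noteq> v i" if "i < n" for i using inj that by (auto dest: injD)
  have ninv: "v n * v i \<noteq> 1" if "i < n" for i using G that by (auto simp: generic_def lessThan_Suc)
  have nz: "v i \<noteq> 0" if "i < n" for i using gen[of n] that by (auto simp: generic_def)
  have "v n \<noteq> inverse (v i)" "inverse (v n) \<noteq> v i" if "i < n" for i
   using ninv[OF that] nz[OF that] \<open>v n \<noteq> 0\<close> by (auto simp: field_simps)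
  with neq show "v n \<notin> U n" "inverse (v n) \<notin> U n" by (auto simp: U_def)
 qed
 have cl: "inv_closed (U n)" for n unfolding U_def by (rule generic_inv_closed[OF gen])
 have US: "U (Suc n) = insert (v n) (insert (inverse (v n)) (U n))" for n by (auto simp: U_def lessThan_Suc)
 have card: "card (U n) = 2 * n" for n
 proof (induction n)
  case (Suc n)
  have "finite (U n)" by (simp add: U_def)
  moreover have "v n \<noteq> inverse (v n)" using v[of n] inverse_neq_self by metis
  ultimately show ?case unfolding US using v[of n] Suc by simp
 qed (simp add: U_def)
 define \<beta> where "\<beta> n j = section_sum (\<lambda>e. 1 + x j * e) t (U n) / a j" for n j
 define \<gamma> where "\<gamma> n = (\<Prod>i<n. 1 - (- 1) * t^i)" for n
 have step: "\<beta> (Suc n) j = (t^n * (1 + x j * v n) * (1 + x j / v n)) * \<beta> n j + \<beta> n (Suc j)" for n j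
 proof -
  have "- x j \<notin> U n" using avoid by (simp add: x_def)
  then have "section_sum (\<lambda>e. 1 + x j * e) t (U (Suc n)) =
   t^n * (1 + x j * v n) * (1 + x j / v n) * section_sum (\<lambda>e. 1 + x j * e) t (U n) +
   (1 - (x j)\<^sup>2) * section_sum (\<lambda>e. 1 + t * x j * e) t (U n)"
   unfolding US using section_sum_one_param_step[OF cl v(1-3) x0, of j n t] by (simp add: card)
  moreover have "t * x j = x (Suc j)" by (simp add: x_def)
  ultimately have "\<beta> (Suc n) j = t^n * (1 + x j * v n) * (1 + x j / v n) * \<beta> n j +
    (1 - (x j)\<^sup>2) * section_sum (\<lambda>e. 1 + x (Suc j) * e) t (U n) / a j" by (simp add: \<beta>_def add_divide_distrib)
  also have "(1 - (x j)\<^sup>2) * section_sum (\<lambda>e. 1 + x (Suc j) * e) t (U n) / a j = \<beta> n (Suc j)"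
   unfolding \<beta>_def aS[of j] using x0(2)[of j] by simp
  finally show ?thesis .
 qed
 have one: "section_sum (\<lambda>e. 1) t (U n) = \<gamma> n" for n
 proof -
  have "section_sum (\<lambda>e. 1) t (U n) = section_sum (\<lambda>e. (1 - 1 * e) * (1 - (- 1) * e) / (1 - e\<^sup>2)) t (U n)"
  proof (rule section_sum_cong)
   fix e assume "e \<in> U n"
   then have "1 - e\<^sup>2 \<noteq> 0" using cl by (auto simp: inv_closed_def power2_eq_square)
   moreover have "(1 - 1 * e) * (1 - (- 1) * e) = 1 - e\<^sup>2" by (simp add: power2_eq_square algebra_simps)
   ultimately show "1 = (1 - 1 * e) * (1 - (- 1) * e) / (1 - e\<^sup>2)" by simp
  qed
  also have "\<dots> = \<gamma> n" unfolding section_sum_two_param[OF cl] by (simp add: card \<gamma>_def)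
  finally show ?thesis .
 qed
 have xlim: "x \<longlonglongrightarrow> 0" using tendsto_mult_right[OF LIMSEQ_power_zero[OF t(1)], of s] by (simp add: x_def[abs_def])
 have lim: "(\<lambda>j. \<beta> n j) \<longlonglongrightarrow> \<gamma> n" for n
 proof -
  have "(\<lambda>j. section_sum (\<lambda>e. 1 + x j * e) t (U n)) \<longlonglongrightarrow> section_sum (\<lambda>e. 1 + 0 * e) t (U n)"
   unfolding section_sum_def section_weight_def by (intro tendsto_intros xlim)
  then have "(\<lambda>j. \<beta> n j) \<longlonglongrightarrow> section_sum (\<lambda>e. 1 + 0 * e) t (U n) / 1"
   unfolding \<beta>_def by (intro tendsto_divide alim) auto
  then show ?thesis by (simp add: one)
 qed
 have "Bseq (\<lambda>j. \<beta> 0 j)" using lim[of 0] by (intro convergent_imp_Bseq) (auto simp: convergent_def)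
 then obtain B where B: "\<And>j. norm (\<beta> 0 j) \<le> B" by (auto simp: Bseq_def)
 have "\<gamma> \<longlonglongrightarrow> qpoch_inf (- 1) t" unfolding \<gamma>_def by (rule qpoch_LIMSEQ[OF t(1)])
 then have "(\<lambda>n. \<beta> n 0) \<longlonglongrightarrow> qpoch_inf (- 1) t"
  using m unfolding x_def[symmetric] by (intro recurrence_limit[of \<beta> _ m B \<gamma>, OF step _ _ B lim]) auto
 then have "(\<lambda>n. \<beta> n 0 * a 0) \<longlonglongrightarrow> qpoch_inf (- 1) t * a 0" by (intro tendsto_mult tendsto_const)
 moreover have "\<beta> n 0 * a 0 = section_sum (\<lambda>e. 1 + s * e) t (U n)" for n using a0[of 0] by (simp add: \<beta>_def x_def)
 ultimately show ?thesis by (simp add: a_def mult.commute)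
qed

section \<open>The two dual systems of progressions\<close>

lemma powi_mult: "x powi (m * int n) = (x powi m)^n" for x :: complex by (simp add: power_int_power')

text \<open>Expresses all exponents in \<open>g_flip\<close> through the values of \<open>u\<close>
  at \<open>l\<close> and \<open>l + 1\<close>, after which that condition is algebra in two
  unknowns.\<close>

lemma (in chain) flip_powers:
 fixes a :: nat
 defines "u \<equiv> \<lambda>i l. w powi (b i + 2 * int N * l)"
 shows "w powi ex i l = u i l * u i (l + 1)" "u i l \<noteq> 0" "u i (l + 1) / u i l = w^(2 * N)"
  "w powi (- ex i l) = inverse (w powi ex i l)" "w powi (2 * ex i l + 4 * int N) = u i (l + 1)^4"
  "w powi (4 * int N - 2 * ex i l) = inverse (u i l)^4"
  "w powi (int a * (b i + 2 * int N * l)) = u i l^a"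
  "w powi (- (int a * (b i + 2 * int N * l))) = inverse (u i l)^a"
proof -
 show "u i l \<noteq> 0" "w powi (- ex i l) = inverse (w powi ex i l)" using w by (simp_all add: u_def power_int_minus)
 show "w powi ex i l = u i l * u i (l + 1)" using w by (simp add: u_def ex_def power_int_add[symmetric] algebra_simps)
 have "u i (l + 1) / u i l = w powi (int (2 * N))" using w by (simp add: u_def power_int_diff[symmetric] algebra_simps)
 then show "u i (l + 1) / u i l = w^(2 * N)" by (simp only: power_int_of_nat)
 have "2 * ex i l + 4 * int N = (b i + 2 * int N * (l + 1)) * int 4" "4 * int N - 2 * ex i l = - (b i + 2 * int N * l) * int 4"
  "int a * x = x * int a" "- (int a * x) = (- x) * int a" for x by (simp_all add: ex_def algebra_simps)
 then show "w powi (2 * ex i l + 4 * int N) = u i (l + 1)^4" "w powi (4 * int N - 2 * ex i l) = inverse (u i l)^4"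
  "w powi (int a * (b i + 2 * int N * l)) = u i l^a" "w powi (- (int a * (b i + 2 * int N * l))) = inverse (u i l)^a"
  by (simp_all only: powi_mult u_def power_int_minus)
qed

text \<open>\<open>w\<close> is a fourth root of \<open>q\<close>, so that square roots of
  \<open>q\<close>, \<open>t\<close> and \<open>p\<close> and all exponents in the two determinants
  are integral powers of \<open>w\<close>. The value \<open>a = 2\<close> belongs to the first
  identity, where \<open>s = 1\<close>, and \<open>a = 1\<close> to the second, where
  \<open>s\<close> is the square root of \<open>t\<close>.\<close>

locale dual_chains =
 fixes w :: complex and R k \<sigma> a :: nat
 assumes w: "w \<noteq> 0" "norm w < 1" and R: "R \<ge> 1" and k: "k \<ge> 1" and \<sigma>: "\<sigma> = 0 \<or> \<sigma> = 1" and a: "a = 1 \<or> a = 2"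
begin

definition N :: nat where "N = 2 * R - \<sigma>"
text \<open>The exponent of the dual nome: \<open>t * q^(2 * k + 1) = q^kap\<close> for
  \<open>t = q^N\<close>.\<close>

definition kap :: nat where "kap = N + 2 * k + 1"
definition sg :: complex where "sg = (if \<sigma> = 0 then 1 else -1)"
definition special :: "nat set" where "special = (if \<sigma> = 0 then {} else {R - 1})"
text \<open>The offsets of one system are the powers in the determinant of the other: system one
  uses the powers \<open>a + 2 * j\<close>, system two the powers \<open>1 + 2 * i\<close>. Likewise
  \<open>N\<close> and \<open>kap\<close> exchange the roles of modulus and Gaussian
  coefficient.\<close>

definition b1 :: "nat \<Rightarrow> int" where "b1 i = 2 * int i + 1"
definition b2 :: "nat \<Rightarrow> int" where "b2 j = int a + 2 * int j"
definition q :: complex where "q = w^4"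
definition s :: complex where "s = (if a = 2 then 1 else w^(2 * N))"
definition z :: complex where "z = w^(2 * (\<sigma> + 1))"
definition rp :: complex where "rp = w^(2 * kap)"
definition p :: complex where "p = w^(4 * kap)"
definition g1 :: "complex \<Rightarrow> complex" where "g1 y = inverse y^k * ((1 + s * y) / (1 - y\<^sup>2))"
text \<open>Made to satisfy \<open>g_flip\<close> for ratio \<open>p\<close> and Gaussian
  coefficient \<open>N\<close>. For \<sigma> = 1 the numerator suffices and flips with
  \<open>- y\<close>; for \<sigma> = 0 a factor \<open>y^2\<close> is required, and the denominator
  supplies the rest through \<open>(1 - y) / (1 - inverse y) = - y\<close>.\<close>

definition g2 :: "complex \<Rightarrow> complex" where "g2 y = (1 + rp * y) / (if \<sigma> = 0 then 1 - y else 1)"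

lemma N_eq: "int N = 2 * int R - int \<sigma>" and N_pos: "N > 0" using R \<sigma> by (auto simp: N_def)

lemma even_case:
 assumes "\<sigma> = 0"
 shows "sg = 1" "special = {}" "g2 y = (1 + rp * y) / (1 - y)" "int \<sigma> = 0" unfolding sg_def special_def g2_def using assms by simp_all

lemma odd_case:
 assumes "\<sigma> \<noteq> 0"
 shows "sg = -1" "special = {R - 1}" "g2 y = 1 + rp * y" "int \<sigma> = 1" unfolding sg_def special_def g2_def using assms \<sigma> by simp_all

lemma sg_cases: "sg = 1 \<or> sg = -1" by (simp add: sg_def)

lemma kap_eq: "int kap = int N + 2 * int k + 1" by (simp add: kap_def)

sublocale one: chain w R N b1 special
proof
 fix i j assume ij: "i < R" "j < R"
 show "b1 i + b1 j < 2 * int N \<or> i = j \<and> i \<in> special" using ij \<sigma> by (auto simp: b1_def N_eq special_def)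
qed (use w N_pos R \<sigma> in \<open>auto simp: b1_def N_eq special_def inj_on_def split: if_splits\<close>)

sublocale two: chain w R kap b2 "{}"
proof
 fix i j assume ij: "i < R" "j < R"
 show "b2 i + b2 j < 2 * int kap \<or> i = j \<and> i \<in> {}" using ij \<sigma> a k by (auto simp: b2_def N_eq kap_eq)
qed (use w a in \<open>auto simp: b2_def kap_def inj_on_def\<close>)

lemma powi_neq_minus_one: "w powi m \<noteq> -1"
proof
 assume m: "w powi m = -1"
 have "w powi (m * int 2) = 1" unfolding powi_mult m by simp
 then have "m = 0" by (simp add: one.powi_eq_1_iff)
 with m show False by simp
qed

text \<open>With \<open>v = u * c\<close> this is an identity of Laurent polynomials. The choice of
  \<open>s'\<close> makes the quotient of \<open>1 + s' / v\<close> by \<open>1 + s' * v\<close>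
  convert differences of second powers of \<open>u\<close> and \<open>c\<close> into differences of
  \<open>a\<close>-th powers, up to a monomial.\<close>

lemma flip_identity:
 fixes u c v s' :: complex
 assumes "u \<noteq> 0" "c \<noteq> 0" "s' = (if a = 2 then 1 else c / u)" "v = u * c" "1 - v\<^sup>2 \<noteq> 0"
 shows "(1 + s' / v) / (1 - inverse v^2) * (1 - c^4) * (u^a - inverse u^a) =
  v^3 * (c^a - inverse c^a) * ((1 + s' * v) / (1 - v\<^sup>2) * (1 - inverse u^4))"
proof -
 have v: "v \<noteq> 0" using assms by simp
 have i: "1 - inverse v^2 = - (1 - v\<^sup>2) / v\<^sup>2" using v by (simp add: field_simps power2_eq_square)
 have "(1 + s' / v) * (- (v\<^sup>2)) * (1 - c^4) * (u^a - inverse u^a) =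
  v^3 * (c^a - inverse c^a) * ((1 + s' * v) * (1 - inverse u^4))" using a assms(1,2) unfolding assms(3,4)
  by (elim disjE) (simp_all add: field_simps power_numeral_reduce power2_eq_square power3_eq_cube)
 moreover have "X / (- D / V) * C * U = (X * (- V) * C * U) / D" if "D \<noteq> 0" "V \<noteq> 0" for X D V C U :: complex
  using that by (simp add: field_simps)
 moreover have "v\<^sup>2 \<noteq> 0" using v by simp
 ultimately have "(1 + s' / v) / (- (1 - v\<^sup>2) / v\<^sup>2) * (1 - c^4) * (u^a - inverse u^a) =
   (v^3 * (c^a - inverse c^a) * ((1 + s' * v) * (1 - inverse u^4))) / (1 - v\<^sup>2)" using assms(5) by metis
 then show ?thesis unfolding i by simp
qed

lemma one_nz: 
 assumes "i < R" "i \<in> special \<Longrightarrow> 0 \<le> l"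
 shows "one.ex i l \<noteq> 0" "g1 (w powi (one.ex i l)) \<noteq> 0" "(w powi (one.ex i l))\<^sup>2 \<noteq> 1"
proof -
 have "one.low (nat \<bar>l\<bar>) i \<le> l" using assms(2) by (auto simp: one.low_def)
 then have "one.ex i l + one.ex i l \<noteq> 0" using assms(1) by (intro one.ex_sum) auto
 then show e: "one.ex i l \<noteq> 0" by simp
 have "(w powi (one.ex i l))\<^sup>2 = w powi (one.ex i l * 2)" using powi_mult[of _ _ 2] by simp
 then show 2: "(w powi (one.ex i l))\<^sup>2 \<noteq> 1" using e by (simp add: one.powi_eq_1_iff)
 have "1 + s * w powi (one.ex i l) \<noteq> 0"
 proof -
  have "s * w powi (one.ex i l) = w powi ((if a = 2 then 0 else int (2 * N)) + one.ex i l)"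
   using w power_int_of_nat[of w "2 * N"] by (simp add: s_def power_int_add)
  then show ?thesis using powi_neq_minus_one by (metis add.commute add_eq_0_iff)
 qed
 then show "g1 (w powi (one.ex i l)) \<noteq> 0" using 2 w by (simp add: g1_def)
qed

sublocale one: chain_weight w R N b1 special g1 a "int kap" sg
proof
 fix i :: nat and l :: int
 assume i: "i < R" "i \<in> special \<Longrightarrow> 0 \<le> l"
 show "g1 (w powi one.ex i l) \<noteq> 0" using one_nz[OF i] by simp
 define u where "u = w powi (b1 i + 2 * int N * l)"
 define c where "c = w powi (b1 i + 2 * int N * (l + 1))"
 define v where "v = w powi (one.ex i l)"
 note e = one.flip_powers[where i = i and l = l, folded u_def c_def v_def]
 note f = one.flip_powers[where i = i and l = "l + 1", folded c_def]
 have u0: "u \<noteq> 0" "c \<noteq> 0" "v \<noteq> 0" using e(1,2) f(2) by auto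
 have s: "s = (if a = 2 then 1 else c / u)" by (simp add: s_def e(3))
 have v2: "1 - v\<^sup>2 \<noteq> 0" using one_nz[OF i] by (simp add: v_def)
 \<comment> \<open>The exponent \<open>kap - 2 * (R - 1)\<close> equals
   \<open>2 * k + 3 - \<sigma>\<close>. For \<sigma> = 1 the missing power of \<open>v\<close> and
   the sign come from the fixed lower end of the special progression, where \<open>cross\<close>
   equals \<open>- v\<close>.\<close>
 have "(\<Prod>j\<in>special. one.cross (one.ex i l) 0) * sg * w powi (one.ex i l * (int kap - 2 * (int R - 1))) = v^(2 * k + 3)"
 proof (cases "\<sigma> = 0")
  case True
  have "int kap - 2 * (int R - 1) = int (2 * k + 3) - int \<sigma>" by (simp add: kap_eq N_eq)
  also have "int \<sigma> = 0" using True by simp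
  finally have "int kap - 2 * (int R - 1) = int (2 * k + 3)" by simp
  then show ?thesis by (simp only: even_case(1,2)[OF True] powi_mult v_def prod.empty mult_1)
 next
  case False
  have "int kap - 2 * (int R - 1) = int (2 * k + 3) - int \<sigma>" by (simp add: kap_eq N_eq)
  also have "\<dots> = int (2 * k + 2)" unfolding odd_case(4)[OF False] by simp
  finally have "int kap - 2 * (int R - 1) = int (2 * k + 2)" .
  then have "w powi (one.ex i l * (int kap - 2 * (int R - 1))) = v^(2 * k + 2)" by (simp only: powi_mult v_def)
  moreover have "one.cross (one.ex i l) 0 = - v"
  proof -
   have "v \<noteq> 1" using v2 by auto
   then show ?thesis using u0 by (simp add: one.cross_def v_def[symmetric] power_int_minus field_simps)
  qed
  ultimately show ?thesis by (simp add: odd_case[OF False] power_add power3_eq_cube power2_eq_square mult_ac)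
 qed
 moreover have "g1 (inverse v) * (1 - c^4) * (u^a - inverse u^a) = v^(2 * k + 3) * (c^a - inverse c^a) * (g1 v * (1 - inverse u^4))"
 proof -
  have "g1 (inverse v) * (1 - c^4) * (u^a - inverse u^a) =
    v^k * ((1 + s / v) / (1 - inverse v^2) * (1 - c^4) * (u^a - inverse u^a))" by (simp add: g1_def divide_inverse)
  also have "\<dots> = (v^k * inverse v^k) * v^k * (v^3 * (c^a - inverse c^a) * ((1 + s * v) / (1 - v\<^sup>2) * (1 - inverse u^4)))"
   unfolding flip_identity[OF u0(1,2) s e(1) v2] using u0 by (simp add: power_mult_distrib[symmetric])
  also have "\<dots> = (v^k * v^k * v^3) * (c^a - inverse c^a) * (g1 v * (1 - inverse u^4))" unfolding g1_def by (simp only: mult_ac)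
  also have "v^k * v^k * v^3 = v^(2 * k + 3)" by (simp only: power_add mult_2)
  finally show ?thesis .
 qed
 ultimately show "g1 (w powi (- one.ex i l)) * (1 - w powi (2 * one.ex i l + 4 * int N)) *
    (w powi (int a * (b1 i + 2 * int N * l)) - w powi (- (int a * (b1 i + 2 * int N * l)))) =
   (\<Prod>j\<in>special. one.cross (one.ex i l) 0) * sg * w powi (one.ex i l * (int kap - 2 * (int R - 1))) *
    (w powi (int a * (b1 i + 2 * int N * (l + 1))) - w powi (- (int a * (b1 i + 2 * int N * (l + 1))))) *
    (g1 (w powi one.ex i l) * (1 - w powi (4 * int N - 2 * one.ex i l)))" unfolding e(4-8) f(7,8) v_def[symmetric] by simp
next
 show "a \<in> {1, 2}" using a by blast
 show "sg = 1 \<or> sg = -1" by (rule sg_cases)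
 show "0 < int kap" unfolding kap_def by simp
qed

lemma two_nz:
 assumes "i < R"
 shows "two.ex i l \<noteq> 0" "g2 (w powi (two.ex i l)) \<noteq> 0"
proof -
 have "two.low (nat \<bar>l\<bar>) i \<le> l" by (auto simp: two.low_def)
 then have "two.ex i l + two.ex i l \<noteq> 0" using assms(1) by (intro two.ex_sum) auto
 then show e: "two.ex i l \<noteq> 0" by simp
 have "rp * w powi (two.ex i l) = w powi (int (2 * kap) + two.ex i l)" using w power_int_of_nat[of w "2 * kap"] by (simp add: rp_def power_int_add)
 then have "1 + rp * w powi (two.ex i l) \<noteq> 0" using powi_neq_minus_one by (metis add.commute add_eq_0_iff)
 moreover have "1 - w powi (two.ex i l) \<noteq> 0" using e by (simp add: two.powi_eq_1_iff)
 moreover from this have "(if c then 1 - w powi (two.ex i l) else 1) \<noteq> 0" for c by simp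
 ultimately show "g2 (w powi (two.ex i l)) \<noteq> 0" unfolding g2_def by (simp only: divide_eq_0_iff simp_thms)
qed

sublocale two: chain_weight w R kap b2 "{}" g2 1 "int N" sg
proof
 fix i :: nat and l :: int
 assume i: "i < R"
 show "g2 (w powi two.ex i l) \<noteq> 0" using two_nz[OF i] by simp
 define u where "u = w powi (b2 i + 2 * int kap * l)"
 define c where "c = w powi (b2 i + 2 * int kap * (l + 1))"
 define v where "v = w powi (two.ex i l)"
 note e = two.flip_powers[where i = i and l = l, folded u_def c_def v_def]
 note f = two.flip_powers[where i = i and l = "l + 1", folded c_def]
 have u0: "u \<noteq> 0" "c \<noteq> 0" "v \<noteq> 0" using e(1,2) f(2) by auto
 have rp: "rp = c / u" by (simp add: rp_def e(3))
 have v1: "v \<noteq> 1" using two_nz[OF i, of l] by (simp add: v_def two.powi_eq_1_iff)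
 have "g2 (inverse v) * (1 - c^4) * (u - inverse u) =
   sg * w powi (two.ex i l * (int N - 2 * (int R - 1))) * (c - inverse c) * (g2 v * (1 - inverse u^4))"
 proof (cases "\<sigma> = 0")
  case True
  have "int N - 2 * (int R - 1) = int 2 - int \<sigma>" by (simp add: N_eq)
  also have "int \<sigma> = 0" using True by simp
  finally have "int N - 2 * (int R - 1) = int 2" by simp
  then have "w powi (two.ex i l * (int N - 2 * (int R - 1))) = v^2" by (simp only: powi_mult v_def)
  moreover have "(1 + c / u * inverse v) / (1 - inverse v) * (1 - c^4) * (u - inverse u) =
   v^2 * (c - inverse c) * ((1 + c / u * v) / (1 - v) * (1 - inverse u^4))"
  proof -
   have i: "1 - inverse v = - (1 - v) / v" using u0 by (simp add: field_simps)
   have "(1 + c / u * inverse v) * (- v) * (1 - c^4) * (u - inverse u) = v^2 * (c - inverse c) * ((1 + c / u * v) * (1 - inverse u^4))"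
    unfolding e(1) using u0(1,2) by (simp add: field_simps power_numeral_reduce power2_eq_square)
   moreover have "X / (- D / V) * C * U = (X * (- V) * C * U) / D" if "D \<noteq> 0" "V \<noteq> 0" for X D V C U :: complex
    using that by (simp add: field_simps)
   moreover have "1 - v \<noteq> 0" using v1 by simp
   ultimately have "(1 + c / u * inverse v) / (- (1 - v) / v) * (1 - c^4) * (u - inverse u) =
    (v^2 * (c - inverse c) * ((1 + c / u * v) * (1 - inverse u^4))) / (1 - v)" using u0(3) by metis
   then show ?thesis unfolding i by simp
  qed
  ultimately show ?thesis by (simp add: even_case[OF True] rp)
 next
  case False
  have "int N - 2 * (int R - 1) = int 2 - int \<sigma>" by (simp add: N_eq)
  also have "\<dots> = int 1" unfolding odd_case(4)[OF False] by simp
  finally have "int N - 2 * (int R - 1) = int 1" .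
  then have "w powi (two.ex i l * (int N - 2 * (int R - 1))) = v^1" by (simp only: powi_mult v_def)
  moreover have "(1 + c / u * inverse v) * (1 - c^4) * (u - inverse u) = - v * (c - inverse c) * ((1 + c / u * v) * (1 - inverse u^4))"
   unfolding e(1) using u0(1,2) by (simp add: field_simps power_numeral_reduce power2_eq_square)
  ultimately show ?thesis by (simp add: odd_case[OF False] rp)
 qed
 then show "g2 (w powi (- two.ex i l)) * (1 - w powi (2 * two.ex i l + 4 * int kap)) *
    (w powi (int 1 * (b2 i + 2 * int kap * l)) - w powi (- (int 1 * (b2 i + 2 * int kap * l)))) =
   (\<Prod>j\<in>{}. two.cross (two.ex i l) 0) * sg * w powi (two.ex i l * (int N - 2 * (int R - 1))) *
    (w powi (int 1 * (b2 i + 2 * int kap * (l + 1))) - w powi (- (int 1 * (b2 i + 2 * int kap * (l + 1))))) *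
    (g2 (w powi two.ex i l) * (1 - w powi (4 * int kap - 2 * two.ex i l)))" unfolding e(4-8) f(7,8) v_def[symmetric] by simp
next
 show "1 \<in> {1, 2 :: nat}" by simp
 show "sg = 1 \<or> sg = -1" by (rule sg_cases)
 show "0 < int N" using N_pos by simp
qed

end

section \<open>Exchange of the two systems and the limit of the bounded sums\<close>

lemma infsum_diff:
 fixes f g :: "'a \<Rightarrow> complex"
 assumes "f summable_on A" "g summable_on A"
 shows "infsum (\<lambda>x. f x - g x) A = infsum f A - infsum g A"
 using infsum_add[of f A "\<lambda>x. - g x"] assms by (simp add: summable_on_uminus infsum_uminus)

context dual_chains
begin

lemma theta_summable:
 assumes "A > 0"
 shows "(\<lambda>l::int. sg powi l * w powi (A * (l * l) + c * l + d)) summable_on UNIV"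
proof -
 let ?G = "\<lambda>l. norm w powi d * ((norm w powi A)^nat (l * l) * (norm w powi (- \<bar>c\<bar>))^nat \<bar>l\<bar>)"
 have "norm (w powi A) \<le> norm w powi 1" using assms by (intro one.norm_powi_le) auto
 then have "norm w powi A < 1" using w by (simp add: norm_power_int)
 then have g: "?G summable_on UNIV" using w by (intro summable_on_cmult_right summable_gaussian) auto
 have bound: "norm (sg powi l * w powi (A * (l * l) + c * l + d)) \<le> ?G l" for l
 proof -
  have "norm (sg powi l) = 1" using sg_cases by (auto simp: norm_power_int)
  then have "norm (sg powi l * w powi (A * (l * l) + c * l + d)) = norm (w powi (A * (l * l) + c * l + d))" by (simp add: norm_mult)
  also have "\<dots> \<le> norm w powi (A * (l * l) + (- \<bar>c\<bar>) * \<bar>l\<bar> + d)"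
  proof (rule one.norm_powi_le)
   have "- (\<bar>c\<bar> * \<bar>l\<bar>) \<le> c * l" by (metis abs_ge_minus_self abs_mult minus_le_iff)
   then show "A * (l * l) + (- \<bar>c\<bar>) * \<bar>l\<bar> + d \<le> A * (l * l) + c * l + d" by simp
  qed
  also have "\<dots> = norm w powi (A * int (nat (l * l)) + (- \<bar>c\<bar>) * int (nat \<bar>l\<bar>) + d)" by simp
  also have "\<dots> = ?G l" using w by (simp only: power_int_add power_int_power' norm_eq_zero disj_not1 simp_thms mult_ac)
  finally show ?thesis .
 qed
 show ?thesis by (rule abs_summable_summable[OF Infinite_Sum.abs_summable_on_comparison_test'[OF g bound]])
qed

lemma infsum_reflect: "infsum (f :: int \<Rightarrow> complex) UNIV = infsum (\<lambda>l. f (- l)) UNIV"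
proof -
 have "inj (uminus :: int \<Rightarrow> int)" by (auto simp: inj_def)
 from infsum_reindex[OF this, of f] show ?thesis by (simp add: comp_def)
qed

lemma total_swap: "two.total j i = one.total i j"
proof -
 define A where "A = int (a + 2 * j)"
 define B where "B = int (2 * i + 1)"
 define Q where "Q = 2 * int kap * int N"
 define P where "P = (\<lambda>l. sg powi l * w powi (Q * (l * l) + (2 * int kap * B + 2 * int N * A) * l + A * B))"
 define M where "M = (\<lambda>l. sg powi l * w powi (Q * (l * l) + (2 * int kap * B - 2 * int N * A) * l + - (A * B)))"
 have "Q > 0" using N_pos by (simp add: Q_def kap_def)
 then have P: "P summable_on UNIV" and M: "M summable_on UNIV" unfolding P_def M_def by (rule theta_summable)+
 have inv: "M (- l) = sg powi l * w powi (Q * (l * l) + (2 * int N * A - 2 * int kap * B) * l + - (A * B))" for l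
 proof -
  have "sg powi (- l) = sg powi l" using sg_cases by (cases "even l") (auto simp: power_int_minus)
  then show ?thesis by (simp add: M_def algebra_simps)
 qed
 have M': "(\<lambda>l. M (- l)) summable_on UNIV" unfolding inv using \<open>Q > 0\<close> by (rule theta_summable)
 have pw: "(w powi m)^n = w powi (m * int n)" "inverse (w powi m)^n = w powi (- m * int n)" for m n by (simp_all only: powi_mult power_int_minus)
 have "one.entry i l j = P l - M l" for l
 proof -
  have "2 * int kap * (int N * l * l + b1 i * l) + one.beta i l * int (a + 2 * j) = Q * (l * l) + (2 * int kap * B + 2 * int N * A) * l + A * B"
   "2 * int kap * (int N * l * l + b1 i * l) + - one.beta i l * int (a + 2 * j) = Q * (l * l) + (2 * int kap * B - 2 * int N * A) * l + - (A * B)"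
   by (simp_all add: one.beta_def b1_def A_def B_def Q_def algebra_simps)
  then show ?thesis unfolding one.entry_def one.mono_def P_def M_def pw by (simp only: right_diff_distrib mult.assoc one.powi_add[symmetric])
 qed
 then have "one.total i j = infsum P UNIV - infsum M UNIV" unfolding one.total_def using infsum_diff[OF P M] by simp
 moreover have "two.entry j l i = P l - M (- l)" for l
 proof -
  have "2 * int N * (int kap * l * l + b2 j * l) + two.beta j l * int (1 + 2 * i) = Q * (l * l) + (2 * int kap * B + 2 * int N * A) * l + A * B"
   "2 * int N * (int kap * l * l + b2 j * l) + - two.beta j l * int (1 + 2 * i) = Q * (l * l) + (2 * int N * A - 2 * int kap * B) * l + - (A * B)"
   by (simp_all add: two.beta_def b2_def A_def B_def Q_def algebra_simps)
  then show ?thesis unfolding two.entry_def two.mono_def P_def inv pw by (simp only: right_diff_distrib mult.assoc one.powi_add[symmetric])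
 qed
 then have "two.total j i = infsum P UNIV - infsum (\<lambda>l. M (- l)) UNIV" unfolding two.total_def using infsum_diff[OF P M'] by simp
 ultimately show ?thesis using infsum_reflect[of M] by simp
qed

lemma norm_pow_w: "n > 0 \<Longrightarrow> norm (w^n) < 1" using w by (simp add: norm_power power_less_one_iff)

lemma norm_q: "norm q < 1" and norm_z: "norm z < 1" and norm_p: "norm p < 1" unfolding q_def z_def p_def kap_def by (intro norm_pow_w; simp)+

lemma q_power: "z * q^n = w powi (2 * (int \<sigma> + 1) + 4 * int n)"
proof -
 have "z * q^n = w^(2 * (\<sigma> + 1) + 4 * n)" by (simp add: z_def q_def power_add power_mult)
 also have "\<dots> = w powi (int (2 * (\<sigma> + 1) + 4 * n))" by (rule power_int_of_nat[symmetric])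
 also have "int (2 * (\<sigma> + 1) + 4 * n) = 2 * (int \<sigma> + 1) + 4 * int n" by simp
 finally show ?thesis .
qed

lemma one_nome: "one.nome = q^N"
proof -
 have "one.nome = w powi (int (4 * N))" by (simp add: one.nome_def)
 then show ?thesis by (simp only: power_int_of_nat q_def power_mult)
qed

lemma below_zero: "one.below J one.zero = {x \<in> one.idx J. snd x < 0}" "two.below J one.zero = {x \<in> two.idx J. snd x < 0}"
 by (auto simp: one.below_def two.below_def one.idx_def two.idx_def)

lemma special_iff: "i \<in> special \<longleftrightarrow> int \<sigma> = 1 \<and> i = R - 1" using \<sigma> by (auto simp: special_def)

text \<open>With all cuts at 0 the section consists of the original variables. Residues of
  \<open>n\<close> modulo \<open>N\<close> from \<open>R - \<sigma>\<close> on belong to points with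
  \<open>l \<ge> 0\<close>; the smaller residues, in reverse order, belong to inverses of points
  with \<open>l < 0\<close>. For \<sigma> = 1 the special index \<open>R - 1\<close> occurs only
  among the former.\<close>

lemma sect_one: "one.sect J (one.below J one.zero) = (\<lambda>n. z * q^n) ` {..<N * J}"
proof (rule set_eqI, rule iffI)
 fix e assume "e \<in> one.sect J (one.below J one.zero)"
 then consider i l where "(i, l) \<in> one.idx J" "0 \<le> l" "e = one.point (i, l)"
  | i l where "(i, l) \<in> one.idx J" "l < 0" "e = inverse (one.point (i, l))" unfolding one.sect_def below_zero by force
 then show "e \<in> (\<lambda>n. z * q^n) ` {..<N * J}"
 proof cases
  case 1
  then have i: "i < R" "l < int J" by (auto simp: one.idx_def)
  define n where "n = int R - int \<sigma> + int i + int N * l"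
  have l: "int N * l \<le> int N * (int J - 1)" "0 \<le> int N * l" using i 1 by (auto intro: mult_left_mono)
  have \<sigma>1: "int \<sigma> \<le> 1" "1 \<le> int R" using \<sigma> R by auto
  have n: "0 \<le> n" "n < int (N * J)" using l i(1) \<sigma>1 N_eq unfolding n_def by (simp_all add: right_diff_distrib)
  have "one.ex i l = 2 * (int \<sigma> + 1) + 4 * int (nat n)" using n by (simp add: n_def one.ex_def b1_def N_eq algebra_simps)
  then have "e = z * q^nat n" unfolding 1 one.point_def q_power by simp
  moreover have "nat n < N * J" using n by (simp only: nat_less_iff)
  ultimately show ?thesis by blast
 next
  case 2
  then have i: "i < R" "i \<notin> special" "- int J \<le> l" by (auto simp: one.idx_def one.low_def split: if_splits)
  define n where "n = int R - int \<sigma> - 1 - int i + int N * (- l - 1)"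
  have l: "int N * (- l - 1) \<le> int N * (int J - 1)" "0 \<le> int N * (- l - 1)" using i 2 by (auto intro: mult_left_mono)
  have i': "int i \<le> int R - 1 - int \<sigma>" using i \<sigma> unfolding special_iff by auto
  have n: "0 \<le> n" "n < int (N * J)" using l i' R N_eq unfolding n_def by (simp_all add: right_diff_distrib)
  have "- one.ex i l = 2 * (int \<sigma> + 1) + 4 * int (nat n)" using n by (simp add: n_def one.ex_def b1_def N_eq algebra_simps)
  moreover have "e = w powi (- one.ex i l)" unfolding 2 one.point_def by (simp add: power_int_minus)
  ultimately have "e = z * q^nat n" unfolding q_power by simp
  moreover have "nat n < N * J" using n by (simp only: nat_less_iff)
  ultimately show ?thesis by blast
 qed
next
 fix e assume "e \<in> (\<lambda>n. z * q^n) ` {..<N * J}"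
 then obtain n where n: "n < N * J" "e = z * q^n" by auto
 define d r where "d = n div N" and "r = n mod N"
 have nd: "int n = int N * int d + int r" "d < J" "r < N"
  using n N_pos by (auto simp: d_def r_def less_mult_imp_div_less mult.commute simp flip: of_nat_mult of_nat_add)
 show "e \<in> one.sect J (one.below J one.zero)"
 proof (cases "R - \<sigma> \<le> r")
  case True
  define i where "i = r - (R - \<sigma>)"
  have i: "int i = int r - int R + int \<sigma>" "i < R" using True nd(3) R \<sigma> N_eq by (auto simp: i_def)
  have ix: "(i, int d) \<in> one.idx J - one.below J one.zero" using i nd by (auto simp: below_zero one.idx_def one.low_def)
  have "one.ex i (int d) = 2 * (int \<sigma> + 1) + 4 * int n" unfolding nd(1) by (simp add: one.ex_def b1_def N_eq i(1) algebra_simps)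
  then have "e = one.point (i, int d)" unfolding n(2) q_power one.point_def by simp
  with ix show ?thesis unfolding one.sect_def by blast
 next
  case False
  define i where "i = R - \<sigma> - 1 - r"
  have i: "int i = int R - int \<sigma> - 1 - int r" "i < R" using False \<sigma> R by (auto simp: i_def)
  have "i \<notin> special" using i False R by (auto simp: special_iff)
  then have ix: "(i, - int d - 1) \<in> one.below J one.zero" using i nd by (auto simp: below_zero one.idx_def one.low_def)
  have "- one.ex i (- int d - 1) = 2 * (int \<sigma> + 1) + 4 * int n" unfolding nd(1) by (simp add: one.ex_def b1_def N_eq i(1) algebra_simps)
  moreover have "inverse (one.point (i, - int d - 1)) = w powi (- one.ex i (- int d - 1))" by (simp add: one.point_def power_int_minus)
  ultimately have "e = inverse (one.point (i, - int d - 1))" unfolding n(2) q_power by simp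
  with ix show ?thesis unfolding one.sect_def by blast
 qed
qed

end

context chain
begin

lemma omega_eq_sect: "M \<subseteq> idx J \<Longrightarrow> omega J = sect J M \<union> inverse ` sect J M"
 by (auto simp: omega_def sect_def image_iff) force+

lemma generic_sect:
 assumes "M \<subseteq> idx J"
 shows "generic (sect J M)"
proof -
 have "point x * inverse (point y) \<noteq> 1" if "x \<in> idx J - M" "y \<in> M" for x y
 proof
  assume "point x * inverse (point y) = 1"
  then have "point x = point y" using point_nz[of y] by (simp add: field_simps)
  then show False using inj_onD[OF point_inj, of x y J] that assms by auto
 qed
 moreover have "inverse (point x) * inverse (point y) \<noteq> 1" if "x \<in> M" "y \<in> M" for x y
  using point_mult_neq_1[of x J y] that assms by (metis inverse_1 inverse_inverse_eq inverse_mult_distrib subsetD)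
 moreover have "finite (sect J M)" using finite_idx finite_subset[OF assms finite_idx] by (simp add: sect_def)
 ultimately show ?thesis using point_mult_neq_1[of _ J] point_nz unfolding generic_def sect_def by (auto simp: mult.commute)
qed

end

context dual_chains
begin

lemma inj_q: "inj (\<lambda>n. z * q^n)" by (rule injI) (simp add: q_power one.powi_eq_iff)

text \<open>The limiting weight of the section of all variables, where \<open>(z * q^n)^k\<close>
  has cancelled the factor \<open>e^(-k)\<close>.\<close>

definition T1 :: complex where
 "T1 = qpoch_inf (- (s * z)) q / qpoch_inf (z\<^sup>2) (q\<^sup>2) * inverse (\<Prod>d<N. qpoch_inf (z\<^sup>2 * q^Suc d) (q\<^sup>2))"

lemma norm_z2: "norm (z\<^sup>2) < 1" and norm_q2: "norm (q\<^sup>2) < 1" using norm_z norm_q by (simp_all add: norm_power power_less_one_iff)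

lemma weight_one_tendsto: "(\<lambda>J. (\<Prod>n<N * J. (z * q^n)^k) * one.wt J one.zero) \<longlonglongrightarrow> T1"
proof -
 let ?x = "\<lambda>n. z * q^n"
 have sub: "filterlim (\<lambda>J. N * J) at_top sequentially" using N_pos by (intro filterlim_subseq) (simp add: strict_mono_def)
 have inj: "inj_on ?x A" for A using inj_q by (rule inj_on_subset) simp
 have "(\<lambda>M. (\<Prod>n<M. 1 - (- (s * z)) * q^n) / (\<Prod>n<M. 1 - z\<^sup>2 * (q\<^sup>2)^n) * pair_prod (hlC (q^N)) (?x ` {..<M})) \<longlonglongrightarrow> T1"
  unfolding T1_def using qpoch_nz_norm[OF norm_q2 norm_z2]
  by (intro tendsto_mult tendsto_divide qpoch_LIMSEQ norm_q norm_q2 pair_prod_geometric_tendsto norm_z inj_q)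
 then have "(\<lambda>J. (\<Prod>n<N * J. 1 - (- (s * z)) * q^n) / (\<Prod>n<N * J. 1 - z\<^sup>2 * (q\<^sup>2)^n) * pair_prod (hlC (q^N)) (?x ` {..<N * J})) \<longlonglongrightarrow> T1"
  by (rule filterlim_compose[OF _ sub])
 moreover have "(\<Prod>n<M. 1 - (- (s * z)) * q^n) / (\<Prod>n<M. 1 - z\<^sup>2 * (q\<^sup>2)^n) * pair_prod (hlC (q^N)) (?x ` {..<M}) =
   (\<Prod>n<M. ?x n^k) * section_weight g1 (q^N) (?x ` {..<M})" for M
 proof -
  have "(\<Prod>n<M. ?x n^k) * (\<Prod>n<M. g1 (?x n)) = (\<Prod>n<M. (1 - (- (s * z)) * q^n) / (1 - z\<^sup>2 * (q\<^sup>2)^n))"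
   unfolding prod.distrib[symmetric]
  proof (intro prod.cong refl)
   fix n
   have "?x n \<noteq> 0" using w by (simp add: q_power)
   then have "?x n^k * inverse (?x n)^k = 1" by (metis power_mult_distrib power_one right_inverse)
   then have "?x n^k * g1 (?x n) = (1 + s * ?x n) / (1 - (?x n)\<^sup>2)" by (simp only: g1_def mult.assoc[symmetric] mult_1)
   moreover have "(?x n)\<^sup>2 = z\<^sup>2 * (q\<^sup>2)^n" by (simp add: power_mult_distrib mult.commute flip: power_mult)
   ultimately show "?x n^k * g1 (?x n) = (1 - (- (s * z)) * q^n) / (1 - z\<^sup>2 * (q\<^sup>2)^n)" by (simp add: mult.assoc)
  qed
  then show ?thesis unfolding section_weight_def prod.reindex[OF inj] comp_def by (simp add: prod_dividef mult.assoc[symmetric])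
 qed
 ultimately show ?thesis unfolding one.wt_def one_nome sect_one by simp
qed

theorem bounded_sum_limit:
 "(\<lambda>J. bounded_sum (2 * k) 1 s (q^N) (\<lambda>i. z * q^i) {..<N * J}) \<longlonglongrightarrow>
  T1 / one.denom one.zero * (1 / 2)^\<sigma> * leibniz R one.total"
proof -
 have s0: "s \<noteq> 0" using w by (simp add: s_def)
 have card: "card special = \<sigma>" using \<sigma> by (auto simp: special_def)
 have "bounded_sum (2 * k) 1 s (q^N) (\<lambda>i. z * q^i) {..<N * J} =
   (\<Prod>n<N * J. (z * q^n)^k) * section_sum g1 one.nome (one.omega J)" for J
 proof -
  have "generic ((\<lambda>i. z * q^i) ` {..<N * J})" unfolding sect_one[symmetric] by (rule one.generic_sect[OF one.below_subset])
  moreover have "inj_on (\<lambda>i. z * q^i) {..<N * J}" using inj_q by (rule inj_on_subset) simp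
  ultimately have "bounded_sum (2 * k) 1 s (q^N) (\<lambda>i. z * q^i) {..<N * J} = (\<Prod>n<N * J. (z * q^n)^k) *
   section_sum (\<lambda>y. inverse y^k * ((1 + s * y) / (1 - y\<^sup>2))) (q^N)
    ((\<lambda>i. z * q^i) ` {..<N * J} \<union> inverse ` (\<lambda>i. z * q^i) ` {..<N * J})" using s0 by (rule bounded_sum_eq_section_sum)
  then show ?thesis unfolding g1_def[abs_def] one_nome one.omega_eq_sect[OF one.below_subset[of J one.zero]] sect_one .
 qed
 moreover have "(\<lambda>J. (\<Prod>n<N * J. (z * q^n)^k) * section_sum g1 one.nome (one.omega J)) \<longlonglongrightarrow>
   T1 / one.denom one.zero * (1 / 2)^card special * leibniz R one.total"
  using odd_case(1,2) even_case(2) by (intro one.section_sum_limit weight_one_tendsto) blast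
 ultimately show ?thesis by (simp add: card)
qed

end

section \<open>Evaluation of the dual section sum\<close>

context dual_chains
begin

definition X :: "nat \<Rightarrow> complex" where "X j = w^(2 * (a + 2 * j))"
text \<open>Starting points of the \<open>2 * R\<close> progressions of ratio \<open>p\<close> that
  make up the base section of the second system, interleaved so that \<open>2 * j\<close> and
  \<open>2 * j + 1\<close> belong to the same index \<open>j\<close>.\<close>

definition ray :: "nat \<Rightarrow> complex" where
 "ray c = rp * (if even c then X (c div 2) else inverse (X (c div 2)))"
definition rexp :: "nat \<Rightarrow> int \<Rightarrow> int" where
 "rexp c l = 2 * (int kap + (if even c then b2 (c div 2) else - b2 (c div 2)) + 2 * int kap * l)"

lemma X_powi: "X j = w powi (2 * b2 j)"
proof -
 have "w powi (int (2 * (a + 2 * j))) = X j" unfolding power_int_of_nat X_def ..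
 moreover have "int (2 * (a + 2 * j)) = 2 * b2 j" by (simp add: b2_def)
 ultimately show ?thesis by simp
qed

lemma X_nz: "X j \<noteq> 0" using w by (simp add: X_def)

lemma ray_power: "ray c * p^l = w powi (rexp c (int l))"
proof -
 have "rp = w powi (2 * int kap)" using power_int_of_nat[of w "2 * kap"] by (simp add: rp_def)
 moreover have "p^l = w powi (4 * int kap * int l)"
 proof -
  have "w powi (4 * int kap) = p" using power_int_of_nat[of w "4 * kap"] by (simp add: p_def)
  then show ?thesis by (simp only: powi_mult)
 qed
 ultimately show ?thesis using one.powi_add by (auto simp: ray_def rexp_def X_powi power_int_minus[symmetric] algebra_simps)
qed

lemma rexp_ex: "rexp c l = (if even c then two.ex (c div 2) l else - two.ex (c div 2) (- l - 1))" by (simp add: rexp_def two.ex_def algebra_simps)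

lemma inj_rays: "inj_on (\<lambda>(c, l). ray c * p^l) ({..<2 * R} \<times> UNIV)"
proof (rule inj_onI, clarify)
 fix c l d m assume c: "c < 2 * R" "d < 2 * R" and "ray c * p^l = ray d * p^m"
 then have e: "rexp c (int l) = rexp d (int m)" by (simp add: ray_power one.powi_eq_iff)
 have i: "c div 2 < R" "d div 2 < R" using c by auto
 have J: "two.low J i = - int J" for J i by (simp add: two.low_def)
 define J where "J = Suc (l + m)"
 have ne: "two.ex (c div 2) x + two.ex (d div 2) y \<noteq> 0" if "- int J \<le> x" "- int J \<le> y" for x y
  using two.ex_sum[OF i, of J x y] that by (simp add: J)
 have "even c = even d \<and> c div 2 = d div 2 \<and> l = m"
 proof (cases "even c"; cases "even d")
  assume p: "even c" "even d"
  then have "two.ex (c div 2) (int l) = two.ex (d div 2) (int m)" using e by (simp add: rexp_ex)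
  then have "c div 2 = d div 2 \<and> int l = int m" using two.ex_inj[OF i] by blast
  then show ?thesis using p by auto
 next
  assume p: "odd c" "odd d"
  then have "two.ex (c div 2) (- int l - 1) = two.ex (d div 2) (- int m - 1)" using e by (simp add: rexp_ex)
  then have "c div 2 = d div 2 \<and> - int l - 1 = - int m - 1" using two.ex_inj[OF i] by blast
  then show ?thesis using p by auto
 next
  assume p: "even c" "odd d"
  have "two.ex (c div 2) (int l) + two.ex (d div 2) (- int m - 1) = 0" using e p by (simp add: rexp_ex)
  then show ?thesis using ne[of "int l" "- int m - 1"] by (simp add: J_def)
 next
  assume p: "odd c" "even d"
  have "two.ex (c div 2) (- int l - 1) + two.ex (d div 2) (int m) = 0" using e p by (simp add: rexp_ex)
  then show ?thesis using ne[of "- int l - 1" "int m"] by (simp add: J_def)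
 qed
 then show "c = d \<and> l = m" by (metis div_mult_mod_eq odd_iff_mod_2_eq_one even_iff_mod_2_eq_zero)
qed

lemma sect_two: "two.sect J (two.below J one.zero) = rays ray p (2 * R) J"
proof (rule set_eqI, rule iffI)
 fix e assume "e \<in> two.sect J (two.below J one.zero)"
 then consider i l where "(i, l) \<in> two.idx J" "0 \<le> l" "e = two.point (i, l)"
  | i l where "(i, l) \<in> two.idx J" "l < 0" "e = inverse (two.point (i, l))" unfolding two.sect_def below_zero by force
 then show "e \<in> rays ray p (2 * R) J"
 proof cases
  case 1
  then have i: "2 * i < 2 * R" "nat l < J" by (auto simp: two.idx_def)
  have "e = ray (2 * i) * p^nat l" unfolding ray_power rexp_ex using 1 by (simp add: two.point_def)
  then show ?thesis using i unfolding rays_def by (intro image_eqI[of _ _ "(2 * i, nat l)"]) auto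
 next
  case 2
  then have i: "2 * i + 1 < 2 * R" "nat (- l - 1) < J" by (auto simp: two.idx_def two.low_def)
  have "e = ray (2 * i + 1) * p^nat (- l - 1)" unfolding ray_power rexp_ex using 2 by (simp add: two.point_def power_int_minus)
  then show ?thesis using i unfolding rays_def by (intro image_eqI[of _ _ "(2 * i + 1, nat (- l - 1))"]) auto
 qed
next
 fix e assume "e \<in> rays ray p (2 * R) J"
 then obtain c l where c: "c < 2 * R" "l < J" "e = w powi (rexp c (int l))" by (auto simp: rays_def ray_power)
 show "e \<in> two.sect J (two.below J one.zero)"
 proof (cases "even c")
  case True
  have "(c div 2, int l) \<in> two.idx J - two.below J one.zero" using c by (auto simp: below_zero two.idx_def two.low_def)
  moreover have "e = two.point (c div 2, int l)" using c True by (simp add: two.point_def rexp_ex)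
  ultimately show ?thesis unfolding two.sect_def by blast
 next
  case False
  have "(c div 2, - int l - 1) \<in> two.below J one.zero" using c by (auto simp: below_zero two.idx_def two.low_def)
  moreover have "e = inverse (two.point (c div 2, - int l - 1))" using c False by (simp add: two.point_def rexp_ex power_int_minus)
  ultimately show ?thesis unfolding two.sect_def by blast
 qed
qed

lemma two_nome: "two.nome = p" using power_int_of_nat[of w "4 * kap"] by (simp add: two.nome_def p_def)

lemma rp_square: "rp\<^sup>2 = p" and norm_rp: "norm rp < 1" and rp_nz: "rp \<noteq> 0" and p_nz: "p \<noteq> 0"
proof -
 show "norm rp < 1" unfolding rp_def kap_def by (rule norm_pow_w) simp
qed (use w in \<open>simp_all add: rp_def p_def flip: power_mult\<close>)

lemma b2_less_kap: "j < R \<Longrightarrow> b2 j < int kap" using a \<sigma> k by (auto simp: b2_def kap_eq N_eq)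

lemma norm_ray: "c < 2 * R \<Longrightarrow> norm (ray c) < 1"
proof -
 assume "c < 2 * R"
 then have i: "c div 2 < R" by auto
 have "1 \<le> rexp c 0" using b2_less_kap[OF i] by (auto simp: rexp_def b2_def)
 then have "norm (w powi rexp c 0) \<le> norm w powi 1" by (rule one.norm_powi_le)
 then show ?thesis using ray_power[of c 0] w by simp
qed

definition rayfun :: "complex \<Rightarrow> complex" where
 "rayfun y = qpoch_inf (- (rp * y)) p / (if \<sigma> = 0 then qpoch_inf y p else 1)"

definition T2 :: complex where
 "T2 = (\<Prod>c<2 * R. rayfun (ray c) * inverse (qpoch_inf ((ray c)\<^sup>2 * p) (p\<^sup>2))) *
  (\<Prod>c<2 * R. \<Prod>d<c. inverse (qpoch_inf (ray c * ray d) p))"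

lemma weight_two_tendsto: "(\<lambda>J. two.wt J one.zero) \<longlonglongrightarrow> T2"
proof -
 have "(\<lambda>J. \<Prod>l<J. g2 (ray c * p^l)) \<longlonglongrightarrow> rayfun (ray c)" if c: "c < 2 * R" for c
 proof -
  have 1: "(\<lambda>J. \<Prod>l<J. 1 - (- (rp * ray c)) * p^l) \<longlonglongrightarrow> qpoch_inf (- (rp * ray c)) p"
   by (rule qpoch_LIMSEQ[OF norm_p])
  show ?thesis
  proof (cases "\<sigma> = 0")
   case True
   have "(\<lambda>J. (\<Prod>l<J. 1 - (- (rp * ray c)) * p^l) / (\<Prod>l<J. 1 - ray c * p^l)) \<longlonglongrightarrow> qpoch_inf (- (rp * ray c)) p / qpoch_inf (ray c) p"
    using qpoch_nz_norm[OF norm_p norm_ray[OF c]] by (intro tendsto_divide 1 qpoch_LIMSEQ[OF norm_p])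
   moreover have "rayfun (ray c) = qpoch_inf (- (rp * ray c)) p / qpoch_inf (ray c) p" unfolding rayfun_def using True by simp
   ultimately show ?thesis unfolding even_case(3)[OF True] by (simp add: prod_dividef mult.assoc)
  next
   case False
   then have "rayfun (ray c) = qpoch_inf (- (rp * ray c)) p" unfolding rayfun_def by simp
   with 1 show ?thesis unfolding odd_case(3)[OF False] by (simp add: mult.assoc)
  qed
 qed
 then show ?thesis unfolding two.wt_def sect_two two_nome T2_def by (intro section_weight_rays_tendsto norm_p norm_ray inj_rays)
qed

text \<open>By \<open>total_swap\<close> the dual determinant is the transpose of the first
  one.\<close>

lemma two_limit: "(\<lambda>J. section_sum g2 p (two.omega J)) \<longlonglongrightarrow> T2 / two.denom one.zero * leibniz R one.total"
proof -
 have "leibniz R two.total = leibniz R (\<lambda>i j. one.total j i)" unfolding total_swap[symmetric] ..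
 also have "\<dots> = leibniz R one.total" by (rule leibniz_transpose)
 finally show ?thesis using two.section_sum_limit[of "\<lambda>_. 1" T2] weight_two_tendsto by (simp add: two_nome)
qed

lemma card_omega_two: "card (two.omega J) = 2 * (2 * R * J)" and closed_two: "inv_closed (two.omega J)"
proof -
 let ?S = "rays ray p (2 * R) J"
 have o: "two.omega J = ?S \<union> inverse ` ?S" using two.omega_eq_sect[OF two.below_subset[of J one.zero]] by (simp add: sect_two)
 have g: "generic ?S" using two.generic_sect[OF two.below_subset[of J one.zero]] by (simp add: sect_two)
 have "inj_on (\<lambda>(c, l). ray c * p^l) ({..<2 * R} \<times> {..<J})" by (rule inj_on_subset[OF inj_rays]) auto
 then have "card ?S = 2 * R * J" unfolding rays_def by (simp add: card_image)
 moreover have "card (inverse ` ?S) = card ?S" by (intro card_image) (auto simp: inj_on_def)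
 moreover have "finite ?S" using g by (simp add: generic_def)
 ultimately show "card (two.omega J) = 2 * (2 * R * J)" unfolding o using generic_inv_closed(2)[OF g] by (simp add: card_Un_disjoint)
 show "inv_closed (two.omega J)" unfolding o by (rule generic_inv_closed(1)[OF g])
qed

lemma subseq_ray: "filterlim (\<lambda>J. 2 * R * J) at_top sequentially" using R by (intro filterlim_subseq) (simp add: strict_mono_def)

text \<open>Expanding by \<open>1 + e\<close> shows \<open>g2\<close> as the two-parameter weight
  with parameters -1 and \<open>- rp\<close>, so every truncated sum is a finite product.\<close>

lemma constant_even:
 assumes "\<sigma> = 0"
 shows "(\<lambda>J. section_sum g2 p (two.omega J)) \<longlonglongrightarrow> qpoch_inf rp p"
proof -
 have "section_sum g2 p (two.omega J) = (\<Prod>i<2 * R * J. 1 - rp * p^i)" for J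
 proof -
  have "section_sum g2 p (two.omega J) = section_sum (\<lambda>e. (1 - (- 1) * e) * (1 - (- rp) * e) / (1 - e\<^sup>2)) p (two.omega J)"
  proof (rule section_sum_cong)
   fix e assume "e \<in> two.omega J"
   then have "e * e \<noteq> 1" using closed_two[of J] by (auto simp: inv_closed_def)
   moreover have "1 - e\<^sup>2 = (1 - e) * (1 + e)" by (simp add: power2_eq_square algebra_simps)
   ultimately have "1 - e \<noteq> 0" "1 + e \<noteq> 0" "1 - e\<^sup>2 = (1 - e) * (1 + e)" by (auto simp: power2_eq_square)
   then show "g2 e = (1 - (- 1) * e) * (1 - (- rp) * e) / (1 - e\<^sup>2)" unfolding even_case(3)[OF assms] by simp
  qed
  moreover have even_half: "card (two.omega J) div 2 = 2 * R * J" unfolding card_omega_two by (rule nonzero_mult_div_cancel_left) simp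
  ultimately show ?thesis using section_sum_two_param[OF closed_two[of J], of "-1" "- rp" p] unfolding even_half by simp
 qed
 then show ?thesis using filterlim_compose[OF qpoch_LIMSEQ[OF norm_p, of rp] subseq_ray] by simp
qed

text \<open>The weight is \<open>1 + rp * e\<close>, and the one-parameter limit gives
  \<open>(p; p^2)\<close> times \<open>(-1; p)\<close>, which is 2 by Euler's identity. Points are
  enumerated round by round, one from each ray, so that \<open>1 / v n\<close> grows only like
  \<open>p\<close> to the power \<open>- (n div C)\<close>.\<close>

lemma constant_odd:
 assumes "\<sigma> \<noteq> 0"
 shows "(\<lambda>J. section_sum g2 p (two.omega J)) \<longlonglongrightarrow> 2"
proof -
 define C where "C = 2 * R"
 have C: "C > 0" using R by (simp add: C_def)
 define v where "v n = ray (n mod C) * p^(n div C)" for n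
 have inj: "inj v"
 proof (rule injI)
  fix m n assume "v m = v n"
  then have "(m mod C, m div C) = (n mod C, n div C)"
   using inj_onD[OF inj_rays, of "(m mod C, m div C)" "(n mod C, n div C)"] C by (simp add: v_def C_def)
  then show "m = n" by (metis Pair_inject div_mult_mod_eq)
 qed
 have rays: "v ` {..<C * J} = rays ray p (2 * R) J" for J
 proof (rule set_eqI, rule iffI)
  fix e assume "e \<in> v ` {..<C * J}"
  then obtain n where n: "n < C * J" "e = v n" by auto
  have "n mod C < C" "n div C < J" using C n by (auto simp: less_mult_imp_div_less mult.commute)
  then show "e \<in> rays ray p (2 * R) J" unfolding rays_def n(2) v_def C_def[symmetric] by force
 next
  fix e assume "e \<in> rays ray p (2 * R) J"
  then obtain c l where c: "c < C" "l < J" "e = ray c * p^l" by (auto simp: rays_def C_def)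
  have "c + C * l < C * Suc l" using c by simp
  also have "C * Suc l \<le> C * J" using c by (intro mult_left_mono) auto
  finally have "c + C * l < C * J" .
  moreover have "v (c + C * l) = e" using c by (simp add: v_def)
  ultimately show "e \<in> v ` {..<C * J}" by blast
 qed
 have gen: "generic (v ` {..<n})" for n
 proof (rule generic_subset)
  show "generic (v ` {..<C * n})" unfolding rays using two.generic_sect[OF two.below_subset[of n one.zero]] by (simp add: sect_two)
  have "n \<le> C * n" using C by simp
  then show "v ` {..<n} \<subseteq> v ` {..<C * n}" by (intro image_mono) auto
 qed
 have avoid: "- (p^j * rp) \<notin> v ` {..<n} \<union> inverse ` v ` {..<n}" for n j
 proof -
  have "p^j * rp = w powi int (4 * kap * j + 2 * kap)" unfolding power_int_of_nat by (simp add: p_def rp_def power_add power_mult)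
  then obtain m where m: "p^j * rp = w powi m" by blast
  have "w powi m + w powi x \<noteq> 0" for x
  proof
   assume "w powi m + w powi x = 0"
   then have "w powi m = - (w powi x)" by (simp add: eq_neg_iff_add_eq_0)
   then have "w powi (m - x) = -1" using w by (simp add: power_int_diff)
   then show False using powi_neq_minus_one by blast
  qed
  then have ne: "- (w powi m) \<noteq> w powi x" for x by (metis add.commute add.right_inverse)
  have "inverse (v i) = w powi (- rexp (i mod C) (int (i div C)))" "v i = w powi (rexp (i mod C) (int (i div C)))" for i
   by (simp_all add: v_def ray_power power_int_minus)
  then show ?thesis unfolding m using ne by (metis (no_types, lifting) UnE imageE)
 qed
 define K where "K = (\<Sum>c<C. norm (inverse (ray c)))"
 have K: "norm (inverse (ray c)) \<le> K" if "c < C" for c unfolding K_def using that by (intro member_le_sum) auto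
 have K0: "0 \<le> K" unfolding K_def by (intro sum_nonneg) auto
 define m where "m n = 2 * (1 + K) * norm p^(n div C)" for n
 have np: "norm p < 1" "0 < norm p" using norm_p p_nz by auto
 have m_summable: "summable m"
 proof -
  have "(\<lambda>(l, c). norm p^l) summable_on (UNIV \<times> {..<C})"
  proof (rule summable_on_SigmaI[where g = "\<lambda>l. of_nat C * norm p^l"])
   have "summable (\<lambda>l. of_nat C * norm p^l)" using np by (intro summable_mult summable_geometric) auto
   then show "(\<lambda>l. of_nat C * norm p^l) summable_on UNIV" by (rule summable_nonneg_imp_summable_on) auto
  qed (auto intro!: has_sum_finiteI)
  moreover have "bij_betw (\<lambda>n. (n div C, n mod C)) UNIV (UNIV \<times> {..<C})"
   by (rule bij_betw_byWitness[where f' = "\<lambda>(l, c). l * C + c"]) (use C in auto)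
  ultimately have "(\<lambda>n. norm p^(n div C)) summable_on UNIV" by (subst (asm) summable_on_reindex_bij_betw[symmetric]) auto
  then have "summable (\<lambda>n. norm p^(n div C))" by (rule summable_on_imp_summable)
  then show ?thesis unfolding m_def by (rule summable_mult)
 qed
 have m_bound: "norm (p^n * (1 + p^j * rp * v n) * (1 + p^j * rp / v n)) \<le> m n" for n j
 proof -
  let ?x = "p^j * rp" and ?c = "n mod C" and ?l = "n div C"
  have c: "?c < C" using C by simp
  have x: "norm ?x \<le> 1" using norm_mult_power_less_1[OF norm_rp norm_p, of j] by (simp add: mult.commute)
  have vn: "norm (v n) \<le> 1" unfolding v_def using norm_mult_power_less_1[OF norm_ray norm_p, of ?c ?l] c by (simp add: C_def)
  have a: "norm (1 + ?x * v n) \<le> 2"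
  proof -
   have "norm (?x * v n) \<le> 1 * 1" unfolding norm_mult[of ?x] by (intro mult_mono x vn) auto
   then show ?thesis using norm_triangle_ineq[of 1 "?x * v n"] by simp
  qed
  have iv: "norm (inverse (v n)) * norm p^?l \<le> K"
  proof -
   have "inverse (v n) * p^?l = inverse (ray ?c)" using p_nz by (simp add: v_def)
   then have "norm (inverse (v n)) * norm p^?l = norm (inverse (ray ?c))" by (metis norm_mult norm_power)
   with K[OF c] show ?thesis by simp
  qed
  have b: "norm p^?l * norm (1 + ?x / v n) \<le> 1 + K"
  proof -
   have "norm (?x / v n) \<le> 1 * norm (inverse (v n))" unfolding divide_inverse norm_mult[of ?x] by (intro mult_right_mono x) auto
   then have "norm (1 + ?x / v n) \<le> 1 + norm (inverse (v n))" using norm_triangle_ineq[of 1 "?x / v n"] by simp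
   then have "norm p^?l * norm (1 + ?x / v n) \<le> norm p^?l * (1 + norm (inverse (v n)))" by (intro mult_left_mono) auto
   also have "\<dots> = norm p^?l + norm (inverse (v n)) * norm p^?l" by (simp add: algebra_simps)
   also have "\<dots> \<le> 1 + K" using iv np by (intro add_mono power_le_one) auto
   finally show ?thesis .
  qed
  \<comment> \<open>Two powers of \<open>norm p^?l\<close> have to be extracted from
    \<open>p^n\<close>, one against the growth of \<open>1 / v n\<close> and one for summability;
    \<open>C \<ge> 2\<close> provides them.\<close>
  have "2 * ?l \<le> C * ?l" using R by (simp add: C_def)
  also have "\<dots> \<le> n" by simp
  finally have "norm p^n \<le> norm p^(?l + ?l)" using np by (intro power_decreasing) auto
  then have "norm (p^n * (1 + ?x * v n) * (1 + ?x / v n)) \<le> (norm p^?l * norm p^?l) * 2 * norm (1 + ?x / v n)"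
   unfolding norm_mult[of _ "1 + ?x / v n"] norm_mult[of "p^n"] norm_power[of p n] power_add by (intro mult_mono a) auto
  also have "\<dots> = 2 * norm p^?l * (norm p^?l * norm (1 + ?x / v n))" by simp
  also have "\<dots> \<le> 2 * norm p^?l * (1 + K)" by (intro mult_left_mono b) auto
  also have "\<dots> = m n" unfolding m_def by (simp only: mult_ac)
  finally show ?thesis .
 qed
 have "(\<lambda>n. section_sum (\<lambda>e. 1 + rp * e) p (v ` {..<n} \<union> inverse ` v ` {..<n})) \<longlonglongrightarrow> qpoch_inf (rp\<^sup>2) (p\<^sup>2) * qpoch_inf (- 1) p"
  by (rule section_sum_one_param_limit[OF norm_p p_nz norm_rp rp_nz inj gen avoid m_bound m_summable])
 then have "(\<lambda>J. section_sum (\<lambda>e. 1 + rp * e) p (v ` {..<C * J} \<union> inverse ` v ` {..<C * J})) \<longlonglongrightarrow> qpoch_inf (rp\<^sup>2) (p\<^sup>2) * qpoch_inf (- 1) p"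
  unfolding C_def by (rule filterlim_compose[OF _ subseq_ray])
 moreover have "v ` {..<C * J} \<union> inverse ` v ` {..<C * J} = two.omega J" for J
  unfolding rays using two.omega_eq_sect[OF two.below_subset[of J one.zero]] by (simp add: sect_two)
 moreover have "qpoch_inf (rp\<^sup>2) (p\<^sup>2) * qpoch_inf (- 1) p = 2"
 proof -
  have "qpoch_inf (- 1) p = 2 * qpoch_inf (- p) p" using qpoch_split[OF norm_p, of "-1" 1] by simp
  then show ?thesis using qpoch_euler[OF norm_p] by (simp add: rp_square mult_ac)
 qed
 moreover have "g2 = (\<lambda>e. 1 + rp * e)" using odd_case(3)[OF assms] by auto
 ultimately show ?thesis by simp
qed

definition cst :: complex where "cst = (if \<sigma> = 0 then qpoch_inf rp p else 2)"

text \<open>Two evaluations of the same limit; their comparison computes the determinant.\<close>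

lemma leibniz_total: "T2 * leibniz R one.total = cst * two.denom one.zero"
proof -
 have "(\<lambda>J. section_sum g2 p (two.omega J)) \<longlonglongrightarrow> cst"
  using constant_even constant_odd unfolding cst_def by (cases "\<sigma> = 0") auto
 from LIMSEQ_unique[OF two_limit this] show ?thesis using two.denom_nz[of one.zero] by (simp add: field_simps)
qed

end

section \<open>Denominators and weights at the base cut\<close>

lemma cosh_diff: "x \<noteq> 0 \<Longrightarrow> y \<noteq> 0 \<Longrightarrow> (y + inverse y) - (x + inverse x) = inverse y * ((1 - x * y) * (1 - y / x))"
 for x y :: complex by (simp add: field_simps)

lemma vandermonde_cosh:
 assumes "\<And>j. j < n \<Longrightarrow> x j \<noteq> 0"
 shows "vandermonde n (\<lambda>j. x j + inverse (x j)) = (\<Prod>j<n. inverse (x j)^j * (\<Prod>i<j. (1 - x i * x j) * (1 - x j / x i)))"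
 unfolding vandermonde_def
proof (rule prod.cong[OF refl])
 fix j assume "j \<in> {..<n}"
 then have "(\<Prod>i<j. (x j + inverse (x j)) - (x i + inverse (x i))) = (\<Prod>i<j. inverse (x j) * ((1 - x i * x j) * (1 - x j / x i)))"
  using assms by (intro prod.cong refl cosh_diff) auto
 then show "(\<Prod>i<j. (x j + inverse (x j)) - (x i + inverse (x i))) = inverse (x j)^j * (\<Prod>i<j. (1 - x i * x j) * (1 - x j / x i))"
  by (simp add: prod.distrib)
qed

text \<open>The monomial has the exponent offset times power, \<open>n j * (a + 2 * j)\<close>. The
  two systems exchange offsets and powers, so this monomial is common to both and cancels in the
  end.\<close>

lemma (in chain_weight) denom_zero:
 assumes n: "\<And>j. b j = int (n j)"
 defines "x \<equiv> \<lambda>j. w^(2 * n j)"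
 shows "denom zero = (\<Prod>j<R. - inverse (w^(n j * (a + 2 * j))) * ((1 - x j^a) * (\<Prod>i<j. (1 - x i * x j) * (1 - x j / x i))))"
proof -
 have u: "w powi (beta j 0) = w^n j" for j by (simp add: beta_def n)
 have x: "(w^n j)\<^sup>2 = x j" "x j \<noteq> 0" for j using w by (simp_all add: x_def mult.commute flip: power_mult)
 have cc: "cc j 0 = x j + inverse (x j)" for j unfolding cc_def u x(1)[symmetric] power_inverse ..
 have dd: "dd j 0 = - (inverse (w^n j)^a) * (1 - x j^a)" for j
 proof -
  have "u^a - inverse u^a = - (inverse u^a) * (1 - (u\<^sup>2)^a)" if "u \<noteq> 0" for u :: complex
   using that by (simp add: field_simps power_mult_distrib power2_eq_square flip: power_mult)
  then show ?thesis unfolding dd_def u x(1)[symmetric] using w by simp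
 qed
 have m: "- (inverse (w^n j)^a) * inverse (x j)^j = - inverse (w^(n j * (a + 2 * j)))" for j
 proof -
  have "(w^n j)^a * x j^j = w^(n j * (a + 2 * j))" unfolding x_def power_mult[symmetric] power_add[symmetric] by (simp add: algebra_simps)
  then show ?thesis by (metis inverse_mult_distrib mult_minus_left power_inverse)
 qed
 have "denom zero = (\<Prod>j<R. dd j 0) * vandermonde R (\<lambda>j. cc j 0)"
  unfolding denom_def vandermonde_def by (intro arg_cong2[where f = "(*)"] prod.cong refl) auto
 also have "\<dots> = (\<Prod>j<R. - (inverse (w^n j)^a) * inverse (x j)^j *
   ((1 - x j^a) * (\<Prod>i<j. (1 - x i * x j) * (1 - x j / x i))))"
  unfolding cc dd vandermonde_cosh[OF x(2)] by (simp only: prod.distrib mult_ac)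
 finally show ?thesis unfolding m .
qed

context dual_chains
begin

definition h :: complex where "h = w\<^sup>2"
definition qf :: "nat \<Rightarrow> complex" where "qf n = (\<Prod>i<n. 1 - q^Suc i)"

lemma h_q: "h^2 = q" and norm_h: "norm h < 1" and h_nz: "h \<noteq> 0" and q_nz: "q \<noteq> 0"
 using w norm_pow_w[of 2] by (simp_all add: h_def q_def flip: power_mult)

lemma z_h: "z = h^(\<sigma> + 1)" and z2_q: "z\<^sup>2 = q^(\<sigma> + 1)" and p_q: "p = q^kap" and rp_h: "rp = h^kap" and X_h: "X j = h^(a + 2 * j)"
 and p_h: "p = h^(2 * kap)"
proof -
 show zh: "z = h^(\<sigma> + 1)" unfolding z_def h_def by (rule power_mult)
 have "z\<^sup>2 = h^((\<sigma> + 1) * 2)" unfolding zh by (rule power_mult[symmetric])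
 also have "(\<sigma> + 1) * 2 = 2 * (\<sigma> + 1)" by simp
 finally show "z\<^sup>2 = q^(\<sigma> + 1)" unfolding h_q[symmetric] by (simp only: power_mult)
 show "p = q^kap" unfolding p_def q_def by (rule power_mult)
 show "rp = h^kap" unfolding rp_def h_def by (rule power_mult)
 show "X j = h^(a + 2 * j)" unfolding X_def h_def by (rule power_mult)
 show "p = h^(2 * kap)" unfolding p_def h_def power_mult[symmetric] by (rule arg_cong[where f = "(^) w"]) simp
qed

lemma norm_q_pow: "n > 0 \<Longrightarrow> norm (q^n) < 1" using norm_q by (simp add: norm_power power_less_one_iff)

lemma qq_split: "qpoch_inf q q = qf n * qpoch_inf (q^Suc n) q" using qpoch_split[OF norm_q, of q n] by (simp add: qf_def)

lemma qpoch_q_nz: "n > 0 \<Longrightarrow> qpoch_inf (q^n) q \<noteq> 0" by (intro qpoch_nz_norm norm_q norm_q_pow)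

text \<open>The \<open>N + 1\<close> symbols of nome \<open>q^2\<close> in \<open>T1\<close> combine
  in neighbouring pairs into symbols of nome \<open>q\<close>. Their number is odd for \<sigma> = 0,
  and then the first one, \<open>(q; q^2)\<close>, is left over.\<close>

lemma T1_eq:
 "T1 * (if \<sigma> = 0 then qpoch_inf q (q\<^sup>2) else 1) * qpoch_inf q q^R = qpoch_inf (- (s * z)) q * (\<Prod>j<R. qf (2 * j + 1))"
proof -
 define E where "E e = qpoch_inf (q^e) (q\<^sup>2)" for e
 have E0: "E e \<noteq> 0" if "e > 0" for e unfolding E_def using that by (intro qpoch_nz_norm norm_q2 norm_q_pow)
 have pair: "E e * E (Suc e) = qpoch_inf (q^e) q" for e using qpoch_parity[OF norm_q, of "q^e"] by (simp add: E_def mult.commute)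
 have row: "(\<Prod>e<2 * n. E (Suc (Suc e))) = (\<Prod>j<n. qpoch_inf (q^(2 * j + 2)) q)" for n
 proof (induction n)
  case (Suc n)
  have "(\<Prod>e<2 * Suc n. E (Suc (Suc e))) = (\<Prod>e<2 * n. E (Suc (Suc e))) * (E (2 * n + 2) * E (Suc (2 * n + 2)))" by simp
  then show ?case unfolding Suc.IH pair by simp
 qed simp
 have D: "qpoch_inf (z\<^sup>2) (q\<^sup>2) * (\<Prod>d<N. qpoch_inf (z\<^sup>2 * q^Suc d) (q\<^sup>2)) =
   (if \<sigma> = 0 then qpoch_inf q (q\<^sup>2) else 1) * (\<Prod>j<R. qpoch_inf (q^(2 * j + 2)) q)"
 proof -
  have z: "z\<^sup>2 * q^n = q^(\<sigma> + 1 + n)" for n by (simp add: z2_q power_add)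
  have "qpoch_inf (z\<^sup>2) (q\<^sup>2) * (\<Prod>d<N. qpoch_inf (z\<^sup>2 * q^Suc d) (q\<^sup>2)) = E (\<sigma> + 1) * (\<Prod>d<N. E (\<sigma> + 1 + Suc d))"
   unfolding z E_def using z[of 0] by simp
  also have "\<dots> = (if \<sigma> = 0 then qpoch_inf q (q\<^sup>2) else 1) * (\<Prod>j<R. qpoch_inf (q^(2 * j + 2)) q)"
  proof (cases "\<sigma> = 0")
   case True
   have "N = 2 * R - \<sigma>" by (rule N_def)
   also have "\<dots> = 2 * R" using True by simp
   finally have N: "N = 2 * R" .
   have "(\<Prod>d<N. E (\<sigma> + 1 + Suc d)) = (\<Prod>e<2 * R. E (Suc (Suc e)))" unfolding N using True by simp
   moreover have "E (\<sigma> + 1) = qpoch_inf q (q\<^sup>2)" unfolding E_def True by simp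
   ultimately show ?thesis unfolding row by (simp only: True if_True simp_thms)
  next
   case False
   then have \<sigma>1: "\<sigma> = 1" using \<sigma> by simp
   have "N = 2 * R - \<sigma>" by (rule N_def)
   moreover have "Suc (2 * R - \<sigma>) = 2 * R" using \<sigma>1 R by simp
   ultimately have N: "Suc N = 2 * R" by simp
   have "E (\<sigma> + 1) * (\<Prod>d<N. E (\<sigma> + 1 + Suc d)) = (\<Prod>e<Suc N. E (Suc (Suc e)))"
    unfolding prod.lessThan_Suc_shift by (intro arg_cong2[where f = "(*)"] prod.cong) (simp_all add: \<sigma>1)
   then show ?thesis unfolding N row using False by simp
  qed
  finally show ?thesis .
 qed
 have qq: "qpoch_inf q q^R = (\<Prod>j<R. qf (2 * j + 1)) * (\<Prod>j<R. qpoch_inf (q^(2 * j + 2)) q)"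
 proof -
  have "(\<Prod>j<R. qf (2 * j + 1)) * (\<Prod>j<R. qpoch_inf (q^(2 * j + 2)) q) = (\<Prod>j<R. qpoch_inf q q)"
   unfolding prod.distrib[symmetric] using qq_split[of "2 * _ + 1"] by (intro prod.cong) simp_all
  then show ?thesis by simp
 qed
 let ?e = "if \<sigma> = 0 then qpoch_inf q (q\<^sup>2) else 1" and ?S = "\<Prod>j<R. qpoch_inf (q^(2 * j + 2)) q"
 have "qpoch_inf (q^(2 * j + 2)) q \<noteq> 0" for j by (rule qpoch_q_nz) simp
 then have "?S \<noteq> 0" unfolding prod_zero_iff[OF finite_lessThan] by blast
 then have nz: "?e * ?S \<noteq> 0" using E0[of 1] by (simp add: E_def)
 have "T1 = qpoch_inf (- (s * z)) q / (?e * ?S)" unfolding T1_def D[symmetric] by (simp add: inverse_eq_divide)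
 then have 1: "T1 * (?e * ?S) = qpoch_inf (- (s * z)) q" using nz by simp
 have "T1 * ?e * qpoch_inf q q^R = (T1 * (?e * ?S)) * (\<Prod>j<R. qf (2 * j + 1))" unfolding qq by (simp only: mult_ac)
 then show ?thesis unfolding 1 .
qed

definition mon :: "nat \<Rightarrow> complex" where "mon j = - inverse (w^((2 * j + 1) * (a + 2 * j)))"

text \<open>For \<open>i < j\<close> the quotients of the nodes are \<open>q^1, ..., q^j\<close> and
  their products \<open>q^(j + 1), ..., q^(2 * j)\<close>, which gives \<open>qf (2 * j)\<close>
  without gaps.\<close>

lemma denom_one: "one.denom one.zero = (\<Prod>j<R. mon j * ((1 - (h^(2 * j + 1))^a) * qf (2 * j)))"
proof -
 let ?x = "\<lambda>j. h^(2 * j + 1)"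
 have x: "w^(2 * (2 * j + 1)) = ?x j" for j unfolding h_def by (rule power_mult)
 have v: "(\<Prod>i<j. (1 - ?x i * ?x j) * (1 - ?x j / ?x i)) = qf (2 * j)" for j
 proof -
  have 1: "?x i * ?x j = q^Suc (j + i)" if "i < j" for i
  proof -
   have "?x i * ?x j = h^(2 * Suc (j + i))" by (simp add: power_add[symmetric] algebra_simps)
   then show ?thesis by (simp only: power_mult h_q)
  qed
  have 2: "?x j / ?x i = q^(j - i)" if "i < j" for i
  proof -
   have "h^(2 * (j - i)) * ?x i = ?x j" unfolding power_add[symmetric] using that by (intro arg_cong[where f = "(^) h"]) simp
   moreover have "?x i \<noteq> 0" using h_nz by simp
   ultimately have "?x j / ?x i = h^(2 * (j - i))" by (metis nonzero_mult_div_cancel_right)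
   then show ?thesis by (simp only: power_mult h_q)
  qed
  have "(\<Prod>i<j. (1 - ?x i * ?x j) * (1 - ?x j / ?x i)) = (\<Prod>i<j. 1 - q^Suc (j + i)) * (\<Prod>i<j. 1 - q^(j - i))"
   unfolding prod.distrib using 1 2 by (intro arg_cong2[where f = "(*)"] prod.cong) auto
  also have "(\<Prod>i<j. 1 - q^(j - i)) = qf j"
  proof -
   have "(\<Prod>i<j. 1 - q^(j - i)) = (\<Prod>i<j. 1 - q^Suc (j - Suc i))" by (intro prod.cong refl) (simp add: Suc_diff_Suc del: power_Suc)
   also have "\<dots> = qf j" unfolding qf_def by (rule prod.nat_diff_reindex)
   finally show ?thesis .
  qed
  also have "(\<Prod>i<n. 1 - q^Suc (j + i)) * qf j = qf (j + n)" for n by (induction n) (simp_all add: qf_def mult_ac)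
  finally show ?thesis by (simp add: mult_2)
 qed
 have "b1 j = int (2 * j + 1)" for j by (simp add: b1_def)
 from one.denom_zero[OF this] show ?thesis unfolding x v mon_def by simp
qed

lemma denom_two: "two.denom one.zero = (\<Prod>j<R. mon j * ((1 - X j) * (\<Prod>i<j. (1 - X i * X j) * (1 - X j / X i))))"
proof -
 have "b2 j = int (a + 2 * j)" for j by (simp add: b2_def)
 from two.denom_zero[OF this] show ?thesis by (simp add: mon_def X_def mult.commute)
qed

end

section \<open>Theta function products\<close>

context dual_chains
begin

abbreviation "ff x \<equiv> qpoch_inf x p"

text \<open>Marks the factors that stem from the denominator \<open>1 - y\<close> of
  \<open>g2\<close>, present for \<sigma> = 0 only.\<close>

definition opt :: "complex \<Rightarrow> complex" where "opt x = (if \<sigma> = 0 then x else 1)"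
definition half_theta :: "complex \<Rightarrow> complex" where "half_theta x = opt (jtheta (rp * x) p)"

lemma opt_nz: "x \<noteq> 0 \<Longrightarrow> opt x \<noteq> 0" and opt_mult: "opt (x * y) = opt x * opt y" unfolding opt_def by simp_all

definition W :: complex where
 "W = (\<Prod>c<2 * R. ff (rp * ray c) * opt (ff (ray c))) * (\<Prod>c<2 * R. \<Prod>d<c. ff (ray c * ray d))"

lemma ff_nz: "norm x < 1 \<Longrightarrow> ff x \<noteq> 0" by (rule qpoch_nz_norm[OF norm_p])

lemma norm_mult_less_1: "norm (x::complex) < 1 \<Longrightarrow> norm y < 1 \<Longrightarrow> norm (x * y) < 1"
 using norm_mult_power_less_1[of x y 1] by simp

lemma W_nz: "W \<noteq> 0"
proof -
 have "ff (rp * ray c) * opt (ff (ray c)) \<noteq> 0" if c: "c < 2 * R" for c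
  using ff_nz[OF norm_mult_less_1[OF norm_rp norm_ray[OF c]]] opt_nz[OF ff_nz[OF norm_ray[OF c]]] by simp
 moreover have "ff (ray c * ray d) \<noteq> 0" if "c < 2 * R" "d < c" for c d using that by (intro ff_nz norm_mult_less_1 norm_ray) auto
 ultimately show ?thesis by (auto simp: W_def)
qed

lemma T2_eq: "T2 = inverse W"
proof -
 have "rayfun (ray c) * inverse (qpoch_inf ((ray c)\<^sup>2 * p) (p\<^sup>2)) = inverse (ff (rp * ray c) * opt (ff (ray c)))"
  if c: "c < 2 * R" for c
 proof -
  have "norm (- (rp * ray c)) < 1" using norm_mult_less_1[OF norm_rp norm_ray[OF c]] by simp
  then have nz: "ff (- (rp * ray c)) \<noteq> 0" by (rule ff_nz)
  have "(ray c)\<^sup>2 * p = (rp * ray c)\<^sup>2" by (simp add: power_mult_distrib rp_square)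
  then have "qpoch_inf ((ray c)\<^sup>2 * p) (p\<^sup>2) = ff (rp * ray c) * ff (- (rp * ray c))" using qpoch_square[OF norm_p] by simp
  then show ?thesis unfolding rayfun_def opt_def[symmetric] using nz by (simp add: field_simps)
 qed
 then have "(\<Prod>c<2 * R. rayfun (ray c) * inverse (qpoch_inf ((ray c)\<^sup>2 * p) (p\<^sup>2))) =
   (\<Prod>c<2 * R. inverse (ff (rp * ray c) * opt (ff (ray c))))" by (intro prod.cong refl) auto
 then show ?thesis unfolding T2_def W_def inverse_mult_distrib prod_inversef[symmetric] comp_def by simp
qed

lemma prod_rays_interleaved: "(\<Prod>c<2 * n. f (ray c)) = (\<Prod>j<n. f (rp * X j) * f (rp * inverse (X j)))" for f :: "complex \<Rightarrow> complex"
proof (induction n)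
 case (Suc n)
 have "(\<Prod>c<2 * Suc n. f (ray c)) = (\<Prod>c<2 * n. f (ray c)) * (f (ray (2 * n)) * f (ray (Suc (2 * n))))" by simp
 then show ?case unfolding Suc.IH by (simp add: ray_def)
qed simp

lemma jtheta_shift: "x \<noteq> 0 \<Longrightarrow> jtheta x p = (1 - x) * (ff (p * x) * ff (p * inverse x))"
 using qpoch_split[OF norm_p, of x 1] by (simp add: jtheta_def divide_inverse mult_ac)

text \<open>The symbols in \<open>W\<close> lack the first factor of the theta functions that they
  should form; \<open>denom\<close> supplies exactly these factors, by
  \<open>jtheta_shift\<close>.\<close>

lemma denom_two_W:
 "two.denom one.zero * W = (\<Prod>j<R. mon j * ff p * jtheta (X j) p * half_theta (X j) *
  (\<Prod>i<j. jtheta (X i * X j) p * jtheta (X j / X i) p))"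
proof -
 have A: "(\<Prod>c<2 * R. ff (rp * ray c) * opt (ff (ray c))) = (\<Prod>j<R. ff (p * X j) * ff (p * inverse (X j)) * half_theta (X j))"
  unfolding prod_rays_interleaved[where f = "\<lambda>y. ff (rp * y) * opt (ff y)"]
 proof (rule prod.cong[OF refl])
  fix j
  have pp: "rp * (rp * x) = p * x" for x by (simp add: rp_square[symmetric] power2_eq_square)
  have qq: "p / (rp * X j) = rp * inverse (X j)" using rp_nz X_nz by (simp add: rp_square[symmetric] power2_eq_square field_simps)
  show "ff (rp * (rp * X j)) * opt (ff (rp * X j)) * (ff (rp * (rp * inverse (X j))) * opt (ff (rp * inverse (X j)))) =
   ff (p * X j) * ff (p * inverse (X j)) * half_theta (X j)" unfolding half_theta_def jtheta_def opt_mult pp qq by (simp only: mult_ac)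
 qed
 have B: "(\<Prod>c<2 * R. \<Prod>d<c. ff (ray c * ray d)) = (\<Prod>j<R. ff p) *
  (\<Prod>j<R. \<Prod>i<j. ff (p * (X j * X i)) * ff (p * (X j / X i)) * (ff (p * (X i / X j)) * ff (p * inverse (X j * X i))))"
  using prod_pairs_interleaved[where X = X, OF X_nz, where r = rp and f = ff and R = R] unfolding rp_square ray_def[symmetric] .
 have C: "ff (p * (X j * X i)) * ff (p * (X j / X i)) * (ff (p * (X i / X j)) * ff (p * inverse (X j * X i))) *
   ((1 - X i * X j) * (1 - X j / X i)) = jtheta (X i * X j) p * jtheta (X j / X i) p" for i j
 proof -
  have "inverse (X j / X i) = X i / X j" "X j / X i \<noteq> 0" "X i * X j \<noteq> 0" using X_nz by auto
  then show ?thesis using jtheta_shift[of "X i * X j"] jtheta_shift[of "X j / X i"] by (simp add: mult_ac)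
 qed
 have "two.denom one.zero * W = (\<Prod>j<R. mon j * ff p * ((1 - X j) * (ff (p * X j) * ff (p * inverse (X j)))) * half_theta (X j) *
   (\<Prod>i<j. ff (p * (X j * X i)) * ff (p * (X j / X i)) * (ff (p * (X i / X j)) * ff (p * inverse (X j * X i))) *
   ((1 - X i * X j) * (1 - X j / X i))))" unfolding W_def A B denom_two by (simp only: prod.distrib mult_ac)
 then show ?thesis unfolding C jtheta_shift[OF X_nz, symmetric] .
qed

definition prefactor :: complex where
 "prefactor = (if \<sigma> = 0 then ff rp / qpoch_inf h q else if a = 2 then qpoch_inf (- q) q else qpoch_inf (- h) q)"

text \<open>For \<open>a = 1\<close> one has \<open>s * z = h * q^R\<close> for either parity, so
  the symbol starts \<open>R\<close> steps late. The first \<open>R\<close> factors are those by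
  which \<open>1 - x^2\<close> exceeds \<open>1 - x\<close> at the nodes
  \<open>x = h^(2 * j + 1)\<close>.\<close>

lemma numerator: "qpoch_inf (- (s * z)) q * (\<Prod>j<R. if a = 2 then 1 else 1 + h^(2 * j + 1)) =
  (if a = 2 then qpoch_inf (- (h^(\<sigma> + 1))) q else qpoch_inf (- h) q)"
proof (cases "a = 2")
 case True
 then show ?thesis unfolding s_def z_h by simp
next
 case False
 have sz: "s * z = h * q^R"
 proof -
  have "N + (\<sigma> + 1) = 2 * R - \<sigma> + (\<sigma> + 1)" by (simp only: N_def)
  also have "\<dots> = 2 * R + 1" using R \<sigma> by auto
  finally have "h^N * h^(\<sigma> + 1) = h^(2 * R + 1)" by (simp only: power_add[symmetric])
  moreover have "w^(2 * N) = h^N" unfolding h_def by (rule power_mult)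
  moreover have "h^(2 * R + 1) = h * q^R" by (simp add: power_mult h_q)
  moreover have "s = w^(2 * N)" unfolding s_def using False by simp
  ultimately show ?thesis unfolding z_h by argo
 qed
 have hj: "h^(2 * j + 1) = h * q^j" for j by (simp add: power_mult h_q)
 have "(\<Prod>j<R. if a = 2 then 1 else 1 + h^(2 * j + 1)) = (\<Prod>j<R. 1 - (- h) * q^j)" unfolding hj if_not_P[OF False] by simp
 with sz show ?thesis using qpoch_split[OF norm_q, of "- h" R] False by simp
qed

text \<open>\<open>leibniz_total\<close> eliminates the determinant and the common monomials
  \<open>mon j\<close> cancel; the result still has \<open>R\<close> rows.\<close>

theorem limit_eq:
 "T1 / one.denom one.zero * (1 / 2)^\<sigma> * leibniz R one.total = prefactor * (qpoch_inf p p / qpoch_inf q q)^R *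
  (\<Prod>j<R. jtheta (X j) p * half_theta (X j) * (\<Prod>i<j. jtheta (X i * X j) p * jtheta (X j / X i) p))"
proof -
 let ?e = "if \<sigma> = 0 then qpoch_inf q (q\<^sup>2) else 1"
 let ?c = "\<lambda>j. if a = 2 then 1 else 1 + h^(2 * j + 1)"
 let ?B = "qpoch_inf (- (s * z)) q"
 let ?Z = "\<Prod>j<R. jtheta (X j) p * half_theta (X j) * (\<Prod>i<j. jtheta (X i * X j) p * jtheta (X j / X i) p)"
 have e: "qpoch_inf q (q\<^sup>2) = qpoch_inf h q * qpoch_inf (- h) q" using qpoch_square[OF norm_q, of h] by (simp add: h_q)
 have nz: "qpoch_inf h q \<noteq> 0" "qpoch_inf (- h) q \<noteq> 0" "qpoch_inf q q \<noteq> 0" using qpoch_nz_norm[OF norm_q] norm_h norm_q by auto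
 then have e0: "?e \<noteq> 0" unfolding e by simp
 have L: "leibniz R one.total = cst * (two.denom one.zero * W)" using leibniz_total W_nz unfolding T2_eq by (simp add: field_simps)
 have qf: "qf (2 * j + 1) = (1 - (h^(2 * j + 1))^a) * qf (2 * j) * ?c j" for j
 proof -
  have "q^Suc (2 * j) = (h^(2 * j + 1))\<^sup>2" unfolding h_q[symmetric] power_mult[symmetric] by (simp only: mult.commute Suc_eq_plus1)
  then have "qf (2 * j + 1) = (1 - (h^(2 * j + 1))\<^sup>2) * qf (2 * j)" by (simp add: qf_def mult_ac del: power_Suc)
  moreover have "1 - x\<^sup>2 = (1 - x^a) * (if a = 2 then 1 else 1 + x)" for x :: complex using a by (auto simp: power2_eq_square algebra_simps)
  ultimately show ?thesis by (simp only: mult_ac)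
 qed
 have "T1 * ?e * qpoch_inf q q^R = ?B * (\<Prod>j<R. qf (2 * j + 1))" by (rule T1_eq)
 also have "\<dots> = (?B * (\<Prod>j<R. ?c j)) * (\<Prod>j<R. (1 - (h^(2 * j + 1))^a) * qf (2 * j))"
  unfolding qf by (simp only: prod.distrib mult_ac)
 finally have T: "T1 * ?e * qpoch_inf q q^R = \<dots>" .
 let ?M = "\<Prod>j<R. mon j"
 have d: "one.denom one.zero = ?M * (\<Prod>j<R. (1 - (h^(2 * j + 1))^a) * qf (2 * j))" unfolding denom_one by (simp only: prod.distrib)
 have d0: "one.denom one.zero \<noteq> 0" by (rule one.denom_nz)
 have dW: "two.denom one.zero * W = ?M * ff p^R * ?Z" unfolding denom_two_W by (simp add: prod.distrib)
 \<comment> \<open>For \<sigma> = 1 the factor 1/2 of the special progression cancels the value 2 of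
   the dual sum.\<close>
 have pre: "?B * (\<Prod>j<R. ?c j) * ((1 / 2)^\<sigma> * cst) = prefactor * ?e"
 proof (cases "\<sigma> = 0")
  case True
  have "?B * (\<Prod>j<R. ?c j) = qpoch_inf (- h) q" unfolding numerator using True by simp
  moreover have "prefactor = ff rp / qpoch_inf h q" "(1 / 2)^\<sigma> * cst = ff rp" unfolding prefactor_def cst_def using True by simp_all
  ultimately show ?thesis using nz unfolding e using True by simp
 next
  case False
  then have "\<sigma> = 1" using \<sigma> by simp
  have "(1 / 2)^\<sigma> * cst = 1" unfolding cst_def using \<open>\<sigma> = 1\<close> by simp
  moreover have "prefactor = (if a = 2 then qpoch_inf (- (h^(\<sigma> + 1))) q else qpoch_inf (- h) q)"
   unfolding prefactor_def using \<open>\<sigma> = 1\<close> h_q by (simp add: power2_eq_square)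
  ultimately show ?thesis unfolding numerator using False by simp
 qed
 have "(T1 / one.denom one.zero * (1 / 2)^\<sigma> * leibniz R one.total) * (one.denom one.zero * (?e * qpoch_inf q q^R)) =
   (T1 * ?e * qpoch_inf q q^R) * ((1 / 2)^\<sigma> * cst * (?M * ff p^R * ?Z))" unfolding L dW using d0 by simp
 also have "\<dots> = (?B * (\<Prod>j<R. ?c j) * ((1 / 2)^\<sigma> * cst)) * one.denom one.zero * (ff p^R * ?Z)"
  unfolding T d by (simp only: mult_ac)
 also have "\<dots> = (prefactor * (ff p / qpoch_inf q q)^R * ?Z) * (one.denom one.zero * (?e * qpoch_inf q q^R))"
  unfolding pre using nz(3) by (simp add: power_divide mult_ac)
 finally have f: "(T1 / one.denom one.zero * (1 / 2)^\<sigma> * leibniz R one.total) * (one.denom one.zero * (?e * qpoch_inf q q^R)) = \<dots>" .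
 have "one.denom one.zero * (?e * qpoch_inf q q^R) \<noteq> 0" using d0 e0 nz(3) by simp
 then show ?thesis using mult_right_cancel f by blast
qed

end

text \<open>Splitting \<open>(x^2; p)\<close> by parity of the index, the even part consists of the
  conjugate symbols of \<open>x\<close> and \<open>- x\<close>, while the odd part keeps nome
  \<open>p^2\<close>. In \<open>jtheta_square_half\<close> the two parts exchange their
  roles.\<close>

lemma jtheta_square:
 assumes p: "norm p < 1" "p \<noteq> 0" and x: "x \<noteq> 0"
 shows "jtheta (x\<^sup>2) p = jtheta x p * jtheta (- x) p * jtheta (p * x\<^sup>2) (p\<^sup>2)"
proof -
 have "qpoch_inf (x\<^sup>2) p = qpoch_inf x p * qpoch_inf (- x) p * qpoch_inf (p * x\<^sup>2) (p\<^sup>2)"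
  unfolding qpoch_parity[OF p(1), of "x\<^sup>2"] qpoch_square[OF p(1)] by (simp add: mult.commute)
 moreover have "qpoch_inf (p / x\<^sup>2) p = qpoch_inf (p / x) p * qpoch_inf (p / - x) p * qpoch_inf (p\<^sup>2 / (p * x\<^sup>2)) (p\<^sup>2)"
 proof -
  have e: "p / x\<^sup>2 * p = (p / x)\<^sup>2" "p\<^sup>2 / (p * x\<^sup>2) = p / x\<^sup>2" "p / - x = - (p / x)"
   using p(2) by (simp_all add: power2_eq_square)
  show ?thesis unfolding e qpoch_parity[OF p(1), of "p / x\<^sup>2"] qpoch_square[OF p(1)] by (simp only: mult_ac)
 qed
 ultimately show ?thesis unfolding jtheta_def by (simp only: mult_ac)
qed

lemma jtheta_square_half:
 assumes r: "norm (r\<^sup>2) < 1" "r \<noteq> 0" and x: "x \<noteq> 0"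
 shows "jtheta (x\<^sup>2) (r\<^sup>2) = jtheta (r * x) (r\<^sup>2) * jtheta (- (r * x)) (r\<^sup>2) * jtheta (x\<^sup>2) ((r\<^sup>2)\<^sup>2)"
proof -
 let ?p = "r\<^sup>2"
 have "qpoch_inf (x\<^sup>2) ?p = qpoch_inf (r * x) ?p * qpoch_inf (- (r * x)) ?p * qpoch_inf (x\<^sup>2) (?p\<^sup>2)"
 proof -
  have e: "x\<^sup>2 * ?p = (r * x)\<^sup>2" by (simp add: power_mult_distrib mult.commute)
  show ?thesis unfolding qpoch_parity[OF r(1), of "x\<^sup>2"] e qpoch_square[OF r(1)] by (simp only: mult_ac)
 qed
 moreover have "qpoch_inf (?p / x\<^sup>2) ?p = qpoch_inf (?p / (r * x)) ?p * qpoch_inf (?p / - (r * x)) ?p * qpoch_inf (?p\<^sup>2 / x\<^sup>2) (?p\<^sup>2)"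
 proof -
  have e: "?p / (r * x) = r / x" "?p / - (r * x) = - (r / x)" "?p\<^sup>2 / x\<^sup>2 = ?p / x\<^sup>2 * ?p"
   using r(2) x by (simp_all add: power2_eq_square field_simps)
  have e2: "?p / x\<^sup>2 = (r / x)\<^sup>2" by (simp add: power_divide)
  show ?thesis unfolding e qpoch_parity[OF r(1), of "?p / x\<^sup>2"] unfolding e2 qpoch_square[OF r(1)] by (simp only: mult_ac)
 qed
 ultimately show ?thesis unfolding jtheta_def by (simp only: mult_ac)
qed

lemma prod_concat:
 fixes f :: "nat \<Rightarrow> 'a::comm_monoid_mult"
 shows "(\<Prod>j<r. f j) * (\<Prod>j<k. f (r + j)) = (\<Prod>j<r + k. f j)"
proof (induction k)
 case (Suc k)
 have "(\<Prod>j<r. f j) * (\<Prod>j<Suc k. f (r + j)) = ((\<Prod>j<r. f j) * (\<Prod>j<k. f (r + j))) * f (r + k)" by (simp add: mult.assoc)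
 then show ?case unfolding Suc.IH by simp
qed simp

lemma prod_concat_rev:
 fixes f :: "nat \<Rightarrow> 'a::comm_monoid_mult"
 assumes "r + k = n"
 shows "(\<Prod>j<r. f j) * (\<Prod>j<k. f (n - 1 - j)) = (\<Prod>j<n. f j)"
proof -
 have "(\<Prod>j<k. f (n - 1 - j)) = (\<Prod>j<k. f (r + (k - Suc j)))" using assms by (intro prod.cong) auto
 also have "\<dots> = (\<Prod>j<k. f (r + j))" by (rule prod.nat_diff_reindex)
 finally show ?thesis using prod_concat[of f r k] assms by simp
qed

text \<open>The combinatorial core of the passage from \<open>R\<close> to \<open>k\<close>:
  \<open>k\<close> pairs taken from the two ends and \<open>r\<close> pairs around the centre
  exhaust a range of length \<open>2 * m\<close>. The odd variant has one central index in
  addition.\<close>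

lemma prod_inside_out:
 fixes f :: "nat \<Rightarrow> 'a::comm_monoid_mult"
 assumes m: "k + r = m"
 shows "(\<Prod>j<k. f j * f (2 * m - 1 - j)) * (\<Prod>j<r. f (m + j) * f (m - 1 - j)) = (\<Prod>j<2 * m. f j)"
proof -
 have "(\<Prod>j<k. f (2 * m - 1 - j)) = (\<Prod>j<k. f (m + (m - 1 - j)))" using m by (intro prod.cong refl arg_cong[of _ _ f]) auto
 then have "(\<Prod>j<k. f j * f (2 * m - 1 - j)) * (\<Prod>j<r. f (m + j) * f (m - 1 - j)) =
   ((\<Prod>j<k. f j) * (\<Prod>j<r. f (m - 1 - j))) * ((\<Prod>j<r. f (m + j)) * (\<Prod>j<k. f (m + (m - 1 - j))))"
  by (simp only: prod.distrib mult_ac)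
 also have "\<dots> = (\<Prod>j<m. f j) * (\<Prod>j<m. f (m + j))"
  using prod_concat_rev[OF m, of f] prod_concat_rev[of r k m "\<lambda>j. f (m + j)"] m by simp
 finally show ?thesis using prod_concat[of f m m] by (simp add: mult_2)
qed

lemma prod_inside_out_odd:
 fixes f :: "nat \<Rightarrow> 'a::comm_monoid_mult"
 assumes m: "k + r = m"
 shows "f m * (\<Prod>j<k. f j * f (2 * m - j)) * (\<Prod>j<r. f (m + 1 + j) * f (m - 1 - j)) = (\<Prod>j<2 * m + 1. f j)"
proof -
 have "(\<Prod>j<k. f (2 * m - j)) = (\<Prod>j<k. f (m + 1 + (m - 1 - j)))" using m by (intro prod.cong refl arg_cong[of _ _ f]) auto
 then have "(\<Prod>j<k. f j * f (2 * m - j)) * (\<Prod>j<r. f (m + 1 + j) * f (m - 1 - j)) =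
   ((\<Prod>j<k. f j) * (\<Prod>j<r. f (m - 1 - j))) * ((\<Prod>j<r. f (m + 1 + j)) * (\<Prod>j<k. f (m + 1 + (m - 1 - j))))"
  by (simp only: prod.distrib mult_ac)
 also have "\<dots> = (\<Prod>j<m. f j) * (\<Prod>j<m. f (m + 1 + j))"
  using prod_concat_rev[OF m, of f] prod_concat_rev[of r k m "\<lambda>j. f (m + 1 + j)"] m by simp
 finally have "f m * (\<Prod>j<k. f j * f (2 * m - j)) * (\<Prod>j<r. f (m + 1 + j) * f (m - 1 - j)) =
   (\<Prod>j<m + 1. f j) * (\<Prod>j<m. f (m + 1 + j))" by (simp add: mult_ac)
 moreover have "m + 1 + m = 2 * m + 1" by simp
 ultimately show ?thesis using prod_concat[of f "m + 1" m] by (simp only:)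
qed

section \<open>Theta values at powers of h\<close>

context dual_chains
begin

definition th :: "nat \<Rightarrow> complex" where "th n = jtheta (q^n) p"
text \<open>The nome is \<open>h^(2 * kap)\<close>, so \<open>jtheta (h^m) p\<close> consists of the
  symbols with exponents \<open>m\<close> and \<open>2 * kap - m\<close>; all theta values below are
  reduced to these symbols.\<close>

definition psi :: "nat \<Rightarrow> complex" where "psi m = ff (h^m)"
definition PP :: "nat \<Rightarrow> complex" where "PP n = (\<Prod>e<n. psi (2 * Suc e))"
definition TT :: "nat \<Rightarrow> complex" where "TT n = (\<Prod>e<n. th (Suc e))"
definition Q :: complex where "Q = qpoch_inf q q / ff p"

lemma q_pow_h: "q^n = h^(2 * n)" unfolding power_mult h_q ..

lemma psi_nz: "m > 0 \<Longrightarrow> psi m \<noteq> 0" unfolding psi_def using norm_h by (intro ff_nz) (simp add: norm_power power_less_one_iff)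

lemma jtheta_h: "m \<le> 2 * kap \<Longrightarrow> jtheta (h^m) p = psi m * psi (2 * kap - m)"
 unfolding jtheta_def psi_def p_h using h_nz by (simp add: power_diff)

lemma jtheta_rp_h: "m \<le> kap \<Longrightarrow> jtheta (rp * h^m) p = psi (kap + m) * psi (kap - m)"
proof -
 assume m: "m \<le> kap"
 have "rp * h^m = h^(kap + m)" by (simp add: rp_h power_add)
 moreover have "2 * kap - (kap + m) = kap - m" by simp
 ultimately show ?thesis using jtheta_h[of "kap + m"] m by simp
qed

lemma th_psi: "n \<le> kap \<Longrightarrow> th n = psi (2 * n) * psi (2 * (kap - n))"
 unfolding th_def q_pow_h by (subst jtheta_h) (simp_all add: diff_mult_distrib2)

lemma PP_nz: "PP n \<noteq> 0" unfolding PP_def using psi_nz by simp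

text \<open>Splitting \<open>(q; q)\<close> by residues modulo \<open>kap\<close> gives the even
  exponents up to \<open>2 * kap\<close>, the last of which is \<open>(p; p)\<close>.\<close>

lemma Q_eq: "PP (kap - 1) = Q"
proof -
 have "kap > 0" by (simp add: kap_def)
 then have "qpoch_inf q q = (\<Prod>c<kap. ff (q * q^c))" unfolding p_q by (rule qpoch_multisection[OF norm_q])
 also have "\<dots> = (\<Prod>c<Suc (kap - 1). psi (2 * Suc c))"
  using \<open>kap > 0\<close> by (simp add: psi_def q_pow_h[symmetric] del: mult_Suc_right)
 also have "\<dots> = PP (kap - 1) * psi (2 * kap)" unfolding prod.lessThan_Suc PP_def using \<open>kap > 0\<close> by simp
 also have "psi (2 * kap) = ff p" by (simp add: psi_def p_h)
 finally show ?thesis using ff_nz[OF norm_p] by (simp add: Q_def)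
qed

lemma Q_nz: "Q \<noteq> 0" unfolding Q_eq[symmetric] by (rule PP_nz)

text \<open>The reflected symbols in \<open>TT n\<close> are those of \<open>Q\<close> beyond the
  first \<open>kap - 1 - n\<close>. After division by \<open>Q\<close> the reflection of
  \<open>n\<close> into \<open>kap - 1 - n\<close> simply inverts the quotient, which is the source
  of the complementation.\<close>

lemma TT_PP: "n < kap \<Longrightarrow> TT n / Q = PP n / PP (kap - 1 - n)"
proof -
 assume n: "n < kap"
 have "(\<Prod>e<n. psi (2 * (kap - Suc e))) * PP (kap - 1 - n) = PP (kap - 1)" using n
 proof (induction n)
  case (Suc n)
  have "kap - 1 - n = Suc (kap - 1 - Suc n)" using Suc.prems by simp
  then have "PP (kap - 1 - n) = PP (kap - 1 - Suc n) * psi (2 * (kap - Suc n))" using Suc.prems by (simp add: PP_def)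
  moreover have "(\<Prod>e<n. psi (2 * (kap - Suc e))) * PP (kap - 1 - n) = PP (kap - 1)" using Suc by simp
  ultimately show ?case by (simp add: mult_ac)
 qed simp
 moreover have "TT n = PP n * (\<Prod>e<n. psi (2 * (kap - Suc e)))"
  unfolding TT_def PP_def prod.distrib[symmetric] using n by (intro prod.cong refl th_psi) auto
 ultimately show ?thesis using PP_nz Q_nz unfolding Q_eq by (simp add: field_simps)
qed

lemma prod_th_rev: "(\<Prod>i<j. th (j - i)) = TT j"
proof -
 have "(\<Prod>i<j. th (j - i)) = (\<Prod>i<j. th (Suc (j - Suc i)))" by (intro prod.cong refl) (simp add: Suc_diff_Suc)
 also have "\<dots> = TT j" unfolding TT_def by (rule prod.nat_diff_reindex)
 finally show ?thesis .
qed

lemma TT_add: "TT j * (\<Prod>i<n. th (j + Suc i)) = TT (j + n)" unfolding TT_def using prod_concat[of "\<lambda>e. th (Suc e)" j n] by simp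

lemma TT_Suc: "TT (Suc n) = TT n * th (Suc n)" by (simp add: TT_def)

text \<open>Within a row the differences give \<open>th\<close> at 1, ..., \<open>j\<close> and the
  sums at the next \<open>j\<close> indices. Here they fit exactly; in \<open>row_shift_2\<close>
  the index \<open>j + 1\<close> is missing, and in \<open>row_shift_0\<close> the index
  \<open>j\<close> is doubled while \<open>2 * j\<close> is missing.\<close>

lemma row_shift_1: "(\<Prod>i<j. th (j - i) * th (i + j + 1)) = TT (2 * j)"
 using TT_add[of j j] unfolding prod.distrib prod_th_rev by (simp add: add_ac mult_2)

lemma row_shift_2: "th (j + 1) * (\<Prod>i<j. th (j - i) * th (i + j + 2)) = TT (2 * j + 1)"
proof -
 have "(\<Prod>i<Suc j. th (j + Suc i)) = th (j + 1) * (\<Prod>i<j. th (i + j + 2))" unfolding prod.lessThan_Suc_shift by (simp add: add_ac)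
 moreover have "j + Suc j = 2 * j + 1" by simp
 ultimately show ?thesis using TT_add[of j "Suc j"] unfolding prod.distrib prod_th_rev by (simp only: mult_ac)
qed

lemma row_shift_0: "j > 0 \<Longrightarrow> th (2 * j) * (\<Prod>i<j. th (j - i) * th (i + j)) = th j * TT (2 * j)"
proof -
 assume "j > 0"
 then obtain m where m: "j = Suc m" by (cases j) auto
 have "(\<Prod>i<Suc m. th (i + j)) = th j * (\<Prod>i<m. th (j + Suc i))" unfolding prod.lessThan_Suc_shift by (simp add: add_ac)
 then have "(\<Prod>i<j. th (j - i) * th (i + j)) = TT j * (th j * (\<Prod>i<m. th (j + Suc i)))" unfolding prod.distrib prod_th_rev m by simp
 also have "\<dots> = th j * TT (j + m)" using TT_add[of j m] by (simp add: mult_ac)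
 finally have "th (2 * j) * (\<Prod>i<j. th (j - i) * th (i + j)) = th j * (TT (j + m) * th (2 * j))" by (simp only: mult_ac)
 moreover have "2 * j = Suc (j + m)" by (simp add: m)
 ultimately show ?thesis by (simp only: TT_Suc)
qed

lemma pairs_X: "i < j \<Longrightarrow> jtheta (X i * X j) p * jtheta (X j / X i) p = th (j - i) * th (i + j + a)"
proof -
 assume ij: "i < j"
 have "X i * X j = q^(i + j + a)" unfolding X_h q_pow_h power_add[symmetric] by (rule arg_cong[of _ _ "\<lambda>n. h^n"]) simp
 moreover have "X j / X i = q^(j - i)"
 proof -
  have "q^(j - i) * X i = X j" unfolding X_h q_pow_h power_add[symmetric] using ij by (intro arg_cong[of _ _ "\<lambda>n. h^n"]) simp
  then show ?thesis using X_nz[of i] by (metis nonzero_mult_div_cancel_right)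
 qed
 ultimately show ?thesis by (simp add: th_def mult.commute)
qed

lemma side_one:
 "(\<Prod>j<R. jtheta (X j) p * half_theta (X j) * (\<Prod>i<j. jtheta (X i * X j) p * jtheta (X j / X i) p)) =
  (if a = 2 then \<Prod>j<R. half_theta (h^(2 * j + 2)) * TT (2 * j + 1)
   else \<Prod>j<R. jtheta (h^(2 * j + 1)) p * half_theta (h^(2 * j + 1)) * TT (2 * j))"
proof -
 have P: "(\<Prod>i<j. jtheta (X i * X j) p * jtheta (X j / X i) p) = (\<Prod>i<j. th (j - i) * th (i + j + a))" for j
  by (intro prod.cong refl pairs_X) auto
 show ?thesis
 proof (cases "a = 2")
  case True
  have "a + 2 * j = 2 * j + 2" for j using True by simp
  then have X: "X j = h^(2 * j + 2)" for j by (simp only: X_h)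
  have "jtheta (X j) p * half_theta (X j) * (\<Prod>i<j. th (j - i) * th (i + j + a)) = half_theta (h^(2 * j + 2)) * TT (2 * j + 1)" for j
  proof -
   have "jtheta (X j) p = th (j + 1)" unfolding X th_def q_pow_h by simp
   moreover have "(\<Prod>i<j. th (j - i) * th (i + j + a)) = (\<Prod>i<j. th (j - i) * th (i + j + 2))" by (simp only: True)
   ultimately show ?thesis using row_shift_2[of j] unfolding X by (simp add: mult_ac)
  qed
  then show ?thesis unfolding P if_P[OF True] by simp
 next
  case False
  then have a1: "a = 1" using a by blast
  have "a + 2 * j = 2 * j + 1" for j using a1 by simp
  then have X: "X j = h^(2 * j + 1)" for j by (simp only: X_h)
  have row: "(\<Prod>i<j. th (j - i) * th (i + j + a)) = TT (2 * j)" for j using row_shift_1[of j] by (simp only: a1)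
  show ?thesis unfolding P if_not_P[OF False] row unfolding X ..
 qed
qed

end

text \<open>Multiplying by the full product of the \<open>B j\<close> cancels the reflected
  denominators and leaves \<open>r\<close> factors \<open>A j\<close> and \<open>k\<close> factors
  \<open>B j\<close>, an expression that treats both sides alike.\<close>

lemma ratio_cross:
 fixes A B :: "nat \<Rightarrow> 'a::field"
 assumes "r + k = n" and nz: "\<And>j. A j \<noteq> 0" "\<And>j. B j \<noteq> 0"
 shows "(\<Prod>j<r. A j / B (n - 1 - j)) * (\<Prod>j<n. B j) = (\<Prod>j<k. B j / A (n - 1 - j)) * (\<Prod>j<n. A j)"
proof -
 have c: "(\<Prod>j<r. A j / B (n - 1 - j)) * (\<Prod>j<n. B j) = (\<Prod>j<r. A j) * (\<Prod>j<k. B j)"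
  if "r + k = n" "\<And>j. B j \<noteq> 0" for r k and A B :: "nat \<Rightarrow> 'a"
 proof -
  have e: "(\<Prod>j<n. B j) = (\<Prod>j<k. B j) * (\<Prod>j<r. B (n - 1 - j))" using that(1) by (intro prod_concat_rev[symmetric]) simp
  have "(\<Prod>j<r. B (n - 1 - j)) \<noteq> 0" using that(2) by simp
  then show ?thesis unfolding prod_dividef e by simp
 qed
 show ?thesis using c[of r k B A] c[of k r A B] assms by (simp add: mult.commute add.commute)
qed

lemma cancel_common: "A * F = B * E \<Longrightarrow> F = E * c \<Longrightarrow> E \<noteq> 0 \<Longrightarrow> A * c = B" for A :: "'a::field"
 by (metis mult.assoc mult.commute mult_left_cancel)

section \<open>Trading R rows for k rows\<close>

context dual_chains
begin

lemma kap_even: "\<sigma> = 0 \<Longrightarrow> kap = 2 * (R + k) + 1"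
proof -
 assume "\<sigma> = 0"
 have "kap = 2 * R - \<sigma> + 2 * k + 1" by (simp only: kap_def N_def)
 also have "\<dots> = 2 * (R + k) + 1" using \<open>\<sigma> = 0\<close> by simp
 finally show ?thesis .
qed

lemma kap_odd: "\<sigma> \<noteq> 0 \<Longrightarrow> kap = 2 * (R + k)"
proof -
 assume s: "\<sigma> \<noteq> 0"
 have "kap = 2 * R - \<sigma> + 2 * k + 1" by (simp only: kap_def N_def)
 also have "\<dots> = 2 * (R + k)" using s \<sigma> R by auto
 finally show ?thesis .
qed

lemma half_even: "\<sigma> = 0 \<Longrightarrow> half_theta x = jtheta (rp * x) p" and half_odd: "\<sigma> \<noteq> 0 \<Longrightarrow> half_theta x = 1"
 unfolding half_theta_def opt_def by simp_all

lemma h_sections: "qpoch_inf h q = (\<Prod>c<kap. psi (2 * c + 1))"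
proof -
 have "kap > 0" by (simp add: kap_def)
 then have "qpoch_inf h q = (\<Prod>c<kap. ff (h * q^c))" unfolding p_q by (rule qpoch_multisection[OF norm_q])
 moreover have "ff (h * q^c) = psi (2 * c + 1)" for c by (simp add: psi_def q_pow_h)
 ultimately show ?thesis by simp
qed

lemma h_nonzero: "qpoch_inf h q \<noteq> 0" "qpoch_inf (- h) q \<noteq> 0" using qpoch_nz_norm[OF norm_q] norm_h by auto

lemma q_half: "qpoch_inf q (q\<^sup>2) = qpoch_inf h q * qpoch_inf (- h) q" using qpoch_square[OF norm_q, of h] by (simp add: h_q)

text \<open>Theta functions at odd powers of \<open>h\<close> use the outer odd exponents, those
  shifted by \<open>rp = h^kap\<close> the inner ones; together every odd exponent below
  \<open>2 * kap\<close> occurs once.\<close>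

lemma half_product_odd:
 assumes s: "\<sigma> \<noteq> 0"
 shows "(\<Prod>j<R. jtheta (h^(2 * j + 1)) p) * (\<Prod>j<k. jtheta (rp * h^(2 * j + 1)) p) = qpoch_inf h q"
proof -
 let ?n = "R + k" and ?f = "\<lambda>c. psi (2 * c + 1)"
 note kap = kap_odd[OF s]
 have "(\<Prod>j<R. jtheta (h^(2 * j + 1)) p) = (\<Prod>j<R. ?f j * ?f (2 * ?n - 1 - j))"
 proof (rule prod.cong[OF refl])
  fix j assume "j \<in> {..<R}"
  then have "2 * j + 1 \<le> 2 * kap" "2 * kap - (2 * j + 1) = 2 * (2 * ?n - 1 - j) + 1" using kap by auto
  then show "jtheta (h^(2 * j + 1)) p = ?f j * ?f (2 * ?n - 1 - j)" using jtheta_h by metis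
 qed
 moreover have "(\<Prod>j<k. jtheta (rp * h^(2 * j + 1)) p) = (\<Prod>j<k. ?f (?n + j) * ?f (?n - 1 - j))"
 proof (rule prod.cong[OF refl])
  fix j assume "j \<in> {..<k}"
  then have "2 * j + 1 \<le> kap" "kap + (2 * j + 1) = 2 * (?n + j) + 1" "kap - (2 * j + 1) = 2 * (?n - 1 - j) + 1" using kap by auto
  then show "jtheta (rp * h^(2 * j + 1)) p = ?f (?n + j) * ?f (?n - 1 - j)" using jtheta_rp_h by metis
 qed
 ultimately show ?thesis unfolding h_sections using prod_inside_out[of R k ?n ?f] kap by simp
qed

text \<open>Here \<open>kap\<close> is odd and is itself the central exponent, which accounts for
  \<open>ff rp\<close>.\<close>

lemma half_product_even:
 assumes s: "\<sigma> = 0" and n: "x + y = R + k"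
 shows "ff rp * (\<Prod>j<x. jtheta (h^(2 * j + 1)) p) * (\<Prod>j<y. jtheta (rp * h^(2 * j + 2)) p) = qpoch_inf h q"
proof -
 let ?n = "R + k" and ?f = "\<lambda>c. psi (2 * c + 1)"
 note kap = kap_even[OF s]
 have "(\<Prod>j<x. jtheta (h^(2 * j + 1)) p) = (\<Prod>j<x. ?f j * ?f (2 * ?n - j))"
 proof (rule prod.cong[OF refl])
  fix j assume "j \<in> {..<x}"
  then have "2 * j + 1 \<le> 2 * kap" "2 * kap - (2 * j + 1) = 2 * (2 * ?n - j) + 1" using kap n by auto
  then show "jtheta (h^(2 * j + 1)) p = ?f j * ?f (2 * ?n - j)" using jtheta_h by metis
 qed
 moreover have "(\<Prod>j<y. jtheta (rp * h^(2 * j + 2)) p) = (\<Prod>j<y. ?f (?n + 1 + j) * ?f (?n - 1 - j))"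
 proof (rule prod.cong[OF refl])
  fix j assume "j \<in> {..<y}"
  then have "2 * j + 2 \<le> kap" "kap + (2 * j + 2) = 2 * (?n + 1 + j) + 1" "kap - (2 * j + 2) = 2 * (?n - 1 - j) + 1" using kap n by auto
  then show "jtheta (rp * h^(2 * j + 2)) p = ?f (?n + 1 + j) * ?f (?n - 1 - j)" using jtheta_rp_h by metis
 qed
 moreover have "ff rp = ?f ?n" unfolding psi_def rp_h kap ..
 moreover have "(\<Prod>c<kap. ?f c) = (\<Prod>c<2 * ?n + 1. ?f c)" by (simp only: kap)
 ultimately show ?thesis unfolding h_sections using prod_inside_out_odd[OF n, of ?f] by (simp only:)
qed

text \<open>The same count with even exponents: \<open>kap\<close> plus an odd number is even, so
  the shifted theta functions fill the centre again.\<close>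

lemma int_product_even:
 assumes s: "\<sigma> = 0"
 shows "(\<Prod>j<R. jtheta (rp * h^(2 * j + 1)) p) * (\<Prod>j<k. th (j + 1)) = Q"
proof -
 let ?n = "R + k" and ?f = "\<lambda>e. psi (2 * Suc e)"
 note kap = kap_even[OF s]
 have "(\<Prod>j<k. th (j + 1)) = (\<Prod>j<k. ?f j * ?f (2 * ?n - 1 - j))"
 proof (rule prod.cong[OF refl])
  fix j assume "j \<in> {..<k}"
  then have "j + 1 \<le> kap" "2 * (kap - (j + 1)) = 2 * Suc (2 * ?n - 1 - j)" "2 * (j + 1) = 2 * Suc j" using kap by auto
  then show "th (j + 1) = ?f j * ?f (2 * ?n - 1 - j)" using th_psi by metis
 qed
 moreover have "(\<Prod>j<R. jtheta (rp * h^(2 * j + 1)) p) = (\<Prod>j<R. ?f (?n + j) * ?f (?n - 1 - j))"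
 proof (rule prod.cong[OF refl])
  fix j assume "j \<in> {..<R}"
  then have "2 * j + 1 \<le> kap" "kap + (2 * j + 1) = 2 * Suc (?n + j)" "kap - (2 * j + 1) = 2 * Suc (?n - 1 - j)" using kap by auto
  then show "jtheta (rp * h^(2 * j + 1)) p = ?f (?n + j) * ?f (?n - 1 - j)" using jtheta_rp_h by metis
 qed
 moreover have "Q = (\<Prod>e<2 * ?n. ?f e)" unfolding Q_eq[symmetric] PP_def kap by simp
 ultimately show ?thesis using prod_inside_out[of k R ?n ?f] by (simp add: mult.commute add.commute)
qed

text \<open>Consecutive values of \<open>PP\<close> differ by one symbol, and the
  \<open>R + k\<close> symbols that arise are the residue classes of
  \<open>(q; q^2)\<close>.\<close>

lemma odd_quotient:
 assumes s: "\<sigma> \<noteq> 0"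
 shows "(\<Prod>j<R + k. PP (2 * j + 1)) = qpoch_inf q (q\<^sup>2) * (\<Prod>j<R + k. PP (2 * j))"
proof -
 let ?n = "R + k"
 have n: "?n > 0" using R by simp
 have "qpoch_inf q (q\<^sup>2) = (\<Prod>j<?n. qpoch_inf (q * (q\<^sup>2)^j) ((q\<^sup>2)^?n))" by (rule qpoch_multisection[OF norm_q2 n])
 also have "(q\<^sup>2)^?n = p" unfolding p_q kap_odd[OF s] by (rule power_mult[symmetric])
 also have "(\<Prod>j<?n. ff (q * (q\<^sup>2)^j)) = (\<Prod>j<?n. psi (2 * Suc (2 * j)))"
 proof (rule prod.cong[OF refl])
  fix j
  have "q * (q\<^sup>2)^j = q^Suc (2 * j)" by (simp add: power_mult)
  then show "ff (q * (q\<^sup>2)^j) = psi (2 * Suc (2 * j))" by (simp only: psi_def q_pow_h)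
 qed
 finally show ?thesis by (simp add: PP_def prod.distrib mult.commute)
qed

lemma TT_scaled: "(\<And>j. j < n \<Longrightarrow> f j < kap) \<Longrightarrow> (1 / Q)^n * (\<Prod>j<n. TT (f j)) = (\<Prod>j<n. PP (f j) / PP (kap - 1 - f j))"
proof -
 assume f: "\<And>j. j < n \<Longrightarrow> f j < kap"
 have "(1 / Q)^n * (\<Prod>j<n. TT (f j)) = (\<Prod>j<n. TT (f j) / Q)" by (simp add: prod_dividef power_divide)
 also have "\<dots> = (\<Prod>j<n. PP (f j) / PP (kap - 1 - f j))" using f by (intro prod.cong refl TT_PP) auto
 finally show ?thesis .
qed

lemma TT_ratio:
 assumes r: "r \<le> R + k"
  and e: "\<And>j. j < R + k \<Longrightarrow> f j < kap \<and> kap - 1 - f j = g (R + k - 1 - j)"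
 shows "(1 / Q)^r * (\<Prod>j<r. TT (f j)) = (\<Prod>j<r. PP (f j) / PP (g (R + k - 1 - j)))"
proof -
 have "(1 / Q)^r * (\<Prod>j<r. TT (f j)) = (\<Prod>j<r. PP (f j) / PP (kap - 1 - f j))" using e r by (intro TT_scaled) auto
 also have "\<dots> = (\<Prod>j<r. PP (f j) / PP (g (R + k - 1 - j)))" using e r by (intro prod.cong refl) auto
 finally show ?thesis .
qed

text \<open>The hypothesis says that reflecting the values by \<open>kap - 1 - n\<close> while
  reversing the index exchanges \<open>f\<close> and \<open>g\<close>. Then
  \<open>ratio_cross\<close> replaces \<open>R\<close> factors by \<open>k\<close> factors.\<close>

lemma TT_cross:
 assumes e: "\<And>j. j < R + k \<Longrightarrow> f j < kap \<and> kap - 1 - f j = g (R + k - 1 - j)"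
  "\<And>j. j < R + k \<Longrightarrow> g j < kap \<and> kap - 1 - g j = f (R + k - 1 - j)"
 shows "(1 / Q)^R * (\<Prod>j<R. TT (f j)) * (\<Prod>j<R + k. PP (g j)) = (1 / Q)^k * (\<Prod>j<k. TT (g j)) * (\<Prod>j<R + k. PP (f j))"
proof -
 have "(1 / Q)^R * (\<Prod>j<R. TT (f j)) = (\<Prod>j<R. PP (f j) / PP (g (R + k - 1 - j)))" using e(1) by (intro TT_ratio) auto
 moreover have "(1 / Q)^k * (\<Prod>j<k. TT (g j)) = (\<Prod>j<k. PP (g j) / PP (f (R + k - 1 - j)))" using e(2) by (intro TT_ratio) auto
 ultimately show ?thesis using ratio_cross[of R k "R + k" "\<lambda>j. PP (f j)" "\<lambda>j. PP (g j)"] PP_nz by simp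
qed

text \<open>The first of four analogous transfers, one for each \<sigma> and \<open>a\<close>:
  \<open>TT_cross\<close> handles the integral powers of \<open>q\<close>, and the product formulas
  over odd or even exponents absorb the remaining theta functions together with the
  prefactor.\<close>

theorem side_even_2:
 assumes "\<sigma> = 0" "a = 2"
 shows "prefactor * (1 / Q)^R * (\<Prod>j<R. half_theta (h^(2 * j + 2)) * TT (2 * j + 1)) =
  (1 / Q)^k * (\<Prod>j<k. TT (2 * j + 1) / jtheta (h^(2 * j + 1)) p)"
proof -
 note kap = kap_even[OF assms(1)]
 let ?A = "\<Prod>j<R + k. PP (2 * j + 1)" and ?S = "\<Prod>j<R. jtheta (rp * h^(2 * j + 2)) p" and ?D = "\<Prod>j<k. jtheta (h^(2 * j + 1)) p"
 have pre: "prefactor = ff rp / qpoch_inf h q" unfolding prefactor_def using assms(1) by simp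
 have "(1 / Q)^R * (\<Prod>j<R. TT (2 * j + 1)) * ?A = (1 / Q)^k * (\<Prod>j<k. TT (2 * j + 1)) * ?A" by (rule TT_cross) (use kap in auto)
 moreover have "?A \<noteq> 0" using PP_nz by simp
 ultimately have X: "(1 / Q)^R * (\<Prod>j<R. TT (2 * j + 1)) = (1 / Q)^k * (\<Prod>j<k. TT (2 * j + 1))" by simp
 have H: "ff rp * ?D * ?S = qpoch_inf h q" using half_product_even[OF assms(1), of k R] by simp
 then have "?D \<noteq> 0" using h_nonzero(1) by (metis mult_zero_left mult_zero_right)
 then have f: "ff rp / qpoch_inf h q * ?S = 1 / ?D" using H h_nonzero(1) by (simp add: field_simps)
 have "ff rp / qpoch_inf h q * (1 / Q)^R * (?S * (\<Prod>j<R. TT (2 * j + 1))) =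
   (ff rp / qpoch_inf h q * ?S) * ((1 / Q)^R * (\<Prod>j<R. TT (2 * j + 1)))" by (simp only: mult_ac)
 also have "\<dots> = (1 / Q)^k * ((\<Prod>j<k. TT (2 * j + 1)) / ?D)" unfolding f X by simp
 finally show ?thesis unfolding pre half_even[OF assms(1)] prod.distrib prod_dividef .
qed

theorem side_even_1:
 assumes "\<sigma> = 0"
 shows "(ff rp / qpoch_inf h q) * (1 / Q)^R * (\<Prod>j<R. jtheta (h^(2 * j + 1)) p * half_theta (h^(2 * j + 1)) * TT (2 * j)) =
  (1 / Q)^k * (\<Prod>j<k. TT (2 * j + 2) / (th (j + 1) * jtheta (rp * h^(2 * j + 2)) p))"
proof -
 note kap = kap_even[OF assms(1)]
 let ?A = "(1 / Q)^R * (\<Prod>j<R. TT (2 * j))" and ?B = "(1 / Q)^k * (\<Prod>j<k. TT (2 * j + 2))"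
 let ?E = "\<Prod>j<R + k. PP (2 * j)"
 let ?J1 = "\<Prod>j<R. jtheta (h^(2 * j + 1)) p" and ?J2 = "\<Prod>j<R. jtheta (rp * h^(2 * j + 1)) p"
  and ?J3 = "\<Prod>j<k. jtheta (rp * h^(2 * j + 2)) p" and ?T = "\<Prod>j<k. th (j + 1)"
 have "?A * (\<Prod>j<R + k. PP (2 * j + 2)) = ?B * ?E" by (rule TT_cross) (use kap in auto)
 moreover have "(\<Prod>j<R + k. PP (2 * j + 2)) = ?E * Q"
 proof -
  have "PP 0 = 1" by (simp add: PP_def)
  moreover have "PP (2 * (R + k)) = Q" unfolding Q_eq[symmetric] kap by simp
  ultimately show ?thesis using prod.lessThan_Suc_shift[of "\<lambda>j. PP (2 * j)" "R + k"] by simp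
 qed
 moreover have "?E \<noteq> 0" using PP_nz by simp
 ultimately have AB: "?A * Q = ?B" by (rule cancel_common)
 have H1: "ff rp * ?J1 * ?J3 = qpoch_inf h q" by (rule half_product_even[OF assms(1) refl])
 have H2: "?J2 * ?T = Q" by (rule int_product_even[OF assms(1)])
 have nz: "?J3 \<noteq> 0" "?T \<noteq> 0" using H1 H2 h_nonzero(1) Q_nz by (metis mult_zero_right)+
 have "ff rp / qpoch_inf h q * ?A * (?J1 * ?J2) = (ff rp * ?J1 * ?J3) / qpoch_inf h q * (?A * (?J2 * ?T)) / (?T * ?J3)" using nz by simp
 also have "\<dots> = ?B / (?T * ?J3)" unfolding H1 H2 AB using h_nonzero(1) by simp
 finally have "ff rp / qpoch_inf h q * ?A * (?J1 * ?J2) = ?B / (?T * ?J3)" .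
 then show ?thesis unfolding half_even[OF assms(1)] prod.distrib prod_dividef times_divide_eq_right by (simp only: mult_ac)
qed

theorem side_odd_1:
 assumes "\<sigma> \<noteq> 0"
 shows "qpoch_inf (- h) q * (1 / Q)^R * (\<Prod>j<R. jtheta (h^(2 * j + 1)) p * half_theta (h^(2 * j + 1)) * TT (2 * j)) =
  (1 / Q)^k * (\<Prod>j<k. TT (2 * j + 1) / jtheta (rp * h^(2 * j + 1)) p)"
proof -
 note kap = kap_odd[OF assms(1)]
 let ?A = "(1 / Q)^R * (\<Prod>j<R. TT (2 * j))" and ?B = "(1 / Q)^k * (\<Prod>j<k. TT (2 * j + 1))"
 let ?E = "\<Prod>j<R + k. PP (2 * j)"
 let ?J1 = "\<Prod>j<R. jtheta (h^(2 * j + 1)) p" and ?J3 = "\<Prod>j<k. jtheta (rp * h^(2 * j + 1)) p"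
 have "?A * (\<Prod>j<R + k. PP (2 * j + 1)) = ?B * ?E" by (rule TT_cross) (use kap in auto)
 moreover have "(\<Prod>j<R + k. PP (2 * j + 1)) = ?E * (qpoch_inf h q * qpoch_inf (- h) q)"
  unfolding odd_quotient[OF assms] q_half by (rule mult.commute)
 moreover have "?E \<noteq> 0" using PP_nz by simp
 ultimately have AB: "?A * (qpoch_inf h q * qpoch_inf (- h) q) = ?B" by (rule cancel_common)
 have H: "?J1 * ?J3 = qpoch_inf h q" by (rule half_product_odd[OF assms])
 have nz: "?J3 \<noteq> 0" using H h_nonzero(1) by (metis mult_zero_right)
 have "qpoch_inf (- h) q * ?A * ?J1 = (?A * ((?J1 * ?J3) * qpoch_inf (- h) q)) / ?J3" using nz by simp
 also have "\<dots> = ?B / ?J3" unfolding H AB ..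
 finally have "qpoch_inf (- h) q * ?A * ?J1 = ?B / ?J3" .
 then show ?thesis unfolding half_odd[OF assms(1)] prod.distrib prod_dividef times_divide_eq_right by (simp add: mult_ac)
qed

theorem side_odd_2:
 assumes "\<sigma> \<noteq> 0"
 shows "qpoch_inf (- q) q * (1 / Q)^R * (\<Prod>j<R. half_theta (h^(2 * j + 2)) * TT (2 * j + 1)) = (1 / Q)^k * (\<Prod>j<k. TT (2 * j))"
proof -
 note kap = kap_odd[OF assms(1)]
 let ?A = "(1 / Q)^R * (\<Prod>j<R. TT (2 * j + 1))" and ?B = "(1 / Q)^k * (\<Prod>j<k. TT (2 * j))"
 let ?E = "\<Prod>j<R + k. PP (2 * j)"
 have "?A * ?E = ?B * (\<Prod>j<R + k. PP (2 * j + 1))" by (rule TT_cross) (use kap in auto)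
 moreover have "?E \<noteq> 0" using PP_nz by simp
 ultimately have "?A = ?B * qpoch_inf q (q\<^sup>2)" unfolding odd_quotient[OF assms] by simp
 then have "qpoch_inf (- q) q * ?A = ?B * (qpoch_inf (- q) q * qpoch_inf q (q\<^sup>2))" by simp
 then show ?thesis unfolding half_odd[OF assms(1)] qpoch_euler[OF norm_q] by (simp add: mult_ac)
qed

section \<open>The rows of the two right-hand sides\<close>

lemma row_even_first: "(jtheta (- (h^(2 * j + 1))) p * jtheta (p * q^(2 * j + 1)) (p\<^sup>2) * (\<Prod>i<j. th (j - i) * th (i + j + 1))) *
  jtheta (h^(2 * j + 1)) p = TT (2 * j + 1)"
proof -
 have e: "q^(2 * j + 1) = (h^(2 * j + 1))\<^sup>2" unfolding q_pow_h power_mult[symmetric] by (simp only: mult.commute)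
 have "th (2 * j + 1) = jtheta (h^(2 * j + 1)) p * jtheta (- (h^(2 * j + 1))) p * jtheta (p * q^(2 * j + 1)) (p\<^sup>2)"
  unfolding th_def e using h_nz by (intro jtheta_square norm_p p_nz) simp
 then show ?thesis unfolding row_shift_1 using TT_Suc[of "2 * j"] by (simp add: mult_ac)
qed

text \<open>For \<sigma> = 1 the first row degenerates to the argument \<open>h^0 = 1\<close>. Its
  value 2 cancels the denominator \<open>\<sigma> + 1\<close> of the first identity.\<close>

lemma row_odd_first_0: "jtheta (- 1) p * jtheta p (p\<^sup>2) = 2"
proof -
 have p2: "p\<^sup>2 / p = p" using p_nz by (simp add: power2_eq_square)
 have s: "ff (- 1) = 2 * ff (- p)" using qpoch_split[OF norm_p, of "-1" 1] by simp
 have "jtheta (- 1) p * jtheta p (p\<^sup>2) = 2 * (ff (- p) * qpoch_inf p (p\<^sup>2)) * (ff (- p) * qpoch_inf p (p\<^sup>2))"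
  unfolding jtheta_def p2 by (simp add: s mult_ac)
 then show ?thesis unfolding qpoch_euler[OF norm_p] by simp
qed

text \<open>The splitting of \<open>th (2 * j)\<close> produces another \<open>th j\<close> besides
  the doubled one of \<open>row_shift_0\<close>. Cancelling it requires
  \<open>th j \<noteq> 0\<close>, which holds for \<open>0 < j < kap\<close>.\<close>

lemma row_odd_first: "j > 0 \<Longrightarrow> jtheta (- (h^(2 * j))) p * jtheta (p * q^(2 * j)) (p\<^sup>2) * (\<Prod>i<j. th (j - i) * th (i + j)) = TT (2 * j)"
 if "j \<le> k"
proof -
 assume j: "j > 0"
 have e: "q^(2 * j) = (h^(2 * j))\<^sup>2" unfolding q_pow_h power_mult[symmetric] by (simp only: mult.commute)
 have "th (2 * j) = jtheta (h^(2 * j)) p * jtheta (- (h^(2 * j))) p * jtheta (p * q^(2 * j)) (p\<^sup>2)"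
  unfolding th_def e using h_nz by (intro jtheta_square norm_p p_nz) simp
 moreover have "jtheta (h^(2 * j)) p = th j" unfolding th_def q_pow_h ..
 ultimately have t: "th (2 * j) = th j * (jtheta (- (h^(2 * j))) p * jtheta (p * q^(2 * j)) (p\<^sup>2))" by (simp add: mult_ac)
 have "j < kap" using that by (simp add: kap_def)
 then have "th j \<noteq> 0" using th_psi[of j] psi_nz j by simp
 then show ?thesis using row_shift_0[OF j] unfolding t by (simp add: mult_ac)
qed

lemma row_even_second: "(jtheta (- (rp * h^(2 * j + 2))) p * jtheta (q^(2 * j + 2)) (p\<^sup>2) * (\<Prod>i<j. th (j - i) * th (i + j + 2))) *
  (th (j + 1) * jtheta (rp * h^(2 * j + 2)) p) = TT (2 * j + 2)"
proof -
 have e: "q^(2 * j + 2) = (h^(2 * j + 2))\<^sup>2" unfolding q_pow_h power_mult[symmetric] by (simp only: mult.commute)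
 have "th (2 * j + 2) = jtheta (rp * h^(2 * j + 2)) p * jtheta (- (rp * h^(2 * j + 2))) p * jtheta (q^(2 * j + 2)) (p\<^sup>2)"
  unfolding th_def e rp_square[symmetric] using h_nz rp_nz norm_p by (intro jtheta_square_half) (simp_all add: rp_square)
 moreover have "TT (2 * j + 2) = TT (2 * j + 1) * th (2 * j + 2)" using TT_Suc[of "2 * j + 1"] by simp
 ultimately show ?thesis unfolding row_shift_2[symmetric] by (simp only: mult_ac)
qed

lemma row_odd_second: "(jtheta (- (rp * h^(2 * j + 1))) p * jtheta (q^(2 * j + 1)) (p\<^sup>2) * (\<Prod>i<j. th (j - i) * th (i + j + 1))) *
  jtheta (rp * h^(2 * j + 1)) p = TT (2 * j + 1)"
proof -
 have e: "q^(2 * j + 1) = (h^(2 * j + 1))\<^sup>2" unfolding q_pow_h power_mult[symmetric] by (simp only: mult.commute)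
 have "th (2 * j + 1) = jtheta (rp * h^(2 * j + 1)) p * jtheta (- (rp * h^(2 * j + 1))) p * jtheta (q^(2 * j + 1)) (p\<^sup>2)"
  unfolding th_def e rp_square[symmetric] using h_nz rp_nz norm_p by (intro jtheta_square_half) (simp_all add: rp_square)
 moreover have "TT (2 * j + 1) = TT (2 * j) * th (2 * j + 1)" using TT_Suc[of "2 * j"] by simp
 ultimately show ?thesis unfolding row_shift_1 by (simp only: mult_ac)
qed

lemma row_reindex:
 fixes f :: "nat \<Rightarrow> complex" and G :: "nat \<Rightarrow> nat \<Rightarrow> complex"
 shows "(\<Prod>i=1..k. f i) * (\<Prod>j=1..k. \<Prod>i=1..<j. G i j) = (\<Prod>j<k. f (Suc j) * (\<Prod>i<j. G (Suc i) (Suc j)))"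
 by (simp add: prod.atLeast1_atMost_eq atLeastLessThanSuc_atLeastAtMost prod.distrib)

text \<open>The right-hand side of the first identity at \<open>t = q^N\<close>, with
  \<open>h\<close> as the square root of \<open>q\<close>.\<close>

definition first_side :: complex where
 "first_side = qpoch_inf p p^k / (of_nat (\<sigma> + 1) * qpoch_inf q q^k) *
  (\<Prod>i=1..k. jtheta (- (h^(2 * i - (\<sigma> + 1)))) p * jtheta (p * q^(2 * i - \<sigma> - 1)) (p^2)) *
  (\<Prod>j=1..k. \<Prod>i=1..<j. jtheta (q^(j - i)) p * jtheta (q^(i + j - \<sigma> - 1)) p)"

definition second_side :: complex where
 "second_side = qpoch_inf p p^k / qpoch_inf q q^k *
  (\<Prod>i=1..k. jtheta (- (rp * h^(2 * i - \<sigma>))) p * jtheta (q^(2 * i - \<sigma>)) (p^2)) *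
  (\<Prod>j=1..k. \<Prod>i=1..<j. jtheta (q^(j - i)) p * jtheta (q^(i + j - \<sigma>)) p)"

lemma first_side_rows: "first_side = (1 / Q)^k / of_nat (\<sigma> + 1) *
  (\<Prod>j<k. jtheta (- (h^(2 * Suc j - (\<sigma> + 1)))) p * jtheta (p * q^(2 * Suc j - \<sigma> - 1)) (p\<^sup>2) *
   (\<Prod>i<j. th (j - i) * th (Suc i + Suc j - \<sigma> - 1)))"
proof -
 have "first_side = qpoch_inf p p^k / (of_nat (\<sigma> + 1) * qpoch_inf q q^k) *
  (\<Prod>j<k. jtheta (- (h^(2 * Suc j - (\<sigma> + 1)))) p * jtheta (p * q^(2 * Suc j - \<sigma> - 1)) (p\<^sup>2) *
   (\<Prod>i<j. jtheta (q^(Suc j - Suc i)) p * jtheta (q^(Suc i + Suc j - \<sigma> - 1)) p))"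
  unfolding first_side_def mult.assoc row_reindex ..
 then show ?thesis unfolding th_def diff_Suc_Suc Q_def by (simp only: power_divide divide_divide_eq_left divide_divide_eq_right power_one mult_1 mult.commute)
qed

lemma second_side_rows: "second_side = (1 / Q)^k *
  (\<Prod>j<k. jtheta (- (rp * h^(2 * Suc j - \<sigma>))) p * jtheta (q^(2 * Suc j - \<sigma>)) (p\<^sup>2) *
   (\<Prod>i<j. th (j - i) * th (Suc i + Suc j - \<sigma>)))"
proof -
 have "second_side = qpoch_inf p p^k / qpoch_inf q q^k *
  (\<Prod>j<k. jtheta (- (rp * h^(2 * Suc j - \<sigma>))) p * jtheta (q^(2 * Suc j - \<sigma>)) (p\<^sup>2) *
   (\<Prod>i<j. jtheta (q^(Suc j - Suc i)) p * jtheta (q^(Suc i + Suc j - \<sigma>)) p))" unfolding second_side_def mult.assoc row_reindex ..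
 then show ?thesis unfolding th_def diff_Suc_Suc Q_def by (simp only: power_divide divide_divide_eq_left divide_divide_eq_right power_one mult_1 mult.commute)
qed

lemma first_side_eq:
 "first_side = (if \<sigma> = 0 then (1 / Q)^k * (\<Prod>j<k. TT (2 * j + 1) / jtheta (h^(2 * j + 1)) p)
   else (1 / Q)^k * (\<Prod>j<k. TT (2 * j)))"
proof (cases "\<sigma> = 0")
 case True
 have e: "2 * Suc j - (\<sigma> + 1) = 2 * j + 1" "2 * Suc j - \<sigma> - 1 = 2 * j + 1" "Suc i + Suc j - \<sigma> - 1 = i + j + 1"
  "of_nat (\<sigma> + 1) = (1 :: complex)" for i j using True by simp_all
 have "jtheta (- (h^(2 * j + 1))) p * jtheta (p * q^(2 * j + 1)) (p\<^sup>2) * (\<Prod>i<j. th (j - i) * th (i + j + 1)) =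
   TT (2 * j + 1) / jtheta (h^(2 * j + 1)) p" if j: "j < k" for j
 proof -
  have nz: "jtheta (h^(2 * j + 1)) p \<noteq> 0"
   using jtheta_h[of "2 * j + 1"] j psi_nz[of "2 * j + 1"] psi_nz[of "2 * kap - (2 * j + 1)"] by (simp add: kap_def)
  show ?thesis by (rule iffD2[OF nonzero_eq_divide_eq[OF nz] row_even_first])
 qed
 then show ?thesis unfolding first_side_rows e if_P[OF True] div_by_1
  by (intro arg_cong[of _ _ "\<lambda>x. (1 / Q)^k * x"] prod.cong[OF refl]) simp_all
next
 case False
 then have s: "\<sigma> = 1" using \<sigma> by simp
 have e: "2 * Suc j - (\<sigma> + 1) = 2 * j" "2 * Suc j - \<sigma> - 1 = 2 * j" "Suc i + Suc j - \<sigma> - 1 = i + j"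
  "of_nat (\<sigma> + 1) = (2 :: complex)" for i j using s by simp_all
 let ?row = "\<lambda>j. jtheta (- (h^(2 * j))) p * jtheta (p * q^(2 * j)) (p\<^sup>2) * (\<Prod>i<j. th (j - i) * th (i + j))"
 obtain m where m: "k = Suc m" using k by (cases k) auto
 have "(\<Prod>j<k. ?row j) = ?row 0 * (\<Prod>j<m. ?row (Suc j))" unfolding m by (rule prod.lessThan_Suc_shift)
 also have "?row 0 = 2 * TT 0" using row_odd_first_0 by (simp add: TT_def)
 also have "(\<Prod>j<m. ?row (Suc j)) = (\<Prod>j<m. TT (2 * Suc j))" using m by (intro prod.cong refl row_odd_first) auto
 also have "2 * TT 0 * (\<Prod>j<m. TT (2 * Suc j)) = 2 * (\<Prod>j<k. TT (2 * j))" unfolding m prod.lessThan_Suc_shift by simp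
 finally have P: "(\<Prod>j<k. ?row j) = 2 * (\<Prod>j<k. TT (2 * j))" .
 show ?thesis unfolding first_side_rows e if_not_P[OF False] P by simp
qed

lemma second_side_eq:
 "second_side = (if \<sigma> = 0 then (1 / Q)^k * (\<Prod>j<k. TT (2 * j + 2) / (th (j + 1) * jtheta (rp * h^(2 * j + 2)) p))
   else (1 / Q)^k * (\<Prod>j<k. TT (2 * j + 1) / jtheta (rp * h^(2 * j + 1)) p))"
proof (cases "\<sigma> = 0")
 case True
 have e: "2 * Suc j - \<sigma> = 2 * j + 2" "Suc i + Suc j - \<sigma> = i + j + 2" for i j using True by simp_all
 have "jtheta (- (rp * h^(2 * j + 2))) p * jtheta (q^(2 * j + 2)) (p\<^sup>2) * (\<Prod>i<j. th (j - i) * th (i + j + 2)) =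
   TT (2 * j + 2) / (th (j + 1) * jtheta (rp * h^(2 * j + 2)) p)" if j: "j < k" for j
 proof -
  have "2 * j + 2 < kap" "j + 1 < kap" using j by (auto simp: kap_def)
  then have "jtheta (rp * h^(2 * j + 2)) p \<noteq> 0" "th (j + 1) \<noteq> 0" using jtheta_rp_h[of "2 * j + 2"] th_psi[of "j + 1"] psi_nz by auto
  then have nz: "th (j + 1) * jtheta (rp * h^(2 * j + 2)) p \<noteq> 0" by simp
  show ?thesis by (rule iffD2[OF nonzero_eq_divide_eq[OF nz] row_even_second])
 qed
 then show ?thesis unfolding second_side_rows e if_P[OF True] by (intro arg_cong[of _ _ "\<lambda>x. (1 / Q)^k * x"] prod.cong[OF refl]) simp_all
next
 case False
 then have s: "\<sigma> = 1" using \<sigma> by simp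
 have e: "2 * Suc j - \<sigma> = 2 * j + 1" "Suc i + Suc j - \<sigma> = i + j + 1" for i j using s by simp_all
 have "jtheta (- (rp * h^(2 * j + 1))) p * jtheta (q^(2 * j + 1)) (p\<^sup>2) * (\<Prod>i<j. th (j - i) * th (i + j + 1)) =
   TT (2 * j + 1) / jtheta (rp * h^(2 * j + 1)) p" if j: "j < k" for j
 proof -
  have "2 * j + 1 < kap" using j by (auto simp: kap_def)
  then have nz: "jtheta (rp * h^(2 * j + 1)) p \<noteq> 0" using jtheta_rp_h[of "2 * j + 1"] psi_nz by auto
  show ?thesis by (rule iffD2[OF nonzero_eq_divide_eq[OF nz] row_odd_second])
 qed
 then show ?thesis unfolding second_side_rows e if_not_P[OF False]
  by (intro arg_cong[of _ _ "\<lambda>x. (1 / Q)^k * x"] prod.cong[OF refl]) simp_all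
qed

text \<open>The \<open>R\<close> rows have become \<open>k\<close> rows; on the right
  \<open>R\<close> now occurs only through \<open>p\<close> and its root.\<close>

theorem bounded_sum_limit_side:
 "(\<lambda>J. bounded_sum (2 * k) 1 s (q^N) (\<lambda>i. z * q^i) {..<N * J}) \<longlonglongrightarrow> (if a = 2 then first_side else second_side)"
proof -
 have Q: "qpoch_inf p p / qpoch_inf q q = 1 / Q" by (simp add: Q_def)
 have "prefactor * (1 / Q)^R * (if a = 2 then \<Prod>j<R. half_theta (h^(2 * j + 2)) * TT (2 * j + 1)
   else \<Prod>j<R. jtheta (h^(2 * j + 1)) p * half_theta (h^(2 * j + 1)) * TT (2 * j)) = (if a = 2 then first_side else second_side)"
 proof (cases "\<sigma> = 0")
  case True
  have "prefactor = ff rp / qpoch_inf h q" unfolding prefactor_def using True by simp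
  then show ?thesis using side_even_2[OF True] side_even_1[OF True] unfolding first_side_eq second_side_eq if_P[OF True] by (cases "a = 2") auto
 next
  case False
  have "prefactor = (if a = 2 then qpoch_inf (- q) q else qpoch_inf (- h) q)" unfolding prefactor_def using False by simp
  then show ?thesis
   using side_odd_2[OF False] side_odd_1[OF False] unfolding first_side_eq second_side_eq if_not_P[OF False] by (cases "a = 2") auto
 qed
 then show ?thesis using bounded_sum_limit unfolding limit_eq side_one Q by simp
qed

end

section \<open>Analytic continuation in the square root of t\<close>

text \<open>By Montel a subsequence converges to a holomorphic function, which has to be the
  pointwise limit.\<close>

lemma holomorphic_on_limit:
 fixes f :: "nat \<Rightarrow> complex \<Rightarrow> complex"
 assumes "open S" and holo: "\<And>n. f n holomorphic_on S"
  and bound: "\<And>K. compact K \<Longrightarrow> K \<subseteq> S \<Longrightarrow> \<exists>B. \<forall>n. \<forall>x\<in>K. norm (f n x) \<le> B"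
  and lim: "\<And>x. x \<in> S \<Longrightarrow> (\<lambda>n. f n x) \<longlonglongrightarrow> g x"
 shows "g holomorphic_on S"
proof -
 have b: "\<exists>B. \<forall>h\<in>range f. \<forall>x\<in>K. norm (h x) \<le> B" if "compact K" "K \<subseteq> S" for K
  using bound[OF that] by auto
 have hol: "h holomorphic_on S" if "h \<in> range f" for h using that holo by auto
 obtain g' r where g': "g' holomorphic_on S" "strict_mono (r :: nat \<Rightarrow> nat)"
  "\<And>x. x \<in> S \<Longrightarrow> (\<lambda>n. f (r n) x) \<longlonglongrightarrow> g' x" using Montel[OF assms(1) hol b order_refl] by metis
 have "g x = g' x" if "x \<in> S" for x using LIMSEQ_unique[OF LIMSEQ_subseq_LIMSEQ[OF lim[OF that] g'(2), unfolded comp_def] g'(3)[OF that]] .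
 then show ?thesis using g'(1) by (metis holomorphic_cong)
qed

lemma holomorphic_on_qpoch:
 assumes S: "open S" and a: "a holomorphic_on S" and b: "b holomorphic_on S" and b1: "\<And>x. x \<in> S \<Longrightarrow> norm (b x) < 1"
 shows "(\<lambda>x. qpoch_inf (a x) (b x)) holomorphic_on S"
proof (rule holomorphic_on_limit[OF S])
 show "(\<lambda>x. \<Prod>i<n. 1 - a x * b x^i) holomorphic_on S" for n by (intro holomorphic_intros a b)
 show "(\<lambda>n. \<Prod>i<n. 1 - a x * b x^i) \<longlonglongrightarrow> qpoch_inf (a x) (b x)" if "x \<in> S" for x
  by (rule qpoch_LIMSEQ[OF b1[OF that]])
 fix K assume K: "compact K" "K \<subseteq> S"
 show "\<exists>B. \<forall>n. \<forall>x\<in>K. norm (\<Prod>i<n. 1 - a x * b x^i) \<le> B"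
 proof (cases "K = {}")
  case False
  have ca: "continuous_on K (\<lambda>x. norm (a x))" and cb: "continuous_on K (\<lambda>x. norm (b x))"
   using holomorphic_on_imp_continuous_on[OF holomorphic_on_subset[OF a K(2)]]
    holomorphic_on_imp_continuous_on[OF holomorphic_on_subset[OF b K(2)]] by (auto intro: continuous_on_norm)
  obtain x0 where x0: "x0 \<in> K" "\<And>x. x \<in> K \<Longrightarrow> norm (a x) \<le> norm (a x0)"
   using continuous_attains_sup[OF K(1) False ca] by blast
  obtain x1 where x1: "x1 \<in> K" "\<And>x. x \<in> K \<Longrightarrow> norm (b x) \<le> norm (b x1)"
   using continuous_attains_sup[OF K(1) False cb] by blast
  define A B where "A = norm (a x0)" and "B = norm (b x1)"
  have B: "0 \<le> B" "B < 1" using x1(1) K(2) b1 by (auto simp: B_def)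
  have A: "0 \<le> A" by (simp add: A_def)
  have "norm (\<Prod>i<n. 1 - a x * b x^i) \<le> exp (A * (1 / (1 - B)))" if x: "x \<in> K" for n x
  proof -
   have "norm (1 - a x * b x^i) \<le> 1 + A * B^i" for i
   proof -
    have "norm (a x * b x^i) \<le> A * B^i" unfolding norm_mult norm_power using x0(2)[OF x] x1(2)[OF x] A
     by (intro mult_mono power_mono) (auto simp: A_def B_def)
    then show ?thesis using norm_triangle_ineq4[of 1 "a x * b x^i"] by simp
   qed
   then have "norm (\<Prod>i<n. 1 - a x * b x^i) \<le> (\<Prod>i<n. 1 + A * B^i)" unfolding prod_norm[symmetric] by (intro prod_mono) auto
   also have "\<dots> \<le> exp (\<Sum>i<n. A * B^i)" using A B by (intro prod_le_exp_sum) auto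
   also have "(\<Sum>i<n. A * B^i) \<le> A * (1 / (1 - B))" unfolding sum_distrib_left[symmetric]
   proof (rule mult_left_mono)
    show "(\<Sum>i<n. B^i) \<le> 1 / (1 - B)"
     using B sum_le_suminf[of "\<lambda>i. B^i" "{..<n}"] suminf_geometric[of B] by (simp add: summable_geometric)
   qed (rule A)
   finally show ?thesis by simp
  qed
  then show ?thesis by blast
 qed simp
qed

text \<open>The right-hand sides as functions of the nome or of its root alone, for fixed
  \<open>h\<close>. Holomorphy is needed up to and including the value 0, where the special points
  accumulate.\<close>

definition first_rhs :: "nat \<Rightarrow> nat \<Rightarrow> complex \<Rightarrow> complex \<Rightarrow> complex" where
 "first_rhs k \<sigma> h p = qpoch_inf p p^k / (of_nat (\<sigma> + 1) * qpoch_inf (h^2) (h^2)^k) *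
  (\<Prod>i=1..k. jtheta (- (h^(2 * i - (\<sigma> + 1)))) p * jtheta (p * (h^2)^(2 * i - \<sigma> - 1)) (p^2)) *
  (\<Prod>j=1..k. \<Prod>i=1..<j. jtheta ((h^2)^(j - i)) p * jtheta ((h^2)^(i + j - \<sigma> - 1)) p)"

definition second_rhs :: "nat \<Rightarrow> nat \<Rightarrow> complex \<Rightarrow> complex \<Rightarrow> complex" where
 "second_rhs k \<sigma> h r = qpoch_inf (r\<^sup>2) (r\<^sup>2)^k / qpoch_inf (h^2) (h^2)^k *
  (\<Prod>i=1..k. jtheta (- (r * h^(2 * i - \<sigma>))) (r\<^sup>2) * jtheta ((h^2)^(2 * i - \<sigma>)) ((r\<^sup>2)^2)) *
  (\<Prod>j=1..k. \<Prod>i=1..<j. jtheta ((h^2)^(j - i)) (r\<^sup>2) * jtheta ((h^2)^(i + j - \<sigma>)) (r\<^sup>2))"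

context
 fixes r :: "complex \<Rightarrow> complex" and S :: "complex set"
 assumes S: "open S" and r: "r holomorphic_on S" and r1: "\<And>x. x \<in> S \<Longrightarrow> norm (r x) < 1"
begin

lemma holomorphic_on_jtheta: "c \<noteq> 0 \<Longrightarrow> (\<lambda>x. jtheta c (r x)) holomorphic_on S"
 unfolding jtheta_def divide_inverse by (intro holomorphic_intros holomorphic_on_qpoch S r r1)

lemma norm_square_less_1: "x \<in> S \<Longrightarrow> norm ((r x)\<^sup>2) < 1" using r1 by (simp add: norm_power power_less_one_iff)

text \<open>Used with \<open>r\<close> as the nome \<open>p\<close>, for a theta function of
  argument \<open>p * c\<close> and nome \<open>p^2\<close>. Since division by 0 gives 0, the
  quotient is \<open>r x * inverse c\<close> even at a zero of \<open>r\<close>, and the apparent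
  singularity is absent.\<close>

lemma holomorphic_on_jtheta_shifted: "c \<noteq> 0 \<Longrightarrow> (\<lambda>x. jtheta (r x * c) ((r x)\<^sup>2)) holomorphic_on S"
proof -
 have e: "(r x)\<^sup>2 / (r x * c) = r x * inverse c" for x by (cases "r x = 0") (simp_all add: power2_eq_square divide_inverse)
 show ?thesis unfolding jtheta_def e by (intro holomorphic_intros holomorphic_on_qpoch S r norm_square_less_1)
qed

lemma holomorphic_on_jtheta_half: "c \<noteq> 0 \<Longrightarrow> (\<lambda>x. jtheta (- (r x * c)) ((r x)\<^sup>2)) holomorphic_on S"
proof -
 have e: "(r x)\<^sup>2 / (- (r x * c)) = - (r x * inverse c)" for x by (cases "r x = 0") (simp_all add: power2_eq_square divide_inverse)
 show ?thesis unfolding jtheta_def e by (intro holomorphic_intros holomorphic_on_qpoch S r norm_square_less_1)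
qed

end

lemma holomorphic_on_sides:
 assumes h: "h \<noteq> 0" "norm h < 1" and S: "open S" and r: "r holomorphic_on S" and r1: "\<And>x. x \<in> S \<Longrightarrow> norm (r x) < 1"
 shows "(\<lambda>x. first_rhs k \<sigma> h ((r x)\<^sup>2)) holomorphic_on S" "(\<lambda>x. second_rhs k \<sigma> h (r x)) holomorphic_on S"
proof -
 have p: "(\<lambda>x. (r x)\<^sup>2) holomorphic_on S" by (intro holomorphic_intros r)
 note p1 = norm_square_less_1[OF S r r1]
 have h2: "norm (h\<^sup>2) < 1" using h by (simp add: norm_power power_less_one_iff)
 have nz: "qpoch_inf (h\<^sup>2) (h\<^sup>2) \<noteq> 0" using h2 by (intro qpoch_nz_norm)
 have p2: "(\<lambda>x. ((r x)\<^sup>2)\<^sup>2) holomorphic_on S" by (intro holomorphic_intros r)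
 have p21: "norm (((r x)\<^sup>2)\<^sup>2) < 1" if "x \<in> S" for x using norm_square_less_1[OF S p p1 that] .
 show "(\<lambda>x. first_rhs k \<sigma> h ((r x)\<^sup>2)) holomorphic_on S" unfolding first_rhs_def
  by (intro holomorphic_on_mult holomorphic_on_divide holomorphic_on_power holomorphic_on_prod holomorphic_on_const
    holomorphic_on_qpoch[OF S p p p1] holomorphic_on_jtheta[OF S p p1] holomorphic_on_jtheta_shifted[OF S p p1])
   (use h nz in \<open>auto simp: of_nat_Suc[symmetric] simp del: of_nat_Suc\<close>)
 show "(\<lambda>x. second_rhs k \<sigma> h (r x)) holomorphic_on S" unfolding second_rhs_def
  by (intro holomorphic_on_mult holomorphic_on_divide holomorphic_on_power holomorphic_on_prod holomorphic_on_const
    holomorphic_on_qpoch[OF S p p p1] holomorphic_on_jtheta[OF S p p1] holomorphic_on_jtheta_half[OF S r r1]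
    holomorphic_on_jtheta[OF S p2 p21])
   (use h nz in auto)
qed

text \<open>For finitely many variables the sum is a polynomial in \<open>s x\<close> and
  \<open>x^2\<close>, since \<open>hlK\<close> is affine in \<open>t\<close>; the bound of
  \<open>norm_bounded_sum_le\<close> involves neither \<open>n\<close> nor \<open>x\<close>.\<close>

lemma holomorphic_on_partition_sum:
 assumes q: "q \<noteq> 0" "norm q < 1" and z: "z \<noteq> 0" "norm z \<le> 1"
  and s: "s holomorphic_on ball 0 1" "\<And>x. x \<in> ball 0 1 \<Longrightarrow> norm (s x) \<le> 1"
 shows "(\<lambda>x. partition_sum m z q (s x) (x\<^sup>2)) holomorphic_on ball 0 1"
proof (rule holomorphic_on_limit)
 let ?f = "\<lambda>n x. bounded_sum m 1 (s x) (x\<^sup>2) (\<lambda>i. z * q^i) {..<n}"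
 have x2: "norm (x\<^sup>2) < 1" if "x \<in> ball 0 1" for x :: complex using that by (simp add: norm_power power_less_one_iff)
 show "?f n holomorphic_on ball 0 1" for n
 proof -
  have "(\<lambda>x. if P then 1 else s x) holomorphic_on ball 0 1" for P using s(1) by (cases P) auto
  moreover have "(\<lambda>x. if P then hlK (x\<^sup>2) u v else 1) holomorphic_on ball 0 1" for P u v
   unfolding hlK_def divide_inverse by (cases P) (auto intro!: holomorphic_intros)
  ultimately show ?thesis unfolding bounded_sum_def fun_weight_def
   by (intro holomorphic_on_sum holomorphic_on_mult holomorphic_on_prod holomorphic_on_const)
 qed
 show "(\<lambda>n. ?f n x) \<longlonglongrightarrow> partition_sum m z q (s x) (x\<^sup>2)" if "x \<in> ball 0 1" for x
  by (rule bounded_sum_tendsto[OF q x2[OF that] z(2) s(2)[OF that] z(1)])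
 show "\<exists>B. \<forall>n. \<forall>x\<in>K. norm (?f n x) \<le> B" if "K \<subseteq> ball 0 1" for K
  using norm_bounded_sum_le[OF q x2 z(2) s(2) z(1)] that by blast
qed simp

context
 fixes h :: complex and k \<sigma> :: nat
 assumes h: "h \<noteq> 0" "norm h < 1" and k: "k \<ge> 1" and \<sigma>: "\<sigma> = 0 \<or> \<sigma> = 1"
begin

lemma partition_sum_special:
 assumes R: "R \<ge> 1"
 defines "\<tau> \<equiv> h^(2 * R - \<sigma>)"
 shows "partition_sum (2 * k) (h^(\<sigma> + 1)) (h\<^sup>2) 1 (\<tau>\<^sup>2) = first_rhs k \<sigma> h ((\<tau> * h^(2 * k + 1))\<^sup>2)"
  and "partition_sum (2 * k) (h^(\<sigma> + 1)) (h\<^sup>2) \<tau> (\<tau>\<^sup>2) = second_rhs k \<sigma> h (\<tau> * h^(2 * k + 1))"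
proof -
 \<comment> \<open>\<open>h\<close> is a square root of \<open>q\<close>, while the two systems of
   progressions need a fourth root.\<close>
 define w where "w = csqrt h"
 have w2: "w\<^sup>2 = h" by (simp add: w_def)
 have w: "w \<noteq> 0" "norm w < 1"
 proof -
  show "w \<noteq> 0" using w2 h by auto
  have "norm w^2 < 1" using h unfolding norm_power[symmetric] w2 by simp
  then show "norm w < 1" by (simp add: power_less_one_iff)
 qed
 have h2: "h\<^sup>2 \<noteq> 0" "norm (h\<^sup>2) < 1" using h by (simp_all add: norm_power power_less_one_iff)
 have N: "2 * R - \<sigma> > 0" using R \<sigma> by auto
 have t: "norm \<tau> < 1" "norm (\<tau>\<^sup>2) < 1"
  unfolding \<tau>_def using h N by (simp_all add: norm_power power_less_one_iff flip: power_mult)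
 have z: "h^(\<sigma> + 1) \<noteq> 0" "norm (h^(\<sigma> + 1)) \<le> 1" using h by (simp_all only: norm_power power_eq_0_iff power_le_one norm_ge_zero less_imp_le simp_thms)
 have main: "partition_sum (2 * k) (h^(\<sigma> + 1)) (h\<^sup>2) (if a = 2 then 1 else \<tau>) (\<tau>\<^sup>2) =
   (if a = 2 then first_rhs k \<sigma> h ((\<tau> * h^(2 * k + 1))\<^sup>2) else second_rhs k \<sigma> h (\<tau> * h^(2 * k + 1)))"
  if a: "a = 1 \<or> a = 2" for a :: nat
 proof -
  interpret dual_chains w R k \<sigma> a by unfold_locales (use w R k \<sigma> a in auto)
  have hh: "dual_chains.h w = h" unfolding h_def by (rule w2)
  have qq: "q = h\<^sup>2" unfolding hh[symmetric] h_q ..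
  have tt: "q^N = \<tau>\<^sup>2" unfolding qq \<tau>_def N_def power_mult[symmetric] by (simp only: mult.commute)
  have ss: "s = (if a = 2 then 1 else \<tau>)" unfolding s_def \<tau>_def N_def w2[symmetric] power_mult[symmetric] ..
  have zz: "z = h^(\<sigma> + 1)" unfolding z_h hh ..
  have rr: "rp = \<tau> * h^(2 * k + 1)" unfolding rp_h hh kap_def \<tau>_def power_add[symmetric] N_def by (simp only: add.assoc)
  have pp: "p = (\<tau> * h^(2 * k + 1))\<^sup>2" unfolding rr[symmetric] rp_square ..
  have lim: "(\<lambda>n. bounded_sum (2 * k) 1 s (q^N) (\<lambda>i. z * q^i) {..<n}) \<longlonglongrightarrow> partition_sum (2 * k) z q s (q^N)"
   unfolding tt unfolding qq zz ss using t by (intro bounded_sum_tendsto h2 z) auto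
  \<comment> \<open>Convergence over all \<open>n\<close> is known from
    \<open>bounded_sum_tendsto\<close>, so the subsequence of multiples of \<open>N\<close>
    identifies the limit.\<close>
  have "filterlim (\<lambda>J. N * J) at_top sequentially" using N_pos by (intro filterlim_subseq) (simp add: strict_mono_def)
  from filterlim_compose[OF lim this] have "partition_sum (2 * k) z q s (q^N) = (if a = 2 then first_side else second_side)"
   using bounded_sum_limit_side by (rule LIMSEQ_unique)
  moreover have "first_side = first_rhs k \<sigma> h ((\<tau> * h^(2 * k + 1))\<^sup>2)" unfolding first_side_def first_rhs_def hh qq pp ..
  moreover have "second_side = second_rhs k \<sigma> h (\<tau> * h^(2 * k + 1))" unfolding second_side_def second_rhs_def hh qq pp rr ..
  ultimately show ?thesis unfolding tt unfolding qq zz ss by simp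
 qed
 show "partition_sum (2 * k) (h^(\<sigma> + 1)) (h\<^sup>2) 1 (\<tau>\<^sup>2) = first_rhs k \<sigma> h ((\<tau> * h^(2 * k + 1))\<^sup>2)"
  using main[of 2] by simp
 show "partition_sum (2 * k) (h^(\<sigma> + 1)) (h\<^sup>2) \<tau> (\<tau>\<^sup>2) = second_rhs k \<sigma> h (\<tau> * h^(2 * k + 1))"
  using main[of 1] by simp
qed

lemma zero_islimpt: "0 islimpt {h^(2 * R - \<sigma>) | R. R \<ge> 1}" unfolding islimpt_approachable
proof (intro allI impI)
 fix e :: real assume e: "e > 0"
 obtain n where n: "norm h^n < e" using real_arch_pow_inv[OF e h(2)] by blast
 have "norm h^(2 * (n + 1) - \<sigma>) \<le> norm h^n" using h \<sigma> by (intro power_decreasing) auto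
 then have "norm (h^(2 * (n + 1) - \<sigma>)) < e" using n by (simp only: norm_power)
 moreover have "h^(2 * (n + 1) - \<sigma>) \<in> {h^(2 * R - \<sigma>) | R. R \<ge> 1}" by fastforce
 ultimately show "\<exists>x'\<in>{h^(2 * R - \<sigma>) | R. R \<ge> 1}. x' \<noteq> 0 \<and> dist x' 0 < e"
  using h(1) by (intro bexI[of _ "h^(2 * (n + 1) - \<sigma>)"]) simp_all
qed

text \<open>The second sum contains the square root of \<open>t\<close> itself, hence the identity
  theorem is applied in \<tau> rather than in its square.\<close>

theorem partition_sum_eq:
 assumes \<tau>: "norm \<tau> < 1"
 shows "partition_sum (2 * k) (h^(\<sigma> + 1)) (h\<^sup>2) 1 (\<tau>\<^sup>2) = first_rhs k \<sigma> h ((\<tau> * h^(2 * k + 1))\<^sup>2)"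
  and "partition_sum (2 * k) (h^(\<sigma> + 1)) (h\<^sup>2) \<tau> (\<tau>\<^sup>2) = second_rhs k \<sigma> h (\<tau> * h^(2 * k + 1))"
proof -
 let ?U = "{h^(2 * R - \<sigma>) | R. R \<ge> 1}" and ?r = "\<lambda>x. x * h^(2 * k + 1)"
 have U: "?U \<subseteq> ball 0 1"
 proof
  fix x assume "x \<in> ?U"
  then obtain R where R: "R \<ge> 1" "x = h^(2 * R - \<sigma>)" by blast
  then have "2 * R - \<sigma> > 0" using \<sigma> by auto
  then show "x \<in> ball 0 1" unfolding R(2) using h by (simp add: norm_power power_less_one_iff)
 qed
 have h2: "h\<^sup>2 \<noteq> 0" "norm (h\<^sup>2) < 1" using h by (simp_all add: norm_power power_less_one_iff)
 have z: "h^(\<sigma> + 1) \<noteq> 0" "norm (h^(\<sigma> + 1)) \<le> 1" using h by (simp_all only: norm_power power_eq_0_iff power_le_one norm_ge_zero less_imp_le simp_thms)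
 have r: "?r holomorphic_on ball 0 1" by (intro holomorphic_intros)
 have r1: "norm (?r x) < 1" if "x \<in> ball 0 1" for x using norm_mult_power_less_1[of x h "2 * k + 1"] that h by simp
 have "(\<lambda>x. partition_sum (2 * k) (h^(\<sigma> + 1)) (h\<^sup>2) 1 (x\<^sup>2) - first_rhs k \<sigma> h ((?r x)\<^sup>2)) holomorphic_on ball 0 1"
  by (intro holomorphic_on_diff holomorphic_on_partition_sum h2 z holomorphic_on_sides(1) h r r1) auto
 from analytic_continuation[OF this open_ball connected_ball U _ zero_islimpt, of \<tau>]
 show "partition_sum (2 * k) (h^(\<sigma> + 1)) (h\<^sup>2) 1 (\<tau>\<^sup>2) = first_rhs k \<sigma> h ((\<tau> * h^(2 * k + 1))\<^sup>2)"
  using partition_sum_special(1) \<tau> by fastforce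
 have "(\<lambda>x. partition_sum (2 * k) (h^(\<sigma> + 1)) (h\<^sup>2) x (x\<^sup>2) - second_rhs k \<sigma> h (?r x)) holomorphic_on ball 0 1"
  by (intro holomorphic_on_diff holomorphic_on_partition_sum h2 z holomorphic_on_sides(2) h r r1) auto
 from analytic_continuation[OF this open_ball connected_ball U _ zero_islimpt, of \<tau>]
 show "partition_sum (2 * k) (h^(\<sigma> + 1)) (h\<^sup>2) \<tau> (\<tau>\<^sup>2) = second_rhs k \<sigma> h (\<tau> * h^(2 * k + 1))"
  using partition_sum_special(2) \<tau> by fastforce
qed

end

section \<open>The case q = 0\<close>

lemma hl_formula_Nil:
 assumes "inj_on y {..<n}" "norm t < 1"
 shows "hl_formula n [] t y = 1"
proof -
 have "funs_of_type {..<n} (padded n []) = {\<lambda>i\<in>{..<n}. 0}"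
 proof (intro equalityI subsetI)
  fix f assume f: "f \<in> funs_of_type {..<n} (padded n [])"
  then have "image_mset f (mset_set {..<n}) = replicate_mset n 0" by (simp add: funs_of_type_def padded_def)
  then have "f ` {..<n} \<subseteq> {0}"
   by (metis finite_set_mset_mset_set finite_lessThan set_image_mset set_mset_replicate_mset_subset empty_subsetI order_refl)
  then show "f \<in> {\<lambda>i\<in>{..<n}. 0}" using f by (auto simp: funs_of_type_def PiE_def extensional_def fun_eq_iff restrict_def image_subset_iff)
 next
  fix f assume "f \<in> {\<lambda>i\<in>{..<n}. 0 :: nat}"
  then have f: "f = (\<lambda>i\<in>{..<n}. 0)" by simp
  have "image_mset f (mset_set {..<n}) = image_mset (\<lambda>_. 0) (mset_set {..<n})" unfolding f by (intro image_mset_cong) simp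
  then show "f \<in> funs_of_type {..<n} (padded n [])" by (simp add: funs_of_type_def padded_def f image_mset_const_eq)
 qed
 then show ?thesis using hall_littlewood_eq_fun_sum[OF assms(1), of "[]" t] assms(2) by (simp add: is_partition_def fun_weight_def)
qed

text \<open>At \<open>q = 0\<close> the variables are 1, 0, 0, ..., so coordinates coincide and
  \<open>hall_littlewood\<close> is a limit in earnest. Imaginary perturbations proportional to
  \<open>i + 1\<close> separate all coordinates, whatever their real parts.\<close>

lemma injective_points_nontrivial_zero:
 "at (\<lambda>i. 0^i :: complex) within {y. inj_on y {..<n}} \<noteq> bot"
proof -
 let ?x = "\<lambda>i. 0^i :: complex"
 let ?y = "\<lambda>m i. 0^i + \<i> / of_nat (Suc m) * of_nat (Suc i)"
 have "(\<lambda>m. ?y m i) \<longlonglongrightarrow> ?x i" for i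
 proof -
  have "(\<lambda>m. 1 / of_nat (Suc m) :: complex) \<longlonglongrightarrow> 0" by (rule LIMSEQ_Suc[OF lim_1_over_n])
  then have "(\<lambda>m. 0^i + \<i> * (1 / of_nat (Suc m)) * of_nat (Suc i)) \<longlonglongrightarrow> 0^i + \<i> * 0 * of_nat (Suc i)"
   by (intro tendsto_add tendsto_mult tendsto_const)
  then show ?thesis by simp
 qed
 then have "limitin (product_topology (\<lambda>i. euclidean) UNIV) ?y ?x sequentially"
  by (simp only: limitin_componentwise limitin_canonical_iff) (auto simp: extensional_def)
 then have lim: "?y \<longlonglongrightarrow> ?x" by (simp only: euclidean_product_topology limitin_canonical_iff)
 have "?y m \<in> {y. inj_on y {..<n}} - {?x}" for m
 proof -
  have "?y m 0 \<noteq> ?x 0" by (simp del: of_nat_Suc)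
  then have "?y m \<noteq> ?x" by metis
  moreover have "inj_on (?y m) A" for A
  proof (rule inj_onI)
   fix i j assume "?y m i = ?y m j"
   then have "Im (?y m i) = Im (?y m j)" by simp
   moreover have "Im (?y m i) = real (Suc i) / real (Suc m)" for i
   proof -
    have "\<i> / of_nat (Suc m) * of_nat (Suc i) = Complex 0 (real (Suc i) / real (Suc m))"
     by (simp add: complex_eq_iff Re_divide Im_divide power2_eq_square del: of_nat_Suc)
    moreover have "Im (0^i :: complex) = 0" by (cases i) auto
    ultimately show ?thesis by (simp del: of_nat_Suc)
   qed
   ultimately show "i = j" by (simp del: of_nat_Suc)
  qed
  ultimately show ?thesis by simp
 qed
 then have "?x islimpt {y. inj_on y {..<n}}" unfolding islimpt_sequential using lim by (intro exI[of _ ?y] conjI allI)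
 then show ?thesis by (simp add: trivial_limit_within)
qed

lemma hl_principal_Nil_zero:
 assumes "norm t < 1"
 shows "hl_principal [] 0 t = 1"
proof -
 have "hall_littlewood n [] t (\<lambda>i. 0^i) = 1" for n
 proof -
  let ?F = "at (\<lambda>i. 0^i :: complex) within {y. inj_on y {..<n}}"
  have "\<forall>\<^sub>F y in ?F. hl_formula n [] t y = 1"
   unfolding eventually_at_filter using hl_formula_Nil[OF _ assms] by (intro always_eventually) simp
  then have "(hl_formula n [] t \<longlongrightarrow> 1) ?F" by (rule tendsto_eventually)
  then show ?thesis unfolding hall_littlewood_def using tendsto_Lim[OF injective_points_nontrivial_zero] by simp
 qed
 then show ?thesis unfolding hl_principal_def by simp
qed

text \<open>By \<open>0^0 = 1\<close> the empty partition contributes 1; every other partition has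
  positive size and is annihilated.\<close>

lemma has_sum_zero_power:
 assumes "norm t < 1" "c > 0"
 shows "((\<lambda>\<mu>. 0^(c * sum_list \<mu>) * s^length (odd_parts \<mu>) * hl_principal \<mu> 0 t) has_sum 1) {\<mu>. is_partition \<mu> \<and> part \<mu> 0 \<le> m}"
proof -
 let ?f = "\<lambda>\<mu>. 0^(c * sum_list \<mu>) * s^length (odd_parts \<mu>) * hl_principal \<mu> 0 t"
 have "?f [] = 1" using hl_principal_Nil_zero[OF assms(1)] by (simp add: odd_parts_def)
 then have f: "(?f has_sum 1) {[]}" by (simp add: has_sum_finiteI)
 have z: "?f \<mu> = 0" if "is_partition \<mu>" "\<mu> \<noteq> []" for \<mu>
 proof -
  have "sum_list \<mu> \<noteq> 0"
  proof
   assume "sum_list \<mu> = 0"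
   then have "x = 0" if "x \<in> set \<mu>" for x using that by simp
   then show False using that by (cases \<mu>) (auto simp: is_partition_def)
  qed
  then have "(0 :: complex)^(c * sum_list \<mu>) = 0" using assms(2) by (intro zero_power) (simp del: sum_list_eq_0_iff)
  then show ?thesis by (simp only: mult_zero_left)
 qed
 have "(?f has_sum 1) {[]} \<longleftrightarrow> (?f has_sum 1) {\<mu>. is_partition \<mu> \<and> part \<mu> 0 \<le> m}"
 proof (rule has_sum_cong_neutral)
  fix \<mu> assume "\<mu> \<in> {\<mu>. is_partition \<mu> \<and> part \<mu> 0 \<le> m} - {[]}"
  then show "?f \<mu> = 0" using z[of \<mu>] by blast
 next
  fix \<mu> :: "nat list" assume "\<mu> \<in> {[]} - {\<mu>. is_partition \<mu> \<and> part \<mu> 0 \<le> m}"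
  then show "?f \<mu> = 0" by (simp add: is_partition_def part_def)
 qed simp
 with f show ?thesis by blast
qed

lemma qpoch_zero: "qpoch_inf a 0 = 1 - a"
proof -
 have "(\<lambda>i. 1 - a * 0^i) = (\<lambda>i. if i \<in> {0} then 1 - a else 1)" by (auto simp: power_0_left)
 then have "qpoch_inf a 0 = (\<Prod>i. if i \<in> {0} then 1 - a else 1)" by (simp only: qpoch_inf_def)
 also have "\<dots> = (\<Prod>i\<in>{0::nat}. 1 - a)" by (rule has_prod_unique[symmetric], rule has_prod_If_finite_set) simp
 finally show ?thesis by simp
qed

lemma jtheta_zero: "jtheta a 0 = 1 - a" by (simp add: jtheta_def qpoch_zero)

text \<open>The only factor different from 1 in the products is \<open>jtheta (- 1) 0 = 2\<close>,
  which occurs in the first product for \<sigma> = 1 and \<open>i = 1\<close> through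
  \<open>0^0 = 1\<close>, and is compensated by \<open>of_nat (\<sigma> + 1)\<close>.\<close>

lemma rhs_zero:
 assumes k: "k \<ge> 1" and \<sigma>: "\<sigma> = 0 \<or> \<sigma> = 1"
 shows "first_rhs k \<sigma> 0 0 = 1" "second_rhs k \<sigma> 0 0 = 1"
proof -
 have "(\<Prod>j=1..k. \<Prod>i=1..<j. (1 - (0\<^sup>2)^(j - i)) * (1 - (0\<^sup>2)^(i + j - \<sigma> - 1))) = (1 :: complex)"
  "(\<Prod>j=1..k. \<Prod>i=1..<j. (1 - (0\<^sup>2)^(j - i)) * (1 - (0\<^sup>2)^(i + j - \<sigma>))) = (1 :: complex)"
  using \<sigma> by (auto intro!: prod.neutral simp: power_0_left)
 moreover have "(\<Prod>i=1..k. 1 - - (0^(2 * i - (\<sigma> + 1)))) = (of_nat (\<sigma> + 1) :: complex)"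
 proof -
  obtain m where m: "k = Suc m" using k by (cases k) auto
  have "(\<Prod>i=1..k. 1 - - (0^(2 * i - (\<sigma> + 1)))) = (\<Prod>i<Suc m. 1 + 0^(2 * Suc i - (\<sigma> + 1)) :: complex)"
   unfolding m by (simp add: prod.atLeast1_atMost_eq)
  also have "\<dots> = (1 + 0^(1 - \<sigma>)) * (\<Prod>i<m. 1 + 0^(2 * Suc (Suc i) - (\<sigma> + 1)))"
   unfolding prod.lessThan_Suc_shift by simp
  also have "(\<Prod>i<m. 1 + 0^(2 * Suc (Suc i) - (\<sigma> + 1)) :: complex) = 1"
   using \<sigma> by (auto intro!: prod.neutral simp: power_0_left)
  also have "(1 + 0^(1 - \<sigma>)) * 1 = (of_nat (\<sigma> + 1) :: complex)" using \<sigma> by auto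
  finally show ?thesis .
 qed
 moreover have "(\<Prod>i=1..k. 1 - (0\<^sup>2)^(2 * i - \<sigma>)) = (1 :: complex)"
  using \<sigma> by (auto intro!: prod.neutral simp: power_0_left)
 moreover have "of_nat (\<sigma> + 1) \<noteq> (0 :: complex)" by (simp only: of_nat_eq_0_iff)
 ultimately show "first_rhs k \<sigma> 0 0 = 1" "second_rhs k \<sigma> 0 0 = 1"
  unfolding first_rhs_def second_rhs_def by (simp_all add: jtheta_zero qpoch_zero del: of_nat_Suc of_nat_add)
qed

theorem theorem1p6:
  fixes q t p q_half t_half p_half :: complex and k \<sigma> :: nat
  assumes "k \<ge> 1" and "\<sigma> \<in> {0, 1}"
    and "norm q < 1" and "norm t < 1"
    and "q_half ^ 2 = q" and "t_half ^ 2 = t"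
    and "p = t * q ^ (2 * k + 1)" and "p_half = t_half * q_half ^ (2 * k + 1)"
  shows
    "((\<lambda>\<mu>. q_half ^ ((\<sigma> + 1) * sum_list \<mu>) * hl_principal \<mu> q t) has_sum
        qpoch_inf p p ^ k / (of_nat (\<sigma> + 1) * qpoch_inf q q ^ k) *
        (\<Prod>i=1..k. jtheta (- (q_half ^ (2 * i - (\<sigma> + 1)))) p *
                   jtheta (p * q ^ (2 * i - \<sigma> - 1)) (p ^ 2)) *
        (\<Prod>j=1..k. \<Prod>i=1..<j. jtheta (q ^ (j - i)) p * jtheta (q ^ (i + j - \<sigma> - 1)) p))
       {\<mu>. is_partition \<mu> \<and> part \<mu> 0 \<le> 2 * k} \<and>
     ((\<lambda>\<mu>. q_half ^ ((\<sigma> + 1) * sum_list \<mu>) * t_half ^ length (odd_parts \<mu>) *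
            hl_principal \<mu> q t) has_sum
        qpoch_inf p p ^ k / qpoch_inf q q ^ k *
        (\<Prod>i=1..k. jtheta (- (p_half * q_half ^ (2 * i - \<sigma>))) p *
                   jtheta (q ^ (2 * i - \<sigma>)) (p ^ 2)) *
        (\<Prod>j=1..k. \<Prod>i=1..<j. jtheta (q ^ (j - i)) p * jtheta (q ^ (i + j - \<sigma>)) p))
       {\<mu>. is_partition \<mu> \<and> part \<mu> 0 \<le> 2 * k}"
proof -
 have \<sigma>: "\<sigma> = 0 \<or> \<sigma> = 1" using assms(2) by auto
 have pp: "p = p_half\<^sup>2"
  unfolding assms(7,8) assms(5,6)[symmetric] by (simp only: power_mult_distrib power_mult[symmetric] mult.commute)
 have h1: "norm q_half < 1" and t1: "norm t_half < 1"
  using assms(3-6) by (auto simp: norm_power power_less_one_iff)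
 let ?P = "{\<mu>. is_partition \<mu> \<and> part \<mu> 0 \<le> 2 * k}"
 \<comment> \<open>The power of 1 brings the first sum into the form shared with the second one,
   where the number of odd parts is counted by \<open>s\<close>.\<close>
 have "((\<lambda>\<mu>. q_half^((\<sigma> + 1) * sum_list \<mu>) * 1^length (odd_parts \<mu>) * hl_principal \<mu> q t) has_sum first_rhs k \<sigma> q_half (p_half\<^sup>2)) ?P \<and>
  ((\<lambda>\<mu>. q_half^((\<sigma> + 1) * sum_list \<mu>) * t_half^length (odd_parts \<mu>) * hl_principal \<mu> q t) has_sum second_rhs k \<sigma> q_half p_half) ?P"
 proof (cases "q_half = 0")
  case True
  have z: "q = 0" "p_half = 0" using assms(5,8) True by simp_all
  have "\<sigma> + 1 > 0" by simp
  from has_sum_zero_power[OF assms(4) this] show ?thesis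
   unfolding z True zero_power2 rhs_zero[OF assms(1) \<sigma>] by blast
 next
  case False
  have q0: "q \<noteq> 0" using False assms(5) by auto
  have z: "norm (q_half^(\<sigma> + 1)) \<le> 1" using h1 by (simp only: norm_power power_le_one norm_ge_zero less_imp_le)
  note eq = partition_sum_eq[OF False h1 assms(1) \<sigma> t1, unfolded assms(5,6,8)[symmetric]]
  have "((\<lambda>\<mu>. (q_half^(\<sigma> + 1))^sum_list \<mu> * 1^length (odd_parts \<mu>) * hl_principal \<mu> q t) has_sum
    partition_sum (2 * k) (q_half^(\<sigma> + 1)) q 1 t) ?P"
   by (rule has_sum_partitions[OF q0 assms(3,4) z]) simp
  moreover have "((\<lambda>\<mu>. (q_half^(\<sigma> + 1))^sum_list \<mu> * t_half^length (odd_parts \<mu>) * hl_principal \<mu> q t) has_sum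
    partition_sum (2 * k) (q_half^(\<sigma> + 1)) q t_half t) ?P"
   by (rule has_sum_partitions[OF q0 assms(3,4) z]) (use t1 in simp)
  ultimately show ?thesis unfolding power_mult[symmetric] using eq by (simp only: assms(5,6))
 qed
 then show ?thesis unfolding first_rhs_def second_rhs_def assms(5) pp by simp
qed

end
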